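(* Let $c_1,c_2\in\overline C_Q$, $a\in R(c_1)\cap R(c_2)$, $b\in\mathbb{R}^n$, and let $f$ be a homogeneous polynomial of degree $d$. Then for all $\tau$ in the upper half-plane: (1) $\widehat{\Theta}^{c_1,c_2}_{a+\lambda,b}[f](\tau)=\widehat{\Theta}^{c_1,c_2}_{a,b}[f](\tau)$ for $\lambda\in\mathbb{Z}^n$; (2) $\widehat{\Theta}^{c_1,c_2}_{a,b+\mu}[f](\tau)=e^{2\pi i B(a,\mu)}\widehat{\Theta}^{c_1,c_2}_{a,b}[f](\tau)$ for $\mu\in A^{-1}\mathbb{Z}^n$; (3) $\widehat{\Theta}^{c_1,c_2}_{-a,-b}[f](\tau)=(-1)^{d+1}\widehat{\Theta}^{c_1,c_2}_{a,b}[f](\tau)$; (4) $\widehat{\Theta}^{c_1,c_2}_{a,b}[f](\tau+1)=e^{-2\pi i Q(a)-\pi i B(A^{-1}A^{*},a)}\,\widehat{\Theta}^{c_1,c_2}_{a,a+b+\frac12A^{-1}A^{*}}[f](\tau)$, where $A^{*}$ is the vector of diagonal entries of $A$; and if $A$ is even (all diagonal entries even), $\widehat{\Theta}^{c_1,c_2}_{a,b}[f](\tau+1)=e^{-2\pi iQ(a)}\widehat{\Theta}^{c_1,c_2}_{a,a+b}[f](\tau)$; (5) if $a,b\in R(c_1)\cap R(c_2)$, then \[\widehat{\Theta}^{c_1,c_2}_{a,b}[f]\big(-\tfrac1\tau\big)=(-i\tau)^{n/2+d}\,\frac{i^{d+1}}{\sqrt{|\det A|}}\,e^{2\pi iB(a,b)}\sum_{p\in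 A^{-1}\mathbb{Z}^n/\mathbb{Z}^n}\widehat{\Theta}^{c_1,c_2}_{b+p,-a}[f](\tau).\]
   Context: Let $A\in\mathbb{Z}^{n\times n}$ be symmetric such that $Q(v)=\tfrac12 v^{T}Av$ has signature $(n-1,1)$, and let $B(u,v)=u^{T}Av$. Fix $c_0\in\mathbb{R}^n$ with $Q(c_0)<0$ and set $C_Q=\{c\in\mathbb{R}^n: Q(c)<0,\ B(c,c_0)<0\}$, $S_Q=\{c\in\mathbb{Q}^n: Q(c)=0,\ B(c,c_0)<0\}$, $\overline{C}_Q=C_Q\cup S_Q$. For $c\in\overline C_Q$ let $R(c)=\mathbb{R}^n$ if $c\in C_Q$ and $R(c)=\{a\in\mathbb{R}^n: B(c,a)\notin\mathbb{Z}\}$ if $c\in S_Q$. Let $E(z)=2\int_0^z e^{-\pi u^2}\,du$ and $E^{(k)}$ its $k$-th derivative. Let $\Delta=(\partial/\partial v)^{T}A^{-1}(\partial/\partial v)$, and for a homogeneous polynomial $f$ of degree $d$ let $\widehat f=\sum_{k\ge0}\frac{(-1)^k}{(8\pi)^k k!}\Delta^k f$. For $c\in C_Q$ let $\partial_c=\frac{1}{\sqrt{-Q(c)}}\sum_{i=1}^n c_i\frac{\partial}{\partial v_i}$. Define $p^{c}[f](v)=\sum_{k=0}^{d}\frac{(-1)^k}{(4\pi)^k k!}E^{(k)}\!\big(\tfrac{B(c,v)}{\sqrt{-Q(c)}}\big)\,\partial_c^k\widehat f(v)$ if $c\in C_Q$, and $p^c[f](v)=\operatorname{sgn}(B(c,v))\,\widehat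 f(v)$ if $c\in S_Q$. For $\tau=x+iy$ with $y>0$, $q=e^{2\pi i\tau}$, and characteristics $a,b$, define \[\widehat{\Theta}^{c_1,c_2}_{a,b}[f](\tau)=y^{-d/2}\sum_{\ell\in a+\mathbb{Z}^n}\big\{p^{c_1}[f](\ell y^{1/2})-p^{c_2}[f](\ell y^{1/2})\big\}q^{Q(\ell)}e^{2\pi i B(\ell,b)}.\] Powers $(-i\tau)^{s}$ use the principal branch.
   Formalization: In (5) it is also assumed that a+λ ∈ R(c_1)∩R(c_2) for all λ∈Z^n and b+p ∈ R(c_1)∩R(c_2) for all p∈A^{-1}Z^n; this is automatic for c_j in C_Q or integral c_j, while for other rational c_j in S_Q the series in (5) can diverge. *)

theory Defs
  imports "HOL-Analysis.Analysis"
begin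

(* Z^n inside R^n; the dimension n is CARD('n). *)
definition int_lattice :: "(real ^ 'n) set" where
  "int_lattice = {v. \<forall>i. v $ i \<in> \<int>}"

definition rat_vectors :: "(real ^ 'n) set" where
  "rat_vectors = {v. \<forall>i. v $ i \<in> \<rat>}"

definition dual_lattice :: "real ^ 'n ^ 'n \<Rightarrow> (real ^ 'n) set" where
  "dual_lattice A = (\<lambda>m. matrix_inv A *v m) ` int_lattice"

(* P picks exactly one representative of each class of A^{-1}Z^n modulo Z^n. *)
definition dual_representatives :: "real ^ 'n ^ 'n \<Rightarrow> (real ^ 'n) set \<Rightarrow> bool" where
  "dual_representatives A P \<longleftrightarrow>
     P \<subseteq> dual_lattice A \<and> (\<forall>x\<in>dual_lattice A. \<exists>!p. p \<in> P \<and> x - p \<in> int_lattice)"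

definition bform :: "real ^ 'n ^ 'n \<Rightarrow> real ^ 'n \<Rightarrow> real ^ 'n \<Rightarrow> real" where
  "bform A u v = u \<bullet> (A *v v)"

definition qform :: "real ^ 'n ^ 'n \<Rightarrow> real ^ 'n \<Rightarrow> real" where
  "qform A v = bform A v v / 2"

(* Sylvester: in some basis (the columns of P) the form is diagonal,
   with r positive and s negative diagonal coefficients. *)
definition has_signature :: "real ^ 'n ^ 'n \<Rightarrow> nat \<Rightarrow> nat \<Rightarrow> bool" where
  "has_signature A r s \<longleftrightarrow>
     (\<exists>P D :: real ^ 'n ^ 'n.
        invertible P \<and> transpose P ** A ** P = D \<and>
        (\<forall>i j. i \<noteq> j \<longrightarrow> D $ i $ j = 0) \<and>
        card {i. D $ i $ i > 0} = r \<and> card {i. D $ i $ i < 0} = s)"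

definition C_Q :: "real ^ 'n ^ 'n \<Rightarrow> real ^ 'n \<Rightarrow> (real ^ 'n) set" where
  "C_Q A c0 = {c. qform A c < 0 \<and> bform A c c0 < 0}"

definition S_Q :: "real ^ 'n ^ 'n \<Rightarrow> real ^ 'n \<Rightarrow> (real ^ 'n) set" where
  "S_Q A c0 = {c \<in> rat_vectors. qform A c = 0 \<and> bform A c c0 < 0}"

definition C_Q_bar :: "real ^ 'n ^ 'n \<Rightarrow> real ^ 'n \<Rightarrow> (real ^ 'n) set" where
  "C_Q_bar A c0 = C_Q A c0 \<union> S_Q A c0"

(* For c in C_Q_bar A c0, the test qform A c < 0 (here and in pfun) says c is in C_Q A c0
   and its negation says c is in S_Q A c0. *)
definition R_char :: "real ^ 'n ^ 'n \<Rightarrow> real ^ 'n \<Rightarrow> (real ^ 'n) set" where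
  "R_char A c = (if qform A c < 0 then UNIV else {a. bform A c a \<notin> \<int>})"

(* For integral c (e.g. the primitive generator of a rational isotropic ray), R_char A c is
   stable under A^{-1}Z^n, hence under Z^n when A is integral.  This fails for general
   rational c: with A = ((0,1),(1,0)), c = (1/2,0), the point (x,1) lies in R_char A c but
   (x,0) does not, and the theta series for the characteristic (x,1) then contains infinitely
   many terms of absolute value tending to 1.  The inversion formula therefore has to ask for
   all translates of the characteristics to be admissible; by the next two lemmas this is
   automatic whenever c is integral. *)
lemma R_char_dual_translate:
  assumes "invertible A" "c \<in> int_lattice"
    and "a \<in> R_char A c" "p \<in> dual_lattice A"
  shows "a + p \<in> R_char A c"
proof -
  obtain m where m: "m \<in> int_lattice" "p = matrix_inv A *v m"
    using assms(4) by (auto simp: dual_lattice_def)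
  have Ap: "A *v p = m"
    using m(2) someI_ex[OF assms(1)[unfolded invertible_def]]
    by (simp add: matrix_vector_mul_assoc matrix_inv_def)
  have int: "bform A c p \<in> \<int>"
    unfolding bform_def Ap inner_vec_def using assms(2) m(1)
    by (auto simp: int_lattice_def intro!: Ints_sum Ints_mult)
  have "bform A c (a + p) = bform A c a + bform A c p"
    by (simp add: bform_def matrix_vector_right_distrib inner_add_right)
  moreover have "bform A c a \<notin> \<int> \<Longrightarrow> bform A c a + bform A c p \<notin> \<int>"
    using int by (metis Ints_diff add_diff_cancel_right')
  ultimately show ?thesis
    using assms(3) by (auto simp: R_char_def split: if_splits)
qed

lemma int_lattice_subset_dual:
  fixes A :: "real ^ 'n ^ 'n"
  assumes "invertible A" "\<forall>i j. A $ i $ j \<in> \<int>"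
  shows "int_lattice \<subseteq> dual_lattice A"
proof
  fix v :: "real ^ 'n" assume v: "v \<in> int_lattice"
  have "A *v v \<in> int_lattice"
    using v assms(2)
    by (auto simp: int_lattice_def matrix_vector_mult_def intro!: Ints_sum Ints_mult)
  moreover have "v = matrix_inv A *v (A *v v)"
    using someI_ex[OF assms(1)[unfolded invertible_def]]
    by (simp add: matrix_vector_mul_assoc matrix_inv_def)
  ultimately show "v \<in> dual_lattice A"
    unfolding dual_lattice_def by blast
qed

(* Polynomials on R^n with complex coefficients, as functions.  The exponents range over
   the finitely many multi-indices of weight d. *)
definition homogeneous_polynomial :: "nat \<Rightarrow> (real ^ 'n \<Rightarrow> complex) \<Rightarrow> bool" where
  "homogeneous_polynomial d f \<longleftrightarrow>
     (\<exists>coef :: ('n \<Rightarrow> nat) \<Rightarrow> complex.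
        f = (\<lambda>v. \<Sum>\<alpha> | (\<Sum>i\<in>UNIV. \<alpha> i) = d. coef \<alpha> * of_real (\<Prod>i\<in>UNIV. (v $ i) ^ \<alpha> i)))"

definition partial_deriv :: "'n \<Rightarrow> (real ^ 'n \<Rightarrow> complex) \<Rightarrow> real ^ 'n \<Rightarrow> complex" where
  "partial_deriv i f v = vector_derivative (\<lambda>t. f (v + t *\<^sub>R axis i 1)) (at 0)"

definition laplace :: "real ^ 'n ^ 'n \<Rightarrow> (real ^ 'n \<Rightarrow> complex) \<Rightarrow> real ^ 'n \<Rightarrow> complex" where
  "laplace A f v =
     (\<Sum>i\<in>UNIV. \<Sum>j\<in>UNIV. of_real (matrix_inv A $ i $ j) * partial_deriv i (partial_deriv j f) v)"

(* For polynomial f all but finitely many terms of the series vanish. *)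
definition fhat :: "real ^ 'n ^ 'n \<Rightarrow> (real ^ 'n \<Rightarrow> complex) \<Rightarrow> real ^ 'n \<Rightarrow> complex" where
  "fhat A f v =
     (\<Sum>k. of_real ((-1) ^ k / ((8 * pi) ^ k * fact k)) * (laplace A ^^ k) f v)"

definition partial_dir ::
    "real ^ 'n ^ 'n \<Rightarrow> real ^ 'n \<Rightarrow> (real ^ 'n \<Rightarrow> complex) \<Rightarrow> real ^ 'n \<Rightarrow> complex" where
  "partial_dir A c f v =
     of_real (1 / sqrt (- qform A c)) * (\<Sum>i\<in>UNIV. of_real (c $ i) * partial_deriv i f v)"

(* Only real arguments occur.  The interval integral is oriented, so E_fun is odd. *)
definition E_fun :: "real \<Rightarrow> real" where
  "E_fun z = 2 * (LBINT u=0..z. exp (- pi * u\<^sup>2))"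

definition pfun :: "real ^ 'n ^ 'n \<Rightarrow> nat \<Rightarrow> real ^ 'n \<Rightarrow> (real ^ 'n \<Rightarrow> complex)
    \<Rightarrow> real ^ 'n \<Rightarrow> complex" where
  "pfun A d c f v =
     (if qform A c < 0
      then (\<Sum>k=0..d. of_real ((-1) ^ k / ((4 * pi) ^ k * fact k)
                          * (deriv ^^ k) E_fun (bform A c v / sqrt (- qform A c)))
                      * (partial_dir A c ^^ k) (fhat A f) v)
      else of_real (sgn (bform A c v)) * fhat A f v)"

definition Theta_hat :: "real ^ 'n ^ 'n \<Rightarrow> nat \<Rightarrow> real ^ 'n \<Rightarrow> real ^ 'n
    \<Rightarrow> real ^ 'n \<Rightarrow> real ^ 'n \<Rightarrow> (real ^ 'n \<Rightarrow> complex) \<Rightarrow> complex \<Rightarrow> complex" where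
  "Theta_hat A d c1 c2 a b f \<tau> =
     of_real (Im \<tau> powr (- (real d / 2))) *
     (\<Sum>\<^sub>\<infinity>l\<in>(\<lambda>m. a + m) ` int_lattice.
        (pfun A d c1 f (sqrt (Im \<tau>) *\<^sub>R l) - pfun A d c2 f (sqrt (Im \<tau>) *\<^sub>R l))
        * exp (2 * pi * \<i> * \<tau> * qform A l) * exp (2 * pi * \<i> * bform A l b))"

definition diag_vec :: "real ^ 'n ^ 'n \<Rightarrow> real ^ 'n" where
  "diag_vec A = (\<chi> i. A $ i $ i)"

definition even_matrix :: "real ^ 'n ^ 'n \<Rightarrow> bool" where
  "even_matrix A \<longleftrightarrow> (\<forall>i. \<exists>k :: int. A $ i $ i = 2 * of_int k)"

end

theory Submission
  imports Defs "HOL-Complex_Analysis.Complex_Analysis" "HOL-Probability.Probability"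
begin

text \<open>The first four identities hold term by term.  For the inversion formula, polarization reduces \<open>f\<close>
  to powers \<open>B(h, v)^d\<close>, and comparing both \<open>c1\<close> and \<open>c2\<close> with \<open>c0\<close> reduces the theta series to
  differences of two kernels.  Such a difference is the integral, along a path of vectors \<open>t\<close> with
  \<open>Q(t) = - 1\<close> in the plane spanned by the two cone vectors, of a Hermite polynomial times the Gaussian
  \<open>exp (2 \<pi> i \<tau> Q(v) - \<pi> y B(t, v)^2)\<close> of the positive definite majorant of \<open>Q\<close> attached to \<open>t\<close>.  For each \<open>t\<close>
  Poisson summation inverts the series of this integrand, and the bounds are uniform along the path; an isotropic
  \<open>c\<close> is a limit of the path, where the bounds need \<open>B(c, v)\<close> to stay away from \<open>0\<close>.\<close>

text \<open>A kernel attached to a single cone vector does not compensate the growth of the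
  exponential where \<open>qform A\<close> is negative, so the series cannot be inverted one cone
  vector at a time; differentiating along a path trades the error function for the Gaussian that
  turns \<open>Q\<close> into its majorant. Powers \<open>B(h, v)^d\<close> are convenient because
  \<open>fhat\<close> makes them \<open>fact d * hermite d\<close>, a coefficient of
  \<open>exp (b x - q x^2 / (4 pi))\<close>: the addition theorem of this generating function
  collapses the sum over \<open>k\<close> in the differentiated \<open>E_kernel\<close>, and
  comparing coefficients carries the inversion from pure Gaussians to polynomial factors. The
  correction in \<open>fhat\<close> is what makes the inversion scale the formal variable by
  \<open>\<i> * \<sigma>\<close> with \<open>\<sigma> = - \<i> * \<tau>\<close>; the degree and one
  tangent direction give the exponent \<open>d + 1\<close>. At an isotropic end the majorant
  degenerates and the tangent vector blows up like a power of \<open>1 / s\<close>; a lower bound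
  for \<open>\<bar>B(c, v)\<bar>\<close>, which rationality of \<open>c\<close> provides on
  translated lattices, yields a factor \<open>exp (- \<delta> / s)\<close> that outweighs
  this.\<close>

no_notation fps_nth (infixl "$" 75)
no_notation Infinite_Set_Sum.abs_summable_on (infix "abs'_summable'_on" 50)


section \<open>Gaussian integrals\<close>

lemma gaussian_integral_real:
  fixes s l :: real
  assumes s: "s > 0"
  shows "has_bochner_integral lborel (\<lambda>x. exp (- pi * s * x\<^sup>2 + l * x)) (exp (l\<^sup>2 / (4 * pi * s)) / sqrt s)"
proof -
  define \<mu> where "\<mu> = l / (2 * pi * s)"
  define \<sigma> where "\<sigma> = sqrt (1 / (2 * pi * s))"
  have \<sigma>: "\<sigma> > 0" "\<sigma>\<^sup>2 = 1 / (2 * pi * s)" using s by (auto simp: \<sigma>_def)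
  have eq: "exp (- pi * s * x\<^sup>2 + l * x) = (exp (l\<^sup>2 / (4 * pi * s)) / sqrt s) * normal_density \<mu> \<sigma> x" for x
  proof -
    have "- pi * s * x\<^sup>2 + l * x = l\<^sup>2 / (4 * pi * s) + (-(x - \<mu>)\<^sup>2 / (2 * \<sigma>\<^sup>2))"
      unfolding \<sigma>(2) \<mu>_def using s by (simp add: field_simps power2_eq_square)
    moreover have "normal_density \<mu> \<sigma> x = sqrt s * exp (-(x - \<mu>)\<^sup>2 / (2 * \<sigma>\<^sup>2))"
      unfolding normal_density_def \<sigma>(2) using s by (simp add: real_sqrt_divide field_simps)
    ultimately show ?thesis using s by (simp only: exp_add) simp
  qed
  have "has_bochner_integral lborel (normal_density \<mu> \<sigma>) 1"
    using \<sigma> by (simp add: has_bochner_integral_iff)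
  from has_bochner_integral_mult_right[OF this, of "exp (l\<^sup>2 / (4 * pi * s)) / sqrt s"] show ?thesis
    unfolding eq by simp
qed

text \<open>Expanding \<open>exp (w * \<beta> x)\<close> in powers of \<open>w\<close> and
  integrating term by term gives a power series; on the ball all partial sums of norms are dominated
  by the integrable function in \<open>int\<close>. This provides the holomorphy for the two
  continuations that extend the real Gaussian integral to complex parameters.\<close>

lemma integral_exp_holomorphic:
  fixes \<alpha> \<beta> :: "real \<Rightarrow> complex"
  assumes [measurable]: "\<alpha> \<in> borel_measurable borel" "\<beta> \<in> borel_measurable borel"
    and int: "integrable lborel (\<lambda>x. exp (Re (\<alpha> x)) * exp (r * norm (\<beta> x)))"
  shows "(\<lambda>w. \<integral>x. exp (\<alpha> x + w * \<beta> x) \<partial>lborel) holomorphic_on ball 0 r"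
proof (rule power_series_holomorphic[of 0 r "\<lambda>n. \<integral>x. exp (\<alpha> x) * (\<beta> x ^ n / fact n) \<partial>lborel"])
  fix w :: complex assume "w \<in> ball 0 r"
  then have w: "norm w \<le> r" by simp
  define F where "F = (\<lambda>n x. exp (\<alpha> x) * ((w * \<beta> x) ^ n / fact n))"
  have F_sums: "(\<lambda>n. F n x) sums exp (\<alpha> x + w * \<beta> x)" for x
    unfolding F_def exp_add
    by (intro sums_mult) (use exp_converges[of "w * \<beta> x"] in \<open>simp add: scaleR_conv_of_real field_simps\<close>)
  have normF: "norm (F n x) = exp (Re (\<alpha> x)) * (norm (w * \<beta> x) ^ n / fact n)" for n x
    by (simp add: F_def norm_mult norm_divide norm_power)
  have le_exp: "(\<Sum>i<n. t ^ i / fact i) \<le> exp t" if "t \<ge> 0" for t :: real and n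
  proof -
    have "(\<lambda>i. t ^ i / fact i) sums exp t"
      using exp_converges[of t] by (simp add: field_simps)
    then have "summable (\<lambda>i. t ^ i / fact i)" "(\<Sum>i. t ^ i / fact i) = exp t" by (simp_all add: sums_iff)
    then show ?thesis using that sum_le_suminf[of "\<lambda>i. t ^ i / fact i" "{..<n}"] by auto
  qed
  have sumF: "(\<Sum>i<n. norm (F i x)) \<le> exp (Re (\<alpha> x)) * exp (r * norm (\<beta> x))" for n x
  proof -
    have "(\<Sum>i<n. norm (F i x)) = exp (Re (\<alpha> x)) * (\<Sum>i<n. norm (w * \<beta> x) ^ i / fact i)"
      by (simp add: normF sum_distrib_left)
    also have "\<dots> \<le> exp (Re (\<alpha> x)) * exp (norm (w * \<beta> x))" by (intro mult_left_mono le_exp) auto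
    also have "\<dots> \<le> exp (Re (\<alpha> x)) * exp (r * norm (\<beta> x))"
      using w by (auto simp: norm_mult intro!: mult_right_mono)
    finally show ?thesis .
  qed
  have intF: "integrable lborel (F n)" for n
  proof (rule Bochner_Integration.integrable_bound[OF int])
    show "F n \<in> borel_measurable lborel" unfolding F_def by measurable
    show "AE x in lborel. norm (F n x) \<le> norm (exp (Re (\<alpha> x)) * exp (r * norm (\<beta> x)))"
    proof (rule AE_I2)
      fix x
      have "norm (F n x) \<le> (\<Sum>i<Suc n. norm (F i x))" by (simp add: sum_nonneg)
      also note sumF
      finally show "norm (F n x) \<le> norm (exp (Re (\<alpha> x)) * exp (r * norm (\<beta> x)))" by simp
    qed
  qed
  have "summable (\<lambda>n. \<integral>x. norm (F n x) \<partial>lborel)"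
  proof (rule bounded_imp_summable)
    show "(\<integral>x. norm (F n x) \<partial>lborel) \<ge> 0" for n by simp
    show "(\<Sum>k\<le>n. \<integral>x. norm (F k x) \<partial>lborel) \<le> (\<integral>x. exp (Re (\<alpha> x)) * exp (r * norm (\<beta> x)) \<partial>lborel)" for n
    proof -
      have "(\<Sum>k\<le>n. \<integral>x. norm (F k x) \<partial>lborel) = (\<integral>x. (\<Sum>k\<le>n. norm (F k x)) \<partial>lborel)"
        by (rule Bochner_Integration.integral_sum[symmetric]) (use intF in auto)
      also have "\<dots> \<le> (\<integral>x. exp (Re (\<alpha> x)) * exp (r * norm (\<beta> x)) \<partial>lborel)"
        by (intro integral_mono Bochner_Integration.integrable_sum integrable_norm intF int)
           (subst lessThan_Suc_atMost[symmetric], rule sumF)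
      finally show ?thesis .
    qed
  qed
  moreover have "summable (\<lambda>n. norm (F n x))" for x
    by (rule bounded_imp_summable[of _ "exp (Re (\<alpha> x)) * exp (r * norm (\<beta> x))"])
       (use sumF[where x=x and n="Suc _"] in \<open>auto simp: lessThan_Suc_atMost\<close>)
  ultimately have "(\<lambda>n. integral\<^sup>L lborel (F n)) sums (\<integral>x. (\<Sum>n. F n x) \<partial>lborel)"
    using intF by (intro sums_integral) auto
  also have "(\<lambda>x. \<Sum>n. F n x) = (\<lambda>x. exp (\<alpha> x + w * \<beta> x))"
    using F_sums by (auto simp: sums_iff)
  also have "(\<lambda>n. integral\<^sup>L lborel (F n)) = (\<lambda>n. (\<integral>x. exp (\<alpha> x) * (\<beta> x ^ n / fact n) \<partial>lborel) * w ^ n)"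
  proof
    fix n
    have "F n = (\<lambda>x. (exp (\<alpha> x) * (\<beta> x ^ n / fact n)) * w ^ n)"
      by (auto simp: F_def power_mult_distrib)
    then show "integral\<^sup>L lborel (F n) = (\<integral>x. exp (\<alpha> x) * (\<beta> x ^ n / fact n) \<partial>lborel) * w ^ n"
      by (simp only: integral_mult_left_zero)
  qed
  finally show "(\<lambda>n. (\<integral>x. exp (\<alpha> x) * (\<beta> x ^ n / fact n) \<partial>lborel) * (w - 0) ^ n) sums
     (\<integral>x. exp (\<alpha> x + w * \<beta> x) \<partial>lborel)" by simp
qed

lemma integrable_gaussian_abs:
  fixes s l :: real
  assumes s: "s > 0"
  shows "integrable lborel (\<lambda>x. exp (- pi * s * x\<^sup>2 + l * \<bar>x\<bar>))"
proof (rule Bochner_Integration.integrable_bound)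
  show "integrable lborel (\<lambda>x. exp (- pi * s * x\<^sup>2 + l * x) + exp (- pi * s * x\<^sup>2 + (-l) * x))"
    using gaussian_integral_real[OF s, of l] gaussian_integral_real[OF s, of "-l"]
    by (auto simp: has_bochner_integral_iff)
  show "AE x in lborel. norm (exp (- pi * s * x\<^sup>2 + l * \<bar>x\<bar>)) \<le>
           norm (exp (- pi * s * x\<^sup>2 + l * x) + exp (- pi * s * x\<^sup>2 + (-l) * x))"
  proof (rule AE_I2)
    fix x :: real
    show "norm (exp (- pi * s * x\<^sup>2 + l * \<bar>x\<bar>)) \<le>
           norm (exp (- pi * s * x\<^sup>2 + l * x) + exp (- pi * s * x\<^sup>2 + (-l) * x))"
      by (cases "x \<ge> 0") (simp_all add: add_increasing add_increasing2 add_pos_pos abs_of_pos)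
  qed
qed auto

lemma of_real_islimpt:
  fixes S :: "real set"
  assumes "x islimpt S"
  shows "complex_of_real x islimpt (of_real ` S)"
  using assms unfolding islimpt_approachable
  by (metis (no_types, lifting) dist_of_real imageI of_real_eq_iff)

text \<open>The identity theorem is applied twice, each time from a real segment: to the linear
  coefficient \<open>l\<close> while the quadratic one is real, then to the quadratic coefficient
  with \<open>l\<close> fixed. In the right half-plane \<open>csqrt\<close> is holomorphic, so the
  branch is settled by its value on the real axis.\<close>

theorem gaussian_integral_complex:
  fixes s l :: complex
  assumes s: "Re s > 0"
  shows "integrable lborel (\<lambda>x::real. exp (- of_real pi * s * of_real x ^ 2 + l * of_real x))"
    and "(\<integral>x. exp (- of_real pi * s * of_real (x::real) ^ 2 + l * of_real x) \<partial>lborel)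
           = exp (l\<^sup>2 / (4 * of_real pi * s)) / csqrt s"
proof -
  show "integrable lborel (\<lambda>x::real. exp (- of_real pi * s * of_real x ^ 2 + l * of_real x))"
  proof (rule Bochner_Integration.integrable_bound[OF integrable_gaussian_abs[OF s, of "norm l"]])
    show "AE x in lborel. norm (exp (- of_real pi * s * of_real x ^ 2 + l * of_real x))
            \<le> norm (exp (- pi * Re s * x\<^sup>2 + cmod l * \<bar>x\<bar>))"
    proof (rule AE_I2)
      fix x :: real
      have "Re l * x \<le> cmod l * \<bar>x\<bar>"
        using mult_mono[OF abs_Re_le_cmod[of l] order_refl[of "\<bar>x\<bar>"]] by (simp add: abs_mult[symmetric])
      then show "norm (exp (- of_real pi * s * of_real x ^ 2 + l * of_real x))
            \<le> norm (exp (- pi * Re s * x\<^sup>2 + cmod l * \<bar>x\<bar>))"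
        by (simp flip: of_real_power)
    qed
  qed measurable
  have step1: "(\<integral>x. exp (- of_real pi * of_real R * of_real x ^ 2 + l * of_real x) \<partial>lborel)
           = exp (l\<^sup>2 / (4 * of_real pi * of_real R)) / of_real (sqrt R)" if R: "R > 0" for R and l :: complex
  proof -
    define f where "f = (\<lambda>l::complex. (\<integral>x. exp (- of_real pi * of_real R * of_real x ^ 2 + l * of_real x) \<partial>lborel)
         - exp (l\<^sup>2 / (4 * of_real pi * of_real R)) / of_real (sqrt R))"
    define r where "r = norm l + 1"
    have r: "r > 0" "norm l < r" by (auto simp: r_def intro: add_nonneg_pos)
    have "f l = 0"
    proof (rule analytic_continuation[where f=f and S="ball 0 r" and U="of_real ` ball 0 r" and \<xi>=0])
      have "integrable lborel (\<lambda>x. exp (Re (- of_real pi * of_real R * of_real x ^ 2)) * exp (r * norm (complex_of_real x)))"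
        using integrable_gaussian_abs[OF R, of r] by (simp flip: of_real_power exp_add)
      from integral_exp_holomorphic[OF _ _ this, simplified]
      have "(\<lambda>l::complex. \<integral>x. exp (- of_real pi * of_real R * of_real x ^ 2 + l * of_real x) \<partial>lborel)
          holomorphic_on ball 0 r" by simp
      then show "f holomorphic_on ball 0 r"
        unfolding f_def using R by (intro holomorphic_intros) auto
      show "complex_of_real ` ball 0 r \<subseteq> ball 0 r" by auto
      show "0 \<in> ball (0::complex) r" using r by auto
      have "complex_of_real 0 islimpt of_real ` ball 0 r"
        using r by (intro of_real_islimpt) (auto simp: mem_interior intro!: interior_limit_point)
      then show "0 islimpt complex_of_real ` ball 0 r" by simp
      show "l \<in> ball 0 r" using r by auto
      fix z assume "z \<in> complex_of_real ` ball 0 r"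
      then obtain t where t: "z = of_real t" by auto
      have "(\<integral>x. exp (- of_real pi * of_real R * of_real x ^ 2 + z * of_real x) \<partial>lborel)
         = (\<integral>x. complex_of_real (exp (- pi * R * x\<^sup>2 + t * x)) \<partial>lborel)"
        unfolding t by (intro Bochner_Integration.integral_cong refl) (simp flip: exp_of_real)
      also have "\<dots> = complex_of_real (exp (t\<^sup>2 / (4 * pi * R)) / sqrt R)"
        using gaussian_integral_real[OF R, of t] by (simp only: integral_of_real has_bochner_integral_iff)
      finally show "f z = 0" by (simp add: f_def t flip: exp_of_real)
    qed auto
    then show ?thesis by (simp add: f_def)
  qed
  show "(\<integral>x. exp (- of_real pi * s * of_real (x::real) ^ 2 + l * of_real x) \<partial>lborel)
           = exp (l\<^sup>2 / (4 * of_real pi * s)) / csqrt s"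
  proof -
    \<comment> \<open>A disc that is centred on the real axis, contains \<open>s\<close> and stays
      in the right half-plane: this \<open>R\<close> gives
      \<open>norm (s - R) ^ 2 = R ^ 2 - norm s ^ 2 < R ^ 2\<close>, and the radius \<open>r\<close>
      is halfway between \<open>norm (s - R)\<close> and \<open>R\<close>.\<close>
    define R where "R = (norm s)\<^sup>2 / Re s"
    have s0: "norm s > 0" using s by auto
    have R: "R > 0" using s s0 by (auto simp: R_def)
    define r where "r = (norm (s - of_real R) + R) / 2"
    have "(norm (s - of_real R))\<^sup>2 = (norm s)\<^sup>2 - 2 * R * Re s + R\<^sup>2"
      unfolding cmod_power2 by (simp add: power2_eq_square algebra_simps)
    also have "\<dots> < R\<^sup>2" using s s0 by (simp add: R_def)
    finally have "norm (s - of_real R) < R" using R by (simp add: power2_less_imp_less)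
    then have r: "norm (s - of_real R) < r" "r < R" "r > 0"
      using R norm_ge_zero[of "s - of_real R"] by (auto simp: r_def simp del: norm_ge_zero)
    define f where "f = (\<lambda>w::complex. (\<integral>x. exp ((- of_real pi * of_real R * of_real x ^ 2 + l * of_real x)
            + w * (- of_real pi * of_real x ^ 2)) \<partial>lborel)
         - exp (l\<^sup>2 / (4 * of_real pi * (of_real R + w))) / csqrt (of_real R + w))"
    have pos: "Re (of_real R + w) > 0" if "norm w < r" for w
      using that abs_Re_le_cmod[of w] r by auto
    have "f (s - of_real R) = 0"
    proof (rule analytic_continuation[where f=f and S="ball 0 r" and U="of_real ` ball 0 r" and \<xi>=0])
      have "integrable lborel (\<lambda>x. exp (Re (- of_real pi * of_real R * of_real x ^ 2 + l * of_real x)) *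
              exp (r * norm (- complex_of_real pi * of_real x ^ 2)))"
      proof (rule Bochner_Integration.integrable_bound)
        show "integrable lborel (\<lambda>x. exp (- pi * (R - r) * x\<^sup>2 + Re l * x))"
          using gaussian_integral_real[of "R - r" "Re l"] r by (auto simp: has_bochner_integral_iff)
        show "AE x in lborel. norm (exp (Re (- of_real pi * of_real R * of_real x ^ 2 + l * of_real x)) *
              exp (r * norm (- complex_of_real pi * of_real x ^ 2))) \<le> norm (exp (- pi * (R - r) * x\<^sup>2 + Re l * x))"
          by (intro AE_I2) (simp add: norm_mult norm_power algebra_simps flip: of_real_power exp_add)
      qed measurable
      from integral_exp_holomorphic[OF _ _ this, simplified]
      have "(\<lambda>w::complex. (\<integral>x. exp ((- of_real pi * of_real R * of_real x ^ 2 + l * of_real x)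
            + w * (- of_real pi * of_real x ^ 2)) \<partial>lborel)) holomorphic_on ball 0 r" by simp
      then show "f holomorphic_on ball 0 r"
        unfolding f_def using pos
        by (intro holomorphic_intros) (force simp: complex_nonpos_Reals_iff dest: pos)+
      show "complex_of_real ` ball 0 r \<subseteq> ball 0 r" by auto
      show "0 \<in> ball (0::complex) r" using r by auto
      have "complex_of_real 0 islimpt of_real ` ball 0 r"
        using r by (intro of_real_islimpt) (auto simp: mem_interior intro!: interior_limit_point)
      then show "0 islimpt complex_of_real ` ball 0 r" by simp
      show "s - of_real R \<in> ball 0 r" using r by auto
      fix z assume "z \<in> complex_of_real ` ball 0 r"
      then obtain t where t: "z = of_real t" "\<bar>t\<bar> < r" by auto
      then have Rt: "R + t > 0" using r by auto
      have "(\<integral>x. exp ((- of_real pi * of_real R * of_real x ^ 2 + l * of_real x)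
            + z * (- of_real pi * of_real x ^ 2)) \<partial>lborel)
         = exp (l\<^sup>2 / (4 * of_real pi * of_real (R + t))) / of_real (sqrt (R + t))"
        unfolding step1[OF Rt, symmetric] by (simp add: t algebra_simps)
      then show "f z = 0" using Rt by (simp add: f_def t flip: of_real_add)
    qed auto
    then show ?thesis by (simp add: f_def algebra_simps)
  qed
qed

section \<open>Linear substitutions on Cartesian space\<close>

lemma measure_shear_cbox:
  fixes a b :: "real^'n"
  assumes "m \<noteq> n"
  shows "measure lebesgue ((\<lambda>x. \<chi> i. if i = m then x$m + x$n else x$i) ` cbox a b) = measure lebesgue (cbox a b)"
proof (cases "cbox a b = {}")
  case False
  let ?h = "\<lambda>x::real^'n. \<chi> i. if i = m then x$m + x$n else x$i"
  \<comment> \<open>Moving the corner to \<open>0\<close> makes the coordinate \<open>x $ n\<close>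
    nonnegative on the box, the situation of \<open>measure_shear_interval\<close>.\<close>
  have "cbox a b = (+) a ` cbox 0 (b - a)"
    using cbox_translation[of a 0 "b - a"] by simp
  then have "?h ` cbox a b = (+) (?h a) ` (?h ` cbox 0 (b - a))"
    by (auto simp: image_image vec_eq_iff intro!: image_cong)
  then have "measure lebesgue (?h ` cbox a b) = measure lebesgue (?h ` cbox 0 (b - a))"
    by (simp only: measure_translation)
  also have "\<dots> = measure lebesgue (cbox 0 (b - a))"
    using False assms by (intro measure_shear_interval) (auto simp: box_ne_empty algebra_simps)
  also have "\<dots> = measure lebesgue (cbox a b)"
    using \<open>cbox a b = (+) a ` cbox 0 (b - a)\<close> by (metis measure_translation)
  finally show ?thesis .
qed auto

text \<open>The library proves this only for well-ordered index types.\<close>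
lemma measure_linear_image_cart:
  fixes f :: "real^'n \<Rightarrow> real^'n"
  assumes "linear f" "S \<in> lmeasurable"
  shows "f ` S \<in> lmeasurable \<and> measure lebesgue (f ` S) = \<bar>det (matrix f)\<bar> * measure lebesgue S"
proof -
  define P where "P = (\<lambda>f::real^'n \<Rightarrow> real^'n. \<forall>S\<in>lmeasurable. f ` S \<in> lmeasurable \<and>
    measure lebesgue (f ` S) = \<bar>det (matrix f)\<bar> * measure lebesgue S)"
  have "P f"
  proof (rule induct_linear_elementary[OF assms(1), of P])
    fix f g :: "real^'n \<Rightarrow> real^'n" assume 2: "linear f" "linear g" "P f" "P g"
    show "P (f \<circ> g)"
      unfolding P_def
    proof
      fix S :: "(real^'n) set" assume S: "S \<in> lmeasurable"
      have im: "(f \<circ> g) ` S = f ` (g ` S)" by auto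
      show "(f \<circ> g) ` S \<in> lmeasurable \<and>
          measure lebesgue ((f \<circ> g) ` S) = \<bar>det (matrix (f \<circ> g))\<bar> * measure lebesgue S"
        using 2(3,4) S unfolding P_def im matrix_compose[OF 2(2,1)] by (simp add: det_mul abs_mult)
    qed
  next
    fix f :: "real^'n \<Rightarrow> real^'n" and i assume 3: "linear f" "\<And>x. f x $ i = 0"
    then have "\<not> surj f"
      by (metis (full_types) one_neq_zero surjE vec_component)
    then have "\<not> inj f"
      using 3(1) linear_injective_imp_surjective by blast
    then have "negligible (f ` S)" "det (matrix f) = 0" for S
      using negligible_linear_singular_image[OF 3(1)] det_nz_iff_inj[OF 3(1)] by auto
    then show "P f"
      by (simp add: negligible_iff_measure P_def)
  next
    fix c :: "'n \<Rightarrow> real"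
    show "P (\<lambda>x. \<chi> i. c i * x $ i)"
      using measurable_stretch[of _ c] measure_stretch[of _ c]
      by (simp add: axis_def matrix_def det_diagonal P_def)
  next
    fix m n :: 'n assume 5: "m \<noteq> n"
    let ?h = "\<lambda>v::real^'n. \<chi> i. v $ Transposition.transpose m n i"
    have lin: "linear ?h" by (rule linearI) (auto simp: vec_eq_iff)
    have im: "measure lebesgue (?h ` cbox a b) = measure lebesgue (cbox a b)" for a b
    proof (cases "cbox a b = {}")
      case False
      have eq: "?h ` cbox a b = cbox (?h a) (?h b)"
      proof (intro set_eqI iffI)
        fix x assume x: "x \<in> cbox (?h a) (?h b)"
        have "?h x \<in> cbox a b"
          using x by (auto simp: mem_box_cart) (metis transpose_involutory)+
        moreover have "x = ?h (?h x)" by (simp add: vec_eq_iff)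
        ultimately show "x \<in> ?h ` cbox a b" by blast
      qed (auto simp: mem_box_cart)
      have "(\<Prod>i\<in>UNIV. b $ Transposition.transpose m n i - a $ Transposition.transpose m n i) = (\<Prod>i\<in>UNIV. b $ i - a $ i)"
        by (rule prod.reindex_bij_betw[of _ UNIV UNIV "\<lambda>i. b $ i - a $ i"]) (simp add: bij_transpose)
      moreover have "cbox (?h a) (?h b) \<noteq> {}" using False eq by auto
      ultimately show ?thesis using False unfolding eq by (simp add: content_cbox_cart)
    qed auto
    have "matrix ?h = (\<chi> i. (mat 1 :: real^'n^'n) $ Transposition.transpose m n i)"
      by (simp add: matrix_def axis_def mat_def vec_eq_iff)
    then have "det (matrix ?h) = of_int (sign (Transposition.transpose m n)) * det (mat 1 :: real^'n^'n)"
      using det_permute_rows[OF permutes_swap_id[of m UNIV n], of "mat 1 :: real^'n^'n"] by simp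
    then have "\<bar>det (matrix ?h)\<bar> = 1"
      by (simp only: sign_swap_id det_I) simp
    show "P ?h"
      unfolding P_def
    proof
      fix S :: "(real^'n) set" assume "S \<in> lmeasurable"
      from measure_linear_sufficient[OF lin this, of 1] im
      show "?h ` S \<in> lmeasurable \<and> measure lebesgue (?h ` S) = \<bar>det (matrix ?h)\<bar> * measure lebesgue S"
        unfolding \<open>\<bar>det (matrix ?h)\<bar> = 1\<close> by simp
    qed
  next
    fix m n :: 'n assume 6: "m \<noteq> n"
    let ?h = "\<lambda>v::real^'n. \<chi> i. if i = m then v $ m + v $ n else v $ i"
    have lin: "linear ?h" by (rule linearI) (auto simp: vec_eq_iff algebra_simps)
    have "matrix ?h = (\<chi> k. if k = m then row m (mat 1) + 1 *s row n (mat 1) else row k (mat 1 :: real^'n^'n))"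
      by (simp add: matrix_def axis_def mat_def vec_eq_iff row_def)
    then have "det (matrix ?h) = 1"
      using det_row_operation[OF 6, where c=1 and A="mat 1 :: real^'n^'n"] by (simp add: det_I)
    show "P ?h"
      unfolding P_def
    proof
      fix S :: "(real^'n) set" assume "S \<in> lmeasurable"
      from measure_linear_sufficient[OF lin this, of 1] measure_shear_cbox[OF 6]
      show "?h ` S \<in> lmeasurable \<and> measure lebesgue (?h ` S) = \<bar>det (matrix ?h)\<bar> * measure lebesgue S"
        unfolding \<open>det (matrix ?h) = 1\<close> by simp
    qed
  qed
  then show ?thesis using assms(2) by (simp add: P_def)
qed

text \<open>Both measures agree on boxes: the preimage of a box under \<open>T\<close> is its image
  under the inverse, and the two determinants cancel. As an identity of measures it transfers
  integrability and the integral at once.\<close>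

lemma lborel_linear_image_cart:
  fixes T :: "real^'n^'n"
  assumes "invertible T"
  shows "lborel = density (distr lborel borel ((*v) T)) (\<lambda>_. ennreal \<bar>det T\<bar>)"
proof (rule lborel_eqI)
  have [measurable]: "(*v) T \<in> borel \<rightarrow>\<^sub>M borel"
    by (intro borel_measurable_continuous_onI matrix_vector_mult_linear_continuous_on)
  obtain T' where T': "T ** T' = mat 1" "T' ** T = mat 1"
    using assms by (auto simp: invertible_def)
  have detT: "det T * det T' = 1" using T' by (metis det_I det_mul)
  fix l u :: "real^'n" assume lu: "\<And>b. b \<in> Basis \<Longrightarrow> l \<bullet> b \<le> u \<bullet> b"
  have vim: "(*v) T -` box l u = (*v) T' ` box l u"
    using T' by (auto simp: image_iff matrix_vector_mul_assoc) (metis matrix_vector_mul_assoc matrix_vector_mul_lid)+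
  have pre: "(*v) T -` box l u \<in> sets borel"
    using measurable_sets[of "(*v) T" borel borel "box l u"] by simp
  have "emeasure (density (distr lborel borel ((*v) T)) (\<lambda>_. ennreal \<bar>det T\<bar>)) (box l u)
      = ennreal \<bar>det T\<bar> * emeasure lborel ((*v) T' ` box l u)"
    by (simp add: emeasure_density nn_integral_cmult emeasure_distr vim)
  also have "emeasure lborel ((*v) T' ` box l u) = emeasure lebesgue ((*v) T' ` box l u)"
    using pre unfolding vim[symmetric] by (subst emeasure_completion) (auto simp: main_part_sets)
  also have "\<dots> = ennreal (measure lebesgue ((*v) T' ` box l u))"
    using measure_linear_image_cart[OF matrix_vector_mul_linear lmeasurable_box]
    by (intro emeasure_eq_measure2 fmeasurableD2) auto
  also have "measure lebesgue ((*v) T' ` box l u) = \<bar>det T'\<bar> * measure lebesgue (box l u)"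
    using measure_linear_image_cart[of "(*v) T'" "box l u"] by simp
  also have "ennreal \<bar>det T\<bar> * ennreal (\<bar>det T'\<bar> * measure lebesgue (box l u)) = ennreal (measure lebesgue (box l u))"
    using detT by (simp flip: ennreal_mult' abs_mult mult.assoc)
  also have "\<dots> = (\<Prod>b\<in>Basis. (u - l) \<bullet> b)"
    using lu by (simp add: measure_lborel_box)
  finally show "emeasure (density (distr lborel borel ((*v) T)) (\<lambda>_. ennreal \<bar>det T\<bar>)) (box l u) = (\<Prod>b\<in>Basis. (u - l) \<bullet> b)" .
qed auto

lemma
  fixes T :: "real^'n^'n" and f :: "real^'n \<Rightarrow> complex"
  assumes "invertible T" and [measurable]: "f \<in> borel_measurable borel"
  shows integrable_linear_cart: "integrable lborel f \<longleftrightarrow> integrable lborel (\<lambda>x. f (T *v x))"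
    and integral_linear_cart: "integral\<^sup>L lborel f = of_real \<bar>det T\<bar> * (\<integral>x. f (T *v x) \<partial>lborel)"
proof -
  have [measurable]: "(*v) T \<in> borel \<rightarrow>\<^sub>M borel"
    by (intro borel_measurable_continuous_onI matrix_vector_mult_linear_continuous_on)
  have d: "det T \<noteq> 0" using assms by (simp add: invertible_det_nz)
  have "integrable lborel g" if "integrable lborel (\<lambda>x. \<bar>det T\<bar> *\<^sub>R g x)" for g :: "real^'n \<Rightarrow> complex"
    using integrable_scaleR_right[OF that, of "1 / \<bar>det T\<bar>"] d by simp
  then have "integrable lborel (\<lambda>x. \<bar>det T\<bar> *\<^sub>R g x) \<longleftrightarrow> integrable lborel g" for g :: "real^'n \<Rightarrow> complex"
    by blast
  then show "integrable lborel f \<longleftrightarrow> integrable lborel (\<lambda>x. f (T *v x))"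
    by (subst lborel_linear_image_cart[OF assms(1)])
      (simp add: integrable_density integrable_distr_eq)
  show "integral\<^sup>L lborel f = of_real \<bar>det T\<bar> * (\<integral>x. f (T *v x) \<partial>lborel)"
    by (subst lborel_linear_image_cart[OF assms(1)])
      (simp add: integral_density integral_distr scaleR_conv_of_real)
qed

text \<open>\<open>lborel\<close> is the image of a product measure indexed by \<open>Basis\<close>,
  so Fubini for products applies once the coordinates are reindexed along \<open>axis i 1\<close>;
  \<open>ix\<close> inverts that correspondence.\<close>

lemma
  fixes \<phi> :: "'n::finite \<Rightarrow> real \<Rightarrow> complex"
  assumes int: "\<And>i. integrable lborel (\<phi> i)"
  shows integrable_prod_cart: "integrable lborel (\<lambda>v::real^'n. \<Prod>i\<in>UNIV. \<phi> i (v $ i))"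
    and integral_prod_cart: "(\<integral>v. (\<Prod>i\<in>UNIV. \<phi> i ((v::real^'n) $ i)) \<partial>lborel) = (\<Prod>i\<in>UNIV. integral\<^sup>L lborel (\<phi> i))"
proof -
  interpret product_sigma_finite "\<lambda>_::real^'n. lborel :: real measure" ..
  define ix where "ix = (\<lambda>b::real^'n. THE i. b = axis i 1)"
  have ix: "ix (axis i 1) = i" for i by (auto simp: ix_def axis_eq_axis)
  have bij: "bij_betw (\<lambda>i. axis i (1::real)) UNIV Basis"
    by (auto simp: bij_betw_def Basis_vec_def inj_on_def axis_eq_axis)
  have [measurable]: "\<phi> i \<in> borel_measurable borel" for i
    using borel_measurable_integrable[OF int] by simp
  have eq: "(\<Prod>i\<in>UNIV. \<phi> i ((\<Sum>b\<in>Basis. x b *\<^sub>R b) $ i)) = (\<Prod>b\<in>Basis. \<phi> (ix b) (x b))" for x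
  proof -
    have "(\<Sum>b\<in>Basis. x b *\<^sub>R b) $ i = x (axis i 1)" for i
    proof -
      have "(\<Sum>b\<in>Basis. x b *\<^sub>R b) $ i = (\<Sum>b\<in>Basis. x b *\<^sub>R b) \<bullet> axis i 1"
        by (simp add: inner_axis)
      also have "\<dots> = x (axis i 1)" by (rule inner_sum_left_Basis) (auto simp: Basis_vec_def)
      finally show ?thesis .
    qed
    then show ?thesis
      using prod.reindex_bij_betw[OF bij, of "\<lambda>b. \<phi> (ix b) (x b)"] by (simp add: ix)
  qed
  have m: "(\<lambda>f. \<Sum>b\<in>Basis. f b *\<^sub>R b) \<in> (\<Pi>\<^sub>M b\<in>(Basis::(real^'n) set). lborel) \<rightarrow>\<^sub>M borel"
    by measurable
  have i1: "integrable (\<Pi>\<^sub>M b\<in>(Basis::(real^'n) set). lborel) (\<lambda>x. \<Prod>b\<in>Basis. \<phi> (ix b) (x b))"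
    by (intro product_integrable_prod int) auto
  have [measurable]: "(\<lambda>v::real^'n. \<Prod>i\<in>UNIV. \<phi> i (v $ i)) \<in> borel_measurable borel" by measurable
  show "integrable lborel (\<lambda>v::real^'n. \<Prod>i\<in>UNIV. \<phi> i (v $ i))"
    by (subst lborel_eq) (use i1 in \<open>subst integrable_distr_eq[OF m], simp, simp only: eq\<close>)
  show "(\<integral>v. (\<Prod>i\<in>UNIV. \<phi> i ((v::real^'n) $ i)) \<partial>lborel) = (\<Prod>i\<in>UNIV. integral\<^sup>L lborel (\<phi> i))"
    apply (subst lborel_eq, subst integral_distr[OF m])
     apply simp
    apply (simp only: eq)
    apply (subst product_integral_prod)
      apply (auto simp: int)
    using prod.reindex_bij_betw[OF bij, of "\<lambda>b. integral\<^sup>L lborel (\<phi> (ix b))"] by (simp add: ix)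
qed

section \<open>Sums over the integer lattice\<close>

lemma int_lattice_0 [simp, intro]: "0 \<in> int_lattice"
  and int_lattice_add [intro]: "u \<in> int_lattice \<Longrightarrow> v \<in> int_lattice \<Longrightarrow> u + v \<in> int_lattice"
  and int_lattice_diff [intro]: "u \<in> int_lattice \<Longrightarrow> v \<in> int_lattice \<Longrightarrow> u - v \<in> int_lattice"
  and int_lattice_uminus [intro]: "u \<in> int_lattice \<Longrightarrow> - u \<in> int_lattice"
  and int_lattice_axis [simp, intro]: "axis i 1 \<in> int_lattice"
  by (auto simp: int_lattice_def axis_def)

lemma inner_int_lattice: "u \<in> int_lattice \<Longrightarrow> v \<in> int_lattice \<Longrightarrow> u \<bullet> v \<in> \<int>"
  by (auto simp: int_lattice_def inner_vec_def)

lemma bij_betw_int_lattice: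
  "bij_betw (\<lambda>k::'n::finite \<Rightarrow> int. \<chi> i. real_of_int (k i)) UNIV int_lattice"
proof (rule bij_betwI[where g="\<lambda>v i. \<lfloor>v $ i\<rfloor>"])
  show "(\<lambda>v i. \<lfloor>v $ i\<rfloor>) \<in> int_lattice \<rightarrow> (UNIV :: ('n \<Rightarrow> int) set)" by auto
qed (auto simp: int_lattice_def vec_eq_iff Ints_def)

lemma countable_int_lattice: "countable (int_lattice :: (real^'n) set)"
proof -
  have "countable (range (\<lambda>k::'n \<Rightarrow> int. \<chi> i. real_of_int (k i)))" by blast
  then show ?thesis using bij_betw_int_lattice by (metis bij_betw_def)
qed

lemma bij_betw_add_int_lattice:
  "m \<in> int_lattice \<Longrightarrow> bij_betw ((+) m) int_lattice (int_lattice :: (real^'n) set)"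
  by (rule bij_betwI[where g="\<lambda>v. v - m"]) auto

lemma summable_on_int_geometric:
  fixes r :: real
  assumes "0 \<le> r" "r < 1"
  shows "(\<lambda>j::int. r ^ nat \<bar>j\<bar>) summable_on UNIV"
proof -
  have nat: "(\<lambda>j::nat. r ^ j) summable_on UNIV"
    using assms by (subst summable_on_UNIV_nonneg_real_iff) auto
  have "(\<lambda>j::int. r ^ nat \<bar>j\<bar>) summable_on range int"
    using nat by (subst summable_on_reindex) (auto simp: o_def)
  moreover have "(\<lambda>j::int. r ^ nat \<bar>j\<bar>) summable_on range (\<lambda>n. - int n)"
    using nat by (subst summable_on_reindex) (auto simp: o_def inj_on_def)
  moreover have "(UNIV :: int set) = range int \<union> range (\<lambda>n. - int n)"
    by (auto simp: image_iff) (metis int_cases2)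
  ultimately show ?thesis by (metis summable_on_union)
qed

text \<open>The Euclidean norm is at least the sum of the absolute coordinates divided by the
  dimension, so the exponential is dominated by a product of one geometric series per coordinate,
  with ratio \<open>exp (- \<kappa> / N)\<close>; the shift by \<open>a\<close> costs only the
  factor \<open>exp (\<kappa> * norm a)\<close>.\<close>

lemma summable_on_exp_norm_lattice:
  fixes a :: "real^'n"
  assumes \<kappa>: "\<kappa> > 0"
  shows "(\<lambda>m. exp (- \<kappa> * norm (a + m))) summable_on int_lattice"
proof -
  define N where "N = real CARD('n)"
  have N: "N > 0" by (simp add: N_def)
  define r where "r = exp (- \<kappa> / N)"
  have r: "0 \<le> r" "r < 1" using \<kappa> N by (auto simp: r_def)
  let ?\<phi> = "\<lambda>k::'n \<Rightarrow> int. \<chi> i. real_of_int (k i)"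
  \<comment> \<open>Two notions of absolute summability coexist;
    \<open>abs_summable_on_prod_PiE\<close> is stated for the one from
    \<open>Infinite_Set_Sum\<close>, hence the passage there and back.\<close>
  have "Infinite_Sum.abs_summable_on (\<lambda>j::int. r ^ nat \<bar>j\<bar>) UNIV"
    using summable_on_int_geometric[OF r] r by simp
  then have "Infinite_Set_Sum.abs_summable_on (\<lambda>j::int. r ^ nat \<bar>j\<bar>) UNIV"
    by (simp only: abs_summable_equivalent)
  then have "Infinite_Set_Sum.abs_summable_on (\<lambda>k::'n \<Rightarrow> int. \<Prod>i\<in>UNIV. r ^ nat \<bar>k i\<bar>) (PiE UNIV (\<lambda>_. UNIV))"
    by (intro abs_summable_on_prod_PiE) auto
  then have "Infinite_Sum.abs_summable_on (\<lambda>k::'n \<Rightarrow> int. \<Prod>i\<in>UNIV. r ^ nat \<bar>k i\<bar>) UNIV"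
    by (simp only: abs_summable_equivalent PiE_UNIV_domain UNIV_I if_True Pi_UNIV)
  then have "(\<lambda>k::'n \<Rightarrow> int. (\<Prod>i\<in>UNIV. r ^ nat \<bar>k i\<bar>)) summable_on UNIV"
    by (rule abs_summable_summable)
  then have sm: "(\<lambda>k::'n \<Rightarrow> int. exp (\<kappa> * norm a) * (\<Prod>i\<in>UNIV. r ^ nat \<bar>k i\<bar>)) summable_on UNIV"
    by (rule summable_on_cmult_right)
  have "(\<lambda>k. exp (- \<kappa> * norm (a + ?\<phi> k))) summable_on UNIV"
  proof (rule summable_on_comparison_test[OF sm])
    fix k :: "'n \<Rightarrow> int"
    have "N * norm (?\<phi> k) \<ge> (\<Sum>i\<in>UNIV. \<bar>real_of_int (k i)\<bar>)"
      using sum_mono[of UNIV "\<lambda>i. \<bar>?\<phi> k $ i\<bar>" "\<lambda>_. norm (?\<phi> k)"] component_le_norm_cart[of "?\<phi> k"]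
      by (simp add: N_def)
    then have le: "norm (?\<phi> k) \<ge> (\<Sum>i\<in>UNIV. \<bar>real_of_int (k i)\<bar>) / N"
      using N by (simp add: field_simps)
    have "norm (?\<phi> k) \<le> norm a + norm (a + ?\<phi> k)"
      using norm_triangle_ineq4[of "a + ?\<phi> k" a] by simp
    with le have "(\<Sum>i\<in>UNIV. \<bar>real_of_int (k i)\<bar>) / N - norm a \<le> norm (a + ?\<phi> k)" by linarith
    then have "- \<kappa> * norm (a + ?\<phi> k) \<le> - \<kappa> * ((\<Sum>i\<in>UNIV. \<bar>real_of_int (k i)\<bar>) / N - norm a)"
      using \<kappa> by simp
    also have "\<dots> = \<kappa> * norm a + (\<Sum>i\<in>UNIV. \<bar>real_of_int (k i)\<bar> * (- \<kappa> / N))"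
      by (simp add: algebra_simps sum_negf sum_distrib_left sum_divide_distrib)
    finally have "exp (- \<kappa> * norm (a + ?\<phi> k)) \<le> exp (\<kappa> * norm a) * (\<Prod>i\<in>UNIV. exp (\<bar>real_of_int (k i)\<bar> * (- \<kappa> / N)))"
      by (simp flip: exp_sum exp_add)
    also have "(\<lambda>i. exp (\<bar>real_of_int (k i)\<bar> * (- \<kappa> / N))) = (\<lambda>i. r ^ nat \<bar>k i\<bar>)"
      by (auto simp: r_def exp_of_nat_mult[symmetric])
    finally show "exp (- \<kappa> * norm (a + ?\<phi> k)) \<le> exp (\<kappa> * norm a) * (\<Prod>i\<in>UNIV. r ^ nat \<bar>k i\<bar>)" .
  qed auto
  then show ?thesis
    using summable_on_reindex_bij_betw[OF bij_betw_int_lattice, of "\<lambda>m. exp (- \<kappa> * norm (a + m))"] by blast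
qed

text \<open>A majorant \<open>B\<close> that is independent of the integration variable and summable
  over \<open>S\<close> suffices because the measure is finite. The exchange serves twice: for
  integrals over the unit cube and for integrals over the parameter of a path.\<close>

lemma
  fixes k :: "'b \<Rightarrow> 'a \<Rightarrow> complex" and B :: "'a \<Rightarrow> real"
  assumes S: "countable S" and M: "finite_measure M"
    and meas: "\<And>v. v \<in> S \<Longrightarrow> (\<lambda>s. k s v) \<in> borel_measurable M"
    and bound: "\<And>v s. v \<in> S \<Longrightarrow> s \<in> space M \<Longrightarrow> norm (k s v) \<le> B v"
    and B: "B summable_on S"
  shows abs_summable_on_integral: "(\<lambda>v. \<integral>s. k s v \<partial>M) abs_summable_on S"
    and infsum_integral_swap: "(\<Sum>\<^sub>\<infinity>v\<in>S. \<integral>s. k s v \<partial>M) = (\<integral>s. (\<Sum>\<^sub>\<infinity>v\<in>S. k s v) \<partial>M)"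
proof -
  interpret finite_measure M by fact
  have int: "integrable M (\<lambda>s. k s v)" if "v \<in> S" for v
    using that by (intro integrable_const_bound[of _ "B v"] meas AE_I2 bound)
  have nint: "(\<integral>s. norm (k s v) \<partial>M) \<le> B v * measure M (space M)" if "v \<in> S" for v
  proof -
    have "(\<integral>s. norm (k s v) \<partial>M) \<le> (\<integral>s. B v \<partial>M)"
      by (rule integral_mono) (use that int bound in auto)
    then show ?thesis by (simp add: mult.commute)
  qed
  have BM: "(\<lambda>v. B v * measure M (space M)) summable_on S"
    using B by (rule summable_on_cmult_left)
  show abs: "(\<lambda>v. \<integral>s. k s v \<partial>M) abs_summable_on S"
    by (rule summable_on_comparison_test[OF BM]) (auto intro: order_trans[OF integral_norm_bound nint])
  show "(\<Sum>\<^sub>\<infinity>v\<in>S. \<integral>s. k s v \<partial>M) = (\<integral>s. (\<Sum>\<^sub>\<infinity>v\<in>S. k s v) \<partial>M)"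
  proof (cases "finite S")
    case True
    then show ?thesis using int by simp
  next
    case False
    \<comment> \<open>An enumeration turns the unordered sum into a series, for which termwise
      integration is available; absolute summability makes the two readings agree.\<close>
    define e where "e = from_nat_into S"
    have e: "bij_betw e UNIV S"
      using False S by (simp add: e_def bij_betw_from_nat_into)
    then have eS: "e n \<in> S" for n by (auto simp: bij_betw_def)
    have Be: "(\<lambda>n. B (e n)) summable_on UNIV"
      using B summable_on_reindex_bij_betw[OF e, of B] by simp
    then have Bs: "summable (\<lambda>n. B (e n))" by (rule summable_on_imp_summable)
    have BMs: "summable (\<lambda>n. B (e n) * measure M (space M))" using Bs by (rule summable_mult2)
    have "summable (\<lambda>n. \<integral>s. norm (k s (e n)) \<partial>M)"
      by (rule summable_comparison_test'[OF BMs, of 0]) (use nint eS in auto)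
    moreover have ks: "summable (\<lambda>n. norm (k s (e n)))" if "s \<in> space M" for s
      by (rule summable_comparison_test'[OF Bs, of 0]) (use that bound eS in auto)
    ultimately have "(\<lambda>n. \<integral>s. k s (e n) \<partial>M) sums (\<integral>s. (\<Sum>n. k s (e n)) \<partial>M)"
      using int eS by (intro sums_integral) auto
    moreover have "(\<integral>s. (\<Sum>n. k s (e n)) \<partial>M) = (\<integral>s. (\<Sum>\<^sub>\<infinity>v\<in>S. k s v) \<partial>M)"
    proof (rule Bochner_Integration.integral_cong[OF refl])
      fix s assume s: "s \<in> space M"
      have "((\<lambda>n. k s (e n)) has_sum (\<Sum>n. k s (e n))) UNIV"
        using ks[OF s] by (intro norm_summable_imp_has_sum) (auto intro: summable_norm_cancel)
      then have "(\<Sum>\<^sub>\<infinity>n. k s (e n)) = (\<Sum>n. k s (e n))" by (rule infsumI)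
      then show "(\<Sum>n. k s (e n)) = (\<Sum>\<^sub>\<infinity>v\<in>S. k s v)"
        using infsum_reindex_bij_betw[OF e, of "k s"] by simp
    qed
    moreover have "((\<lambda>n. \<integral>s. k s (e n) \<partial>M) has_sum (\<Sum>\<^sub>\<infinity>v\<in>S. \<integral>s. k s v \<partial>M)) UNIV"
      using has_sum_reindex_bij_betw[OF e, of "\<lambda>v. \<integral>s. k s v \<partial>M"] abs_summable_summable[OF abs]
      by (simp add: has_sum_infsum)
    then have "(\<lambda>n. \<integral>s. k s (e n) \<partial>M) sums (\<Sum>\<^sub>\<infinity>v\<in>S. \<integral>s. k s v \<partial>M)" by (rule has_sum_imp_sums)
    ultimately show ?thesis by (metis sums_unique2)
  qed
qed

section \<open>The half-open unit cube, whose lattice translates tile the space without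
  overlap\<close>

definition unit_cube :: "(real^'n) set" where
  "unit_cube = {x. \<forall>i. 0 \<le> x $ i \<and> x $ i < 1}"

lemma unit_cube_borel [measurable]: "unit_cube \<in> sets borel"
  unfolding unit_cube_def by measurable

lemma unit_cube_translates:
  fixes x :: "real^'n"
  obtains m where "m \<in> int_lattice" "x - m \<in> unit_cube"
proof
  show "(\<chi> i. real_of_int \<lfloor>x $ i\<rfloor>) \<in> int_lattice" by (simp add: int_lattice_def)
  show "x - (\<chi> i. real_of_int \<lfloor>x $ i\<rfloor>) \<in> unit_cube"
    by (auto simp: unit_cube_def) linarith
qed

lemma unit_cube_unique:
  assumes "x \<in> unit_cube" "y \<in> unit_cube" "x - y \<in> int_lattice"
  shows "x = y"
proof -
  have "x $ i = y $ i" for i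
  proof -
    have "x $ i - y $ i \<in> \<int>" "\<bar>x $ i - y $ i\<bar> < 1"
      using assms by (auto simp: unit_cube_def int_lattice_def) (smt (verit, best))
    then show ?thesis by (metis Ints_nonzero_abs_less1 eq_iff_diff_eq_0)
  qed
  then show ?thesis by (simp add: vec_eq_iff)
qed

text \<open>Unfolding: the translates of the cube partition the space, and each piece is moved back
  to the cube by translation invariance. The hypothesis \<open>abs\<close> ties the unordered sum to
  the series over an enumeration of the lattice.\<close>

lemma infsum_unit_cube_translates:
  fixes h :: "real^'n \<Rightarrow> complex"
  assumes h: "integrable lborel h"
    and abs: "(\<lambda>m. \<integral>x. indicator unit_cube x *\<^sub>R h (x + m) \<partial>lborel) abs_summable_on int_lattice"
  shows "(\<Sum>\<^sub>\<infinity>m\<in>int_lattice. \<integral>x. indicator unit_cube x *\<^sub>R h (x + m) \<partial>lborel) = integral\<^sup>L lborel h"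
proof -
  have inf: "infinite (int_lattice :: (real^'n) set)"
  proof -
    have "infinite (UNIV :: ('n \<Rightarrow> int) set)"
      by (simp add: finite_UNIV_fun infinite_UNIV_int)
    then show ?thesis using bij_betw_finite[OF bij_betw_int_lattice[where 'n='n]] by simp
  qed
  define e where "e = from_nat_into (int_lattice :: (real^'n) set)"
  have e: "bij_betw e UNIV int_lattice"
    unfolding e_def by (rule bij_betw_from_nat_into[OF countable_int_lattice inf])
  then have eS: "e n \<in> int_lattice" for n by (auto simp: bij_betw_def)
  define A where "A = (\<lambda>n. (\<lambda>x. x - e n) -` unit_cube)"
  have UA: "(\<Union>n. A n) = UNIV"
  proof -
    have "\<exists>n. x \<in> A n" for x
    proof -
      obtain m where "m \<in> int_lattice" "x - m \<in> unit_cube" by (rule unit_cube_translates)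
      then show ?thesis using e by (auto simp: A_def bij_betw_def) (metis rangeE)
    qed
    then show ?thesis by auto
  qed
  have "(LINT x:(\<Union>n. A n)|lborel. h x) = (\<Sum>n. (LINT x:(A n)|lborel. h x))"
  proof (rule lebesgue_integral_countable_add)
    show "A n \<in> sets lborel" for n
      unfolding A_def using measurable_sets[of "\<lambda>x. x - e n" borel borel unit_cube] by simp
    show "A i \<inter> A j = {}" if "i \<noteq> j" for i j
    proof -
      have False if x: "x \<in> A i" "x \<in> A j" for x
      proof -
        have "x - e i = x - e j"
          using x eS by (intro unit_cube_unique) (auto simp: A_def)
        then have "e i = e j" by simp
        with \<open>i \<noteq> j\<close> e show False by (metis bij_betw_def injD)
      qed
      then show ?thesis by blast
    qed
    show "set_integrable lborel (\<Union>n. A n) h" using h by (simp add: UA set_integrable_def)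
  qed
  moreover have "(LINT x:(A n)|lborel. h x) = (\<integral>x. indicator unit_cube x *\<^sub>R h (x + e n) \<partial>lborel)" for n
  proof -
    have "(LINT x:(A n)|lborel. h x) = (\<integral>x. indicator (A n) (e n + x) *\<^sub>R h (e n + x) \<partial>lborel)"
      unfolding set_lebesgue_integral_def
    proof -
      have "(\<lambda>x. indicator (A n) x *\<^sub>R h x) \<in> borel_measurable borel"
        using borel_measurable_integrable[OF h] measurable_sets[of "\<lambda>x. x - e n" borel borel unit_cube]
        by (auto simp: A_def)
      then show "(\<integral>x. indicator (A n) x *\<^sub>R h x \<partial>lborel) = (\<integral>x. indicator (A n) (e n + x) *\<^sub>R h (e n + x) \<partial>lborel)"
        by (subst lborel_distr_plus[of "e n", symmetric]) (simp add: integral_distr)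
    qed
    also have "\<dots> = (\<integral>x. indicator unit_cube x *\<^sub>R h (x + e n) \<partial>lborel)"
      by (simp add: A_def indicator_def add.commute)
    finally show ?thesis .
  qed
  moreover have "((\<lambda>n. \<integral>x. indicator unit_cube x *\<^sub>R h (x + e n) \<partial>lborel) has_sum
      (\<Sum>\<^sub>\<infinity>m\<in>int_lattice. \<integral>x. indicator unit_cube x *\<^sub>R h (x + m) \<partial>lborel)) UNIV"
    using has_sum_reindex_bij_betw[OF e, of "\<lambda>m. \<integral>x. indicator unit_cube x *\<^sub>R h (x + m) \<partial>lborel"]
      abs_summable_summable[OF abs] by (simp add: has_sum_infsum)
  then have "(\<Sum>n. \<integral>x. indicator unit_cube x *\<^sub>R h (x + e n) \<partial>lborel) =
      (\<Sum>\<^sub>\<infinity>m\<in>int_lattice. \<integral>x. indicator unit_cube x *\<^sub>R h (x + m) \<partial>lborel)"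
    by (simp add: has_sum_imp_sums sums_unique[symmetric])
  ultimately show ?thesis by (simp add: UA set_lebesgue_integral_def)
qed

section \<open>Poisson summation\<close>

text \<open>Realises the quotient by \<open>int_lattice\<close> as a compact subset of complex
  space, so that periodic functions become functions on a compact set.\<close>

definition torus_map :: "real^'n \<Rightarrow> complex^'n" where
  "torus_map x = (\<chi> i. cis (2 * pi * x $ i))"

lemma torus_map_eq_iff: "torus_map x = torus_map y \<longleftrightarrow> x - y \<in> int_lattice"
proof -
  have "cis (2 * pi * s) = cis (2 * pi * t) \<longleftrightarrow> s - t \<in> \<int>" for s t :: real
  proof -
    have "cis (2 * pi * s) = cis (2 * pi * t) \<longleftrightarrow> cis (2 * pi * (s - t)) = 1"
      by (simp add: cis_divide[symmetric] right_diff_distrib)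
    also have "\<dots> \<longleftrightarrow> (\<exists>n::int. 2 * pi * (s - t - of_int n) = 0)"
      unfolding right_diff_distrib[of "2 * pi"] by (simp add: cis_conv_exp exp_eq_1 algebra_simps del: mult_eq_0_iff)
    also have "\<dots> \<longleftrightarrow> (\<exists>n::int. s - t = of_int n)" by simp
    finally show ?thesis by (auto simp: Ints_def)
  qed
  then show ?thesis by (simp add: torus_map_def vec_eq_iff int_lattice_def)
qed

lemma continuous_on_torus_map: "continuous_on S torus_map"
  unfolding torus_map_def cis_conv_exp by (intro continuous_intros continuous_on_vec_lambda)

text \<open>The functions whose products with every null function below are null form an
  algebra, so Stone--Weierstrass on the torus makes a real continuous null function orthogonal
  to itself.\<close>

definition null_fourier :: "(real^'n \<Rightarrow> complex) \<Rightarrow> bool" where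
  "null_fourier D \<longleftrightarrow> continuous_on (cbox 0 1) D \<and>
     (\<forall>k\<in>int_lattice. integral (cbox 0 1) (\<lambda>x. D x * cis (2 * pi * (k \<bullet> x))) = 0)"

lemma continuous_on_cis_inner: "continuous_on S (\<lambda>x::real^'n. cis (2 * pi * (k \<bullet> x)))"
  unfolding cis_conv_exp by (intro continuous_intros)

lemma null_fourier_integrable:
  assumes "null_fourier D"
  shows "(\<lambda>x. D x * cis (2 * pi * (k \<bullet> x))) integrable_on cbox 0 1"
  using assms unfolding null_fourier_def
  by (intro integrable_continuous continuous_intros continuous_on_cis_inner) auto

lemma null_fourier_add: "null_fourier D \<Longrightarrow> null_fourier D' \<Longrightarrow> null_fourier (\<lambda>x. D x + D' x)"
  using null_fourier_integrable[of D] null_fourier_integrable[of D']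
  by (auto simp: null_fourier_def distrib_right integral_add intro!: continuous_intros)

lemma null_fourier_cmult: "null_fourier D \<Longrightarrow> null_fourier (\<lambda>x. c * D x)"
  by (auto simp: null_fourier_def mult.assoc intro!: continuous_intros)

text \<open>Multiplication by a character only shifts the frequency.\<close>

lemma null_fourier_cis: "null_fourier D \<Longrightarrow> m \<in> int_lattice \<Longrightarrow> null_fourier (\<lambda>x. cis (2 * pi * (m \<bullet> x)) * D x)"
proof -
  assume *: "null_fourier D" "m \<in> int_lattice"
  have "integral (cbox 0 1) (\<lambda>x. cis (2 * pi * (m \<bullet> x)) * D x * cis (2 * pi * (k \<bullet> x))) = 0" if "k \<in> int_lattice" for k
  proof -
    have "(\<lambda>x. cis (2 * pi * (m \<bullet> x)) * D x * cis (2 * pi * (k \<bullet> x))) = (\<lambda>x. D x * cis (2 * pi * ((m + k) \<bullet> x)))"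
      by (auto simp: cis_mult[symmetric] distrib_left inner_add_left)
    then show ?thesis using * that by (auto simp: null_fourier_def)
  qed
  then show "null_fourier (\<lambda>x. cis (2 * pi * (m \<bullet> x)) * D x)"
    using * by (auto simp: null_fourier_def intro!: continuous_intros continuous_on_cis_inner)
qed

lemma null_fourier_cnj: "null_fourier D \<Longrightarrow> null_fourier (\<lambda>x. cnj (D x))"
proof -
  assume *: "null_fourier D"
  have "integral (cbox 0 1) (\<lambda>x. cnj (D x) * cis (2 * pi * (k \<bullet> x))) = 0" if "k \<in> int_lattice" for k
  proof -
    have "(\<lambda>x. cnj (D x) * cis (2 * pi * (k \<bullet> x))) = (\<lambda>x. cnj (D x * cis (2 * pi * (- k \<bullet> x))))"
      by (auto simp: cis_cnj)
    moreover have "integral (cbox 0 1) (\<lambda>x. D x * cis (2 * pi * (- k \<bullet> x))) = 0"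
      using * that unfolding null_fourier_def by (metis int_lattice_uminus)
    ultimately show ?thesis by (simp only: integral_cnj[symmetric] complex_cnj_zero)
  qed
  then show ?thesis
    using * by (auto simp: null_fourier_def intro!: continuous_intros)
qed

text \<open>If \<open>G\<close> comes from the algebra and is uniformly within \<open>e\<close> of
  \<open>\<psi>\<close>, then the integral of \<open>G * \<psi>\<close> vanishes, so that of
  \<open>\<psi> ^ 2\<close> equals that of \<open>(\<psi> - G) * \<psi>\<close> and is at most
  \<open>e * I\<close>. Hence it is \<open>0\<close>, and continuity forces \<open>\<psi>\<close> to
  vanish on the closed cube.\<close>

lemma null_fourier_real_eq_0:
  fixes \<psi> :: "real^'n \<Rightarrow> real"
  assumes null: "null_fourier (\<lambda>x. complex_of_real (\<psi> x))"
    and per: "\<And>x y. x \<in> cbox 0 1 \<Longrightarrow> y \<in> cbox 0 1 \<Longrightarrow> x - y \<in> int_lattice \<Longrightarrow> \<psi> x = \<psi> y"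
    and x: "x \<in> cbox 0 1"
  shows "\<psi> x = 0"
proof -
  define Q where "Q = cbox 0 (1::real^'n)"
  define K where "K = torus_map ` Q"
  \<comment> \<open>\<open>\<psi>\<close> pushed down to the torus. The choice of a preimage does
    not matter: points of the cube with equal image differ by a lattice vector, and
    \<open>per\<close> applies.\<close>
  define \<phi> where "\<phi> = (\<lambda>w. \<psi> (SOME x. x \<in> Q \<and> torus_map x = w))"
  have \<phi>: "\<phi> (torus_map x) = \<psi> x" if "x \<in> Q" for x
  proof -
    have "(SOME y. y \<in> Q \<and> torus_map y = torus_map x) \<in> Q \<and> torus_map (SOME y. y \<in> Q \<and> torus_map y = torus_map x) = torus_map x"
      by (rule someI[of _ x]) (use that in auto)
    then show ?thesis
      unfolding \<phi>_def using that by (intro per) (auto simp: Q_def torus_map_eq_iff)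
  qed
  have "continuous_on Q (\<lambda>x. Re (complex_of_real (\<psi> x)))"
    using null unfolding null_fourier_def Q_def by (intro continuous_intros) auto
  then have cont: "continuous_on Q \<psi>" by simp
  have K: "compact K" unfolding K_def Q_def by (intro compact_continuous_image continuous_on_torus_map compact_cbox)
  \<comment> \<open>Continuity descends along the quotient because the preimage of a closed set
    under \<open>\<phi>\<close> is the image of a compact set.\<close>
  have cont\<phi>: "continuous_on K \<phi>"
  proof (subst continuous_on_closed_vimage[OF compact_imp_closed[OF K]], intro allI impI)
    fix B :: "real set" assume B: "closed B"
    have "\<phi> -` B \<inter> K = torus_map ` (\<psi> -` B \<inter> Q)" by (auto simp: K_def \<phi>)
    moreover have "compact (\<psi> -` B \<inter> Q)"
      using continuous_on_closed_vimage[of Q \<psi>] cont B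
      by (metis Int_absorb1 Q_def closed_cbox compact_Int_closed compact_cbox inf_commute inf_le2)
    ultimately show "closed (\<phi> -` B \<inter> K)"
      by (auto intro!: compact_imp_closed compact_continuous_image continuous_on_torus_map)
  qed
  define R where "R = {f. continuous_on K f \<and>
    (\<forall>D. null_fourier D \<longrightarrow> null_fourier (\<lambda>x. complex_of_real (f (torus_map x)) * D x))}"
  have Re_in: "(\<lambda>w. Re (w $ i)) \<in> R" for i
  proof -
    have "null_fourier (\<lambda>x. complex_of_real (Re (torus_map x $ i)) * D x)" if "null_fourier D" for D
    proof -
      have "null_fourier (\<lambda>x. 1/2 * (cis (2 * pi * (axis i 1 \<bullet> x)) * D x + cis (2 * pi * (- axis i 1 \<bullet> x)) * D x))"
        by (intro null_fourier_add null_fourier_cmult null_fourier_cis that) auto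
      moreover have "1/2 * (cis (2 * pi * (axis i 1 \<bullet> x)) * D x + cis (2 * pi * (- axis i 1 \<bullet> x)) * D x)
          = complex_of_real (Re (torus_map x $ i)) * D x" for x
        by (simp add: torus_map_def inner_axis' complex_eq_iff field_simps)
      ultimately show ?thesis by simp
    qed
    then show ?thesis by (auto simp: R_def intro!: continuous_intros)
  qed
  have Im_in: "(\<lambda>w. Im (w $ i)) \<in> R" for i
  proof -
    have "null_fourier (\<lambda>x. complex_of_real (Im (torus_map x $ i)) * D x)" if "null_fourier D" for D
    proof -
      have "null_fourier (\<lambda>x. (-\<i>/2) * (cis (2 * pi * (axis i 1 \<bullet> x)) * D x + (-1) * (cis (2 * pi * (- axis i 1 \<bullet> x)) * D x)))"
        by (intro null_fourier_add null_fourier_cmult null_fourier_cis that) auto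
      moreover have "(-\<i>/2) * (cis (2 * pi * (axis i 1 \<bullet> x)) * D x + (-1) * (cis (2 * pi * (- axis i 1 \<bullet> x)) * D x))
          = complex_of_real (Im (torus_map x $ i)) * D x" for x
        by (simp add: torus_map_def inner_axis' complex_eq_iff field_simps)
      ultimately show ?thesis by simp
    qed
    then show ?thesis by (auto simp: R_def intro!: continuous_intros)
  qed
  have R: "function_ring_on R K"
  proof
    show "compact K" by fact
    show "(\<lambda>x. f x + g x) \<in> R" if "f \<in> R" "g \<in> R" for f g
      using that unfolding R_def
      by (auto simp: distrib_right intro!: continuous_intros null_fourier_add)
    show "(\<lambda>x. f x * g x) \<in> R" if "f \<in> R" "g \<in> R" for f g
      using that unfolding R_def
      by (auto simp: mult.assoc intro!: continuous_intros)
    show "(\<lambda>_. c) \<in> R" for c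
      unfolding R_def by (auto intro!: null_fourier_cmult)
    show "\<exists>f\<in>R. f v \<noteq> f w" if "v \<in> K" "w \<in> K" "v \<noteq> w" for v w
    proof -
      obtain i where "v $ i \<noteq> w $ i" using \<open>v \<noteq> w\<close> by (auto simp: vec_eq_iff)
      then have "Re (v $ i) \<noteq> Re (w $ i) \<or> Im (v $ i) \<noteq> Im (w $ i)" by (auto simp: complex_eq_iff)
      then show ?thesis using Re_in[of i] Im_in[of i] by (elim disjE) (rule bexI, assumption, assumption)+
    qed
  qed (auto simp: R_def)
  have int: "(\<lambda>x. h x) integrable_on Q" if "continuous_on Q h" for h :: "real^'n \<Rightarrow> real"
    unfolding Q_def by (rule integrable_continuous) (use that Q_def in auto)
  define I where "I = integral Q (\<lambda>x. \<bar>\<psi> x\<bar>)"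
  have le: "integral Q (\<lambda>x. (\<psi> x)\<^sup>2) \<le> e * I" if e: "e > 0" for e
  proof -
    obtain g where g: "g \<in> R" "\<And>w. w \<in> K \<Longrightarrow> \<bar>\<phi> w - g w\<bar> < e"
      using function_ring_on.Stone_Weierstrass_basic[OF R cont\<phi> e] by blast
    define G where "G = (\<lambda>x. g (torus_map x))"
    have contG: "continuous_on Q G"
      unfolding G_def using g(1)
      by (intro continuous_on_compose2[of K g Q torus_map] continuous_on_torus_map) (auto simp: R_def K_def)
    have "null_fourier (\<lambda>x. complex_of_real (G x) * complex_of_real (\<psi> x))"
      using g(1) null by (auto simp: R_def G_def)
    \<comment> \<open>The Fourier coefficient of \<open>G * \<psi>\<close> at frequency
      \<open>0\<close> is its integral.\<close>
    from conjunct2[OF this[unfolded null_fourier_def], THEN bspec, OF int_lattice_0]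
    have "integral Q (\<lambda>x. complex_of_real (G x) * complex_of_real (\<psi> x) * cis (2 * pi * (0 \<bullet> x))) = 0"
      unfolding Q_def .
    then have "integral Q (\<lambda>x. complex_of_real (G x * \<psi> x)) = 0" by simp
    then have 0: "integral Q (\<lambda>x. G x * \<psi> x) = 0"
      using integral_linear[OF int[of "\<lambda>x. G x * \<psi> x"] bounded_linear_of_real[where 'a=complex]] contG cont
      by (simp add: o_def continuous_intros)
    have "integral Q (\<lambda>x. (\<psi> x)\<^sup>2) = integral Q (\<lambda>x. (\<psi> x - G x) * \<psi> x + G x * \<psi> x)"
      by (simp add: power2_eq_square algebra_simps)
    also have "\<dots> = integral Q (\<lambda>x. (\<psi> x - G x) * \<psi> x)"
      using contG cont 0 by (subst integral_add) (auto intro!: int continuous_intros)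
    also have "\<dots> \<le> integral Q (\<lambda>x. e * \<bar>\<psi> x\<bar>)"
    proof (rule integral_le)
      fix x assume x: "x \<in> Q"
      have "\<bar>\<psi> x - G x\<bar> \<le> e"
        using g(2)[of "torus_map x"] x by (auto simp: K_def \<phi> G_def intro: less_imp_le)
      then show "(\<psi> x - G x) * \<psi> x \<le> e * \<bar>\<psi> x\<bar>"
        by (metis abs_ge_self abs_mult abs_ge_zero mult_right_mono order_trans)
    qed (use contG cont in \<open>auto intro!: int continuous_intros\<close>)
    finally show ?thesis by (simp add: I_def)
  qed
  have "I \<ge> 0" unfolding I_def by (intro integral_nonneg int continuous_intros cont) auto
  have "integral Q (\<lambda>x. (\<psi> x)\<^sup>2) \<le> 0"
  proof (rule field_le_epsilon)
    fix e :: real assume e: "e > 0"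
    have "integral Q (\<lambda>x. (\<psi> x)\<^sup>2) \<le> e / (I + 1) * I" using \<open>I \<ge> 0\<close> e by (intro le) auto
    also have "\<dots> \<le> e" using \<open>I \<ge> 0\<close> e by (simp add: field_simps)
    finally show "integral Q (\<lambda>x. (\<psi> x)\<^sup>2) \<le> 0 + e" by simp
  qed
  moreover have "integral Q (\<lambda>x. (\<psi> x)\<^sup>2) \<ge> 0" by (intro integral_nonneg int continuous_intros cont) auto
  ultimately have "integral Q (\<lambda>x. (\<psi> x)\<^sup>2) = 0" by simp
  moreover have "box 0 (1::real^'n) \<noteq> {}" 
  proof -
    have "(\<chi> i. 1/2) \<in> box 0 (1::real^'n)" by (simp add: mem_box_cart)
    then show ?thesis by blast
  qed
  ultimately have "\<forall>x\<in>Q. (\<psi> x)\<^sup>2 = 0"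
    using cont unfolding Q_def by (subst (asm) integral_cbox_eq_0_iff) (auto intro!: continuous_intros)
  then show ?thesis using x by (simp add: Q_def)
qed

text \<open>Conjugation exchanges the frequencies \<open>k\<close> and \<open>- k\<close>, so the
  real and the imaginary part are null as well and can be treated separately.\<close>

theorem null_fourier_eq_0:
  fixes D :: "real^'n \<Rightarrow> complex"
  assumes null: "null_fourier D"
    and per: "\<And>x y. x \<in> cbox 0 1 \<Longrightarrow> y \<in> cbox 0 1 \<Longrightarrow> x - y \<in> int_lattice \<Longrightarrow> D x = D y"
    and x: "x \<in> cbox 0 1"
  shows "D x = 0"
proof -
  have "null_fourier (\<lambda>x. 1/2 * (D x + cnj (D x)))"
    by (intro null_fourier_add null_fourier_cmult null_fourier_cnj null)
  moreover have "1/2 * (D x + cnj (D x)) = complex_of_real (Re (D x))" for x by (simp add: complex_eq_iff)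
  ultimately have "null_fourier (\<lambda>x. complex_of_real (Re (D x)))" by simp
  then have 1: "Re (D x) = 0" by (rule null_fourier_real_eq_0[OF _ _ x]) (metis per)
  have "null_fourier (\<lambda>x. (-\<i>/2) * (D x + (-1) * cnj (D x)))"
    by (intro null_fourier_add null_fourier_cmult null_fourier_cnj null)
  moreover have "(-\<i>/2) * (D x + (-1) * cnj (D x)) = complex_of_real (Im (D x))" for x by (simp add: complex_eq_iff)
  ultimately have "null_fourier (\<lambda>x. complex_of_real (Im (D x)))" by simp
  then have 2: "Im (D x) = 0" by (rule null_fourier_real_eq_0[OF _ _ x]) (metis per)
  show ?thesis using 1 2 by (simp add: complex_eq_iff)
qed

section \<open>Orthogonality of characters on the unit cube\<close>

lemma integral_cbox_unit_cube:
  fixes f :: "real^'n \<Rightarrow> complex"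
  assumes f: "continuous_on (cbox 0 1) f"
  shows "integral (cbox 0 1) f = (\<integral>x. f x \<partial>restrict_space lborel unit_cube)"
proof -
  have sub: "unit_cube \<subseteq> cbox 0 (1::real^'n)"
    by (auto simp: unit_cube_def mem_box_cart less_imp_le)
  have "set_integrable lborel (cbox 0 1) f"
    using borel_integrable_compact[OF compact_cbox f] by (simp add: set_integrable_def)
  then have "set_integrable lborel unit_cube f"
    by (rule set_integrable_subset) (use sub in auto)
  then have "(LINT x:unit_cube|lborel. f x) = integral unit_cube f"
    by (rule set_borel_integral_eq_integral)
  also have "integral unit_cube f = integral (cbox 0 1) f"
  proof (rule integral_spike_set)
    have "negligible (\<Union>i\<in>UNIV. {x::real^'n. x $ i = 1})"
      by (intro negligible_Union) (auto simp: cart_eq_inner_axis intro!: negligible_standard_hyperplane)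
    moreover have "cbox 0 1 - unit_cube \<subseteq> (\<Union>i\<in>UNIV. {x::real^'n. x $ i = 1})"
      by (auto simp: unit_cube_def mem_box_cart) (meson less_eq_real_def)
    ultimately have "negligible (cbox 0 (1::real^'n) - unit_cube)" by (rule negligible_subset)
    then show "negligible {x \<in> cbox 0 1 - unit_cube. f x \<noteq> 0}" by (rule negligible_subset) auto
    show "negligible {x \<in> unit_cube - cbox 0 1. f x \<noteq> 0}" using sub by (auto intro: negligible_subset[OF negligible_empty])
  qed
  finally show ?thesis
    by (simp add: integral_restrict_space set_lebesgue_integral_def)
qed

lemma integral_cis_unit_interval:
  assumes "c \<in> \<int>"
  shows "integrable lborel (\<lambda>t. indicator {0..<1} t *\<^sub>R cis (2 * pi * (c * t)))"
    and "(\<integral>t. indicator {0..<1} t *\<^sub>R cis (2 * pi * (c * t)) \<partial>lborel) = (if c = 0 then 1 else 0)"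
proof -
  have cont: "continuous_on {0..1} (\<lambda>t. cis (2 * pi * (c * t)))"
    unfolding cis_conv_exp by (intro continuous_intros)
  then have si: "set_integrable lborel {0..1} (\<lambda>t. cis (2 * pi * (c * t)))"
    using borel_integrable_compact[of "{0..1::real}"] by (simp add: set_integrable_def)
  have "set_integrable lborel {0..<1} (\<lambda>t. cis (2 * pi * (c * t)))"
    by (rule set_integrable_subset[OF si]) auto
  then show "integrable lborel (\<lambda>t. indicator {0..<1} t *\<^sub>R cis (2 * pi * (c * t)))"
    by (simp add: set_integrable_def)
  have [measurable]: "(\<lambda>t. cis (2 * pi * (c * t))) \<in> borel_measurable borel"
    unfolding cis_conv_exp by (intro borel_measurable_continuous_onI continuous_intros)
  have "(\<integral>t. indicator {0..<1} t *\<^sub>R cis (2 * pi * (c * t)) \<partial>lborel) = (LINT t:{0..1}|lborel. cis (2 * pi * (c * t)))"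
    unfolding set_lebesgue_integral_def
  proof (rule integral_cong_AE)
    show "AE t in lborel. indicator {0..<1} t *\<^sub>R cis (2 * pi * (c * t)) = indicator {0..1} t *\<^sub>R cis (2 * pi * (c * t))"
      using AE_lborel_singleton[of "1::real"] by eventually_elim (auto simp: indicator_def)
  qed measurable
  also have "\<dots> = integral {0..1} (\<lambda>t. cis (2 * pi * (c * t)))"
    using si by (rule set_borel_integral_eq_integral)
  also have "\<dots> = (if c = 0 then 1 else 0)"
  proof (cases "c = 0")
    case False
    have "((\<lambda>t. cis (2 * pi * (c * t))) has_integral
        cis (2 * pi * (c * 1)) / (2 * pi * \<i> * c) - cis (2 * pi * (c * 0)) / (2 * pi * \<i> * c)) {0..1}"
    proof (rule fundamental_theorem_of_calculus)
      fix x :: real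
      have "((\<lambda>t. exp (\<i> * of_real (2 * pi * (c * t))) / (2 * pi * \<i> * c)) has_vector_derivative
          exp (\<i> * of_real (2 * pi * (c * x)))) (at x within {0..1})"
        using False by (auto intro!: derivative_eq_intros has_vector_derivative_real_field simp: field_simps)
      then show "((\<lambda>t. cis (2 * pi * (c * t)) / (2 * pi * \<i> * c)) has_vector_derivative
          cis (2 * pi * (c * x))) (at x within {0..1})" by (simp only: cis_conv_exp)
    qed simp
    then show ?thesis using False assms by (auto dest!: integral_unique)
  qed simp
  finally show "(\<integral>t. indicator {0..<1} t *\<^sub>R cis (2 * pi * (c * t)) \<partial>lborel) = (if c = 0 then 1 else 0)" .
qed

lemma integral_cis_unit_cube:
  fixes k :: "real^'n"
  assumes k: "k \<in> int_lattice"
  shows "(\<integral>x. cis (2 * pi * (k \<bullet> x)) \<partial>restrict_space lborel unit_cube) = (if k = 0 then 1 else 0)"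
proof -
  have kI: "k $ i \<in> \<int>" for i using k by (simp add: int_lattice_def)
  have eq: "indicator unit_cube x *\<^sub>R cis (2 * pi * (k \<bullet> x)) =
      (\<Prod>i\<in>UNIV. indicator {0..<1} (x $ i) *\<^sub>R cis (2 * pi * (k $ i * x $ i)))" for x
  proof (cases "x \<in> unit_cube")
    case True
    then have "\<And>i. x $ i \<in> {0..<1}" by (auto simp: unit_cube_def)
    moreover have "cis (2 * pi * (k \<bullet> x)) = (\<Prod>i\<in>UNIV. cis (2 * pi * (k $ i * x $ i)))"
      unfolding cis_conv_exp by (simp add: inner_vec_def sum_distrib_left flip: exp_sum)
    ultimately show ?thesis using True by simp
  next
    case False
    then obtain i where "x $ i \<notin> {0..<1}" by (auto simp: unit_cube_def)
    then have "(\<Prod>i\<in>UNIV. indicator {0..<1} (x $ i) *\<^sub>R cis (2 * pi * (k $ i * x $ i))) = 0"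
      by (intro prod_zero) (auto intro!: exI[of _ i])
    then show ?thesis using False by simp
  qed
  have "(\<integral>x. cis (2 * pi * (k \<bullet> x)) \<partial>restrict_space lborel unit_cube) =
      (\<integral>x. (\<Prod>i\<in>UNIV. indicator {0..<1} (x $ i) *\<^sub>R cis (2 * pi * (k $ i * x $ i))) \<partial>lborel)"
    by (simp add: integral_restrict_space eq)
  also have "\<dots> = (\<Prod>i\<in>UNIV. if k $ i = 0 then 1 else 0)"
    by (subst integral_prod_cart[of "\<lambda>i t. indicator {0..<1} t *\<^sub>R cis (2 * pi * (k $ i * t))"])
       (simp_all only: integral_cis_unit_interval[OF kI])
  also have "\<dots> = (if k = 0 then 1 else 0)"
    by (auto simp: vec_eq_iff prod_zero_iff)
  finally show ?thesis .
qed

lemma finite_measure_unit_cube: "finite_measure (restrict_space lborel (unit_cube :: (real^'n) set))"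
proof (rule finite_measureI)
  have sub: "unit_cube \<subseteq> cbox 0 (1::real^'n)"
    by (auto simp: unit_cube_def mem_box_cart less_imp_le)
  have "emeasure lborel (unit_cube :: (real^'n) set) \<le> emeasure lborel (cbox 0 (1::real^'n))"
    by (rule emeasure_mono[OF sub]) simp
  also have "\<dots> < \<infinity>" by (rule emeasure_lborel_cbox_finite)
  finally show "emeasure (restrict_space lborel (unit_cube :: (real^'n) set)) (space (restrict_space lborel unit_cube)) \<noteq> \<infinity>"
    by (simp add: emeasure_restrict_space space_restrict_space)
qed

text \<open>As functions of \<open>a\<close> both sides are continuous, periodic and have the same
  Fourier coefficients, so their difference satisfies \<open>null_fourier\<close> and vanishes.
  Exponential decay makes the left series converge uniformly on the cube; \<open>fourier\<close>
  does the same for the right one.\<close>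

theorem poisson_summation:
  fixes g :: "real^'n \<Rightarrow> complex"
  assumes cont: "continuous_on UNIV g" and int: "integrable lborel g"
    and decay: "\<And>v. norm (g v) \<le> C * exp (- \<kappa> * norm v)" and \<kappa>: "\<kappa> > 0"
    and fourier: "(\<lambda>k. \<integral>v. g v * cis (- (2 * pi * (k \<bullet> v))) \<partial>lborel) abs_summable_on int_lattice"
  shows "(\<Sum>\<^sub>\<infinity>m\<in>int_lattice. g (a + m)) =
    (\<Sum>\<^sub>\<infinity>k\<in>int_lattice. (\<integral>v. g v * cis (- (2 * pi * (k \<bullet> v))) \<partial>lborel) * cis (2 * pi * (k \<bullet> a)))"
proof -
  define Q where "Q = cbox 0 (1::real^'n)"
  define G where "G = (\<lambda>k. \<integral>v. g v * cis (- (2 * pi * (k \<bullet> v))) \<partial>lborel)"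
  define F where "F = (\<lambda>x. \<Sum>\<^sub>\<infinity>m\<in>int_lattice. g (x + m))"
  define H where "H = (\<lambda>x. \<Sum>\<^sub>\<infinity>k\<in>int_lattice. G k * cis (2 * pi * (k \<bullet> x)))"
  have sub: "unit_cube \<subseteq> Q" by (auto simp: Q_def unit_cube_def mem_box_cart less_imp_le)
  obtain R where R: "\<And>x. x \<in> Q \<Longrightarrow> norm x \<le> R"
    using bounded_cbox[of 0 "1::real^'n"] by (auto simp: bounded_iff Q_def)
  \<comment> \<open>For \<open>x\<close> in the closed cube
    \<open>norm m \<le> R + norm (x + m)\<close>, so the decay of \<open>g (x + m)\<close> becomes a
    bound in \<open>m\<close> alone, uniform in \<open>x\<close>.\<close>
  define B where "B = (\<lambda>m::real^'n. (\<bar>C\<bar> * exp (\<kappa> * R)) * exp (- \<kappa> * norm (0 + m)))"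
  have Bsum: "B summable_on int_lattice"
    unfolding B_def by (intro summable_on_cmult_right summable_on_exp_norm_lattice \<kappa>)
  have gB: "norm (g (x + m)) \<le> B m" if "x \<in> Q" for x m
  proof -
    have "norm m \<le> R + norm (x + m)"
      using norm_triangle_ineq4[of "x + m" x] R[OF that] by simp
    then have "- \<kappa> * norm (x + m) \<le> \<kappa> * R + - \<kappa> * norm m"
      using \<kappa> mult_left_mono[of "norm m" "R + norm (x + m)" \<kappa>] by (simp add: algebra_simps)
    then have "exp (- \<kappa> * norm (x + m)) \<le> exp (\<kappa> * R) * exp (- \<kappa> * norm m)"
      by (simp flip: exp_add)
    then have "\<bar>C\<bar> * exp (- \<kappa> * norm (x + m)) \<le> \<bar>C\<bar> * (exp (\<kappa> * R) * exp (- \<kappa> * norm m))"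
      by (rule mult_left_mono) simp
    moreover have "C * exp (- \<kappa> * norm (x + m)) \<le> \<bar>C\<bar> * exp (- \<kappa> * norm (x + m))"
      by (intro mult_right_mono) auto
    moreover note decay[of "x + m"]
    ultimately have "norm (g (x + m)) \<le> \<bar>C\<bar> * (exp (\<kappa> * R) * exp (- \<kappa> * norm m))"
      by linarith
    then show ?thesis by (simp add: B_def mult.assoc)
  qed
  have Gsum: "(\<lambda>k. norm (G k)) summable_on int_lattice" using fourier by (simp add: G_def)
  have contF: "continuous_on Q F" unfolding F_def
  proof (rule uniform_limit_theorem[OF _ Weierstrass_m_test_general[OF _ Bsum]])
    show "\<forall>\<^sub>F X in finite_subsets_at_top int_lattice. continuous_on Q (\<lambda>x. \<Sum>m\<in>X. g (x + m))"
      by (intro always_eventually allI continuous_on_sum continuous_on_compose2[OF cont] continuous_intros) auto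
  qed (use gB in auto)
  have contH: "continuous_on Q H" unfolding H_def
  proof (rule uniform_limit_theorem[OF _ Weierstrass_m_test_general[OF _ Gsum]])
    show "\<forall>\<^sub>F X in finite_subsets_at_top int_lattice. continuous_on Q (\<lambda>x. \<Sum>k\<in>X. G k * cis (2 * pi * (k \<bullet> x)))"
      by (intro always_eventually allI continuous_on_sum continuous_intros continuous_on_cis_inner)
  qed (auto simp: norm_mult)
  have F_per: "F (x + m) = F x" if "m \<in> int_lattice" for x m
    using infsum_reindex_bij_betw[OF bij_betw_add_int_lattice[OF that], of "\<lambda>l. g (x + l)"]
    by (simp add: F_def add.assoc)
  have H_per: "H (x + m) = H x" if "m \<in> int_lattice" for x m
    unfolding H_def using that
    by (intro infsum_cong) (simp add: inner_add_right distrib_left inner_int_lattice flip: cis_mult)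
  have measure_cont: "h \<in> borel_measurable (restrict_space lborel unit_cube)" if "continuous_on UNIV h" for h :: "real^'n \<Rightarrow> complex"
    by (intro measurable_restrict_space1) (use that borel_measurable_continuous_onI in auto)
  note swap = infsum_integral_swap[OF countable_int_lattice finite_measure_unit_cube]
    abs_summable_on_integral[OF countable_int_lattice finite_measure_unit_cube]
  have null: "null_fourier (\<lambda>x. F x - H x)" unfolding null_fourier_def
  proof (intro conjI ballI)
    show "continuous_on (cbox 0 1) (\<lambda>x. F x - H x)" using contF contH unfolding Q_def by (intro continuous_intros)
    fix k :: "real^'n" assume k: "k \<in> int_lattice"
    \<comment> \<open>The test functions of \<open>null_fourier\<close> carry the opposite sign to
      the transform \<open>G\<close>, whence \<open>G (- k)\<close>. Unfolding turns the cube
      integral of the periodised function into an integral over the whole space.\<close>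
    have "integral Q (\<lambda>x. F x * cis (2 * pi * (k \<bullet> x))) = G (- k)"
    proof -
      let ?h = "\<lambda>v. g v * cis (2 * pi * (k \<bullet> v))"
      have hm: "?h (x + m) = g (x + m) * cis (2 * pi * (k \<bullet> x))" if "m \<in> int_lattice" for x m
        using that k by (simp add: inner_add_right distrib_left inner_int_lattice flip: cis_mult)
      have inth: "integrable lborel ?h"
      proof (rule Bochner_Integration.integrable_bound[OF int])
        show "?h \<in> borel_measurable lborel"
          using cont by (auto intro!: borel_measurable_continuous_onI continuous_intros continuous_on_cis_inner)
      qed (auto simp: norm_mult)
      have sw: "(\<lambda>x. ?h (x + m)) \<in> borel_measurable (restrict_space lborel unit_cube)"
        "x \<in> space (restrict_space lborel unit_cube) \<Longrightarrow> norm (?h (x + m)) \<le> B m" for m x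
        using gB sub
        by (auto simp: norm_mult space_restrict_space intro!: measure_cont continuous_intros continuous_on_compose2[OF cont]
            continuous_on_compose2[OF continuous_on_cis_inner])
      have "integral Q (\<lambda>x. F x * cis (2 * pi * (k \<bullet> x))) = (\<integral>x. F x * cis (2 * pi * (k \<bullet> x)) \<partial>restrict_space lborel unit_cube)"
        unfolding Q_def by (rule integral_cbox_unit_cube) (use contF Q_def in \<open>auto intro!: continuous_intros continuous_on_cis_inner\<close>)
      also have "\<dots> = (\<integral>x. (\<Sum>\<^sub>\<infinity>m\<in>int_lattice. ?h (x + m)) \<partial>restrict_space lborel unit_cube)"
        by (intro Bochner_Integration.integral_cong refl) (simp add: F_def hm infsum_cmult_left' cong: infsum_cong)
      also have "\<dots> = (\<Sum>\<^sub>\<infinity>m\<in>int_lattice. \<integral>x. ?h (x + m) \<partial>restrict_space lborel unit_cube)"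
        by (rule swap(1)[symmetric, OF _ _ Bsum]) (use sw in auto)
      also have "\<dots> = integral\<^sup>L lborel ?h"
      proof -
        have "(\<lambda>m. \<integral>x. ?h (x + m) \<partial>restrict_space lborel unit_cube) abs_summable_on int_lattice"
          by (rule swap(2)[OF _ _ Bsum]) (use sw in auto)
        then show ?thesis
          using infsum_unit_cube_translates[OF inth] by (simp add: integral_restrict_space)
      qed
      finally show ?thesis by (simp add: G_def)
    qed
    moreover have "integral Q (\<lambda>x. H x * cis (2 * pi * (k \<bullet> x))) = G (- k)"
    proof -
      let ?h = "\<lambda>x j. G j * cis (2 * pi * ((j + k) \<bullet> x))"
      have "integral Q (\<lambda>x. H x * cis (2 * pi * (k \<bullet> x))) = (\<integral>x. H x * cis (2 * pi * (k \<bullet> x)) \<partial>restrict_space lborel unit_cube)"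
        unfolding Q_def by (rule integral_cbox_unit_cube) (use contH Q_def in \<open>auto intro!: continuous_intros continuous_on_cis_inner\<close>)
      also have "\<dots> = (\<integral>x. (\<Sum>\<^sub>\<infinity>j\<in>int_lattice. ?h x j) \<partial>restrict_space lborel unit_cube)"
        by (intro Bochner_Integration.integral_cong refl)
           (simp add: H_def inner_add_left distrib_left infsum_cmult_left' flip: cis_mult mult.assoc)
      also have "\<dots> = (\<Sum>\<^sub>\<infinity>j\<in>int_lattice. \<integral>x. ?h x j \<partial>restrict_space lborel unit_cube)"
        by (rule swap(1)[symmetric, OF _ _ Gsum])
           (auto simp: norm_mult intro!: measure_cont continuous_intros continuous_on_cis_inner)
      \<comment> \<open>By orthogonality only the frequency \<open>j = - k\<close>
        contributes.\<close>
      also have "\<dots> = (\<Sum>\<^sub>\<infinity>j\<in>int_lattice. if j = - k then G (- k) else 0)"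
      proof (rule infsum_cong)
        fix j :: "real^'n" assume "j \<in> int_lattice"
        then have "j + k \<in> int_lattice" using k by blast
        have "(\<integral>x. ?h x j \<partial>restrict_space lborel unit_cube) =
            G j * (\<integral>x. cis (2 * pi * ((j + k) \<bullet> x)) \<partial>restrict_space lborel unit_cube)"
          by (rule integral_mult_right_zero)
        also have "\<dots> = G j * (if j + k = 0 then 1 else 0)"
          by (simp only: integral_cis_unit_cube[OF \<open>j + k \<in> int_lattice\<close>])
        also have "\<dots> = (if j = - k then G (- k) else 0)"
          by (auto simp: add_eq_0_iff2)
        finally show "(\<integral>x. ?h x j \<partial>restrict_space lborel unit_cube) = (if j = - k then G (- k) else 0)" .
      qed
      also have "\<dots> = (\<Sum>\<^sub>\<infinity>j\<in>{- k}. G (- k))"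
        using k by (intro infsum_cong_neutral) auto
      finally show ?thesis by simp
    qed
    moreover have "integral Q (\<lambda>x. (F x - H x) * cis (2 * pi * (k \<bullet> x))) =
      integral Q (\<lambda>x. F x * cis (2 * pi * (k \<bullet> x))) - integral Q (\<lambda>x. H x * cis (2 * pi * (k \<bullet> x)))"
      unfolding left_diff_distrib Q_def
      using contF contH unfolding Q_def
      by (intro integral_diff integrable_continuous continuous_intros continuous_on_cis_inner)
    ultimately show "integral (cbox 0 1) (\<lambda>x. (F x - H x) * cis (2 * pi * (k \<bullet> x))) = 0"
      by (simp add: Q_def)
  qed
  \<comment> \<open>\<open>null_fourier_eq_0\<close> speaks about the closed cube only, so
    \<open>a\<close> is first moved into it by a period.\<close>
  obtain m where m: "m \<in> int_lattice" "a - m \<in> unit_cube" by (rule unit_cube_translates)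
  have "F (a - m) - H (a - m) = 0"
  proof (rule null_fourier_eq_0[OF null])
    show "F x - H x = F y - H y" if "x - y \<in> int_lattice" for x y
      using F_per[OF that, of y] H_per[OF that, of y] by simp
    show "a - m \<in> cbox 0 1" using m sub by (auto simp: Q_def)
  qed
  moreover have "F a = F (a - m)" "H a = H (a - m)"
    using F_per[OF m(1), of "a - m"] H_per[OF m(1), of "a - m"] by auto
  ultimately have "F a = H a" by simp
  then show ?thesis by (simp add: F_def H_def G_def)
qed

section \<open>Hermite polynomials and the error function\<close>

text \<open>The coefficient of \<open>x ^ d\<close> in
  \<open>exp (b * x - q * x ^ 2 / (4 * pi))\<close>: a Hermite polynomial in \<open>b\<close>,
  scaled by \<open>q\<close> and divided by \<open>fact d\<close>. The division keeps the addition
  theorem free of binomial coefficients. With \<open>b = bform A h v\<close> and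
  \<open>q = qform A h\<close> it is \<open>fhat\<close> of \<open>B(h, v) ^ d\<close> up to
  \<open>fact d\<close>.\<close>

definition hermite :: "nat \<Rightarrow> 'a \<Rightarrow> 'a \<Rightarrow> 'a::real_normed_field" where
  "hermite d b q = (\<Sum>m | 2 * m \<le> d. b ^ (d - 2 * m) / fact (d - 2 * m) * ((- q / (4 * of_real pi)) ^ m / fact m))"

lemma finite_double_le [simp]: "finite {m::nat. 2 * m \<le> d}"
  by (rule finite_subset[of _ "{..d}"]) auto

text \<open>The formal power series of \<open>exp (c * X ^ 2)\<close>, given by its
  coefficients.\<close>

definition gauss_fps :: "'a \<Rightarrow> 'a::real_normed_field fps" where
  "gauss_fps c = Abs_fps (\<lambda>n. if even n then c ^ (n div 2) / fact (n div 2) else 0)"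

lemma hermite_conv_fps:
  fixes b q :: "'a::real_normed_field"
  shows "hermite d b q = fps_nth (fps_exp b * gauss_fps (- q / (4 * of_real pi))) d"
proof -
  let ?c = "- q / (4 * of_real pi)"
  have "fps_nth (fps_exp b * gauss_fps ?c) d = (\<Sum>i=0..d. fps_nth (gauss_fps ?c) i * fps_nth (fps_exp b) (d - i))"
    by (subst mult.commute) (simp add: fps_mult_nth)
  also have "\<dots> = (\<Sum>i\<in>(*) 2 ` {m. 2 * m \<le> d}. fps_nth (gauss_fps ?c) i * fps_nth (fps_exp b) (d - i))"
    by (rule sum.mono_neutral_right) (auto simp: gauss_fps_def elim!: evenE)
  also have "\<dots> = hermite d b q"
    by (subst sum.reindex) (auto simp: inj_on_def hermite_def gauss_fps_def mult.commute intro!: sum.cong)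
  finally show ?thesis by simp
qed

text \<open>This first-order equation is the common source of the recursion
  \<open>hermite_Suc\<close> and, through uniqueness of solutions, of the addition theorem.\<close>

lemma hermite_fps_deriv:
  fixes b c :: "'a::real_normed_field"
  defines "G \<equiv> fps_exp b * gauss_fps c"
  shows "fps_deriv G = (fps_const b + fps_const (2 * c) * fps_X) * G"
proof -
  have "fps_deriv (gauss_fps c) = fps_const (2 * c) * fps_X * gauss_fps c"
  proof (rule fps_ext)
    fix n
    show "fps_nth (fps_deriv (gauss_fps c)) n = fps_nth (fps_const (2 * c) * fps_X * gauss_fps c) n"
    proof (cases n)
      case (Suc k)
      show ?thesis
      proof (cases "even k")
        case True
        then obtain j where "k = 2 * j" by (elim evenE)
        then show ?thesis using Suc
          by (simp add: gauss_fps_def mult.assoc field_simps del: of_nat_Suc)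
            (simp add: field_simps)
      qed (use Suc in \<open>simp add: gauss_fps_def mult.assoc\<close>)
    qed (simp add: gauss_fps_def mult.assoc)
  qed
  then show ?thesis
    by (simp add: G_def algebra_simps)
qed

text \<open>The equation determines the coefficient of index \<open>Suc k\<close> from the lower
  ones, as \<open>of_nat (Suc k)\<close> is nonzero.\<close>

lemma fps_linear_ode_unique:
  fixes F G L :: "'a::real_normed_field fps"
  assumes "fps_deriv F = L * F" "fps_deriv G = L * G" "fps_nth F 0 = fps_nth G 0"
  shows "F = G"
proof (rule fps_ext)
  fix n show "fps_nth F n = fps_nth G n"
  proof (induction n rule: less_induct)
    case (less n)
    show ?case
    proof (cases n)
      case (Suc k)
      have "of_nat (Suc k) * fps_nth F (Suc k) = fps_nth (L * F) k"
        unfolding assms(1)[symmetric] by simp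
      also have "\<dots> = fps_nth (L * G) k"
        using less Suc by (auto simp: fps_mult_nth intro!: sum.cong)
      also have "\<dots> = of_nat (Suc k) * fps_nth G (Suc k)"
        unfolding assms(2)[symmetric] by simp
      finally show ?thesis unfolding Suc by (simp only: mult_cancel_left of_nat_eq_0_iff) simp
    qed (use assms in simp)
  qed
qed

text \<open>The product rule adds the two logarithmic derivatives, so both sides solve the same
  equation with constant term \<open>1\<close>.\<close>

lemma gauss_fps_add:
  fixes b c b' c' :: "'a::real_normed_field"
  shows "(fps_exp b * gauss_fps c) * (fps_exp b' * gauss_fps c') = fps_exp (b + b') * gauss_fps (c + c')"
proof (rule fps_linear_ode_unique)
  let ?L = "fps_const (b + b') + fps_const (2 * (c + c')) * fps_X"
  have L: "?L = (fps_const b + fps_const (2 * c) * fps_X) + (fps_const b' + fps_const (2 * c') * fps_X)"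
    by (simp add: distrib_left distrib_right flip: fps_const_add)
  show "fps_deriv ((fps_exp b * gauss_fps c) * (fps_exp b' * gauss_fps c')) = ?L * ((fps_exp b * gauss_fps c) * (fps_exp b' * gauss_fps c'))"
    unfolding L fps_deriv_mult[of "fps_exp b * gauss_fps c"] hermite_fps_deriv by (simp only: algebra_simps)
  show "fps_deriv (fps_exp (b + b') * gauss_fps (c + c')) = ?L * (fps_exp (b + b') * gauss_fps (c + c'))"
    by (rule hermite_fps_deriv)
qed (simp add: gauss_fps_def)

text \<open>The generating functions multiply and their exponents add. Through this convolution the
  sum over \<open>k\<close> in the derivative of \<open>E_kernel\<close> becomes a single
  \<open>hermite\<close> value.\<close>

lemma hermite_add:
  fixes b b' q q' :: "'a::real_normed_field"
  shows "(\<Sum>k\<le>d. hermite k b q * hermite (d - k) b' q') = hermite d (b + b') (q + q')"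
proof -
  let ?G = "\<lambda>b q. fps_exp b * gauss_fps (- q / (4 * of_real pi)) :: 'a fps"
  have "?G b q * ?G b' q' = ?G (b + b') (q + q')"
    using gauss_fps_add[of b "- q / (4 * of_real pi)" b' "- q' / (4 * of_real pi)"]
    by (simp add: diff_divide_distrib add_divide_distrib)
  then have "fps_nth (?G b q * ?G b' q') d = hermite d (b + b') (q + q')"
    by (simp only: hermite_conv_fps)
  then show ?thesis by (simp only: fps_mult_nth[of "?G b q"] hermite_conv_fps atMost_atLeast0)
qed

lemma hermite_scale:
  fixes l b q :: "'a::real_normed_field"
  shows "hermite d (l * b) (l\<^sup>2 * q) = l ^ d * hermite d b q"
  unfolding hermite_def sum_distrib_left
proof (rule sum.cong)
  fix m assume "m \<in> {m. 2 * m \<le> d}"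
  then have "l ^ d = l ^ (d - 2 * m) * (l\<^sup>2) ^ m"
    by (simp flip: power_mult power_add)
  moreover have "(- (l\<^sup>2 * q) / (4 * of_real pi)) ^ m = (l\<^sup>2) ^ m * (- q / (4 * of_real pi)) ^ m"
    by (simp flip: power_mult_distrib)
  ultimately show "(l * b) ^ (d - 2 * m) / fact (d - 2 * m) * ((- (l\<^sup>2 * q) / (4 * of_real pi)) ^ m / fact m) =
      l ^ d * (b ^ (d - 2 * m) / fact (d - 2 * m) * ((- q / (4 * of_real pi)) ^ m / fact m))"
    by (simp add: power_mult_distrib)
qed simp

lemma hermite_0 [simp]: "hermite 0 b q = 1"
  by (simp add: hermite_def)

lemma hermite_1 [simp]: "hermite (Suc 0) b q = b"
proof -
  have "{m::nat. 2 * m \<le> Suc 0} = {0}" by auto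
  then show ?thesis by (simp add: hermite_def)
qed

lemma hermite_uminus: "hermite d (- b) q = (- 1) ^ d * hermite d b q"
  using hermite_scale[of d "-1" b q] by simp

lemma of_real_hermite: "hermite d (of_real b) (of_real q) = of_real (hermite d b q)"
  by (simp add: hermite_def)

text \<open>The derivative of \<open>hermite d b q\<close> in \<open>b\<close>. The case split
  matters: truncated subtraction would give \<open>hermite 0 b q = 1\<close> at \<open>d = 0\<close>
  instead of \<open>0\<close>.\<close>

definition hermite_pred :: "nat \<Rightarrow> 'a \<Rightarrow> 'a \<Rightarrow> 'a::real_normed_field" where
  "hermite_pred d b q = (if d = 0 then 0 else hermite (d - 1) b q)"

lemma hermite_Suc:
  fixes b q :: "'a::real_normed_field"
  shows "of_nat (Suc d) * hermite (Suc d) b q = b * hermite d b q - q / (2 * of_real pi) * hermite_pred d b q"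
proof -
  let ?c = "- q / (4 * of_real pi)"
  have "of_nat (Suc d) * hermite (Suc d) b q = fps_nth (fps_deriv (fps_exp b * gauss_fps ?c)) d"
    by (simp only: hermite_conv_fps fps_deriv_nth Suc_eq_plus1)
  also have "\<dots> = b * hermite d b q - q / (2 * of_real pi) * hermite_pred d b q"
  proof -
    have "fps_nth ((fps_const b + fps_const r * fps_X) * G) d = b * fps_nth G d + r * (if d = 0 then 0 else fps_nth G (d - 1))"
      for r and G :: "'a fps"
      by (cases d) (simp_all add: distrib_right mult.assoc)
    moreover have "2 * ?c = - (q / (2 * of_real pi))" by simp
    ultimately show ?thesis
      unfolding hermite_fps_deriv by (simp only: hermite_conv_fps hermite_pred_def) simp
  qed
  finally show ?thesis .
qed

lemma hermite_has_derivative: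
  fixes b q :: "'a::real_normed_field"
  shows "((\<lambda>b. hermite d b q) has_field_derivative hermite_pred d b q) (at b within S)"
proof -
  have "((\<lambda>b. hermite d b q) has_field_derivative
      (\<Sum>m | 2 * m \<le> d. of_nat (d - 2 * m) * b ^ (d - 2 * m - 1) / fact (d - 2 * m) * ((- q / (4 * of_real pi)) ^ m / fact m))) (at b within S)"
    unfolding hermite_def by (auto intro!: derivative_eq_intros)
  also have "(\<Sum>m | 2 * m \<le> d. of_nat (d - 2 * m) * b ^ (d - 2 * m - 1) / fact (d - 2 * m) * ((- q / (4 * of_real pi)) ^ m / fact m)) = hermite_pred d b q"
  proof (cases d)
    case (Suc e)
    have "(\<Sum>m | 2 * m \<le> d. of_nat (d - 2 * m) * b ^ (d - 2 * m - 1) / fact (d - 2 * m) * ((- q / (4 * of_real pi)) ^ m / fact m))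
        = (\<Sum>m | 2 * m \<le> e. of_nat (d - 2 * m) * b ^ (d - 2 * m - 1) / fact (d - 2 * m) * ((- q / (4 * of_real pi)) ^ m / fact m))"
      by (rule sum.mono_neutral_right) (auto simp: Suc)
    also have "\<dots> = hermite e b q"
      unfolding hermite_def
    proof (rule sum.cong)
      fix m assume "m \<in> {m. 2 * m \<le> e}"
      then have "d - 2 * m = Suc (e - 2 * m)" using Suc by auto
      then show "of_nat (d - 2 * m) * b ^ (d - 2 * m - 1) / fact (d - 2 * m) * ((- q / (4 * of_real pi)) ^ m / fact m) =
        b ^ (e - 2 * m) / fact (e - 2 * m) * ((- q / (4 * of_real pi)) ^ m / fact m)"
        by (simp del: of_nat_Suc)
    qed simp
    finally show ?thesis by (simp add: hermite_pred_def Suc)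
  qed (simp add: hermite_pred_def)
  finally show ?thesis .
qed

lemma hermite_sums:
  fixes b q x :: "'a::{real_normed_field,banach}"
  shows "(\<lambda>d. hermite d b q * x ^ d) sums exp (b * x - q * x\<^sup>2 / (4 * of_real pi))"
proof -
  define c where "c = - q / (4 * of_real pi)"
  define f where "f = (\<lambda>i. (b * x) ^ i / fact i)"
  define g where "g = (\<lambda>j. fps_nth (gauss_fps c) j * x ^ j)"
  have f: "f sums exp (b * x)" "summable (\<lambda>i. norm (f i))"
    using exp_converges[of "b * x"] summable_norm_exp[of "b * x"]
    by (simp_all add: f_def scaleR_conv_of_real divide_inverse mult.commute)
  have e: "(\<lambda>i. (c * x\<^sup>2) ^ i / fact i) sums exp (c * x\<^sup>2)" "summable (\<lambda>i. norm ((c * x\<^sup>2) ^ i / fact i))"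
    using exp_converges[of "c * x\<^sup>2"] summable_norm_exp[of "c * x\<^sup>2"]
    by (simp_all add: scaleR_conv_of_real divide_inverse mult.commute)
  have g2: "g (2 * i) = (c * x\<^sup>2) ^ i / fact i" for i
    by (simp add: g_def gauss_fps_def power_mult_distrib power_mult)
  have gz: "g n = 0" if "n \<notin> range ((*) 2)" for n
    using that by (auto simp: g_def gauss_fps_def elim!: evenE)
  have sm: "strict_mono ((*) (2::nat))" by (simp add: strict_mono_def)
  have g: "g sums exp (c * x\<^sup>2)"
    using sums_mono_reindex[OF sm, of g] gz e(1) g2 by simp
  have "summable (\<lambda>j. norm (g j))"
    using summable_mono_reindex[OF sm, of "\<lambda>j. norm (g j)"] gz e(2) g2 by simp
  from Cauchy_product_sums[OF f(2) this]
  have "(\<lambda>k. \<Sum>i\<le>k. f i * g (k - i)) sums (exp (b * x) * exp (c * x\<^sup>2))"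
    using f(1) g by (simp add: sums_iff)
  moreover have "(\<Sum>i\<le>k. f i * g (k - i)) = hermite k b q * x ^ k" for k
  proof -
    have "f i * g (k - i) = fps_nth (fps_exp b) i * fps_nth (gauss_fps c) (k - i) * x ^ k" if "i \<le> k" for i
      using that power_add[of x i "k - i"] by (simp add: f_def g_def power_mult_distrib)
    then show ?thesis
      by (simp add: hermite_conv_fps fps_mult_nth atMost_atLeast0 sum_distrib_right c_def)
  qed
  moreover have "exp (b * x) * exp (c * x\<^sup>2) = exp (b * x - q * x\<^sup>2 / (4 * of_real pi))"
    by (simp add: c_def flip: exp_add)
  ultimately show ?thesis by simp
qed

text \<open>Replacing \<open>q\<close> by \<open>- norm q\<close> makes every term nonnegative, so
  the majorant is itself a \<open>hermite\<close> value and its generating function is known in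
  closed form.\<close>

lemma norm_hermite_le: "norm (hermite d b q) \<le> hermite d (norm b) (- norm q)"
  unfolding hermite_def
  by (rule order_trans[OF norm_sum])
     (auto simp: norm_mult norm_divide norm_power intro!: sum_mono)

text \<open>Bounds on partial sums for every radius \<open>r\<close> are the form in which
  \<open>coefficient_extraction\<close> asks for majorants.\<close>

lemma hermite_partial_sum_le:
  fixes b q :: "'a::real_normed_field"
  assumes r: "r \<ge> 0"
  shows "(\<Sum>k<n. norm (hermite k b q) * r ^ k) \<le> exp (norm b * r + norm q * r\<^sup>2 / (4 * pi))"
proof -
  have nn: "hermite k (norm b) (- norm q) \<ge> 0" for k
    using norm_hermite_le[of k b q] norm_ge_zero order_trans by blast
  have "(\<lambda>k. hermite k (norm b) (- norm q) * r ^ k) sums exp (norm b * r + norm q * r\<^sup>2 / (4 * pi))"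
    using hermite_sums[of "norm b" "- norm q" r] by simp
  then have s: "summable (\<lambda>k. hermite k (norm b) (- norm q) * r ^ k)"
    "(\<Sum>k. hermite k (norm b) (- norm q) * r ^ k) = exp (norm b * r + norm q * r\<^sup>2 / (4 * pi))"
    by (auto simp: sums_iff)
  have "(\<Sum>k<n. norm (hermite k b q) * r ^ k) \<le> (\<Sum>k<n. hermite k (norm b) (- norm q) * r ^ k)"
    using r by (intro sum_mono mult_right_mono norm_hermite_le) auto
  also have "\<dots> \<le> (\<Sum>k. hermite k (norm b) (- norm q) * r ^ k)"
    using s(1) nn r by (intro sum_le_suminf) auto
  finally show ?thesis using s(2) by simp
qed

text \<open>Deliberately crude: only polynomial growth in both arguments matters, since a Gaussian
  or exponential factor absorbs it later.\<close>

lemma norm_hermite_le_poly: "norm (hermite d b q) \<le> real (Suc d) * ((1 + norm b) ^ d * (1 + norm q) ^ d)"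
proof -
  have "norm (b ^ (d - 2 * m) / fact (d - 2 * m) * ((- q / (4 * of_real pi)) ^ m / fact m)) \<le> (1 + norm b) ^ d * (1 + norm q) ^ d"
    if m: "2 * m \<le> d" for m
  proof -
    have 1: "norm (b ^ (d - 2 * m) / fact (d - 2 * m)) \<le> (1 + norm b) ^ d"
    proof -
      have "norm (b ^ (d - 2 * m) / fact (d - 2 * m)) \<le> norm b ^ (d - 2 * m)"
        by (simp add: norm_divide norm_power divide_le_eq_1 mult_le_cancel_left1 divide_le_eq)
      also have "\<dots> \<le> (1 + norm b) ^ (d - 2 * m)" by (intro power_mono) auto
      also have "\<dots> \<le> (1 + norm b) ^ d" by (intro power_increasing) auto
      finally show ?thesis .
    qed
    have 2: "norm ((- q / (4 * of_real pi)) ^ m / fact m) \<le> (1 + norm q) ^ d"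
    proof -
      have pi4: "norm (- q / (4 * of_real pi)) \<le> norm q"
        using pi_gt3 mult_right_mono[of 1 "4 * pi" "norm q"] by (simp add: norm_divide norm_mult divide_le_eq mult.commute)
      have "norm ((- q / (4 * of_real pi)) ^ m / fact m) \<le> norm (- q / (4 * of_real pi)) ^ m"
        unfolding norm_divide[of _ "fact m"] norm_power
        by (simp add: divide_le_eq mult_le_cancel_left1)
      also have "\<dots> \<le> (1 + norm q) ^ m" using pi4 by (intro power_mono) auto
      also have "\<dots> \<le> (1 + norm q) ^ d" using m by (intro power_increasing) auto
      finally show ?thesis .
    qed
    show ?thesis unfolding norm_mult by (intro mult_mono 1 2) auto
  qed
  then have "norm (hermite d b q) \<le> (\<Sum>m | 2 * m \<le> d. (1 + norm b) ^ d * (1 + norm q) ^ d)"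
    unfolding hermite_def by (intro sum_norm_le) auto
  also have "\<dots> = real (card {m. 2 * m \<le> d}) * ((1 + norm b) ^ d * (1 + norm q) ^ d)" by simp
  also have "\<dots> \<le> real (Suc d) * ((1 + norm b) ^ d * (1 + norm q) ^ d)"
  proof -
    have "{m. 2 * m \<le> d} \<subseteq> {..d}" by auto
    then have "card {m. 2 * m \<le> d} \<le> Suc d" using card_mono[of "{..d}"] by fastforce
    then show ?thesis by (intro mult_right_mono) simp_all
  qed
  finally show ?thesis .
qed

section \<open>Derivatives of the error function and their parity\<close>

lemma E_fun_has_derivative: "(E_fun has_real_derivative 2 * exp (- pi * z\<^sup>2)) (at z)"
proof -
  \<comment> \<open>The interval contains \<open>0\<close> and has \<open>z\<close> in its interior,
    so the derivative within it is the two-sided one.\<close>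
  have "((\<lambda>x. LBINT u=ereal 0..ereal x. exp (- pi * u\<^sup>2)) has_vector_derivative exp (- pi * z\<^sup>2)) (at z within {- \<bar>z\<bar> - 1..\<bar>z\<bar> + 1})"
    by (rule interval_integral_FTC2[of "- \<bar>z\<bar> - 1" 0 "\<bar>z\<bar> + 1"]) (auto intro!: continuous_intros)
  moreover have "at z within {- \<bar>z\<bar> - 1..\<bar>z\<bar> + 1} = at z"
    by (rule at_within_interior) auto
  ultimately have "((\<lambda>x. LBINT u=0..ereal x. exp (- pi * u\<^sup>2)) has_real_derivative exp (- pi * z\<^sup>2)) (at z)"
    by (simp add: has_real_derivative_iff_has_vector_derivative zero_ereal_def)
  from DERIV_cmult[OF this, of 2] show ?thesis by (simp add: E_fun_def[abs_def])
qed

text \<open>Behind this is \<open>exp (- pi * (z + x) ^ 2) = exp (- pi * z ^ 2) * exp (- 2 * pi * z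
  * x - pi * x ^ 2)\<close>: Taylor coefficients of a Gaussian are \<open>hermite\<close> values,
  and \<open>q / (4 * pi) = pi\<close> forces \<open>q = 4 * pi ^ 2\<close>. The induction step is
  \<open>hermite_Suc\<close>.\<close>

lemma E_fun_higher_deriv:
  "(deriv ^^ Suc k) E_fun z = 2 * fact k * exp (- pi * z\<^sup>2) * hermite k (- 2 * pi * z) (4 * pi\<^sup>2)"
proof (induction k arbitrary: z)
  case 0
  show ?case using DERIV_imp_deriv[OF E_fun_has_derivative] by simp
next
  case (Suc k)
  have eq: "(deriv ^^ Suc k) E_fun = (\<lambda>z. 2 * fact k * exp (- pi * z\<^sup>2) * hermite k (- 2 * pi * z) (4 * pi\<^sup>2))"
    using Suc by blast
  have "((\<lambda>z. hermite k (- 2 * pi * z) (4 * pi\<^sup>2)) has_real_derivative hermite_pred k (- 2 * pi * z) (4 * pi\<^sup>2) * (- 2 * pi)) (at z)"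
    by (rule DERIV_chain2[OF hermite_has_derivative]) (auto intro!: derivative_eq_intros)
  then have "((\<lambda>z. 2 * fact k * exp (- pi * z\<^sup>2) * hermite k (- 2 * pi * z) (4 * pi\<^sup>2)) has_real_derivative
     2 * fact k * exp (- pi * z\<^sup>2) * (hermite_pred k (- 2 * pi * z) (4 * pi\<^sup>2) * (- 2 * pi))
     + 2 * fact k * (exp (- pi * z\<^sup>2) * (- pi * (2 * z))) * hermite k (- 2 * pi * z) (4 * pi\<^sup>2)) (at z)"
    by (auto intro!: derivative_eq_intros)
  then have "(deriv ^^ Suc (Suc k)) E_fun z =
     2 * fact k * exp (- pi * z\<^sup>2) * (hermite_pred k (- 2 * pi * z) (4 * pi\<^sup>2) * (- 2 * pi))
     + 2 * fact k * (exp (- pi * z\<^sup>2) * (- pi * (2 * z))) * hermite k (- 2 * pi * z) (4 * pi\<^sup>2)"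
    unfolding funpow.simps(2)[of "Suc k"] o_def eq by (rule DERIV_imp_deriv)
  also have "\<dots> = 2 * fact k * exp (- pi * z\<^sup>2) *
      (- 2 * pi * z * hermite k (- 2 * pi * z) (4 * pi\<^sup>2) - 4 * pi\<^sup>2 / (2 * pi) * hermite_pred k (- 2 * pi * z) (4 * pi\<^sup>2))"
    by (simp add: algebra_simps power2_eq_square)
  also have "- 2 * pi * z * hermite k (- 2 * pi * z) (4 * pi\<^sup>2) - 4 * pi\<^sup>2 / (2 * pi) * hermite_pred k (- 2 * pi * z) (4 * pi\<^sup>2)
     = real (Suc k) * hermite (Suc k) (- 2 * pi * z) (4 * pi\<^sup>2)"
    unfolding hermite_Suc by simp
  finally show ?case by (simp add: algebra_simps)
qed

lemma E_fun_deriv_has_derivative: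
  "((deriv ^^ k) E_fun has_real_derivative (deriv ^^ Suc k) E_fun z) (at z)"
proof (cases k)
  case 0
  then show ?thesis using E_fun_has_derivative[of z] DERIV_imp_deriv[OF E_fun_has_derivative, of z] by simp
next
  case (Suc j)
  have "(deriv ^^ k) E_fun = (\<lambda>z. 2 * fact j * exp (- pi * z\<^sup>2) * hermite j (- 2 * pi * z) (4 * pi\<^sup>2))"
    using E_fun_higher_deriv[of j] Suc by blast
  moreover have "(\<lambda>z. 2 * fact j * exp (- pi * z\<^sup>2) * hermite j (- 2 * pi * z) (4 * pi\<^sup>2)) field_differentiable (at z)"
    using field_differentiable_def DERIV_chain2[OF hermite_has_derivative]
    by (intro field_differentiable_mult field_differentiable_const field_differentiable_compose[of _ z exp, unfolded o_def])
       (auto simp: field_differentiable_def intro!: exI derivative_eq_intros DERIV_chain2[OF hermite_has_derivative])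
  ultimately have "(deriv ^^ k) E_fun field_differentiable (at z)" by simp
  then show ?thesis by (simp add: field_differentiable_derivI)
qed

text \<open>Homogeneity absorbs the power of \<open>w\<close> into the arguments, which puts the
  terms of the differentiated \<open>E_kernel\<close> into the shape required by
  \<open>hermite_add\<close>.\<close>

lemma E_fun_higher_deriv_scaled:
  "(deriv ^^ Suc k) E_fun z * w ^ k / fact k = 2 * exp (- pi * z\<^sup>2) * hermite k (- 2 * pi * z * w) (4 * pi\<^sup>2 * w\<^sup>2)"
proof -
  have "hermite k (- 2 * pi * z * w) (4 * pi\<^sup>2 * w\<^sup>2) = w ^ k * hermite k (- 2 * pi * z) (4 * pi\<^sup>2)"
    using hermite_scale[of k w "- 2 * pi * z" "4 * pi\<^sup>2"] by (simp add: mult.commute mult.left_commute)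
  then show ?thesis unfolding E_fun_higher_deriv by simp
qed

lemma E_fun_deriv_uminus: "(deriv ^^ k) E_fun (- z) = (- 1) ^ Suc k * (deriv ^^ k) E_fun z"
proof (cases k)
  case 0
  have "((\<lambda>z. E_fun z + E_fun (- z)) has_real_derivative 0) (at x)" for x
  proof -
    have "((\<lambda>z. E_fun (- z)) has_real_derivative 2 * exp (- pi * (- x)\<^sup>2) * (- 1)) (at x)"
      by (rule DERIV_chain2[OF E_fun_has_derivative]) (auto intro!: derivative_eq_intros)
    from DERIV_add[OF E_fun_has_derivative this] show ?thesis by simp
  qed
  then have "E_fun z + E_fun (- z) = E_fun 0 + E_fun (- 0)"
    using DERIV_isconst_all[of "\<lambda>z. E_fun z + E_fun (- z)" z 0] by blast
  also have "\<dots> = 0" by (simp add: E_fun_def zero_ereal_def)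
  finally show ?thesis using 0 by simp
next
  case (Suc j)
  show ?thesis
    unfolding Suc E_fun_higher_deriv using hermite_uminus[of j "2 * pi * z" "4 * pi\<^sup>2"]
      hermite_uminus[of j "- 2 * pi * z" "4 * pi\<^sup>2"] by simp
qed

section \<open>The polynomials of the theta kernel\<close>

lemma bform_add_left: "bform A (u + u') v = bform A u v + bform A u' v"
  and bform_add_right: "bform A u (v + v') = bform A u v + bform A u v'"
  and bform_diff_left: "bform A (u - u') v = bform A u v - bform A u' v"
  and bform_diff_right: "bform A u (v - v') = bform A u v - bform A u v'"
  and bform_scaleR_left: "bform A (r *\<^sub>R u) v = r * bform A u v"
  and bform_scaleR_right: "bform A u (r *\<^sub>R v) = r * bform A u v"
  and bform_minus_left: "bform A (- u) v = - bform A u v"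
  and bform_zero_left [simp]: "bform A 0 v = 0"
  and bform_zero_right [simp]: "bform A u 0 = 0"
  and bform_minus_right: "bform A u (- v) = - bform A u v"
  by (simp_all add: bform_def inner_add_left inner_add_right inner_diff_left inner_diff_right
      matrix_vector_right_distrib matrix_vector_mult_diff_distrib matrix_vector_mult_scaleR
      linear_neg[OF matrix_vector_mul_linear])

lemmas bform_simps = bform_add_left bform_add_right bform_diff_left bform_diff_right
  bform_scaleR_left bform_scaleR_right bform_minus_left bform_minus_right

lemma bform_commute: "transpose A = A \<Longrightarrow> bform A u v = bform A v u"
  by (metis bform_def dot_lmul_matrix inner_commute vector_transpose_matrix)

lemma bform_sum_right: "bform A u (\<Sum>i\<in>I. v i) = (\<Sum>i\<in>I. bform A u (v i))"
  by (induction I rule: infinite_finite_induct) (auto simp: bform_add_right)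

lemma matrix_inv_mul_vec:
  assumes "invertible A"
  shows "matrix_inv A *v (A *v v) = v" "A *v (matrix_inv A *v v) = v"
  using someI_ex[OF assms[unfolded invertible_def]]
  by (simp_all add: matrix_vector_mul_assoc matrix_inv_def)

lemma bform_matrix_inv:
  assumes "invertible A" "transpose A = A"
  shows "bform A (matrix_inv A *v u) v = u \<bullet> v"
  unfolding bform_commute[OF assms(2), of _ v] unfolding bform_def matrix_inv_mul_vec[OF assms(1)]
  by (rule inner_commute)

text \<open>Iterated finite differences of a power; the case \<open>k = card S\<close> is polarization.\<close>
lemma alternating_subset_sum_power:
  fixes x :: "'a \<Rightarrow> real"
  assumes "finite S" "k \<le> card S"
  shows "(\<Sum>T\<in>Pow S. (- 1) ^ (card S - card T) * (y + sum x T) ^ k) =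
    (if k = card S then fact k * prod x S else 0)"
  using assms
proof (induction S arbitrary: y k rule: finite_induct)
  case (insert a S)
  have fin: "finite T" "card T \<le> card S" "a \<notin> T" if "T \<in> Pow S" for T
    using that insert by (auto intro: finite_subset card_mono)
  have "(\<Sum>T\<in>Pow (insert a S). (- 1) ^ (card (insert a S) - card T) * (y + sum x T) ^ k) =
     (\<Sum>T\<in>Pow S. (- 1) ^ (card (insert a S) - card T) * (y + sum x T) ^ k) +
     (\<Sum>T\<in>insert a ` Pow S. (- 1) ^ (card (insert a S) - card T) * (y + sum x T) ^ k)"
    unfolding Pow_insert using insert by (intro sum.union_disjoint) auto
  also have "(\<Sum>T\<in>insert a ` Pow S. (- 1) ^ (card (insert a S) - card T) * (y + sum x T) ^ k) =
     (\<Sum>T\<in>Pow S. (- 1) ^ (card S - card T) * (y + x a + sum x T) ^ k)"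
  proof (subst sum.reindex)
    show "inj_on (insert a) (Pow S)" using insert(2) by (auto simp: inj_on_def)
  qed (use insert fin in \<open>auto simp: o_def add.assoc intro!: sum.cong\<close>)
  also have "(\<Sum>T\<in>Pow S. (- 1) ^ (card (insert a S) - card T) * (y + sum x T) ^ k) =
     - (\<Sum>T\<in>Pow S. (- 1) ^ (card S - card T) * (y + sum x T) ^ k)"
    unfolding sum_negf[symmetric] using insert fin
    by (intro sum.cong) (auto simp: Suc_diff_le)
  also have "(\<Sum>T\<in>Pow S. (- 1) ^ (card S - card T) * (y + x a + sum x T) ^ k) =
     (\<Sum>m\<le>k. real (k choose m) * x a ^ (k - m) * (\<Sum>T\<in>Pow S. (- 1) ^ (card S - card T) * (y + sum x T) ^ m))"
  proof -
    have "(\<Sum>T\<in>Pow S. (- 1) ^ (card S - card T) * (y + x a + sum x T) ^ k) =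
       (\<Sum>T\<in>Pow S. \<Sum>m\<le>k. real (k choose m) * x a ^ (k - m) * ((- 1) ^ (card S - card T) * (y + sum x T) ^ m))"
    proof (rule sum.cong[OF refl])
      fix T
      have "(y + x a + sum x T) ^ k = ((y + sum x T) + x a) ^ k" by (simp add: add_ac)
      also have "\<dots> = (\<Sum>m\<le>k. real (k choose m) * (y + sum x T) ^ m * x a ^ (k - m))"
        by (rule binomial_ring)
      finally show "(- 1) ^ (card S - card T) * (y + x a + sum x T) ^ k =
         (\<Sum>m\<le>k. real (k choose m) * x a ^ (k - m) * ((- 1) ^ (card S - card T) * (y + sum x T) ^ m))"
        by (simp add: sum_distrib_left mult_ac)
    qed
    then show ?thesis by (subst (asm) sum.swap) (simp add: sum_distrib_left)
  qed
  \<comment> \<open>The term \<open>m = k\<close> cancels the sum over subsets without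
    \<open>a\<close>. Among the terms with \<open>m < k\<close> the induction hypothesis leaves only
    \<open>m = card S\<close>, which occurs just for \<open>k = Suc (card S)\<close> and contributes
    the factor \<open>k * x a\<close>.\<close>
  also have "\<dots> = (\<Sum>T\<in>Pow S. (- 1) ^ (card S - card T) * (y + sum x T) ^ k) +
     (\<Sum>m<k. real (k choose m) * x a ^ (k - m) * (\<Sum>T\<in>Pow S. (- 1) ^ (card S - card T) * (y + sum x T) ^ m))"
    by (cases k) (simp_all add: lessThan_Suc_atMost)
  also have "(\<Sum>m<k. real (k choose m) * x a ^ (k - m) * (\<Sum>T\<in>Pow S. (- 1) ^ (card S - card T) * (y + sum x T) ^ m)) =
     (\<Sum>m<k. if m = card S then real (k choose m) * x a ^ (k - m) * (fact m * prod x S) else 0)"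
    using insert.prems insert.hyps by (intro sum.cong[OF refl]) (subst insert.IH, auto)
  also have "\<dots> = (if k = card (insert a S) then fact k * prod x (insert a S) else 0)"
    using insert.hyps insert.prems by (auto simp: sum.delta algebra_simps)
  finally show ?case by simp
qed simp

lemma finite_multi_indices: "finite {\<alpha>::'n::finite \<Rightarrow> nat. (\<Sum>i\<in>UNIV. \<alpha> i) = d}"
proof (rule finite_subset)
  show "{\<alpha>::'n \<Rightarrow> nat. (\<Sum>i\<in>UNIV. \<alpha> i) = d} \<subseteq> PiE UNIV (\<lambda>_. {..d})"
  proof
    fix \<alpha> :: "'n \<Rightarrow> nat" assume "\<alpha> \<in> {\<alpha>. (\<Sum>i\<in>UNIV. \<alpha> i) = d}"
    then have "\<alpha> i \<le> d" for i using member_le_sum[of i UNIV \<alpha>] by simp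
    then show "\<alpha> \<in> PiE UNIV (\<lambda>_. {..d})" by (simp add: PiE_UNIV_domain)
  qed
qed (simp add: finite_PiE)

text \<open>A monomial of degree \<open>d\<close> is a product of \<open>d\<close> coordinate forms,
  and polarization writes such a product as a combination of \<open>d\<close>-th powers of partial
  sums of these forms. An index \<open>j\<close> consists of an exponent vector and a subset of the
  factors.\<close>

lemma homogeneous_polynomial_powers:
  fixes f :: "real^'n \<Rightarrow> complex"
  assumes "homogeneous_polynomial d f"
  obtains J :: "(('n \<Rightarrow> nat) \<times> ('n \<times> nat) set) set" and r w where
    "finite J" "f = (\<lambda>v. \<Sum>j\<in>J. r j * of_real ((w j \<bullet> v) ^ d))"
proof -
  obtain coef where f: "f = (\<lambda>v. \<Sum>\<alpha> | (\<Sum>i\<in>UNIV. \<alpha> i) = d. coef \<alpha> * of_real (\<Prod>i\<in>UNIV. (v $ i) ^ \<alpha> i))"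
    using assms by (auto simp: homogeneous_polynomial_def)
  \<comment> \<open>Labels \<open>(i, k)\<close> with \<open>k < \<alpha> i\<close> keep repeated
    factors \<open>v $ i\<close> apart, so that the \<open>d\<close> factors form a genuine
    set.\<close>
  define S where "S = (\<lambda>\<alpha>::'n \<Rightarrow> nat. Sigma UNIV (\<lambda>i. {..<\<alpha> i}))"
  define w where "w = (\<lambda>j::('n \<Rightarrow> nat) \<times> ('n \<times> nat) set. \<Sum>p\<in>snd j. axis (fst p) (1::real))"
  define r where "r = (\<lambda>j::('n \<Rightarrow> nat) \<times> ('n \<times> nat) set. coef (fst j) * of_real ((- 1) ^ (d - card (snd j)) / fact d))"
  define J where "J = Sigma {\<alpha>. (\<Sum>i\<in>UNIV. \<alpha> i) = d} (\<lambda>\<alpha>. Pow (S \<alpha>))"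
  have finS: "finite (S \<alpha>)" for \<alpha> by (auto simp: S_def)
  have "(\<Prod>i\<in>UNIV. (v $ i) ^ \<alpha> i) = (\<Sum>T\<in>Pow (S \<alpha>). (- 1) ^ (d - card T) / fact d * (w (\<alpha>, T) \<bullet> v) ^ d)"
    if "(\<Sum>i\<in>UNIV. \<alpha> i) = d" for \<alpha> and v :: "real^'n"
  proof -
    have card: "card (S \<alpha>) = d" using that by (simp add: S_def)
    have "fact d * (\<Prod>i\<in>UNIV. (v $ i) ^ \<alpha> i) = fact d * (\<Prod>p\<in>S \<alpha>. v $ fst p)"
    proof -
      have "(\<Prod>i\<in>UNIV. (v $ i) ^ \<alpha> i) = (\<Prod>i\<in>UNIV. \<Prod>k<\<alpha> i. v $ i)" by simp
      also have "\<dots> = (\<Prod>p\<in>S \<alpha>. v $ fst p)"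
        unfolding S_def by (subst prod.Sigma) (auto simp: case_prod_unfold)
      finally show ?thesis by simp
    qed
    also have "\<dots> = (\<Sum>T\<in>Pow (S \<alpha>). (- 1) ^ (d - card T) * (0 + (\<Sum>p\<in>T. v $ fst p)) ^ d)"
      using alternating_subset_sum_power[OF finS, of d \<alpha> 0 "\<lambda>p. v $ fst p"] by (simp add: card)
    also have "\<dots> = (\<Sum>T\<in>Pow (S \<alpha>). (- 1) ^ (d - card T) * (w (\<alpha>, T) \<bullet> v) ^ d)"
      by (simp add: w_def inner_sum_left inner_axis')
    finally show ?thesis by (simp add: sum_divide_distrib[symmetric] field_simps)
  qed
  then have "f = (\<lambda>v. \<Sum>\<alpha> | (\<Sum>i\<in>UNIV. \<alpha> i) = d. \<Sum>T\<in>Pow (S \<alpha>). r (\<alpha>, T) * of_real ((w (\<alpha>, T) \<bullet> v) ^ d))"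
    unfolding f by (intro ext sum.cong) (auto simp: r_def sum_distrib_left mult.assoc)
  also have "\<dots> = (\<lambda>v. \<Sum>j\<in>J. r j * of_real ((w j \<bullet> v) ^ d))"
    unfolding J_def by (subst sum.Sigma) (auto simp: finite_multi_indices finS case_prod_unfold)
  finally have "f = (\<lambda>v. \<Sum>j\<in>J. r j * of_real ((w j \<bullet> v) ^ d))" .
  moreover have "finite J" unfolding J_def using finite_multi_indices finS by auto
  ultimately show ?thesis using that by blast
qed

text \<open>Functions \<open>g (B(h, v))\<close> of a linear form are stable under partial
  derivatives, so every operator acts on the profiles \<open>g j\<close> alone. Carrying the finite
  sum along builds linearity of \<open>laplace\<close> and \<open>partial_dir\<close> into the
  statements.\<close>

lemma partial_deriv_ridge_sum:
  fixes g g' :: "'j \<Rightarrow> real \<Rightarrow> real"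
  assumes g: "\<And>j x. j \<in> J \<Longrightarrow> (g j has_real_derivative g' j x) (at x)"
  shows "partial_deriv i (\<lambda>v. \<Sum>j\<in>J. r j * of_real (g j (bform A (h j) v))) =
    (\<lambda>v. \<Sum>j\<in>J. r j * of_real (g' j (bform A (h j) v) * bform A (h j) (axis i 1)))"
proof
  fix v
  have "((\<lambda>t. of_real (g j (bform A (h j) (v + t *\<^sub>R axis i 1))) :: complex) has_vector_derivative
      of_real (g' j (bform A (h j) v) * bform A (h j) (axis i 1))) (at 0)" if "j \<in> J" for j
  proof -
    have "((\<lambda>t. g j (bform A (h j) v + t * bform A (h j) (axis i 1))) has_real_derivative
        g' j (bform A (h j) v) * bform A (h j) (axis i 1)) (at 0)"
      by (rule DERIV_chain2[of "g j"]) (use g[OF that, of "bform A (h j) v"] in \<open>auto intro!: derivative_eq_intros\<close>)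
    then have "((\<lambda>t. complex_of_real (g j (bform A (h j) v + t * bform A (h j) (axis i 1)))) has_vector_derivative
        of_real (g' j (bform A (h j) v) * bform A (h j) (axis i 1))) (at 0)"
      by (intro has_vector_derivative_of_real) (simp add: has_real_derivative_iff_has_vector_derivative)
    then show ?thesis by (simp only: bform_simps)
  qed
  then have "((\<lambda>t. \<Sum>j\<in>J. r j * of_real (g j (bform A (h j) (v + t *\<^sub>R axis i 1)))) has_vector_derivative
      (\<Sum>j\<in>J. r j * of_real (g' j (bform A (h j) v) * bform A (h j) (axis i 1)))) (at 0)"
    by (intro has_vector_derivative_sum has_vector_derivative_mult_right)
  then show "partial_deriv i (\<lambda>v. \<Sum>j\<in>J. r j * of_real (g j (bform A (h j) v))) v =
      (\<Sum>j\<in>J. r j * of_real (g' j (bform A (h j) v) * bform A (h j) (axis i 1)))"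
    unfolding partial_deriv_def by (rule vector_derivative_at)
qed

lemma laplace_ridge_sum:
  fixes g g' g'' :: "'j \<Rightarrow> real \<Rightarrow> real"
  assumes A: "invertible A" "transpose A = A"
    and g: "\<And>j x. j \<in> J \<Longrightarrow> (g j has_real_derivative g' j x) (at x)"
    and g': "\<And>j x. j \<in> J \<Longrightarrow> (g' j has_real_derivative g'' j x) (at x)"
  shows "laplace A (\<lambda>v. \<Sum>j\<in>J. r j * of_real (g j (bform A (h j) v))) =
    (\<lambda>v. \<Sum>j\<in>J. r j * of_real (2 * qform A (h j) * g'' j (bform A (h j) v)))"
proof
  fix v
  \<comment> \<open>The gradient of \<open>bform A u\<close> is \<open>A *v u\<close>, and
    contracting two copies of it with \<open>matrix_inv A\<close> leaves
    \<open>bform A u u\<close>.\<close>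
  have quad: "(\<Sum>i\<in>UNIV. \<Sum>k\<in>UNIV. matrix_inv A $ i $ k * (bform A u (axis k 1) * bform A u (axis i 1))) = 2 * qform A u" for u
  proof -
    have ax: "bform A u (axis k 1) = (A *v u) $ k" for k
      unfolding bform_commute[OF A(2), of u] by (simp add: bform_def inner_axis')
    have "(\<Sum>i\<in>UNIV. \<Sum>k\<in>UNIV. matrix_inv A $ i $ k * (bform A u (axis k 1) * bform A u (axis i 1)))
        = (A *v u) \<bullet> (matrix_inv A *v (A *v u))"
      unfolding ax by (simp add: inner_vec_def matrix_vector_mult_def[of "matrix_inv A"] sum_distrib_left mult_ac)
    also have "\<dots> = 2 * qform A u"
      unfolding matrix_inv_mul_vec[OF A(1)] by (simp add: qform_def bform_def inner_commute)
    finally show ?thesis .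
  qed
  have pd1: "partial_deriv k (\<lambda>v. \<Sum>j\<in>J. r j * of_real (g j (bform A (h j) v))) =
    (\<lambda>v. \<Sum>j\<in>J. r j * of_real (g' j (bform A (h j) v) * bform A (h j) (axis k 1)))" for k
    by (rule partial_deriv_ridge_sum) (rule g)
  have pd: "partial_deriv i (partial_deriv k (\<lambda>v. \<Sum>j\<in>J. r j * of_real (g j (bform A (h j) v)))) v =
    (\<Sum>j\<in>J. r j * of_real (g'' j (bform A (h j) v) * (bform A (h j) (axis k 1) * bform A (h j) (axis i 1))))" for i k
    unfolding pd1
    by (subst partial_deriv_ridge_sum[where g="\<lambda>j x. g' j x * bform A (h j) (axis k 1)" and g'="\<lambda>j x. g'' j x * bform A (h j) (axis k 1)"])
       (use g' in \<open>auto intro!: derivative_eq_intros simp: mult_ac\<close>)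
  have "laplace A (\<lambda>v. \<Sum>j\<in>J. r j * of_real (g j (bform A (h j) v))) v =
      (\<Sum>j\<in>J. \<Sum>i\<in>UNIV. \<Sum>k\<in>UNIV. r j * of_real (g'' j (bform A (h j) v) *
        (matrix_inv A $ i $ k * (bform A (h j) (axis k 1) * bform A (h j) (axis i 1)))))"
    unfolding laplace_def pd sum_distrib_left
    by (subst (2) sum.swap, subst sum.swap) (simp add: mult_ac)
  also have "\<dots> = (\<Sum>j\<in>J. r j * of_real (2 * qform A (h j) * g'' j (bform A (h j) v)))"
    by (simp only: quad[symmetric] sum_distrib_left[symmetric] of_real_sum[symmetric] mult.commute[of "2 * _"] mult.commute)
  finally show "laplace A (\<lambda>v. \<Sum>j\<in>J. r j * of_real (g j (bform A (h j) v))) v =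
    (\<Sum>j\<in>J. r j * of_real (2 * qform A (h j) * g'' j (bform A (h j) v)))" .
qed

lemma partial_dir_ridge_sum:
  fixes g g' :: "'j \<Rightarrow> real \<Rightarrow> real"
  assumes A: "transpose A = A"
    and g: "\<And>j x. j \<in> J \<Longrightarrow> (g j has_real_derivative g' j x) (at x)"
  shows "partial_dir A c (\<lambda>v. \<Sum>j\<in>J. r j * of_real (g j (bform A (h j) v))) =
    (\<lambda>v. \<Sum>j\<in>J. r j * of_real (bform A c (h j) / sqrt (- qform A c) * g' j (bform A (h j) v)))"
proof
  fix v
  have c: "(\<Sum>i\<in>UNIV. c $ i * bform A u (axis i 1)) = bform A c u" for u
  proof -
    have "(\<Sum>i\<in>UNIV. c $ i * bform A u (axis i 1)) = bform A u (\<Sum>i\<in>UNIV. c $ i *\<^sub>R axis i 1)"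
      by (simp add: bform_sum_right bform_scaleR_right)
    also have "(\<Sum>i\<in>UNIV. c $ i *\<^sub>R axis i 1) = c"
      using basis_expansion[of c] by (simp add: scalar_mult_eq_scaleR)
    finally show ?thesis using bform_commute[OF A] by simp
  qed
  have pd1: "partial_deriv k (\<lambda>v. \<Sum>j\<in>J. r j * of_real (g j (bform A (h j) v))) =
    (\<lambda>v. \<Sum>j\<in>J. r j * of_real (g' j (bform A (h j) v) * bform A (h j) (axis k 1)))" for k
    by (rule partial_deriv_ridge_sum) (rule g)
  have "partial_dir A c (\<lambda>v. \<Sum>j\<in>J. r j * of_real (g j (bform A (h j) v))) v =
     (\<Sum>j\<in>J. r j * of_real (1 / sqrt (- qform A c) * g' j (bform A (h j) v) * (\<Sum>i\<in>UNIV. c $ i * bform A (h j) (axis i 1))))"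
    unfolding partial_dir_def pd1 sum_distrib_left of_real_sum of_real_mult
    by (subst sum.swap) (simp add: sum_distrib_left mult_ac)
  then show "partial_dir A c (\<lambda>v. \<Sum>j\<in>J. r j * of_real (g j (bform A (h j) v))) v =
    (\<Sum>j\<in>J. r j * of_real (bform A c (h j) / sqrt (- qform A c) * g' j (bform A (h j) v)))"
    unfolding c by (simp add: mult_ac)
qed

text \<open>The \<open>m\<close>-th derivative of \<open>x ^ d\<close>; the guard prevents truncated
  subtraction from producing a nonzero constant for \<open>m > d\<close>.\<close>

definition power_deriv :: "nat \<Rightarrow> nat \<Rightarrow> real \<Rightarrow> real" where
  "power_deriv d m x = (if m \<le> d then fact d / fact (d - m) * x ^ (d - m) else 0)"

lemma power_deriv_has_derivative: "(power_deriv d m has_real_derivative power_deriv d (Suc m) x) (at x)"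
proof (cases "Suc m \<le> d")
  case True
  define n where "n = d - Suc m"
  have n: "d - m = Suc n" using True by (simp add: n_def)
  have "power_deriv d m = (\<lambda>x. fact d / fact (Suc n) * x ^ Suc n)"
    using True n by (auto simp: power_deriv_def fun_eq_iff)
  moreover have "((\<lambda>x::real. fact d / fact (Suc n) * x ^ Suc n) has_real_derivative
      fact d / fact (Suc n) * (real (Suc n) * x ^ n)) (at x)"
    using DERIV_cmult[OF DERIV_pow[of "Suc n" x], of "fact d / fact (Suc n)"] by simp
  moreover have "fact d / fact (Suc n) * (real (Suc n) * x ^ n) = power_deriv d (Suc m) x"
    using True by (simp add: power_deriv_def n_def[symmetric] del: of_nat_Suc)
  ultimately show ?thesis by simp
next
  case False
  then have "power_deriv d m = (\<lambda>_. if m \<le> d then fact d else 0)"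
    by (auto simp: power_deriv_def fun_eq_iff)
  then show ?thesis using False by (auto simp: power_deriv_def)
qed

lemma laplace_power_ridge_sum:
  assumes A: "invertible A" "transpose A = A"
  shows "(laplace A ^^ k) (\<lambda>v. \<Sum>j\<in>J. r j * of_real (bform A (h j) v ^ d)) =
    (\<lambda>v. \<Sum>j\<in>J. r j * of_real ((2 * qform A (h j)) ^ k * power_deriv d (2 * k) (bform A (h j) v)))"
proof (induction k)
  case (Suc k)
  have "(laplace A ^^ Suc k) (\<lambda>v. \<Sum>j\<in>J. r j * of_real (bform A (h j) v ^ d)) =
    laplace A (\<lambda>v. \<Sum>j\<in>J. r j * of_real ((2 * qform A (h j)) ^ k * power_deriv d (2 * k) (bform A (h j) v)))"
    using Suc by simp
  also have "\<dots> = (\<lambda>v. \<Sum>j\<in>J. r j * of_real (2 * qform A (h j) * ((2 * qform A (h j)) ^ k * power_deriv d (Suc (Suc (2 * k))) (bform A (h j) v))))"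
    by (rule laplace_ridge_sum[OF A]) (auto intro!: DERIV_cmult power_deriv_has_derivative)
  finally show ?case by (simp add: mult_ac)
qed (simp add: power_deriv_def)

text \<open>On a ridge function \<open>laplace\<close> is \<open>2 * qform A h\<close> times the
  second derivative, so the coefficient \<open>(- 1 / (8 * pi)) ^ k\<close> of \<open>fhat\<close>
  turns into \<open>(- q / (4 * pi)) ^ k\<close> with \<open>q = qform A h\<close>: exactly the
  terms of \<open>hermite\<close>. The series is finite because derivatives beyond order
  \<open>d\<close> vanish.\<close>

lemma fhat_power_ridge_sum:
  assumes A: "invertible A" "transpose A = A"
  shows "fhat A (\<lambda>v. \<Sum>j\<in>J. r j * of_real (bform A (h j) v ^ d)) =
    (\<lambda>v. \<Sum>j\<in>J. r j * of_real (fact d * hermite d (bform A (h j) v) (qform A (h j))))"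
proof
  fix v
  define T where "T = (\<lambda>j k. (if 2 * k \<le> d then fact d * (bform A (h j) v ^ (d - 2 * k) / fact (d - 2 * k) *
      ((- qform A (h j) / (4 * pi)) ^ k / fact k)) else 0))"
  have term_eq: "of_real ((-1) ^ k / ((8 * pi) ^ k * fact k)) * (\<Sum>j\<in>J. r j * of_real ((2 * qform A (h j)) ^ k * power_deriv d (2 * k) (bform A (h j) v)))
     = (\<Sum>j\<in>J. r j * of_real (T j k))" for k
  proof -
    have "(-1) ^ k / ((8 * pi) ^ k * fact k) * ((2 * q) ^ k) = ((- q / (4 * pi)) ^ k / fact k)" for q :: real
    proof -
      have "(-1) ^ k / ((8 * pi) ^ k * fact k) * ((2 * q) ^ k) = ((- 1) * (2 * q) / (8 * pi)) ^ k / fact k"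
        by (simp only: power_mult_distrib power_divide) simp
      also have "(- 1) * (2 * q) / (8 * pi) = - q / (4 * pi)" by simp
      finally show ?thesis .
    qed
    then have "(-1) ^ k / ((8 * pi) ^ k * fact k) * ((2 * qform A (h j)) ^ k * power_deriv d (2 * k) (bform A (h j) v)) = T j k" for j
      unfolding mult.assoc[symmetric] by (simp add: T_def power_deriv_def)
    then show ?thesis
      unfolding sum_distrib_left by (simp only: mult.left_commute[of _ "r _"] of_real_mult[symmetric])
  qed
  have "fhat A (\<lambda>v. \<Sum>j\<in>J. r j * of_real (bform A (h j) v ^ d)) v = (\<Sum>k. \<Sum>j\<in>J. r j * of_real (T j k))"
    unfolding fhat_def laplace_power_ridge_sum[OF A] term_eq ..
  also have "\<dots> = (\<Sum>k | 2 * k \<le> d. \<Sum>j\<in>J. r j * of_real (T j k))"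
    by (rule suminf_finite) (auto simp: T_def)
  also have "\<dots> = (\<Sum>j\<in>J. r j * of_real (\<Sum>k | 2 * k \<le> d. T j k))"
    by (subst sum.swap) (simp add: sum_distrib_left)
  also have "(\<lambda>j. \<Sum>k | 2 * k \<le> d. T j k) = (\<lambda>j. fact d * hermite d (bform A (h j) v) (qform A (h j)))"
    unfolding hermite_def sum_distrib_left by (intro ext sum.cong) (auto simp: T_def)
  finally show "fhat A (\<lambda>v. \<Sum>j\<in>J. r j * of_real (bform A (h j) v ^ d)) v =
    (\<Sum>j\<in>J. r j * of_real (fact d * hermite d (bform A (h j) v) (qform A (h j))))" .
qed

definition hermite_deriv :: "nat \<Rightarrow> nat \<Rightarrow> real \<Rightarrow> real \<Rightarrow> real" where
  "hermite_deriv d k b q = (if k \<le> d then hermite (d - k) b q else 0)"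

lemma hermite_deriv_has_derivative:
  "((\<lambda>b. hermite_deriv d k b q) has_real_derivative hermite_deriv d (Suc k) b q) (at b)"
proof (cases "k < d")
  case True
  then have "hermite_pred (d - k) b q = hermite_deriv d (Suc k) b q"
    by (simp add: hermite_pred_def hermite_deriv_def)
  then show ?thesis
    using hermite_has_derivative[of "d - k" q b UNIV] True by (simp add: hermite_deriv_def)
next
  case False
  then have "(\<lambda>b. hermite_deriv d k b q) = (\<lambda>b. if k = d then 1 else 0)"
    by (auto simp: hermite_deriv_def)
  then show ?thesis using False by (simp add: hermite_deriv_def)
qed

lemma partial_dir_hermite_ridge_sum:
  assumes A: "transpose A = A"
  shows "(partial_dir A c ^^ k) (\<lambda>v. \<Sum>j\<in>J. r j * of_real (fact d * hermite d (bform A (h j) v) (q j))) =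
    (\<lambda>v. \<Sum>j\<in>J. r j * of_real ((bform A c (h j) / sqrt (- qform A c)) ^ k * (fact d * hermite_deriv d k (bform A (h j) v) (q j))))"
proof (induction k)
  case (Suc k)
  have "(partial_dir A c ^^ Suc k) (\<lambda>v. \<Sum>j\<in>J. r j * of_real (fact d * hermite d (bform A (h j) v) (q j))) =
    partial_dir A c (\<lambda>v. \<Sum>j\<in>J. r j * of_real ((bform A c (h j) / sqrt (- qform A c)) ^ k * (fact d * hermite_deriv d k (bform A (h j) v) (q j))))"
    using Suc by simp
  also have "\<dots> = (\<lambda>v. \<Sum>j\<in>J. r j * of_real (bform A c (h j) / sqrt (- qform A c) *
      ((bform A c (h j) / sqrt (- qform A c)) ^ k * (fact d * hermite_deriv d (Suc k) (bform A (h j) v) (q j)))))"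
    by (rule partial_dir_ridge_sum[OF A]) (auto intro!: DERIV_cmult hermite_deriv_has_derivative)
  finally show ?case by (simp add: mult_ac)
qed (simp add: hermite_deriv_def)

text \<open>The contribution of the polynomial \<open>B(h, v)^d\<close> to \<open>y powr (- d / 2) p^t[f](\<surd>y v)\<close>:
  \<open>E_kernel\<close> for \<open>Q(t) = - 1\<close>, \<open>sgn_kernel\<close> for isotropic \<open>t\<close>.\<close>

definition E_kernel :: "real^'n^'n \<Rightarrow> nat \<Rightarrow> real^'n \<Rightarrow> real \<Rightarrow> real^'n \<Rightarrow> real^'n \<Rightarrow> real" where
  "E_kernel A d h y t v = fact d * (\<Sum>k\<le>d. (deriv ^^ k) E_fun (sqrt y * bform A t v) *
     (- bform A t h / (4 * pi * sqrt y)) ^ k / fact k * hermite (d - k) (bform A h v) (qform A h / y))"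

definition sgn_kernel :: "real^'n^'n \<Rightarrow> nat \<Rightarrow> real^'n \<Rightarrow> real \<Rightarrow> real^'n \<Rightarrow> real^'n \<Rightarrow> real" where
  "sgn_kernel A d h y t v = fact d * (sgn (bform A t v) * hermite d (bform A h v) (qform A h / y))"

text \<open>Only a timelike \<open>c\<close> can be normalised to \<open>Q = - 1\<close>; for
  isotropic \<open>c\<close> the kernel depends on \<open>c\<close> through a sign, which positive
  scaling does not change.\<close>

definition p_kernel :: "real^'n^'n \<Rightarrow> nat \<Rightarrow> real^'n \<Rightarrow> real \<Rightarrow> real^'n \<Rightarrow> real^'n \<Rightarrow> real" where
  "p_kernel A d h y c v = (if qform A c < 0 then E_kernel A d h y (c /\<^sub>R sqrt (- qform A c)) v
     else sgn_kernel A d h y c v)"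

lemma sqrt_power_powr:
  assumes "y > 0"
  shows "sqrt y ^ k = y powr (real k / 2)"
proof -
  have "sqrt y ^ k = (y powr (1 / 2)) powr real k"
    using assms by (simp add: powr_half_sqrt powr_realpow)
  then show ?thesis by (simp add: powr_powr)
qed

lemma hermite_sqrt_scale:
  assumes "y > 0"
  shows "y powr (- (real d / 2)) * hermite d (sqrt y * b) q = hermite d b (q / y)"
proof -
  have "hermite d (sqrt y * b) ((sqrt y)\<^sup>2 * (q / y)) = sqrt y ^ d * hermite d b (q / y)"
    by (rule hermite_scale)
  moreover have "y powr (- (real d / 2)) * sqrt y ^ d = 1"
    using assms by (simp add: sqrt_power_powr flip: powr_add)
  ultimately show ?thesis using assms by (simp add: mult.assoc[symmetric])
qed

text \<open>The factor \<open>y powr (- (d / 2))\<close> splits for each \<open>k\<close>: the part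
  with \<open>(d - k) / 2\<close> rescales the \<open>hermite\<close> factor of degree
  \<open>d - k\<close>, the part with \<open>k / 2\<close> becomes the \<open>sqrt y\<close> under
  \<open>bform A t h\<close> in \<open>E_kernel\<close>. In this form the kernels at
  \<open>Im \<tau>\<close> and at \<open>Im (- 1 / \<tau>)\<close> are compared on unscaled lattice
  vectors.\<close>

lemma pfun_power_ridge_sum:
  assumes A: "invertible A" "transpose A = A" and y: "y > 0"
  shows "of_real (y powr (- (real d / 2))) * pfun A d c (\<lambda>v. \<Sum>j\<in>J. r j * of_real (bform A (h j) v ^ d)) (sqrt y *\<^sub>R v) =
    (\<Sum>j\<in>J. r j * of_real (p_kernel A d (h j) y c v))"
proof (cases "qform A c < 0")
  case True
  define s where "s = sqrt (- qform A c)"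
  have bs: "bform A (c /\<^sub>R s) u = bform A c u / s" for u
    by (simp only: bform_scaleR_left divide_inverse mult.commute)
  define Sf where "Sf = (\<lambda>u. \<Sum>k=0..d. (-1) ^ k / ((4 * pi) ^ k * fact k) * (deriv ^^ k) E_fun (sqrt y * bform A c v / s) *
      ((bform A c u / s) ^ k * (fact d * hermite_deriv d k (sqrt y * bform A u v) (qform A u))))"
  have key: "y powr (- (real d / 2)) * Sf u = p_kernel A d u y c v" for u
  proof -
    have "y powr (- (real d / 2)) * ((-1) ^ k / ((4 * pi) ^ k * fact k) * (deriv ^^ k) E_fun (sqrt y * bform A c v / s) *
      ((bform A c u / s) ^ k * (fact d * hermite_deriv d k (sqrt y * bform A u v) (qform A u)))) =
      fact d * ((deriv ^^ k) E_fun (sqrt y * bform A (c /\<^sub>R s) v) *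
         (- bform A (c /\<^sub>R s) u / (4 * pi * sqrt y)) ^ k / fact k * hermite (d - k) (bform A u v) (qform A u / y))"
      if k: "k \<le> d" for k
    proof -
      have "y powr (- (real d / 2)) = y powr (- (real (d - k) / 2)) * (1 / sqrt y ^ k)"
      proof -
        have "1 / sqrt y ^ k = y powr (- (real k / 2))"
          unfolding sqrt_power_powr[OF y] by (rule powr_minus_divide[symmetric])
        moreover have "- (real d / 2) = - (real (d - k) / 2) + - (real k / 2)"
          using k by (simp add: of_nat_diff diff_divide_distrib)
        ultimately show ?thesis by (simp only: powr_add)
      qed
      then have h1: "y powr (- (real d / 2)) * hermite_deriv d k (sqrt y * bform A u v) (qform A u) =
          hermite (d - k) (bform A u v) (qform A u / y) / sqrt y ^ k"
        using k hermite_sqrt_scale[OF y, of "d - k" "bform A u v" "qform A u"] by (simp add: hermite_deriv_def)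
      have h2: "(-1) ^ k / ((4 * pi) ^ k * fact k) * (bform A c u / s) ^ k / sqrt y ^ k =
          (- bform A (c /\<^sub>R s) u / (4 * pi * sqrt y)) ^ k / fact k"
      proof -
        have "(- bform A (c /\<^sub>R s) u / (4 * pi * sqrt y)) = (-1) * (bform A c u / s) / (4 * pi * sqrt y)"
          unfolding bs by simp
        then have "(- bform A (c /\<^sub>R s) u / (4 * pi * sqrt y)) ^ k =
            ((-1) ^ k * (bform A c u / s) ^ k) / ((4 * pi) ^ k * sqrt y ^ k)"
          by (simp only: power_mult_distrib power_divide[of _ "4 * pi * sqrt y"])
        moreover have "m / (P * F) * Z / Y = (m * Z) / (P * Y) / F" for m P F Z Y :: real
          by (simp only: divide_inverse inverse_mult_distrib mult_ac)
        ultimately show ?thesis by (simp only:)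
      qed
      have h3: "sqrt y * bform A (c /\<^sub>R s) v = sqrt y * bform A c v / s"
        unfolding bs by simp
      have h4: "p * (m * e * (z * (f * H))) = f * (e * N * G)" if "p * H = G / q" "m * z / q = N" for p m e z f H N G q :: real
      proof -
        have "p * (m * e * (z * (f * H))) = f * (e * (m * z) * (p * H))" by (simp add: mult_ac)
        then show ?thesis unfolding that(1) that(2)[symmetric] by simp
      qed
      show ?thesis
        using h4[OF h1 h2] unfolding h3 by (simp only: times_divide_eq_right)
    qed
    then show ?thesis
      using True by (simp add: p_kernel_def E_kernel_def Sf_def s_def[symmetric] sum_distrib_left atMost_atLeast0)
  qed
  have "pfun A d c (\<lambda>v. \<Sum>j\<in>J. r j * of_real (bform A (h j) v ^ d)) (sqrt y *\<^sub>R v) =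
     (\<Sum>j\<in>J. r j * of_real (Sf (h j)))"
    unfolding pfun_def fhat_power_ridge_sum[OF A] partial_dir_hermite_ridge_sum[OF A(2)] of_real_sum sum_distrib_left Sf_def
    using True by (subst sum.swap) (simp add: s_def bform_scaleR_right sum_distrib_left mult_ac)
  then show ?thesis
    unfolding key[symmetric] by (simp add: sum_distrib_left mult.left_commute)
next
  case False
  then show ?thesis
    unfolding pfun_def fhat_power_ridge_sum[OF A] p_kernel_def sgn_kernel_def
      hermite_sqrt_scale[OF y, symmetric]
    using y by (simp add: bform_scaleR_right sgn_mult sum_distrib_left mult_ac)
qed

text \<open>In every term the parity \<open>Suc k\<close> of the error function derivative and the
  parity \<open>d - k\<close> of the polynomial add up to \<open>Suc d\<close>.\<close>

lemma p_kernel_uminus: "p_kernel A d h y c (- v) = (- 1) ^ Suc d * p_kernel A d h y c v"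
proof -
  have "E_kernel A d h y t (- v) = (- 1) ^ Suc d * E_kernel A d h y t v" for t
  proof -
    have "(\<Sum>k\<le>d. (deriv ^^ k) E_fun (sqrt y * bform A t (- v)) * (- bform A t h / (4 * pi * sqrt y)) ^ k / fact k *
         hermite (d - k) (bform A h (- v)) (qform A h / y)) =
       (- 1) ^ Suc d * (\<Sum>k\<le>d. (deriv ^^ k) E_fun (sqrt y * bform A t v) * (- bform A t h / (4 * pi * sqrt y)) ^ k / fact k *
         hermite (d - k) (bform A h v) (qform A h / y))"
      unfolding sum_distrib_left
    proof (rule sum.cong[OF refl])
    fix k assume "k \<in> {..d}"
    then have "(- 1) ^ Suc k * (- 1) ^ (d - k) = ((- 1) ^ Suc d :: real)"
      by (simp flip: power_add)
    moreover have "E' * w / f * H' = s * (E * w / f * H)" if "E' = p * E" "H' = q * H" "p * q = s" for E' E w f H H' p q s :: real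
      unfolding that(1,2) that(3)[symmetric] by simp
    ultimately show "(deriv ^^ k) E_fun (sqrt y * bform A t (- v)) * (- bform A t h / (4 * pi * sqrt y)) ^ k / fact k *
         hermite (d - k) (bform A h (- v)) (qform A h / y) =
         (- 1) ^ Suc d * ((deriv ^^ k) E_fun (sqrt y * bform A t v) * (- bform A t h / (4 * pi * sqrt y)) ^ k / fact k *
         hermite (d - k) (bform A h v) (qform A h / y))"
      using E_fun_deriv_uminus[of k "sqrt y * bform A t v"] hermite_uminus[of "d - k" "bform A h v" "qform A h / y"]
      by (simp only: bform_minus_right mult_minus_right)
    qed
    then show ?thesis unfolding E_kernel_def by simp
  qed
  moreover have "sgn_kernel A d h y t (- v) = (- 1) ^ Suc d * sgn_kernel A d h y t v" for t
    by (simp add: sgn_kernel_def bform_minus_right hermite_uminus sgn_minus mult_ac)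
  ultimately show ?thesis unfolding p_kernel_def by (cases "qform A c < 0") simp_all
qed

section \<open>Lorentzian quadratic forms\<close>

definition lorentz_sign :: "'n \<Rightarrow> 'n \<Rightarrow> real" where
  "lorentz_sign i0 i = (if i = i0 then - 1 else 1)"

lemma inner_matrix_vector: "(P *v x) \<bullet> z = x \<bullet> (transpose P *v z)" for P :: "real^'n^'m"
  by (metis dot_lmul_matrix transpose_matrix_vector transpose_transpose)

text \<open>The two counts add up to the dimension, so no diagonal coefficient vanishes and scaling
  the basis vectors normalises all of them to \<open>1\<close> or \<open>- 1\<close>.\<close>

lemma signature_basis:
  fixes A :: "real^'n^'n"
  assumes "has_signature A (CARD('n) - 1) 1"
  obtains P :: "real^'n^'n" and i0 where
    "\<And>w w'. bform A (P *v w) (P *v w') = (\<Sum>i\<in>UNIV. lorentz_sign i0 i * (w $ i * w' $ i))"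
proof -
  obtain P D :: "real^'n^'n" where PD: "transpose P ** A ** P = D" "\<And>i j. i \<noteq> j \<Longrightarrow> D $ i $ j = 0"
    and card: "card {i. D $ i $ i > 0} = CARD('n) - 1" "card {i. D $ i $ i < 0} = 1"
    using assms unfolding has_signature_def by blast
  obtain i0 where i0: "{i. D $ i $ i < 0} = {i0}" using card(2) by (auto simp: card_1_singleton_iff)
  have "{i. D $ i $ i > 0} = UNIV - {i0}"
  proof (rule card_subset_eq)
    show "{i. D $ i $ i > 0} \<subseteq> UNIV - {i0}" using i0 by force
  qed (simp_all add: card)
  then have pos: "D $ i $ i > 0" if "i \<noteq> i0" for i using that by blast
  have neg: "D $ i0 $ i0 < 0" using i0 by blast
  have D: "bform A (P *v x) (P *v y) = (\<Sum>i\<in>UNIV. D $ i $ i * (x $ i * y $ i))" for x y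
  proof -
    have "bform A (P *v x) (P *v y) = x \<bullet> (D *v y)"
      by (simp only: bform_def inner_matrix_vector PD(1)[symmetric] matrix_vector_mul_assoc matrix_mul_assoc)
    also have "\<dots> = (\<Sum>i\<in>UNIV. x $ i * (\<Sum>j\<in>UNIV. D $ i $ j * y $ j))"
      by (simp add: inner_vec_def matrix_vector_mult_def)
    also have "\<dots> = (\<Sum>i\<in>UNIV. x $ i * (\<Sum>j\<in>{i}. D $ i $ j * y $ j))"
      using PD(2) by (intro sum.cong refl arg_cong2[of _ _ _ _ "(*)"] sum.mono_neutral_right) auto
    finally show ?thesis by (simp add: mult_ac)
  qed
  define S where "S = (\<chi> i j. if i = j then 1 / sqrt \<bar>D $ i $ i\<bar> else 0)"
  have S: "(S *v w) $ i = w $ i / sqrt \<bar>D $ i $ i\<bar>" for w i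
  proof -
    have "(S *v w) $ i = (\<Sum>j\<in>UNIV. if i = j then w $ j / sqrt \<bar>D $ i $ i\<bar> else 0)"
      unfolding S_def matrix_vector_mult_def vec_lambda_beta by (rule sum.cong) auto
    then show ?thesis by simp
  qed
  have "bform A ((P ** S) *v w) ((P ** S) *v w') = (\<Sum>i\<in>UNIV. lorentz_sign i0 i * (w $ i * w' $ i))" for w w'
  proof -
    have "bform A ((P ** S) *v w) ((P ** S) *v w') = (\<Sum>i\<in>UNIV. D $ i $ i * ((S *v w) $ i * (S *v w') $ i))"
      by (simp add: D flip: matrix_vector_mul_assoc)
    also have "\<dots> = (\<Sum>i\<in>UNIV. lorentz_sign i0 i * (w $ i * w' $ i))"
    proof (rule sum.cong[OF refl])
      fix i
      have "D $ i $ i = lorentz_sign i0 i * (sqrt \<bar>D $ i $ i\<bar> * sqrt \<bar>D $ i $ i\<bar>)" "D $ i $ i \<noteq> 0"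
        using pos[of i] neg by (cases "i = i0"; force simp: lorentz_sign_def)+
      then show "D $ i $ i * ((S *v w) $ i * (S *v w') $ i) = lorentz_sign i0 i * (w $ i * w' $ i)"
        unfolding S by (simp add: field_simps)
    qed
    finally show ?thesis .
  qed
  then show ?thesis using that by blast
qed

lemma axis_sum_lorentz: "(\<Sum>i\<in>UNIV. lorentz_sign i0 i * (axis k 1 $ i * w $ i)) = lorentz_sign i0 k * w $ k"
proof -
  have "(\<Sum>i\<in>UNIV. lorentz_sign i0 i * (axis k 1 $ i * w $ i)) = (\<Sum>i\<in>UNIV. if i = k then lorentz_sign i0 k * w $ k else 0)"
    by (intro sum.cong) (auto simp: axis_def)
  then show ?thesis by simp
qed

text \<open>The basis is the Sylvester basis moved by a reflection taking its timelike vector to \<open>\<plusminus>t\<close>.\<close>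
lemma lorentz_basis:
  fixes A :: "real^'n^'n"
  assumes sig: "has_signature A (CARD('n) - 1) 1" and sym: "transpose A = A" and t: "bform A t t = - 1"
  obtains T :: "real^'n^'n" and i0 where
    "\<And>w w'. bform A (T *v w) (T *v w') = (\<Sum>i\<in>UNIV. lorentz_sign i0 i * (w $ i * w' $ i))"
    "\<And>w w'. bform A t (T *v w) * bform A t (T *v w') = w $ i0 * w' $ i0"
    "\<bar>det T\<bar> = 1 / sqrt \<bar>det A\<bar>" "invertible T"
proof -
  obtain P :: "real^'n^'n" and i0 where
    P: "\<And>w w'. bform A (P *v w) (P *v w') = (\<Sum>i\<in>UNIV. lorentz_sign i0 i * (w $ i * w' $ i))"
    using signature_basis[OF sig] by blast
  define e where "e = P *v axis i0 1"
  have e: "bform A e e = - 1" by (simp add: e_def P axis_sum_lorentz) (simp add: lorentz_sign_def)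
  have comm: "bform A u v = bform A v u" for u v by (rule bform_commute[OF sym])
  \<comment> \<open>For \<open>r = e + \<sigma> t\<close> one has
    \<open>B(r, r) = 2 * (\<sigma> * B(e, t) - 1)\<close>; the sign is chosen so that the reflection
    vector is not isotropic.\<close>
  obtain \<sigma> :: real where \<sigma>: "\<sigma> = 1 \<or> \<sigma> = - 1" "\<sigma> * bform A e t \<noteq> 1"
  proof (cases "bform A e t = 1")
    case True then show ?thesis using that[of "- 1"] by simp
  next
    case False then show ?thesis using that[of 1] by simp
  qed
  define r where "r = e + \<sigma> *\<^sub>R t"
  have rr: "bform A r r = 2 * bform A e r" "bform A r r \<noteq> 0"
    using \<sigma> e t comm[of t e] by (auto simp: r_def bform_simps)
  define R where "R = (\<lambda>v. v - (2 * bform A r v / bform A r r) *\<^sub>R r)"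
  have lin: "linear R"
    unfolding R_def by (rule linearI) (simp_all add: bform_simps algebra_simps add_divide_distrib)
  have RR: "bform A (R v) (R w) = bform A v w" for v w
    using rr(2) unfolding R_def by (simp add: bform_simps comm[of v r] comm[of w r] field_simps)
  \<comment> \<open>Since \<open>2 * B(r, e) = B(r, r)\<close>, the reflection removes exactly one
    copy of \<open>r\<close> from \<open>e\<close>.\<close>
  have Re: "R e = - \<sigma> *\<^sub>R t"
  proof -
    have "2 * bform A r e / bform A r r = 1" using rr by (simp add: comm[of r e])
    then show ?thesis by (simp add: R_def r_def)
  qed
  define T where "T = matrix R ** P"
  have T: "T *v w = R (P *v w)" for w
    unfolding T_def matrix_vector_mul_assoc[symmetric] by (rule fun_cong[OF matrix_vector_mul(2)[OF lin]])
  have TT: "bform A (T *v w) (T *v w') = (\<Sum>i\<in>UNIV. lorentz_sign i0 i * (w $ i * w' $ i))" for w w'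
    unfolding T RR P ..
  have Tt: "bform A t (T *v w) = \<sigma> * w $ i0" for w
  proof -
    have "- \<sigma> * bform A t (T *v w) = bform A (T *v axis i0 1) (T *v w)"
      unfolding T e_def[symmetric] Re by (simp add: bform_simps)
    also have "\<dots> = - w $ i0" unfolding TT axis_sum_lorentz by (simp add: lorentz_sign_def)
    finally show ?thesis using \<sigma>(1) by auto
  qed
  \<comment> \<open>The Gram matrix of the new basis; its determinant \<open>- 1\<close> fixes
    \<open>det T\<close> up to sign.\<close>
  have J: "transpose T ** A ** T = (\<chi> i j. if i = j then lorentz_sign i0 i else 0)"
  proof -
    have "(transpose T ** A ** T) $ i $ j = bform A (T *v axis i 1) (T *v axis j 1)" for i j
    proof -
      have "bform A (T *v axis i 1) (T *v axis j 1) = axis i 1 \<bullet> ((transpose T ** A ** T) *v axis j 1)"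
        by (simp only: bform_def inner_matrix_vector matrix_vector_mul_assoc matrix_mul_assoc)
      also have "\<dots> = (transpose T ** A ** T) $ i $ j"
        by (simp add: inner_axis' matrix_vector_mult_basis column_def)
      finally show ?thesis by simp
    qed
    then show ?thesis unfolding TT axis_sum_lorentz by (auto simp: vec_eq_iff axis_def)
  qed
  have "det (transpose T ** A ** T) = (\<Prod>i\<in>UNIV. lorentz_sign i0 i)"
    unfolding J by (subst det_diagonal) auto
  also have "\<dots> = - 1"
    by (subst prod.remove[of _ i0]) (auto simp: lorentz_sign_def)
  finally have "(det T)\<^sup>2 * det A = - 1" by (simp add: det_mul det_transpose power2_eq_square mult_ac)
  then have d: "(det T)\<^sup>2 * \<bar>det A\<bar> = 1" by (metis abs_minus_cancel abs_mult abs_one abs_power2)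
  then have "\<bar>det T\<bar> * sqrt \<bar>det A\<bar> = 1"
    by (metis real_sqrt_abs real_sqrt_mult real_sqrt_one)
  then have "\<bar>det T\<bar> = 1 / sqrt \<bar>det A\<bar>"
    by (metis divide_self_if mult_zero_right nonzero_eq_divide_eq zero_neq_one)
  moreover have "det T \<noteq> 0" using d by auto
  moreover have "bform A t (T *v w) * bform A t (T *v w') = w $ i0 * w' $ i0" for w w'
    unfolding Tt using \<sigma>(1) by auto
  ultimately show ?thesis using that[OF TT] by (simp add: invertible_det_nz)
qed

text \<open>Read off from \<open>lorentz_basis\<close>: if \<open>det A\<close> were
  \<open>0\<close>, then \<open>\<bar>det T\<bar> = 1 / sqrt 0 = 0\<close> would contradict the
  invertibility of \<open>T\<close>.\<close>

lemma signature_invertible: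
  fixes A :: "real^'n^'n"
  assumes sig: "has_signature A (CARD('n) - 1) 1" and sym: "transpose A = A"
  shows "invertible A"
proof -
  obtain P :: "real^'n^'n" and i0 where
    P: "\<And>w w'. bform A (P *v w) (P *v w') = (\<Sum>i\<in>UNIV. lorentz_sign i0 i * (w $ i * w' $ i))"
    using signature_basis[OF sig] by blast
  have "bform A (P *v axis i0 1) (P *v axis i0 1) = - 1"
    by (simp add: P axis_sum_lorentz) (simp add: lorentz_sign_def)
  then obtain T :: "real^'n^'n" and i1 where
    T: "\<And>w w'. bform A (T *v w) (T *v w') = (\<Sum>i\<in>UNIV. lorentz_sign i1 i * (w $ i * w' $ i))"
    "\<And>w w'. bform A (P *v axis i0 1) (T *v w) * bform A (P *v axis i0 1) (T *v w') = w $ i1 * w' $ i1"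
    "\<bar>det T\<bar> = 1 / sqrt \<bar>det A\<bar>" "invertible T"
    by (rule lorentz_basis[OF sig sym]) (rule that)
  then have "det A \<noteq> 0" by (auto simp: invertible_det_nz)
  then show ?thesis by (simp add: invertible_det_nz)
qed

text \<open>In coordinates adapted to \<open>t\<close> the time coordinate enters \<open>Q\<close>
  with coefficient \<open>- 1 / 2\<close>, and \<open>B(t, v) ^ 2 / 2\<close> adds \<open>1\<close>
  to it, leaving \<open>norm w ^ 2 / 2\<close>. The rescaling by \<open>1 / sqrt 2\<close>
  reconciles \<open>Q(t) = - 1\<close> with the normalisation \<open>B(t, t) = - 1\<close> of
  \<open>lorentz_basis\<close>.\<close>

lemma majorant_pos:
  fixes A :: "real^'n^'n"
  assumes sig: "has_signature A (CARD('n) - 1) 1" and sym: "transpose A = A" and t: "qform A t = - 1"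
  obtains \<kappa> where "\<kappa> > 0" "\<And>v. \<kappa> * (norm v)\<^sup>2 \<le> qform A v + (bform A t v)\<^sup>2 / 2"
proof -
  define t' where "t' = (1 / sqrt 2) *\<^sub>R t"
  have "bform A t' t' = - 1" using t by (simp add: t'_def bform_simps qform_def)
  then obtain T :: "real^'n^'n" and i0 where
    T: "\<And>w w'. bform A (T *v w) (T *v w') = (\<Sum>i\<in>UNIV. lorentz_sign i0 i * (w $ i * w' $ i))"
    "\<And>w w'. bform A t' (T *v w) * bform A t' (T *v w') = w $ i0 * w' $ i0"
    "\<bar>det T\<bar> = 1 / sqrt \<bar>det A\<bar>" "invertible T"
    by (rule lorentz_basis[OF sig sym]) (rule that)
  obtain K where K: "K > 0" "\<And>w. norm (T *v w) \<le> K * norm w"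
    using linear_bounded_pos[OF matrix_vector_mul_linear] by metis
  have "1 / (2 * K\<^sup>2) * (norm v)\<^sup>2 \<le> qform A v + (bform A t v)\<^sup>2 / 2" for v
  proof -
    obtain w where w: "v = T *v w" using T(4) by (metis matrix_inv_mul_vec(2))
    have 1: "(bform A t v)\<^sup>2 / 2 = (w $ i0)\<^sup>2"
      using T(2)[of w w] by (simp add: t'_def bform_scaleR_left w power2_eq_square)
    have "qform A v = (\<Sum>i\<in>UNIV. lorentz_sign i0 i * (w $ i * w $ i)) / 2"
      by (simp add: qform_def w T)
    also have "(\<Sum>i\<in>UNIV. lorentz_sign i0 i * (w $ i * w $ i)) = (\<Sum>i\<in>UNIV. w $ i * w $ i) - 2 * (w $ i0)\<^sup>2"
      by (subst (1 2) sum.remove[of _ i0]) (auto simp: lorentz_sign_def power2_eq_square)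
    also have "(\<Sum>i\<in>UNIV. w $ i * w $ i) = (norm w)\<^sup>2"
      by (simp add: power2_norm_eq_inner inner_vec_def)
    finally have 2: "qform A v + (bform A t v)\<^sup>2 / 2 = (norm w)\<^sup>2 / 2" using 1 by simp
    have "(norm v)\<^sup>2 \<le> (K * norm w)\<^sup>2" unfolding w by (intro power_mono K) auto
    then show ?thesis unfolding 2 using K by (simp add: field_simps power_mult_distrib)
  qed
  then show ?thesis using K that[of "1 / (2 * K\<^sup>2)"] by simp
qed

section \<open>Hyperbolas \<open>Q = - 1\<close> in planes spanned by two null vectors\<close>

lemma qform_add: "transpose A = A \<Longrightarrow> qform A (u + v) = qform A u + bform A u v + qform A v"
  using bform_commute[of A v u] by (simp add: qform_def bform_simps field_simps)

lemma qform_diff: "transpose A = A \<Longrightarrow> qform A (u - v) = qform A u - bform A u v + qform A v"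
  using bform_commute[of A v u] by (simp add: qform_def bform_simps field_simps)

lemma qform_scaleR: "qform A (r *\<^sub>R v) = r\<^sup>2 * qform A v"
  by (simp add: qform_def bform_simps power2_eq_square)

text \<open>A branch of the hyperbola \<open>Q = - 1\<close> in the plane of a null pair: the
  coefficients have product \<open>1\<close> and \<open>B(n, n') = - 1\<close>. As \<open>s\<close>
  tends to \<open>0\<close> its direction tends to \<open>n\<close>. In
  \<open>B(null_path n n' s, v) ^ 2\<close> the mixed term \<open>2 * B(n, v) * B(n', v)\<close> is
  free of \<open>s\<close>, which separates the degenerating part of the majorant.\<close>

definition null_path :: "real^'n \<Rightarrow> real^'n \<Rightarrow> real \<Rightarrow> real^'n" where
  "null_path n n' s = (1 / sqrt s) *\<^sub>R n + sqrt s *\<^sub>R n'"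

definition null_pair :: "real^'n^'n \<Rightarrow> real^'n \<Rightarrow> real^'n \<Rightarrow> bool" where
  "null_pair A n n' \<longleftrightarrow> qform A n = 0 \<and> qform A n' = 0 \<and> bform A n n' = - 1"

lemma qform_null_path:
  assumes "transpose A = A" "null_pair A n n'" "s > 0"
  shows "qform A (null_path n n' s) = - 1"
  using assms unfolding null_path_def null_pair_def
  by (simp add: qform_add qform_scaleR bform_simps)

text \<open>The component \<open>w\<close> of \<open>c0\<close> orthogonal to \<open>t\<close> is
  zero or spacelike. If it is zero the two vectors are proportional; otherwise \<open>t\<close> and
  \<open>w\<close> span a Lorentzian plane, whose two null directions carry the hyperbola through
  both normalised vectors.\<close>

lemma timelike_null_pair:
  fixes A :: "real^'n^'n"
  assumes sig: "has_signature A (CARD('n) - 1) 1" and sym: "transpose A = A"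
    and c: "qform A c < 0" and c0: "qform A c0 < 0" and cc0: "bform A c c0 < 0"
  obtains (proportional) "c /\<^sub>R sqrt (- qform A c) = c0 /\<^sub>R sqrt (- qform A c0)"
  | (path) n n' s1 where "null_pair A n n'" "s1 > 1" "null_path n n' 1 = c /\<^sub>R sqrt (- qform A c)"
      "null_path n n' s1 = c0 /\<^sub>R sqrt (- qform A c0)"
proof -
  define t where "t = c /\<^sub>R sqrt (- qform A c)"
  have t: "qform A t = - 1" using c by (simp add: t_def qform_scaleR field_simps)
  have tt: "bform A t t = - 2" using t by (simp add: qform_def)
  define \<alpha> where "\<alpha> = - bform A t c0 / 2"
  have \<alpha>: "\<alpha> > 0" using c cc0 by (simp add: \<alpha>_def t_def bform_simps field_simps)
  define w where "w = c0 - \<alpha> *\<^sub>R t"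
  have tw: "bform A t w = 0" using tt by (simp add: w_def bform_simps \<alpha>_def)
  have c0w: "c0 = \<alpha> *\<^sub>R t + w" by (simp add: w_def)
  have Qc0: "qform A c0 = qform A w - \<alpha>\<^sup>2"
    unfolding c0w by (simp add: qform_add[OF sym] qform_scaleR bform_simps t tw)
  obtain \<kappa> where \<kappa>: "\<kappa> > 0" "\<And>v. \<kappa> * (norm v)\<^sup>2 \<le> qform A v + (bform A t v)\<^sup>2 / 2"
    using majorant_pos[OF sig sym t] by blast
  \<comment> \<open>On the orthogonal complement of \<open>t\<close> the majorant at
    \<open>t\<close> coincides with \<open>Q\<close>, which is therefore positive there.\<close>
  have Qw: "\<kappa> * (norm w)\<^sup>2 \<le> qform A w" using \<kappa>(2)[of w] tw by simp
  show ?thesis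
  proof (cases "w = 0")
    case True
    then have "c0 /\<^sub>R sqrt (- qform A c0) = t" using Qc0 \<alpha> c0w by (simp add: qform_def)
    then show ?thesis using proportional by (simp add: t_def)
  next
    case False
    then have Qpos: "qform A w > 0" using Qw \<kappa>(1) by (smt (verit) mult_pos_pos zero_less_norm_iff zero_less_power)
    define \<beta> where "\<beta> = sqrt (qform A w)"
    have \<beta>: "\<beta> > 0" "\<beta>\<^sup>2 = qform A w" using Qpos by (auto simp: \<beta>_def)
    define e where "e = (1 / \<beta>) *\<^sub>R w"
    have e: "qform A e = 1" "bform A t e = 0" "w = \<beta> *\<^sub>R e" using \<beta> tw
      by (auto simp: e_def qform_scaleR bform_simps field_simps)
    have lt: "\<beta> < \<alpha>"
    proof (rule power2_less_imp_less)
      show "\<beta>\<^sup>2 < \<alpha>\<^sup>2" using Qc0 c0 unfolding \<beta>(2) by linarith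
    qed (use \<alpha> in simp)
    \<comment> \<open>\<open>B(t, t) = - 2\<close> and \<open>B(e, e) = 2\<close> make both vectors
      null, and the factors \<open>1 / 2\<close> give \<open>B(n, n') = - 1\<close>.\<close>
    define n n' where "n = (1/2) *\<^sub>R (t + (- 1) *\<^sub>R e)" and "n' = (1/2) *\<^sub>R (t + e)"
    have et: "bform A e t = 0" using e(2) bform_commute[OF sym] by simp
    have ee: "bform A e e = 2" using e(1) by (simp add: qform_def)
    have np: "null_pair A n n'"
      unfolding null_pair_def n_def n'_def using t e et ee tt
      by (simp add: qform_add[OF sym] qform_diff[OF sym] qform_scaleR bform_simps)
    \<comment> \<open>In terms of \<open>n\<close> and \<open>n'\<close> the vector
      \<open>c0\<close> has coefficients \<open>\<alpha> - \<beta>\<close> and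
      \<open>\<alpha> + \<beta>\<close>, while on the path the ratio of the second coefficient to
      the first is the parameter.\<close>
    define s1 where "s1 = (\<alpha> + \<beta>) / (\<alpha> - \<beta>)"
    have s1: "s1 > 1" using lt \<beta> by (simp add: s1_def)
    have p1: "null_path n n' 1 = t" by (simp add: null_path_def n_def n'_def algebra_simps flip: scaleR_left_distrib)
    have c0n: "c0 = (\<alpha> - \<beta>) *\<^sub>R n + (\<alpha> + \<beta>) *\<^sub>R n'"
    proof -
      have "(\<alpha> - \<beta>) *\<^sub>R n + (\<alpha> + \<beta>) *\<^sub>R n' = ((\<alpha> - \<beta>)/2 + (\<alpha> + \<beta>)/2) *\<^sub>R t + ((\<alpha> + \<beta>)/2 - (\<alpha> - \<beta>)/2) *\<^sub>R e"
        by (simp add: n_def n'_def scaleR_left_distrib scaleR_left_diff_distrib scaleR_right_distrib scaleR_right_diff_distrib)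
      also have "\<dots> = \<alpha> *\<^sub>R t + \<beta> *\<^sub>R e" by (simp add: field_simps)
      finally show ?thesis by (simp add: c0w e(3))
    qed
    have sq: "sqrt (- qform A c0) = sqrt (\<alpha> - \<beta>) * sqrt (\<alpha> + \<beta>)"
      using \<beta> Qc0 by (simp add: real_sqrt_mult[symmetric] power2_eq_square algebra_simps)
    have p2: "null_path n n' s1 = c0 /\<^sub>R sqrt (- qform A c0)"
    proof -
      define x y where "x = sqrt (\<alpha> - \<beta>)" and "y = sqrt (\<alpha> + \<beta>)"
      have xy: "x > 0" "y > 0" "\<alpha> - \<beta> = x * x" "\<alpha> + \<beta> = y * y" "sqrt s1 = y / x"
        using lt \<beta> \<alpha> by (auto simp: x_def y_def s1_def real_sqrt_divide)
      then have "(\<alpha> - \<beta>) / (sqrt (\<alpha> - \<beta>) * sqrt (\<alpha> + \<beta>)) = 1 / sqrt s1"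
        "(\<alpha> + \<beta>) / (sqrt (\<alpha> - \<beta>) * sqrt (\<alpha> + \<beta>)) = sqrt s1"
        by (simp_all add: x_def[symmetric] y_def[symmetric])
      then show ?thesis
        unfolding sq by (subst c0n) (simp add: null_path_def scaleR_right_distrib divide_inverse_commute)
    qed
    show ?thesis by (rule path[OF np s1]) (use p1 p2 t_def in auto)
  qed
qed

text \<open>\<open>n'\<close> is the null combination of \<open>c0\<close> and \<open>c\<close>,
  scaled to \<open>B(c, n') = - 1\<close>; the condition \<open>Q(c0 + x c) = 0\<close> gives
  \<open>x = - \<gamma> / \<beta>\<close>. Keeping \<open>c\<close> itself as the first null vector
  makes \<open>sgn_kernel\<close> at \<open>c\<close> the limit along the path.\<close>

lemma isotropic_null_pair:
  fixes A :: "real^'n^'n"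
  assumes sym: "transpose A = A"
    and c: "qform A c = 0" and c0: "qform A c0 < 0" and cc0: "bform A c c0 < 0"
  obtains n' s1 where "null_pair A c n'" "s1 > 0" "null_path c n' s1 = c0 /\<^sub>R sqrt (- qform A c0)"
proof -
  define \<beta> \<gamma> where "\<beta> = - bform A c c0" and "\<gamma> = - qform A c0"
  have pos: "\<beta> > 0" "\<gamma> > 0" using c0 cc0 by (auto simp: \<beta>_def \<gamma>_def)
  define n' where "n' = (1 / \<beta>) *\<^sub>R (c0 + (- \<gamma> / \<beta>) *\<^sub>R c)"
  have cc: "bform A c c = 0" using c by (simp add: qform_def)
  have "bform A c0 c = - \<beta>" using bform_commute[OF sym] by (simp add: \<beta>_def)
  then have np: "null_pair A c n'"
    unfolding null_pair_def n'_def using pos c cc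
    by (simp add: qform_add[OF sym] qform_diff[OF sym] qform_scaleR bform_simps)
       (simp add: \<beta>_def \<gamma>_def field_simps)
  define s1 where "s1 = \<beta>\<^sup>2 / \<gamma>"
  have s1: "s1 > 0" using pos by (simp add: s1_def)
  have "null_path c n' s1 = c0 /\<^sub>R sqrt \<gamma>"
  proof -
    have sq: "sqrt s1 = \<beta> / sqrt \<gamma>" using pos by (simp add: s1_def real_sqrt_divide)
    have "null_path c n' s1 = (1 / sqrt s1 - sqrt s1 / \<beta> * (\<gamma> / \<beta>)) *\<^sub>R c + (sqrt s1 / \<beta>) *\<^sub>R c0"
      by (simp add: null_path_def n'_def scaleR_right_distrib scaleR_left_diff_distrib scaleR_right_diff_distrib)
    also have "1 / sqrt s1 - sqrt s1 / \<beta> * (\<gamma> / \<beta>) = 0"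
      unfolding sq using pos by (simp add: field_simps real_sqrt_mult_self)
    also have "sqrt s1 / \<beta> = inverse (sqrt \<gamma>)" unfolding sq using pos by (simp add: field_simps)
    finally show ?thesis by simp
  qed
  then show ?thesis using that np s1 by (simp add: \<gamma>_def)
qed

section \<open>Coefficient extraction and exponential decay\<close>

lemma abs_summable_on_times_UNIV:
  fixes f :: "'a \<Rightarrow> nat \<Rightarrow> complex"
  assumes M: "M summable_on S"
    and le: "\<And>v n. v \<in> S \<Longrightarrow> (\<Sum>k<n. norm (f v k)) \<le> M v"
  shows "(\<lambda>(v, k). f v k) abs_summable_on S \<times> UNIV"
proof -
  have sm: "(\<lambda>k. norm (f v k)) summable_on UNIV \<and> (\<Sum>\<^sub>\<infinity>k. norm (f v k)) \<le> M v" if v: "v \<in> S" for v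
  proof -
    have "summable (\<lambda>k. norm (f v k))"
      by (rule bounded_imp_summable[of _ "M v"]) (use le[OF v, of "Suc _"] in \<open>simp_all add: lessThan_Suc_atMost\<close>)
    moreover from this have "(\<Sum>k. norm (f v k)) \<le> M v"
      using le[OF v] by (intro suminf_le_const) auto
    moreover have "((\<lambda>k. norm (f v k)) has_sum (\<Sum>k. norm (f v k))) UNIV"
      using calculation(1) by (intro norm_summable_imp_has_sum) (auto simp: summable_sums)
    ultimately show ?thesis by (auto simp: has_sum_iff)
  qed
  have "(\<lambda>v. \<Sum>\<^sub>\<infinity>k. norm (f v k)) summable_on S"
    by (rule summable_on_comparison_test[OF M]) (use sm in \<open>auto intro: infsum_nonneg\<close>)
  then have "(\<lambda>v. norm (\<Sum>\<^sub>\<infinity>k. norm (f v k))) summable_on S"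
    by (simp add: infsum_nonneg)
  then show ?thesis
    using sm Infinite_Sum.abs_summable_on_Sigma_iff[where f="\<lambda>(v, k). f v k" and A=S and B="\<lambda>_. UNIV"] by simp
qed

text \<open>Majorants for every radius permit the exchange of the lattice sum with the power series,
  so both sides are everywhere convergent power series in \<open>x\<close> that agree pointwise, and
  their coefficients coincide. The bound on partial sums is phrased so that the generating function
  of \<open>hermite\<close> supplies it directly.\<close>

lemma coefficient_extraction:
  fixes f :: "'a \<Rightarrow> nat \<Rightarrow> complex" and g :: "'b \<Rightarrow> nat \<Rightarrow> complex"
  assumes f: "\<And>r. r \<ge> 0 \<Longrightarrow> \<exists>M. M summable_on S \<and> (\<forall>v\<in>S. \<forall>n. (\<Sum>k<n. norm (f v k) * r ^ k) \<le> M v)"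
    and g: "\<And>r. r \<ge> 0 \<Longrightarrow> \<exists>M. M summable_on S' \<and> (\<forall>v\<in>S'. \<forall>n. (\<Sum>k<n. norm (g v k) * r ^ k) \<le> M v)"
    and F: "\<And>v x. v \<in> S \<Longrightarrow> (\<lambda>k. f v k * x ^ k) sums F v x"
    and G: "\<And>v x. v \<in> S' \<Longrightarrow> (\<lambda>k. g v k * x ^ k) sums G v x"
    and eq: "\<And>x. (\<Sum>\<^sub>\<infinity>v\<in>S. F v x) = (\<Sum>\<^sub>\<infinity>v\<in>S'. G v x)"
  shows "(\<Sum>\<^sub>\<infinity>v\<in>S. f v k) = (\<Sum>\<^sub>\<infinity>v\<in>S'. g v k)"
proof -
  \<comment> \<open>The exchange of summations for one side, stated for an arbitrary family because
    both sides use it.\<close>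
  have main: "(\<lambda>k. (\<Sum>\<^sub>\<infinity>v\<in>S. f v k) * x ^ k) sums (\<Sum>\<^sub>\<infinity>v\<in>S. F v x)"
    if f: "\<And>r. r \<ge> 0 \<Longrightarrow> \<exists>M. M summable_on S \<and> (\<forall>v\<in>S. \<forall>n. (\<Sum>k<n. norm (f v k) * r ^ k) \<le> M v)"
      and F: "\<And>v x. v \<in> S \<Longrightarrow> (\<lambda>k. f v k * x ^ k) sums F v x"
    for f :: "'c \<Rightarrow> nat \<Rightarrow> complex" and F S x
  proof -
    obtain M where M: "M summable_on S" "\<forall>v\<in>S. \<forall>n. (\<Sum>k<n. norm (f v k) * norm x ^ k) \<le> M v"
      using f[of "norm x"] by auto
    have "(\<lambda>(v, k). f v k * x ^ k) abs_summable_on S \<times> UNIV"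
      by (rule abs_summable_on_times_UNIV[OF M(1)]) (use M(2) in \<open>auto simp: norm_mult norm_power\<close>)
    then have sm: "(\<lambda>(v, k). f v k * x ^ k) summable_on S \<times> UNIV" by (rule abs_summable_summable)
    have inner: "(\<Sum>\<^sub>\<infinity>k. f v k * x ^ k) = F v x" if "v \<in> S" for v
    proof -
      have "(\<lambda>k. f v k * x ^ k) summable_on UNIV"
        using summable_on_SigmaD1[OF sm that] by simp
      then have "(\<lambda>k. f v k * x ^ k) sums (\<Sum>\<^sub>\<infinity>k. f v k * x ^ k)"
        by (intro has_sum_imp_sums has_sum_infsum)
      then show ?thesis using F[OF that] sums_unique2 by blast
    qed
    have sw: "(\<lambda>(k, v). f v k * x ^ k) summable_on UNIV \<times> S"
      using summable_on_swap[THEN iffD1, OF sm] by (simp add: case_prod_unfold)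
    have "(\<Sum>\<^sub>\<infinity>v\<in>S. F v x) = (\<Sum>\<^sub>\<infinity>v\<in>S. \<Sum>\<^sub>\<infinity>k. f v k * x ^ k)"
      by (rule infsum_cong) (simp add: inner)
    also have "\<dots> = (\<Sum>\<^sub>\<infinity>k. \<Sum>\<^sub>\<infinity>v\<in>S. f v k * x ^ k)"
      by (rule infsum_swap_banach[OF sm])
    finally have "(\<Sum>\<^sub>\<infinity>k. \<Sum>\<^sub>\<infinity>v\<in>S. f v k * x ^ k) = (\<Sum>\<^sub>\<infinity>v\<in>S. F v x)" by simp
    moreover have "(\<lambda>k. \<Sum>\<^sub>\<infinity>v\<in>S. f v k * x ^ k) summable_on UNIV"
      using summable_on_Sigma_banach[OF sw] by simp
    from has_sum_imp_sums[OF has_sum_infsum[OF this]]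
    have "(\<lambda>k. \<Sum>\<^sub>\<infinity>v\<in>S. f v k * x ^ k) sums (\<Sum>\<^sub>\<infinity>k. \<Sum>\<^sub>\<infinity>v\<in>S. f v k * x ^ k)" .
    ultimately have "(\<lambda>k. \<Sum>\<^sub>\<infinity>v\<in>S. f v k * x ^ k) sums (\<Sum>\<^sub>\<infinity>v\<in>S. F v x)"
      by (simp only:)
    then show ?thesis by (simp add: infsum_cmult_left')
  qed
  define P Q where "P = Abs_fps (\<lambda>k. \<Sum>\<^sub>\<infinity>v\<in>S. f v k)" and "Q = Abs_fps (\<lambda>k. \<Sum>\<^sub>\<infinity>v\<in>S'. g v k)"
  have P: "(\<lambda>k. fps_nth P k * x ^ k) sums (\<Sum>\<^sub>\<infinity>v\<in>S. F v x)" for x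
    using main[OF f F] by (simp add: P_def)
  have Q: "(\<lambda>k. fps_nth Q k * x ^ k) sums (\<Sum>\<^sub>\<infinity>v\<in>S. F v x)" for x
    unfolding eq using main[OF g G] by (simp add: Q_def)
  have "fps_conv_radius P = \<infinity>" "fps_conv_radius Q = \<infinity>"
    unfolding fps_conv_radius_def using P Q by (auto intro!: conv_radius_inftyI'' simp: sums_iff)
  moreover have "eval_fps P x = eval_fps Q x" for x
    using P[of x] Q[of x] by (simp add: eval_fps_def sums_iff)
  ultimately have "P = Q" by (intro eval_fps_eqD) auto
  then have "fps_nth P k = fps_nth Q k" by simp
  then show ?thesis by (simp add: P_def Q_def)
qed

section \<open>Exponential decay as a summability criterion for lattice series\<close>

definition exp_decay :: "('a::real_normed_vector \<Rightarrow> real) \<Rightarrow> bool" where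
  "exp_decay F \<longleftrightarrow> (\<exists>C \<kappa>. \<kappa> > 0 \<and> (\<forall>v. F v \<le> C * exp (- \<kappa> * norm v)))"

lemma gaussian_exp_decay:
  fixes \<kappa> \<alpha> \<beta> :: real
  assumes "\<kappa> > 0"
  shows "exp_decay (\<lambda>v. exp (\<alpha> * norm v + \<beta> - \<kappa> * (norm v)\<^sup>2))"
  unfolding exp_decay_def
proof (intro exI conjI allI)
  fix v :: 'a
  \<comment> \<open>Completing the square with \<open>\<alpha> + 1\<close> in place of
    \<open>\<alpha>\<close> leaves one spare \<open>- norm v\<close> in the exponent.\<close>
  have "0 \<le> \<kappa> * (norm v - (\<alpha> + 1) / (2 * \<kappa>))\<^sup>2" using assms by simp
  also have "\<dots> = \<kappa> * (norm v)\<^sup>2 - (\<alpha> + 1) * norm v + (\<alpha> + 1)\<^sup>2 / (4 * \<kappa>)"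
    using assms by (simp add: power2_eq_square field_simps)
  finally have "\<alpha> * norm v + \<beta> - \<kappa> * (norm v)\<^sup>2 \<le> (\<beta> + (\<alpha> + 1)\<^sup>2 / (4 * \<kappa>)) + - 1 * norm v"
    by (simp add: algebra_simps)
  then show "exp (\<alpha> * norm v + \<beta> - \<kappa> * (norm v)\<^sup>2) \<le> exp (\<beta> + (\<alpha> + 1)\<^sup>2 / (4 * \<kappa>)) * exp (- 1 * norm v)"
    by (simp flip: exp_add)
qed simp

lemma exp_decay_mono: "exp_decay G \<Longrightarrow> (\<And>v. F v \<le> G v) \<Longrightarrow> exp_decay F"
  unfolding exp_decay_def by (meson order_trans)

lemma exp_decay_cmult:
  assumes "exp_decay F" "c \<ge> 0"
  shows "exp_decay (\<lambda>v. c * F v)"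
proof -
  obtain C \<kappa> where C: "\<kappa> > 0" "\<And>v. F v \<le> C * exp (- \<kappa> * norm v)"
    using assms unfolding exp_decay_def by blast
  have "c * F v \<le> (c * C) * exp (- \<kappa> * norm v)" for v
    using mult_left_mono[OF C(2) assms(2)] by (simp add: mult.assoc)
  then show ?thesis unfolding exp_decay_def using C(1) by blast
qed

lemma exp_decay_linear:
  fixes L :: "'a::real_normed_vector \<Rightarrow> 'b::real_normed_vector"
  assumes F: "exp_decay F" "\<And>v. F v \<ge> 0" and K: "K > 0" "\<And>v. norm v \<le> K * norm (L v)"
  shows "exp_decay (\<lambda>v. F (L v))"
proof -
  obtain C \<kappa> where C: "\<kappa> > 0" "\<And>v. F v \<le> C * exp (- \<kappa> * norm v)"
    using F unfolding exp_decay_def by blast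
  have "F (L v) \<le> C * exp (- (\<kappa> / K) * norm v)" for v
  proof -
    have "C * exp (- \<kappa> * norm (L v)) \<ge> 0" using C(2) F(2) order_trans by blast
    then have "C \<ge> 0" by (simp add: zero_le_mult_iff)
    moreover have "(\<kappa> / K) * norm v \<le> \<kappa> * norm (L v)"
      using mult_left_mono[OF K(2)[of v], of "\<kappa> / K"] K(1) C(1) by simp
    ultimately have "C * exp (- \<kappa> * norm (L v)) \<le> C * exp (- (\<kappa> / K) * norm v)"
      by (intro mult_left_mono) auto
    then show ?thesis using C(2)[of "L v"] by linarith
  qed
  then show ?thesis unfolding exp_decay_def using C(1) K(1) by (intro exI[of _ C] exI[of _ "\<kappa> / K"]) auto
qed

lemma exp_decay_summable:
  fixes F :: "real^'n \<Rightarrow> real"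
  assumes "exp_decay F" "\<And>v. F v \<ge> 0"
  shows "(\<lambda>m. F (a + m)) summable_on int_lattice"
proof -
  obtain C \<kappa> where C: "\<kappa> > 0" "\<And>v. F v \<le> C * exp (- \<kappa> * norm v)"
    using assms unfolding exp_decay_def by blast
  have "(\<lambda>m. C * exp (- \<kappa> * norm (a + m))) summable_on int_lattice"
    by (intro summable_on_cmult_right summable_on_exp_norm_lattice C)
  then show ?thesis
    by (rule summable_on_comparison_test) (use C assms in auto)
qed

section \<open>Inversion of Gaussian theta series\<close>

text \<open>In coordinates \<open>w\<close> adapted to \<open>t\<close>, the exponent of
  \<open>theta_weight\<close> is \<open>- pi\<close> times the sum of
  \<open>wick \<tau> i0 i * w $ i ^ 2\<close>. In the negative direction the sign of
  \<open>Q\<close> and the added majorant term turn \<open>- \<i> * \<tau>\<close> into its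
  conjugate, so all real parts equal \<open>Im \<tau>\<close>.\<close>

definition wick :: "complex \<Rightarrow> 'n \<Rightarrow> 'n \<Rightarrow> complex" where
  "wick \<tau> i0 i = (if i = i0 then cnj (- \<i> * \<tau>) else - \<i> * \<tau>)"

lemma Re_wick [simp]: "Re (wick \<tau> i0 i) = Im \<tau>"
  by (simp add: wick_def)

text \<open>This is why the Fourier transform of a Gaussian at \<open>- 1 / \<tau>\<close> is one at
  \<open>\<tau>\<close>, in the negative direction as well.\<close>

lemma wick_inversion: "wick (- 1 / \<tau>) i0 i = 1 / wick \<tau> i0 i"
  by (cases "\<tau> = 0") (auto simp: wick_def field_simps)

lemma Im_inversion: "Im (- 1 / \<tau>) = Im \<tau> / (norm \<tau>)\<^sup>2"
  by (simp add: Im_divide cmod_power2)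

lemma Im_inversion_pos: "Im \<tau> > 0 \<Longrightarrow> Im (- 1 / \<tau>) > 0"
  unfolding Im_inversion by (intro divide_pos_pos) auto

definition gauss_kernel :: "complex \<Rightarrow> 'n::finite \<Rightarrow> ('n \<Rightarrow> complex) \<Rightarrow> real^'n \<Rightarrow> complex" where
  "gauss_kernel \<tau> i0 \<mu> w = (\<Prod>i\<in>UNIV. exp (- of_real pi * wick \<tau> i0 i * of_real (w $ i) ^ 2 + \<mu> i * of_real (w $ i)))"

lemma gauss_kernel_cis:
  "gauss_kernel \<tau> i0 \<mu> w * cis (2 * pi * (\<Sum>i\<in>UNIV. r i * w $ i)) = gauss_kernel \<tau> i0 (\<lambda>i. \<mu> i + 2 * pi * \<i> * r i) w"
proof -
  have "cis (2 * pi * (\<Sum>i\<in>UNIV. r i * w $ i)) = (\<Prod>i\<in>UNIV. exp (2 * pi * \<i> * r i * w $ i))"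
    by (simp add: cis_conv_exp sum_distrib_left mult_ac flip: exp_sum)
  then show ?thesis
    by (simp add: gauss_kernel_def prod.distrib[symmetric] algebra_simps flip: exp_add)
qed

lemma gauss_kernel_exp_decay:
  assumes "Im \<tau> > 0"
  shows "exp_decay (\<lambda>w. norm (gauss_kernel \<tau> i0 \<mu> w))"
proof (rule exp_decay_mono[OF gaussian_exp_decay[where \<kappa>="pi * Im \<tau>" and \<alpha>="\<Sum>i\<in>UNIV. norm (\<mu> i)" and \<beta>=0]])
  fix w :: "real^'a"
  have "norm (gauss_kernel \<tau> i0 \<mu> w) = exp (\<Sum>i\<in>UNIV. Re (\<mu> i) * w $ i - pi * Im \<tau> * (w $ i)\<^sup>2)"
    unfolding gauss_kernel_def prod_norm[symmetric] exp_sum[OF finite]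
    by (intro prod.cong refl) (simp flip: of_real_power)
  also have "(\<Sum>i\<in>UNIV. Re (\<mu> i) * w $ i - pi * Im \<tau> * (w $ i)\<^sup>2) = (\<Sum>i\<in>UNIV. Re (\<mu> i) * w $ i) - pi * Im \<tau> * (norm w)\<^sup>2"
  proof -
    have "(norm w)\<^sup>2 = (\<Sum>i\<in>UNIV. (w $ i)\<^sup>2)"
      unfolding power2_norm_eq_inner inner_vec_def by (simp add: power2_eq_square)
    then show ?thesis by (simp add: sum_subtractf sum_distrib_left)
  qed
  also have "(\<Sum>i\<in>UNIV. Re (\<mu> i) * w $ i) \<le> (\<Sum>i\<in>UNIV. norm (\<mu> i)) * norm w"
    unfolding sum_distrib_right
  proof (rule sum_mono)
    fix i
    have "Re (\<mu> i) * w $ i \<le> \<bar>Re (\<mu> i)\<bar> * \<bar>w $ i\<bar>" by (metis abs_ge_self abs_mult)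
    also have "\<dots> \<le> norm (\<mu> i) * norm w"
      by (intro mult_mono abs_Re_le_cmod component_le_norm_cart) auto
    finally show "Re (\<mu> i) * w $ i \<le> norm (\<mu> i) * norm w" .
  qed
  finally show "norm (gauss_kernel \<tau> i0 \<mu> w) \<le> exp ((\<Sum>i\<in>UNIV. norm (\<mu> i)) * norm w + 0 - pi * Im \<tau> * (norm w)\<^sup>2)"
    by simp
qed (use assms in simp)

lemma matrix_inv_bounded_below:
  fixes T :: "real^'n^'n"
  assumes "invertible T"
  obtains K where "K > 0" "\<And>v. norm v \<le> K * norm (matrix_inv T *v v)"
proof -
  obtain K where K: "K > 0" "\<And>w. norm (T *v w) \<le> K * norm w"
    using linear_bounded_pos[OF matrix_vector_mul_linear] by metis
  have "norm v \<le> K * norm (matrix_inv T *v v)" for v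
    using K(2)[of "matrix_inv T *v v"] by (simp add: matrix_inv_mul_vec[OF assms])
  then show ?thesis using that K(1) by blast
qed

lemma continuous_gauss_kernel: "continuous_on S (gauss_kernel \<tau> i0 \<mu>)"
  unfolding gauss_kernel_def by (intro continuous_intros)

lemma
  fixes T :: "real^'n^'n"
  assumes \<tau>: "Im \<tau> > 0" and T: "invertible T"
  shows integrable_gauss_kernel: "integrable lborel (\<lambda>v. gauss_kernel \<tau> i0 \<mu> (matrix_inv T *v v))"
    and integral_gauss_kernel: "(\<integral>v. gauss_kernel \<tau> i0 \<mu> (matrix_inv T *v v) \<partial>lborel) =
      of_real \<bar>det T\<bar> * (\<Prod>i\<in>UNIV. exp ((\<mu> i)\<^sup>2 / (4 * of_real pi * wick \<tau> i0 i)) / csqrt (wick \<tau> i0 i))"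
proof -
  have m: "(\<lambda>v. gauss_kernel \<tau> i0 \<mu> (matrix_inv T *v v)) \<in> borel_measurable borel"
    by (intro borel_measurable_continuous_onI continuous_on_compose2[OF continuous_gauss_kernel]
        matrix_vector_mult_linear_continuous_on) auto
  have G1: "integrable lborel (\<lambda>x::real. exp (- of_real pi * wick \<tau> i0 i * of_real x ^ 2 + \<mu> i * of_real x))"
   and G2: "(\<integral>x. exp (- of_real pi * wick \<tau> i0 i * of_real (x::real) ^ 2 + \<mu> i * of_real x) \<partial>lborel)
      = exp ((\<mu> i)\<^sup>2 / (4 * of_real pi * wick \<tau> i0 i)) / csqrt (wick \<tau> i0 i)" for i
    using gaussian_integral_complex[of "wick \<tau> i0 i" "\<mu> i"] \<tau> by auto
  show "integrable lborel (\<lambda>v. gauss_kernel \<tau> i0 \<mu> (matrix_inv T *v v))"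
    unfolding integrable_linear_cart[OF T m] unfolding matrix_inv_mul_vec[OF T] gauss_kernel_def
    by (rule integrable_prod_cart[of "\<lambda>i x. exp (- of_real pi * wick \<tau> i0 i * of_real x ^ 2 + \<mu> i * of_real x)"]) (rule G1)
  show "(\<integral>v. gauss_kernel \<tau> i0 \<mu> (matrix_inv T *v v) \<partial>lborel) =
      of_real \<bar>det T\<bar> * (\<Prod>i\<in>UNIV. exp ((\<mu> i)\<^sup>2 / (4 * of_real pi * wick \<tau> i0 i)) / csqrt (wick \<tau> i0 i))"
    unfolding integral_linear_cart[OF T m] unfolding matrix_inv_mul_vec[OF T] gauss_kernel_def
    using integral_prod_cart[of "\<lambda>i x. exp (- of_real pi * wick \<tau> i0 i * of_real x ^ 2 + \<mu> i * of_real x)", OF G1]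
    unfolding G2 by simp
qed

locale lorentzian =
  fixes A :: "real^'n^'n"
  assumes A_int: "\<forall>i j. A $ i $ j \<in> \<int>" and A_sym: "transpose A = A"
    and A_sig: "has_signature A (CARD('n) - 1) 1"
begin

lemma A_inv: "invertible A"
  by (rule signature_invertible[OF A_sig A_sym])

lemma bij_betw_dual_lattice: "bij_betw (\<lambda>m. matrix_inv A *v m) int_lattice (dual_lattice A)"
  unfolding dual_lattice_def
  by (rule inj_on_imp_bij_betw) (metis inj_onI matrix_inv_mul_vec(2)[OF A_inv])

lemma countable_dual_lattice: "countable (dual_lattice A)"
  unfolding dual_lattice_def using countable_int_lattice by (rule countable_image)

lemma exp_decay_summable_dual:
  assumes "exp_decay F" "\<And>v. F v \<ge> 0"
  shows "(\<lambda>p. F (b + p)) summable_on dual_lattice A"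
proof -
  obtain K where "K > 0" "\<And>v. norm v \<le> K * norm (matrix_inv A *v v)"
    using matrix_inv_bounded_below[OF A_inv] by blast
  from exp_decay_linear[OF assms this] have "exp_decay (\<lambda>v. F (matrix_inv A *v v))" .
  \<comment> \<open>The shift is absorbed before the substitution:
    \<open>b + A^-1 m = A^-1 (A b + m)\<close>.\<close>
  then have "(\<lambda>m. F (matrix_inv A *v (A *v b + m))) summable_on int_lattice"
    by (rule exp_decay_summable) (rule assms)
  then have "(\<lambda>m. F (b + matrix_inv A *v m)) summable_on int_lattice"
    by (simp add: matrix_vector_right_distrib matrix_inv_mul_vec[OF A_inv])
  then show ?thesis
    using summable_on_reindex_bij_betw[OF bij_betw_dual_lattice, of "\<lambda>p. F (b + p)"] by simp
qed

text \<open>The character \<open>B(v, b)\<close> is absorbed into the linear coefficient, and the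
  Fourier transform at \<open>k\<close> then depends on \<open>b - A^-1 k\<close> only; Poisson
  summation therefore lands on the dual lattice. The coefficient \<open>\<mu>\<close> is kept
  general because it carries the formal variables of the later generating functions.\<close>

lemma gauss_kernel_inversion:
  assumes \<tau>: "Im \<tau> > 0" and T: "invertible T"
    and basis: "\<And>w w'. bform A (T *v w) (T *v w') = (\<Sum>i\<in>UNIV. lorentz_sign i0 i * (w $ i * w' $ i))"
  shows "(\<Sum>\<^sub>\<infinity>m\<in>int_lattice. gauss_kernel (- 1 / \<tau>) i0 \<mu> (matrix_inv T *v (a + m)) * cis (2 * pi * bform A (a + m) b)) =
    of_real \<bar>det T\<bar> * (\<Prod>i\<in>UNIV. csqrt (wick \<tau> i0 i) * exp (wick \<tau> i0 i * (\<mu> i)\<^sup>2 / (4 * of_real pi))) * cis (2 * pi * bform A a b) *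
    (\<Sum>\<^sub>\<infinity>p\<in>dual_lattice A. gauss_kernel \<tau> i0 (\<lambda>i. \<i> * lorentz_sign i0 i * wick \<tau> i0 i * \<mu> i) (matrix_inv T *v (b + p)) *
        cis (- (2 * pi * bform A (b + p) a)))"
proof -
  define \<tau>' where "\<tau>' = - 1 / \<tau>"
  have \<tau>0: "\<tau> \<noteq> 0" using \<tau> by auto
  have \<tau>': "Im \<tau>' > 0" using \<tau> \<tau>0 unfolding \<tau>'_def Im_inversion by simp
  define W where "W = (\<lambda>v. matrix_inv T *v v)"
  have W_simps: "W (u + v) = W u + W v" "W (u - v) = W u - W v" for u v
    by (simp_all add: W_def matrix_vector_right_distrib matrix_vector_mult_diff_distrib)
  have bW: "bform A u v = (\<Sum>i\<in>UNIV. lorentz_sign i0 i * (W u $ i * W v $ i))" for u v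
    using basis[of "W u" "W v"] by (simp add: W_def matrix_inv_mul_vec[OF T])
  have eps2: "lorentz_sign i0 i * lorentz_sign i0 i = 1" for i by (simp add: lorentz_sign_def)
  define C where "C = of_real \<bar>det T\<bar> * (\<Prod>i\<in>UNIV. csqrt (wick \<tau> i0 i) * exp (wick \<tau> i0 i * (\<mu> i)\<^sup>2 / (4 * of_real pi)))"
  define \<nu> where "\<nu> = (\<lambda>i. \<i> * lorentz_sign i0 i * wick \<tau> i0 i * \<mu> i)"
  have shift: "gauss_kernel \<tau>' i0 \<mu> (W v) * cis (2 * pi * bform A u v) =
      gauss_kernel \<tau>' i0 (\<lambda>i. \<mu> i + 2 * pi * \<i> * (lorentz_sign i0 i * W u $ i)) (W v)" for u v
    unfolding bW using gauss_kernel_cis[of \<tau>' i0 \<mu> "W v" "\<lambda>i. lorentz_sign i0 i * W u $ i"] by (simp add: mult.assoc)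
  define g where "g = (\<lambda>v. gauss_kernel \<tau>' i0 (\<lambda>i. \<mu> i + 2 * pi * \<i> * (lorentz_sign i0 i * W b $ i)) (W v))"
  have fourier: "(\<integral>v. g v * cis (- (2 * pi * (k \<bullet> v))) \<partial>lborel) = C * gauss_kernel \<tau> i0 \<nu> (W (b - matrix_inv A *v k))" for k
  proof -
    define u where "u = b - matrix_inv A *v k"
    have "g v * cis (- (2 * pi * (k \<bullet> v))) = gauss_kernel \<tau>' i0 (\<lambda>i. \<mu> i + 2 * pi * \<i> * (lorentz_sign i0 i * W u $ i)) (W v)" for v
    proof -
      have "k \<bullet> v = bform A (matrix_inv A *v k) v"
        by (rule bform_matrix_inv[OF A_inv A_sym, symmetric])
      then have "g v * cis (- (2 * pi * (k \<bullet> v))) = gauss_kernel \<tau>' i0 \<mu> (W v) * (cis (2 * pi * bform A b v) * cis (- (2 * pi * bform A (matrix_inv A *v k) v)))"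
        unfolding g_def shift[symmetric] by simp
      also have "cis (2 * pi * bform A b v) * cis (- (2 * pi * bform A (matrix_inv A *v k) v)) = cis (2 * pi * bform A u v)"
        by (simp add: u_def bform_simps cis_mult right_diff_distrib)
      finally show ?thesis unfolding shift .
    qed
    then have "(\<integral>v. g v * cis (- (2 * pi * (k \<bullet> v))) \<partial>lborel) =
       of_real \<bar>det T\<bar> * (\<Prod>i\<in>UNIV. exp ((\<mu> i + 2 * pi * \<i> * (lorentz_sign i0 i * W u $ i))\<^sup>2 / (4 * of_real pi * wick \<tau>' i0 i)) / csqrt (wick \<tau>' i0 i))"
      unfolding W_def by (simp add: integral_gauss_kernel[OF \<tau>' T])
    also have "(\<Prod>i\<in>UNIV. exp ((\<mu> i + 2 * pi * \<i> * (lorentz_sign i0 i * W u $ i))\<^sup>2 / (4 * of_real pi * wick \<tau>' i0 i)) / csqrt (wick \<tau>' i0 i))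
       = (\<Prod>i\<in>UNIV. csqrt (wick \<tau> i0 i) * exp (wick \<tau> i0 i * (\<mu> i)\<^sup>2 / (4 * of_real pi)) *
           exp (- of_real pi * wick \<tau> i0 i * of_real (W u $ i) ^ 2 + \<nu> i * of_real (W u $ i)))"
    proof (rule prod.cong[OF refl])
      fix i
      define s e x where "s = wick \<tau> i0 i" and "e = complex_of_real (lorentz_sign i0 i)" and "x = complex_of_real (W u $ i)"
      have s: "Re s > 0" "s \<noteq> 0" using \<tau> by (auto simp: s_def dest: arg_cong[of _ _ Re])
      have wt: "wick \<tau>' i0 i = 1 / wick \<tau> i0 i" by (simp only: \<tau>'_def wick_inversion)
      have ee: "e * e = 1" unfolding e_def of_real_mult[symmetric] eps2 by simp
      have cs: "csqrt (1 / s) = 1 / csqrt s"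
        using csqrt_inverse[of s] s by (simp add: inverse_eq_divide complex_nonpos_Reals_iff)
      \<comment> \<open>The square separates into a constant, the new Gaussian and a cross term. The
        cross term is the new linear coefficient \<open>\<nu>\<close>, and \<open>e * e = 1\<close>
        removes the signature from the Gaussian.\<close>
      have "(\<mu> i + 2 * pi * \<i> * (e * x))\<^sup>2 / (4 * of_real pi * (1 / s)) =
          s * (\<mu> i)\<^sup>2 / (4 * pi) + (- of_real pi * s * x\<^sup>2 * (e * e) + \<i> * e * s * \<mu> i * x)"
        by (simp add: power2_eq_square field_simps)
      then have "exp ((\<mu> i + 2 * pi * \<i> * (e * x))\<^sup>2 / (4 * of_real pi * (1 / s))) / csqrt (1 / s) =
          csqrt s * (exp (s * (\<mu> i)\<^sup>2 / (4 * pi)) * exp (- of_real pi * s * x\<^sup>2 + \<i> * e * s * \<mu> i * x))"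
        unfolding cs ee by (simp add: exp_add)
      then show "exp ((\<mu> i + 2 * pi * \<i> * (lorentz_sign i0 i * W u $ i))\<^sup>2 / (4 * of_real pi * wick \<tau>' i0 i)) / csqrt (wick \<tau>' i0 i) =
         csqrt (wick \<tau> i0 i) * exp (wick \<tau> i0 i * (\<mu> i)\<^sup>2 / (4 * of_real pi)) *
           exp (- of_real pi * wick \<tau> i0 i * of_real (W u $ i) ^ 2 + \<nu> i * of_real (W u $ i))"
        by (simp add: wt \<nu>_def s_def e_def x_def mult.assoc)
    qed
    also have "of_real \<bar>det T\<bar> * \<dots> = C * gauss_kernel \<tau> i0 \<nu> (W u)"
      by (simp only: C_def gauss_kernel_def prod.distrib mult.assoc)
    finally show ?thesis unfolding u_def .
  qed
  obtain K where K: "K > 0" "\<And>v. norm v \<le> K * norm (W v)"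
    using matrix_inv_bounded_below[OF T] unfolding W_def by blast
  have decay: "exp_decay (\<lambda>v. norm (gauss_kernel \<tau> i0 \<nu> (W v)))"
    by (rule exp_decay_linear[OF gauss_kernel_exp_decay[OF \<tau>] _ K]) auto
  \<comment> \<open>The transform sits at \<open>b - A^-1 k\<close>, so the dual lattice is
    parametrised with a minus sign.\<close>
  have bij: "bij_betw (\<lambda>m. matrix_inv A *v (- m)) int_lattice (dual_lattice A)"
  proof -
    have "bij_betw uminus int_lattice (int_lattice :: (real^'n) set)"
      by (rule bij_betwI[where g=uminus]) auto
    from bij_betw_trans[OF this bij_betw_dual_lattice] show ?thesis by (simp add: o_def)
  qed
  have minus: "b + matrix_inv A *v (- m) = b - matrix_inv A *v m" for m
    by (simp add: linear_neg[OF matrix_vector_mul_linear])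
  have "(\<Sum>\<^sub>\<infinity>m\<in>int_lattice. g (a + m)) =
     (\<Sum>\<^sub>\<infinity>k\<in>int_lattice. C * gauss_kernel \<tau> i0 \<nu> (W (b - matrix_inv A *v k)) * cis (2 * pi * (k \<bullet> a)))"
  proof -
    have "exp_decay (\<lambda>v. norm (g v))" unfolding g_def
      by (rule exp_decay_linear[OF gauss_kernel_exp_decay[OF \<tau>'] _ K]) auto
    then obtain C' \<kappa> where d: "\<kappa> > 0" "\<And>v. norm (g v) \<le> C' * exp (- \<kappa> * norm v)"
      unfolding exp_decay_def by blast
    show ?thesis unfolding fourier[symmetric]
    proof (rule poisson_summation[OF _ _ d(2) d(1)])
      show "continuous_on UNIV g" unfolding g_def W_def
        by (intro continuous_on_compose2[OF continuous_gauss_kernel] matrix_vector_mult_linear_continuous_on) auto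
      show "integrable lborel g" unfolding g_def W_def by (rule integrable_gauss_kernel[OF \<tau>' T])
      have "(\<lambda>p. norm (gauss_kernel \<tau> i0 \<nu> (W (b + p)))) summable_on dual_lattice A"
        using exp_decay_summable_dual[OF decay] by simp
      then have "(\<lambda>k. norm (gauss_kernel \<tau> i0 \<nu> (W (b - matrix_inv A *v k)))) summable_on int_lattice"
        using summable_on_reindex_bij_betw[OF bij, of "\<lambda>p. norm (gauss_kernel \<tau> i0 \<nu> (W (b + p)))"] unfolding minus by simp
      then show "(\<lambda>k. \<integral>v. g v * cis (- (2 * pi * (k \<bullet> v))) \<partial>lborel) abs_summable_on int_lattice"
        unfolding fourier norm_mult by (rule summable_on_cmult_right)
    qed
  qed
  also have "\<dots> = (\<Sum>\<^sub>\<infinity>m\<in>int_lattice. (C * cis (2 * pi * bform A a b)) * (gauss_kernel \<tau> i0 \<nu> (W (b + matrix_inv A *v (- m))) *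
      cis (- (2 * pi * bform A (b + matrix_inv A *v (- m)) a))))"
  proof (rule infsum_cong)
    fix k
    have "k \<bullet> a = bform A (matrix_inv A *v k) a"
      by (rule bform_matrix_inv[OF A_inv A_sym, symmetric])
    then have "cis (2 * pi * (k \<bullet> a)) = cis (2 * pi * bform A a b) * cis (- (2 * pi * bform A (b + matrix_inv A *v (- k)) a))"
      unfolding minus using bform_commute[OF A_sym, of a b]
      by (simp add: cis_mult bform_simps algebra_simps)
    then show "C * gauss_kernel \<tau> i0 \<nu> (W (b - matrix_inv A *v k)) * cis (2 * pi * (k \<bullet> a)) =
       (C * cis (2 * pi * bform A a b)) * (gauss_kernel \<tau> i0 \<nu> (W (b + matrix_inv A *v (- k))) *
      cis (- (2 * pi * bform A (b + matrix_inv A *v (- k)) a)))"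
      unfolding minus by simp
  qed
  also have "\<dots> = (\<Sum>\<^sub>\<infinity>p\<in>dual_lattice A. (C * cis (2 * pi * bform A a b)) * (gauss_kernel \<tau> i0 \<nu> (W (b + p)) * cis (- (2 * pi * bform A (b + p) a))))"
    by (rule infsum_reindex_bij_betw[OF bij])
  also have "\<dots> = (C * cis (2 * pi * bform A a b)) * (\<Sum>\<^sub>\<infinity>p\<in>dual_lattice A. gauss_kernel \<tau> i0 \<nu> (W (b + p)) * cis (- (2 * pi * bform A (b + p) a)))"
    by (rule infsum_cmult_right')
  also have "(\<Sum>\<^sub>\<infinity>m\<in>int_lattice. g (a + m)) =
      (\<Sum>\<^sub>\<infinity>m\<in>int_lattice. gauss_kernel (- 1 / \<tau>) i0 \<mu> (matrix_inv T *v (a + m)) * cis (2 * pi * bform A (a + m) b))"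
    unfolding g_def shift[symmetric] bform_commute[OF A_sym, of b] by (simp add: \<tau>'_def W_def)
  finally show ?thesis by (simp add: C_def \<nu>_def W_def)
qed

end

section \<open>Inversion of Hermite theta series\<close>

text \<open>For \<open>Q(t) = - 1\<close> this is \<open>B\<close> of the components of
  \<open>u\<close> and \<open>v\<close> orthogonal to \<open>t\<close>: since
  \<open>B(t, t) = - 2\<close>, projecting \<open>u\<close> adds \<open>B(t, u) / 2\<close> times
  \<open>t\<close>.\<close>

definition perp_form :: "real^'n^'n \<Rightarrow> real^'n \<Rightarrow> real^'n \<Rightarrow> real^'n \<Rightarrow> real" where
  "perp_form A t u v = bform A u v + bform A t u * bform A t v / 2"

definition theta_weight :: "real^'n^'n \<Rightarrow> real^'n \<Rightarrow> complex \<Rightarrow> real^'n \<Rightarrow> complex" where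
  "theta_weight A t \<tau> v = exp (2 * pi * \<i> * \<tau> * qform A v - pi * Im \<tau> * (bform A t v)\<^sup>2)"

text \<open>Up to a factor this is \<open>d/ds\<close> of the \<open>E_kernel\<close> along a path with derivative \<open>e\<close> at \<open>t\<close>.\<close>
definition hermite_kernel :: "real^'n^'n \<Rightarrow> real^'n \<Rightarrow> nat \<Rightarrow> real \<Rightarrow> real^'n \<Rightarrow> real^'n \<Rightarrow> real^'n \<Rightarrow> real" where
  "hermite_kernel A t d y h e v =
     perp_form A t e v * hermite d (perp_form A t h v) (perp_form A t h h / (2 * y))
     - perp_form A t h e / (4 * pi * y) * hermite_pred d (perp_form A t h v) (perp_form A t h h / (2 * y))"

text \<open>The product of the principal square roots of all \<open>wick\<close> coefficients with
  \<open>\<bar>det T\<bar>\<close>, for any basis \<open>T\<close> adapted to any \<open>t\<close>;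
  it is therefore constant along a path.\<close>

definition theta_factor :: "real^'n^'n \<Rightarrow> complex \<Rightarrow> complex" where
  "theta_factor A \<tau> = csqrt (- \<i> * \<tau>) ^ (CARD('n) - 1) * csqrt (cnj (- \<i> * \<tau>)) / of_real (sqrt \<bar>det A\<bar>)"

lemma norm_theta_weight: "norm (theta_weight A t \<tau> v) = exp (- 2 * pi * Im \<tau> * (qform A v + (bform A t v)\<^sup>2 / 2))"
  by (simp add: theta_weight_def algebra_simps flip: of_real_power)

lemma abs_perp_form_le: obtains c where "c \<ge> 0" "\<And>v. \<bar>perp_form A t u v\<bar> \<le> c * norm v"
proof -
  have "linear (\<lambda>v. perp_form A t u v)"
    by (rule linearI) (simp_all add: perp_form_def bform_simps algebra_simps add_divide_distrib)
  then obtain K where "K > 0" "\<And>v. norm (perp_form A t u v) \<le> K * norm v"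
    using linear_bounded_pos by blast
  then show ?thesis using that[of K] by simp
qed

lemma hermite_pred_sums:
  fixes b q x :: "'a::{real_normed_field,banach}"
  shows "(\<lambda>d. hermite_pred d b q * x ^ d) sums (x * exp (b * x - q * x\<^sup>2 / (4 * of_real pi)))"
proof -
  have "(\<lambda>d. hermite_pred (Suc d) b q * x ^ Suc d) sums (x * exp (b * x - q * x\<^sup>2 / (4 * of_real pi)))"
    using sums_mult[OF hermite_sums[of b q x], of x] by (simp add: hermite_pred_def mult_ac)
  then show ?thesis by (subst (asm) sums_Suc_iff) (simp add: hermite_pred_def)
qed

lemma hermite_pred_partial_sum_le:
  fixes b q :: "'a::real_normed_field"
  assumes r: "r \<ge> 0"
  shows "(\<Sum>k<n. norm (hermite_pred k b q) * r ^ k) \<le> r * exp (norm b * r + norm q * r\<^sup>2 / (4 * pi))"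
proof (cases n)
  case (Suc m)
  have "(\<Sum>k<n. norm (hermite_pred k b q) * r ^ k) = (\<Sum>k<m. r * (norm (hermite k b q) * r ^ k))"
    unfolding Suc sum.lessThan_Suc_shift by (simp add: hermite_pred_def mult_ac)
  also have "\<dots> \<le> r * exp (norm b * r + norm q * r\<^sup>2 / (4 * pi))"
    unfolding sum_distrib_left[symmetric] using r by (intro mult_left_mono hermite_partial_sum_le)
  finally show ?thesis .
qed (use r in simp)

context lorentzian
begin

lemma basis_at:
  assumes t: "qform A t = - 1"
  obtains T :: "real^'n^'n" and i0 where
    "\<And>w w'. bform A (T *v w) (T *v w') = (\<Sum>i\<in>UNIV. lorentz_sign i0 i * (w $ i * w' $ i))"
    "\<And>u v. bform A t u * bform A t v / 2 = (matrix_inv T *v u) $ i0 * (matrix_inv T *v v) $ i0"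
    "\<bar>det T\<bar> = 1 / sqrt \<bar>det A\<bar>" "invertible T"
    "\<And>u v. perp_form A t u v = (\<Sum>i\<in>UNIV - {i0}. (matrix_inv T *v u) $ i * (matrix_inv T *v v) $ i)"
proof -
  define t' where "t' = (1 / sqrt 2) *\<^sub>R t"
  have "bform A t' t' = - 1" using t by (simp add: t'_def bform_simps qform_def)
  then obtain T :: "real^'n^'n" and i0 where
    T: "\<And>w w'. bform A (T *v w) (T *v w') = (\<Sum>i\<in>UNIV. lorentz_sign i0 i * (w $ i * w' $ i))"
    "\<And>w w'. bform A t' (T *v w) * bform A t' (T *v w') = w $ i0 * w' $ i0"
    "\<bar>det T\<bar> = 1 / sqrt \<bar>det A\<bar>" "invertible T"
    by (rule lorentz_basis[OF A_sig A_sym]) (rule that)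
  have 2: "bform A t u * bform A t v / 2 = (matrix_inv T *v u) $ i0 * (matrix_inv T *v v) $ i0" for u v
    using T(2)[of "matrix_inv T *v u" "matrix_inv T *v v"]
    by (simp add: matrix_inv_mul_vec[OF T(4)] t'_def bform_scaleR_left)
  have "perp_form A t u v = (\<Sum>i\<in>UNIV - {i0}. (matrix_inv T *v u) $ i * (matrix_inv T *v v) $ i)" for u v
  proof -
    have "bform A u v = (\<Sum>i\<in>UNIV. lorentz_sign i0 i * ((matrix_inv T *v u) $ i * (matrix_inv T *v v) $ i))"
      using T(1)[of "matrix_inv T *v u" "matrix_inv T *v v"] by (simp add: matrix_inv_mul_vec[OF T(4)])
    also have "\<dots> = (\<Sum>i\<in>UNIV - {i0}. (matrix_inv T *v u) $ i * (matrix_inv T *v v) $ i) - (matrix_inv T *v u) $ i0 * (matrix_inv T *v v) $ i0"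
      by (subst sum.remove[of _ i0]) (auto simp: lorentz_sign_def)
    finally show ?thesis unfolding perp_form_def 2 by simp
  qed
  then show ?thesis using that[OF T(1) 2 T(3,4)] by blast
qed

lemma theta_weight_exp_decay:
  assumes t: "qform A t = - 1" and \<tau>: "Im \<tau> > 0"
  shows "exp_decay (\<lambda>v. norm (theta_weight A t \<tau> v) * exp (\<alpha> * norm v + \<beta>))"
proof -
  obtain \<kappa> where \<kappa>: "\<kappa> > 0" "\<And>v. \<kappa> * (norm v)\<^sup>2 \<le> qform A v + (bform A t v)\<^sup>2 / 2"
    by (rule majorant_pos[OF A_sig A_sym t]) (rule that)
  have "norm (theta_weight A t \<tau> v) * exp (\<alpha> * norm v + \<beta>) \<le> exp (\<alpha> * norm v + \<beta> - (2 * pi * Im \<tau> * \<kappa>) * (norm v)\<^sup>2)" for v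
  proof -
    have "(2 * pi * Im \<tau>) * (\<kappa> * (norm v)\<^sup>2) \<le> (2 * pi * Im \<tau>) * (qform A v + (bform A t v)\<^sup>2 / 2)"
      using \<kappa>(2) \<tau> by (intro mult_left_mono) auto
    then show ?thesis unfolding norm_theta_weight exp_add[symmetric] by (simp add: mult.assoc)
  qed
  moreover have "2 * pi * Im \<tau> * \<kappa> > 0" using \<tau> \<kappa>(1) by simp
  ultimately show ?thesis
    by (intro exp_decay_mono[OF gaussian_exp_decay[of "2 * pi * Im \<tau> * \<kappa>" \<alpha> \<beta>]])
qed

text \<open>A generating function in two formal variables, \<open>X\<close> for the polynomial
  direction \<open>h\<close> and \<open>Z\<close> for the tangent direction \<open>e\<close>. Its
  quadratic correction with \<open>8 * pi * Im \<tau>\<close> compensates the constant produced by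
  the Gaussian integral, so that the inversion acts on \<open>X\<close> and \<open>Z\<close> purely
  by the factor \<open>\<i> * \<sigma>\<close>.\<close>

lemma exponential_inversion:
  fixes X Z \<tau> :: complex and t h e a b :: "real^'n"
  assumes t: "qform A t = - 1" and \<tau>: "Im \<tau> > 0"
  defines "\<sigma> \<equiv> - \<i> * \<tau>"
  defines "G \<equiv> \<lambda>\<tau> (X::complex) (Z::complex) v. theta_weight A t \<tau> v * exp (X * perp_form A t h v + Z * perp_form A t e v
      - (X\<^sup>2 * perp_form A t h h + 2 * X * Z * perp_form A t h e + Z\<^sup>2 * perp_form A t e e) / (8 * pi * Im \<tau>))"
  shows "(\<Sum>\<^sub>\<infinity>m\<in>int_lattice. G (- 1 / \<tau>) X Z (a + m) * cis (2 * pi * bform A (a + m) b)) =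
    theta_factor A \<tau> * cis (2 * pi * bform A a b) *
    (\<Sum>\<^sub>\<infinity>p\<in>dual_lattice A. G \<tau> (\<i> * \<sigma> * X) (\<i> * \<sigma> * Z) (b + p) * cis (- (2 * pi * bform A (b + p) a)))"
proof -
  obtain T :: "real^'n^'n" and i0 where
    T: "\<And>w w'. bform A (T *v w) (T *v w') = (\<Sum>i\<in>UNIV. lorentz_sign i0 i * (w $ i * w' $ i))"
    "\<And>u v. bform A t u * bform A t v / 2 = (matrix_inv T *v u) $ i0 * (matrix_inv T *v v) $ i0"
    "\<bar>det T\<bar> = 1 / sqrt \<bar>det A\<bar>" "invertible T"
    "\<And>u v. perp_form A t u v = (\<Sum>i\<in>UNIV - {i0}. (matrix_inv T *v u) $ i * (matrix_inv T *v v) $ i)"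
    by (rule basis_at[OF t]) (rule that)
  define W where "W = (\<lambda>v. matrix_inv T *v v)"
  have perp: "perp_form A t u v = (\<Sum>i\<in>UNIV - {i0}. W u $ i * W v $ i)" for u v
    by (simp add: T(5) W_def)
  have q2: "(bform A t v)\<^sup>2 = 2 * (W v $ i0)\<^sup>2" for v
    using T(2)[of v v] by (simp add: W_def power2_eq_square)
  have q: "2 * qform A v = (\<Sum>i\<in>UNIV - {i0}. (W v $ i)\<^sup>2) - (W v $ i0)\<^sup>2" for v
    using perp[of v v] q2[of v] by (simp add: perp_form_def qform_def power2_eq_square)
  \<comment> \<open>\<open>perp_form\<close> does not see the coordinate \<open>i0\<close>, so the
    linear term vanishes there.\<close>
  define \<mu> where "\<mu> = (\<lambda>(X::complex) (Z::complex) i. if i = i0 then 0 else X * complex_of_real (W h $ i) + Z * of_real (W e $ i))"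
  define \<tau>' where "\<tau>' = - 1 / \<tau>"
  have \<tau>0: "\<tau> \<noteq> 0" "\<sigma> \<noteq> 0" using \<tau> by (auto simp: \<sigma>_def)
  have \<tau>': "Im \<tau>' > 0" using \<tau> \<tau>0 unfolding \<tau>'_def Im_inversion by simp
  have kernel: "gauss_kernel \<tau> i0 (\<mu> X Z) (W v) = theta_weight A t \<tau> v * exp (X * perp_form A t h v + Z * perp_form A t e v)"
    for \<tau> X Z :: complex and v
  proof -
    define S where "S = (\<Sum>i\<in>UNIV - {i0}. (W v $ i)\<^sup>2)"
    define x where "x = (W v $ i0)\<^sup>2"
    have "gauss_kernel \<tau> i0 (\<mu> X Z) (W v) = exp (\<Sum>i\<in>UNIV. - of_real pi * wick \<tau> i0 i * of_real (W v $ i) ^ 2 + \<mu> X Z i * of_real (W v $ i))"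
      unfolding gauss_kernel_def by (simp add: exp_sum)
    also have "(\<Sum>i\<in>UNIV. - of_real pi * wick \<tau> i0 i * of_real (W v $ i) ^ 2 + \<mu> X Z i * of_real (W v $ i)) =
      - of_real pi * cnj (- \<i> * \<tau>) * of_real x + (\<Sum>i\<in>UNIV - {i0}. - of_real pi * (- \<i> * \<tau>) * of_real ((W v $ i)\<^sup>2)
        + (X * of_real (W h $ i * W v $ i) + Z * of_real (W e $ i * W v $ i)))"
      by (subst sum.remove[of _ i0]) (auto simp: wick_def \<mu>_def x_def algebra_simps intro!: sum.cong)
    also have "(\<Sum>i\<in>UNIV - {i0}. - of_real pi * (- \<i> * \<tau>) * of_real ((W v $ i)\<^sup>2)
        + (X * of_real (W h $ i * W v $ i) + Z * of_real (W e $ i * W v $ i))) =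
       - of_real pi * (- \<i> * \<tau>) * of_real S + (X * perp_form A t h v + Z * perp_form A t e v)"
      unfolding sum.distrib S_def perp by (simp add: sum_distrib_left)
    also have "- of_real pi * cnj (- \<i> * \<tau>) * of_real x + (- of_real pi * (- \<i> * \<tau>) * of_real S + (X * perp_form A t h v + Z * perp_form A t e v)) =
       (2 * pi * \<i> * \<tau> * qform A v - pi * Im \<tau> * (bform A t v)\<^sup>2) + (X * perp_form A t h v + Z * perp_form A t e v)"
    proof -
      have "S = 2 * qform A v + x" "(bform A t v)\<^sup>2 = 2 * x" using q[of v] q2[of v] by (auto simp: S_def x_def)
      moreover have "cnj (- \<i> * \<tau>) = \<i> * \<tau> + 2 * of_real (Im \<tau>)" by (simp add: complex_eq_iff)
      ultimately show ?thesis by (simp add: algebra_simps)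
    qed
    finally show ?thesis by (simp add: theta_weight_def exp_add)
  qed
  define qq where "qq = X\<^sup>2 * perp_form A t h h + 2 * X * Z * perp_form A t h e + Z\<^sup>2 * perp_form A t e e"
  have factor: "of_real \<bar>det T\<bar> * (\<Prod>i\<in>UNIV. csqrt (wick \<tau> i0 i) * exp (wick \<tau> i0 i * (\<mu> X Z i)\<^sup>2 / (4 * of_real pi))) =
     theta_factor A \<tau> * exp (\<sigma> * qq / (4 * pi))"
  proof -
    have "(\<Prod>i\<in>UNIV. csqrt (wick \<tau> i0 i)) = csqrt (cnj (- \<i> * \<tau>)) * csqrt (- \<i> * \<tau>) ^ (CARD('n) - 1)"
      by (subst prod.remove[of _ i0]) (auto simp: wick_def)
    moreover have "(\<Prod>i\<in>UNIV. exp (wick \<tau> i0 i * (\<mu> X Z i)\<^sup>2 / (4 * of_real pi))) = exp (\<sigma> * qq / (4 * pi))"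
    proof -
      have "(\<Sum>i\<in>UNIV. wick \<tau> i0 i * (\<mu> X Z i)\<^sup>2 / (4 * of_real pi)) =
          (\<Sum>i\<in>UNIV - {i0}. \<sigma> / (4 * pi) * (X\<^sup>2 * of_real (W h $ i * W h $ i) + 2 * X * Z * of_real (W h $ i * W e $ i) + Z\<^sup>2 * of_real (W e $ i * W e $ i)))"
      proof -
        have sq: "(X * u + Z * w)\<^sup>2 = X\<^sup>2 * (u * u) + 2 * X * Z * (u * w) + Z\<^sup>2 * (w * w)" for u w
          by (simp add: power2_eq_square algebra_simps)
        show ?thesis
          by (subst sum.remove[of _ i0]) (auto simp: wick_def \<mu>_def \<sigma>_def sq intro!: sum.cong)
      qed
      also have "\<dots> = \<sigma> / (4 * pi) * qq"
        unfolding qq_def perp sum_distrib_left[symmetric] sum.distrib of_real_sum by (simp add: sum_distrib_left)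
      finally show ?thesis by (simp flip: exp_sum)
    qed
    ultimately show ?thesis
      unfolding prod.distrib theta_factor_def T(3) by simp
  qed
  have \<mu>': "(\<lambda>i. \<i> * lorentz_sign i0 i * wick \<tau> i0 i * \<mu> X Z i) = \<mu> (\<i> * \<sigma> * X) (\<i> * \<sigma> * Z)"
    by (auto simp: \<mu>_def lorentz_sign_def wick_def \<sigma>_def algebra_simps)
  define E where "E = exp (- qq / (8 * pi * Im \<tau>'))"
  have "(\<Sum>\<^sub>\<infinity>m\<in>int_lattice. G \<tau>' X Z (a + m) * cis (2 * pi * bform A (a + m) b)) =
     (\<Sum>\<^sub>\<infinity>m\<in>int_lattice. E * (gauss_kernel \<tau>' i0 (\<mu> X Z) (W (a + m)) * cis (2 * pi * bform A (a + m) b)))"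
    unfolding G_def kernel qq_def[symmetric] E_def by (intro infsum_cong) (simp add: exp_diff exp_minus field_simps)
  also have "\<dots> = E * (theta_factor A \<tau> * exp (\<sigma> * qq / (4 * pi)) * cis (2 * pi * bform A a b) *
    (\<Sum>\<^sub>\<infinity>p\<in>dual_lattice A. gauss_kernel \<tau> i0 (\<mu> (\<i> * \<sigma> * X) (\<i> * \<sigma> * Z)) (W (b + p)) * cis (- (2 * pi * bform A (b + p) a))))"
    unfolding infsum_cmult_right' \<tau>'_def W_def gauss_kernel_inversion[OF \<tau> T(4) T(1)] factor \<mu>' ..
  also have "\<dots> = theta_factor A \<tau> * cis (2 * pi * bform A a b) *
    (\<Sum>\<^sub>\<infinity>p\<in>dual_lattice A. E * exp (\<sigma> * qq / (4 * pi)) * (gauss_kernel \<tau> i0 (\<mu> (\<i> * \<sigma> * X) (\<i> * \<sigma> * Z)) (W (b + p)) * cis (- (2 * pi * bform A (b + p) a))))"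
    unfolding infsum_cmult_right' by (simp only: mult_ac)
  \<comment> \<open>From \<open>1 / Im (- 1 / \<tau>) = \<sigma> * cnj \<sigma> / Im \<tau>\<close>
    and \<open>2 * Im \<tau> = \<sigma> + cnj \<sigma>\<close>, the correction at
    \<open>- 1 / \<tau>\<close> and the Gaussian constant add up to the correction at
    \<open>\<tau>\<close> for the variables multiplied by \<open>\<i> * \<sigma>\<close>.\<close>
  also have "E * exp (\<sigma> * qq / (4 * pi)) = exp (\<sigma>\<^sup>2 * qq / (8 * pi * Im \<tau>))"
  proof -
    define y where "y = complex_of_real (Im \<tau>)"
    have sc: "\<sigma> + cnj \<sigma> = 2 * y" by (simp add: \<sigma>_def y_def complex_eq_iff)
    have "complex_of_real ((norm \<tau>)\<^sup>2) = \<sigma> * cnj \<sigma>"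
      unfolding complex_norm_square \<sigma>_def by (simp add: algebra_simps)
    then have y': "complex_of_real (Im \<tau>') = y / (\<sigma> * cnj \<sigma>)"
      unfolding \<tau>'_def Im_inversion of_real_divide y_def by simp
    have y: "y \<noteq> 0" using \<tau> by (simp add: y_def)
    have "\<sigma> * qq / (4 * pi) = \<sigma> * qq * (\<sigma> + cnj \<sigma>) / (8 * pi * y)"
      unfolding sc using y by (simp add: field_simps)
    moreover have "- qq / (8 * pi * Im \<tau>') = - (qq * (\<sigma> * cnj \<sigma>)) / (8 * pi * y)"
      by (simp add: y')
    moreover have "- (qq * (\<sigma> * cnj \<sigma>)) + \<sigma> * qq * (\<sigma> + cnj \<sigma>) = \<sigma>\<^sup>2 * qq"
      by (simp add: power2_eq_square algebra_simps)
    ultimately have "- qq / (8 * pi * Im \<tau>') + \<sigma> * qq / (4 * pi) = \<sigma>\<^sup>2 * qq / (8 * pi * Im \<tau>)"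
      by (simp only: add_divide_distrib[symmetric] y_def of_real_mult)
    then show ?thesis unfolding E_def by (simp flip: exp_add)
  qed
  also have "(\<Sum>\<^sub>\<infinity>p\<in>dual_lattice A. exp (\<sigma>\<^sup>2 * qq / (8 * pi * Im \<tau>)) * (gauss_kernel \<tau> i0 (\<mu> (\<i> * \<sigma> * X) (\<i> * \<sigma> * Z)) (W (b + p)) * cis (- (2 * pi * bform A (b + p) a)))) =
     (\<Sum>\<^sub>\<infinity>p\<in>dual_lattice A. G \<tau> (\<i> * \<sigma> * X) (\<i> * \<sigma> * Z) (b + p) * cis (- (2 * pi * bform A (b + p) a)))"
  proof (rule infsum_cong)
    fix p
    have "- ((\<i> * \<sigma> * X)\<^sup>2 * perp_form A t h h + 2 * (\<i> * \<sigma> * X) * (\<i> * \<sigma> * Z) * perp_form A t h e + (\<i> * \<sigma> * Z)\<^sup>2 * perp_form A t e e) / (8 * pi * Im \<tau>)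
       = \<sigma>\<^sup>2 * qq / (8 * pi * Im \<tau>)"
      by (simp add: qq_def power_mult_distrib power2_eq_square algebra_simps)
    then show "exp (\<sigma>\<^sup>2 * qq / (8 * pi * Im \<tau>)) * (gauss_kernel \<tau> i0 (\<mu> (\<i> * \<sigma> * X) (\<i> * \<sigma> * Z)) (W (b + p)) * cis (- (2 * pi * bform A (b + p) a))) =
       G \<tau> (\<i> * \<sigma> * X) (\<i> * \<sigma> * Z) (b + p) * cis (- (2 * pi * bform A (b + p) a))"
      unfolding G_def kernel
    proof -
      fix L M N x y z :: complex
      assume "- M / N = x"
      then have "L - M / N = L + x" by simp
      then show "exp x * (y * exp L * z) = y * exp (L - M / N) * z"
        unfolding \<open>L - M / N = L + x\<close> exp_add by (simp only: mult_ac)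
    qed
  qed
  finally show ?thesis unfolding \<tau>'_def .
qed

text \<open>Prepares majorants for \<open>coefficient_extraction\<close>: partial sums growing like
  \<open>exp (\<alpha> * norm v)\<close> are beaten by the Gaussian weight. The factor
  \<open>u\<close> stands for a character times a constant.\<close>

lemma theta_weight_sum_le:
  fixes g :: "nat \<Rightarrow> real^'n \<Rightarrow> complex"
  assumes t: "qform A t = - 1" and \<tau>: "Im \<tau> > 0"
    and g: "\<And>v n. (\<Sum>k<n. norm (g k v)) \<le> exp (\<alpha> * norm v + \<beta>)"
  obtains F where "exp_decay F" "\<And>v. F v \<ge> 0"
    "\<And>u v n. norm u \<le> U \<Longrightarrow> (\<Sum>k<n. norm (theta_weight A t \<tau> v * g k v * u)) \<le> F v"
proof
  define F where "F = (\<lambda>v. \<bar>U\<bar> * (norm (theta_weight A t \<tau> v) * exp (\<alpha> * norm v + \<beta>)))"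
  show "exp_decay F" unfolding F_def by (intro exp_decay_cmult theta_weight_exp_decay t \<tau>) auto
  show "F v \<ge> 0" for v by (simp add: F_def)
  show "(\<Sum>k<n. norm (theta_weight A t \<tau> v * g k v * u)) \<le> F v" if "norm u \<le> U" for u v n
  proof -
    have "(\<Sum>k<n. norm (theta_weight A t \<tau> v * g k v * u)) = norm u * (norm (theta_weight A t \<tau> v) * (\<Sum>k<n. norm (g k v)))"
      by (simp add: norm_mult sum_distrib_left mult_ac)
    also have "\<dots> \<le> \<bar>U\<bar> * (norm (theta_weight A t \<tau> v) * exp (\<alpha> * norm v + \<beta>))"
      using that g by (intro mult_mono mult_left_mono) (auto intro!: mult_nonneg_nonneg sum_nonneg)
    finally show ?thesis by (simp add: F_def)
  qed
qed

text \<open>The coefficient of \<open>Z\<close> in \<open>exponential_inversion\<close>: the tangent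
  vector enters the derivative along a path linearly, which accounts for one factor
  \<open>\<i> * \<sigma>\<close>.\<close>

lemma linear_exponential_inversion:
  fixes X \<tau> :: complex and t h e a b :: "real^'n"
  assumes t: "qform A t = - 1" and \<tau>: "Im \<tau> > 0"
  defines "\<sigma> \<equiv> - \<i> * \<tau>"
  defines "G \<equiv> \<lambda>\<tau> (X::complex) v. theta_weight A t \<tau> v * (exp (X * perp_form A t h v - X\<^sup>2 * perp_form A t h h / (8 * pi * Im \<tau>)) *
      (perp_form A t e v - X * perp_form A t h e / (4 * pi * Im \<tau>)))"
  shows "(\<Sum>\<^sub>\<infinity>m\<in>int_lattice. G (- 1 / \<tau>) X (a + m) * cis (2 * pi * bform A (a + m) b)) =
    theta_factor A \<tau> * cis (2 * pi * bform A a b) * (\<i> * \<sigma>) *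
    (\<Sum>\<^sub>\<infinity>p\<in>dual_lattice A. G \<tau> (\<i> * \<sigma> * X) (b + p) * cis (- (2 * pi * bform A (b + p) a)))"
proof -
  define \<tau>' where "\<tau>' = - 1 / \<tau>"
  have \<tau>0: "\<tau> \<noteq> 0" using \<tau> by auto
  have \<tau>': "Im \<tau>' > 0" using \<tau> \<tau>0 unfolding \<tau>'_def Im_inversion by simp
  define K where "K = theta_factor A \<tau> * cis (2 * pi * bform A a b)"
  \<comment> \<open>Collecting the exponent of \<open>P\<close> by powers of \<open>Z\<close> leaves
    \<open>exp (b * Z - q * Z ^ 2 / (4 * pi))\<close> with the two arguments given to
    \<open>hermite\<close> here, so \<open>H\<close> lists the coefficients in \<open>Z\<close> up
    to the weight.\<close>
  define H where "H = (\<lambda>y (X::complex) k v. exp (X * perp_form A t h v - X\<^sup>2 * perp_form A t h h / (8 * pi * y)) *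
    hermite k (perp_form A t e v - X * perp_form A t h e / (4 * pi * y)) (of_real (perp_form A t e e / (2 * y))))"
  define P where "P = (\<lambda>\<tau> (X::complex) (Z::complex) v. theta_weight A t \<tau> v * exp (X * perp_form A t h v + Z * perp_form A t e v
      - (X\<^sup>2 * perp_form A t h h + 2 * X * Z * perp_form A t h e + Z\<^sup>2 * perp_form A t e e) / (8 * pi * Im \<tau>)))"
  have H_sums: "(\<lambda>k. theta_weight A t \<tau> v * H (Im \<tau>) X k v * Z ^ k) sums P \<tau> X Z v" if "Im \<tau> > 0" for \<tau> X Z v
  proof -
    let ?y = "Im \<tau>"
    let ?b = "perp_form A t e v - X * perp_form A t h e / (4 * pi * ?y)" and ?q = "complex_of_real (perp_form A t e e / (2 * ?y))"
    have "(\<lambda>k. (theta_weight A t \<tau> v * exp (X * perp_form A t h v - X\<^sup>2 * perp_form A t h h / (8 * pi * ?y))) * (hermite k ?b ?q * Z ^ k))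
       sums ((theta_weight A t \<tau> v * exp (X * perp_form A t h v - X\<^sup>2 * perp_form A t h h / (8 * pi * ?y))) * exp (?b * Z - ?q * Z\<^sup>2 / (4 * of_real pi)))"
      by (intro sums_mult hermite_sums)
    moreover have E: "X * perp_form A t h v + Z * perp_form A t e v
      - (X\<^sup>2 * perp_form A t h h + 2 * X * Z * perp_form A t h e + Z\<^sup>2 * perp_form A t e e) / (8 * pi * ?y) =
      (X * perp_form A t h v - X\<^sup>2 * perp_form A t h h / (8 * pi * ?y)) + (?b * Z - ?q * Z\<^sup>2 / (4 * of_real pi))"
      using that by (simp add: field_simps)
    ultimately show ?thesis unfolding P_def H_def E exp_add by (simp only: mult.assoc)
  qed
  have H_le: "\<exists>\<alpha> \<beta>. \<forall>v n. (\<Sum>k<n. norm (H y X k v * s ^ k * of_real r ^ k)) \<le> exp (\<alpha> * norm v + \<beta>)" if r: "r \<ge> 0" for y X s r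
  proof -
    obtain ch where ch: "ch \<ge> 0" "\<And>v. \<bar>perp_form A t h v\<bar> \<le> ch * norm v" by (rule abs_perp_form_le[where A=A and t=t and u=h]) (rule that)
    obtain ce where ce: "ce \<ge> 0" "\<And>v. \<bar>perp_form A t e v\<bar> \<le> ce * norm v" by (rule abs_perp_form_le[where A=A and t=t and u=e]) (rule that)
    define c1 where "c1 = X\<^sup>2 * perp_form A t h h / (8 * pi * y)"
    define c2 where "c2 = X * perp_form A t h e / (4 * pi * y)"
    define q where "q = complex_of_real (perp_form A t e e / (2 * y))"
    define R where "R = norm s * r"
    have R: "R \<ge> 0" using r by (simp add: R_def)
    have H: "H y X k v = exp (X * perp_form A t h v - c1) * hermite k (perp_form A t e v - c2) q" for k v
      by (simp only: H_def c1_def c2_def q_def)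
    have "(\<Sum>k<n. norm (H y X k v * s ^ k * of_real r ^ k)) \<le>
       exp ((norm X * ch + ce * R) * norm v + (norm c1 + norm c2 * R + norm q * R\<^sup>2 / (4 * pi)))" for v n
    proof -
      have "(\<Sum>k<n. norm (H y X k v * s ^ k * of_real r ^ k)) =
         norm (exp (X * perp_form A t h v - c1)) * (\<Sum>k<n. norm (hermite k (perp_form A t e v - c2) q) * R ^ k)"
        unfolding H using r by (simp add: norm_mult norm_power R_def power_mult_distrib sum_distrib_left mult.assoc)
      also have "\<dots> \<le> exp (norm X * (ch * norm v) + norm c1) * exp ((ce * norm v + norm c2) * R + norm q * R\<^sup>2 / (4 * pi))"
      proof (intro mult_mono)
        have "norm (X * perp_form A t h v - c1) \<le> norm X * (ch * norm v) + norm c1"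
          by (rule order_trans[OF norm_triangle_ineq4]) (simp add: norm_mult ch(2) mult_left_mono)
        then show "norm (exp (X * perp_form A t h v - c1)) \<le> exp (norm X * (ch * norm v) + norm c1)"
          unfolding norm_exp_eq_Re using complex_Re_le_cmod order_trans by (intro iffD2[OF exp_le_cancel_iff]) blast
        have "norm (perp_form A t e v - c2) \<le> ce * norm v + norm c2"
          by (rule order_trans[OF norm_triangle_ineq4]) (simp add: ce(2))
        then have "exp (norm (perp_form A t e v - c2) * R + norm q * R\<^sup>2 / (4 * pi)) \<le> exp ((ce * norm v + norm c2) * R + norm q * R\<^sup>2 / (4 * pi))"
          using R by (simp add: mult_right_mono)
        then show "(\<Sum>k<n. norm (hermite k (perp_form A t e v - c2) q) * R ^ k) \<le> exp ((ce * norm v + norm c2) * R + norm q * R\<^sup>2 / (4 * pi))"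
          using hermite_partial_sum_le[OF R] order_trans by blast
      qed (use R in \<open>auto intro!: sum_nonneg\<close>)
      finally show ?thesis by (simp add: algebra_simps flip: exp_add)
    qed
    then show ?thesis by blast
  qed
  have "(\<Sum>\<^sub>\<infinity>m\<in>int_lattice. theta_weight A t \<tau>' (a + m) * H (Im \<tau>') X 1 (a + m) * cis (2 * pi * bform A (a + m) b)) =
     (\<Sum>\<^sub>\<infinity>p\<in>dual_lattice A. theta_weight A t \<tau> (b + p) * (H (Im \<tau>) (\<i> * \<sigma> * X) 1 (b + p) * (\<i> * \<sigma>) ^ 1) * (K * cis (- (2 * pi * bform A (b + p) a))))"
  proof (rule coefficient_extraction)
    show "\<exists>M. M summable_on int_lattice \<and> (\<forall>m\<in>int_lattice. \<forall>n. (\<Sum>k<n. norm (theta_weight A t \<tau>' (a + m) * H (Im \<tau>') X k (a + m) * cis (2 * pi * bform A (a + m) b)) * r ^ k) \<le> M m)"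
      if "r \<ge> 0" for r
    proof -
      obtain \<alpha> \<beta> where ab: "\<And>v n. (\<Sum>k<n. norm (H (Im \<tau>') X k v * 1 ^ k * of_real r ^ k)) \<le> exp (\<alpha> * norm v + \<beta>)"
        using H_le[OF \<open>r \<ge> 0\<close>] by blast
      obtain F where F: "exp_decay F" "\<And>v. F v \<ge> 0"
        "\<And>u v n. norm u \<le> 1 \<Longrightarrow> (\<Sum>k<n. norm (theta_weight A t \<tau>' v * (H (Im \<tau>') X k v * 1 ^ k * of_real r ^ k) * u)) \<le> F v"
        by (rule theta_weight_sum_le[OF t \<tau>' ab, where U=1]) (rule that)
      show ?thesis
        using F(3)[of "cis (2 * pi * bform A (a + m) b)" for m] \<open>r \<ge> 0\<close> exp_decay_summable[OF F(1,2), of a]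
        by (intro exI[of _ "\<lambda>m. F (a + m)"]) (simp add: norm_mult norm_power mult_ac)
    qed
    show "\<exists>M. M summable_on dual_lattice A \<and> (\<forall>p\<in>dual_lattice A. \<forall>n. (\<Sum>k<n. norm (theta_weight A t \<tau> (b + p) * (H (Im \<tau>) (\<i> * \<sigma> * X) k (b + p) * (\<i> * \<sigma>) ^ k) * (K * cis (- (2 * pi * bform A (b + p) a)))) * r ^ k) \<le> M p)"
      if "r \<ge> 0" for r
    proof -
      obtain \<alpha> \<beta> where ab: "\<And>v n. (\<Sum>k<n. norm (H (Im \<tau>) (\<i> * \<sigma> * X) k v * (\<i> * \<sigma>) ^ k * of_real r ^ k)) \<le> exp (\<alpha> * norm v + \<beta>)"
        using H_le[OF \<open>r \<ge> 0\<close>] by blast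
      obtain F where F: "exp_decay F" "\<And>v. F v \<ge> 0"
        "\<And>u v n. norm u \<le> norm K \<Longrightarrow> (\<Sum>k<n. norm (theta_weight A t \<tau> v * (H (Im \<tau>) (\<i> * \<sigma> * X) k v * (\<i> * \<sigma>) ^ k * of_real r ^ k) * u)) \<le> F v"
        by (rule theta_weight_sum_le[OF t \<tau> ab, where U="norm K"]) (rule that)
      show ?thesis
        using F(3)[of "K * cis (- (2 * pi * bform A (b + p) a))" for p] \<open>r \<ge> 0\<close> exp_decay_summable_dual[OF F(1,2), of b]
        by (intro exI[of _ "\<lambda>p. F (b + p)"]) (simp add: norm_mult norm_power mult_ac)
    qed
    show "(\<lambda>k. theta_weight A t \<tau>' (a + m) * H (Im \<tau>') X k (a + m) * cis (2 * pi * bform A (a + m) b) * Z ^ k) sums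
        (P \<tau>' X Z (a + m) * cis (2 * pi * bform A (a + m) b))" for m Z
      using sums_mult2[OF H_sums[OF \<tau>', of "a + m" X Z], of "cis (2 * pi * bform A (a + m) b)"] by (simp add: mult_ac)
    show "(\<lambda>k. theta_weight A t \<tau> (b + p) * (H (Im \<tau>) (\<i> * \<sigma> * X) k (b + p) * (\<i> * \<sigma>) ^ k) * (K * cis (- (2 * pi * bform A (b + p) a))) * Z ^ k) sums
        (K * (P \<tau> (\<i> * \<sigma> * X) (\<i> * \<sigma> * Z) (b + p) * cis (- (2 * pi * bform A (b + p) a))))" for p Z
      using sums_mult2[OF H_sums[OF \<tau>, of "b + p" "\<i> * \<sigma> * X" "\<i> * \<sigma> * Z"], of "K * cis (- (2 * pi * bform A (b + p) a))"]
      by (simp add: power_mult_distrib mult_ac)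
    show "(\<Sum>\<^sub>\<infinity>m\<in>int_lattice. P \<tau>' X Z (a + m) * cis (2 * pi * bform A (a + m) b)) =
       (\<Sum>\<^sub>\<infinity>p\<in>dual_lattice A. K * (P \<tau> (\<i> * \<sigma> * X) (\<i> * \<sigma> * Z) (b + p) * cis (- (2 * pi * bform A (b + p) a))))" for Z
      unfolding infsum_cmult_right' K_def P_def \<tau>'_def \<sigma>_def by (rule exponential_inversion[OF t \<tau>])
  qed
  moreover have G: "theta_weight A t \<tau> v * H (Im \<tau>) X 1 v = G \<tau> X v" for \<tau> X v
    by (simp add: H_def G_def)
  moreover have "theta_weight A t \<tau> (b + p) * (H (Im \<tau>) (\<i> * \<sigma> * X) 1 (b + p) * (\<i> * \<sigma>) ^ 1) * (K * cis (- (2 * pi * bform A (b + p) a))) =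
     (K * (\<i> * \<sigma>)) * (G \<tau> (\<i> * \<sigma> * X) (b + p) * cis (- (2 * pi * bform A (b + p) a)))" for p
    unfolding G[symmetric] power_one_right by (simp only: mult_ac)
  ultimately show ?thesis
    unfolding \<tau>'_def[symmetric] K_def[symmetric] by (simp only: infsum_cmult_right')
qed

text \<open>The coefficient of \<open>X ^ d\<close> in \<open>linear_exponential_inversion\<close>.
  The scaling of \<open>X\<close> contributes \<open>d\<close> factors
  \<open>\<i> * \<sigma>\<close> and the tangent direction one more; the summand linear in
  \<open>X\<close> is what becomes the \<open>hermite_pred\<close> term of
  \<open>hermite_kernel\<close>.\<close>

theorem hermite_inversion:
  fixes \<tau> :: complex and t h e a b :: "real^'n" and d :: nat
  assumes t: "qform A t = - 1" and \<tau>: "Im \<tau> > 0"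
  defines "G \<equiv> \<lambda>\<tau> v. theta_weight A t \<tau> v * of_real (hermite_kernel A t d (Im \<tau>) h e v)"
  shows "(\<Sum>\<^sub>\<infinity>m\<in>int_lattice. G (- 1 / \<tau>) (a + m) * cis (2 * pi * bform A (a + m) b)) =
    theta_factor A \<tau> * cis (2 * pi * bform A a b) * (\<i> * (- \<i> * \<tau>)) ^ (d + 1) *
    (\<Sum>\<^sub>\<infinity>p\<in>dual_lattice A. G \<tau> (b + p) * cis (- (2 * pi * bform A (b + p) a)))"
proof -
  define \<sigma> where "\<sigma> = - \<i> * \<tau>"
  define \<tau>' where "\<tau>' = - 1 / \<tau>"
  have \<tau>0: "\<tau> \<noteq> 0" using \<tau> by auto
  have \<tau>': "Im \<tau>' > 0" using \<tau> \<tau>0 unfolding \<tau>'_def Im_inversion by simp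
  define K where "K = theta_factor A \<tau> * cis (2 * pi * bform A a b) * (\<i> * \<sigma>)"
  define H where "H = (\<lambda>y k v. complex_of_real (hermite_kernel A t k y h e v))"
  define P where "P = (\<lambda>\<tau> (X::complex) v. theta_weight A t \<tau> v * (exp (X * perp_form A t h v - X\<^sup>2 * perp_form A t h h / (8 * pi * Im \<tau>)) *
      (perp_form A t e v - X * perp_form A t h e / (4 * pi * Im \<tau>))))"
  have H: "H y k v = perp_form A t e v * hermite k (complex_of_real (perp_form A t h v)) (complex_of_real (perp_form A t h h / (2 * y)))
     - complex_of_real (perp_form A t h e / (4 * pi * y)) * hermite_pred k (complex_of_real (perp_form A t h v)) (complex_of_real (perp_form A t h h / (2 * y)))" for y k v
    unfolding H_def hermite_kernel_def by (simp add: hermite_pred_def of_real_hermite[symmetric])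
  have H_sums: "(\<lambda>k. theta_weight A t \<tau> v * H (Im \<tau>) k v * X ^ k) sums P \<tau> X v" if "Im \<tau> > 0" for \<tau> X v
  proof -
    let ?y = "Im \<tau>"
    let ?b = "complex_of_real (perp_form A t h v)" and ?q = "complex_of_real (perp_form A t h h / (2 * ?y))"
    have "(\<lambda>k. theta_weight A t \<tau> v * (perp_form A t e v * (hermite k ?b ?q * X ^ k) - complex_of_real (perp_form A t h e / (4 * pi * ?y)) * (hermite_pred k ?b ?q * X ^ k)))
       sums (theta_weight A t \<tau> v * (perp_form A t e v * exp (?b * X - ?q * X\<^sup>2 / (4 * of_real pi)) -
         complex_of_real (perp_form A t h e / (4 * pi * ?y)) * (X * exp (?b * X - ?q * X\<^sup>2 / (4 * of_real pi)))))"
      by (intro sums_mult sums_diff hermite_sums hermite_pred_sums)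
    moreover have "X * perp_form A t h v - X\<^sup>2 * perp_form A t h h / (8 * pi * ?y) = ?b * X - ?q * X\<^sup>2 / (4 * of_real pi)"
      using that by (simp add: field_simps)
    ultimately show ?thesis unfolding P_def H by (simp add: algebra_simps)
  qed
  have H_le: "\<exists>\<alpha> \<beta>. \<forall>v n. (\<Sum>k<n. norm (H y k v * s ^ k * of_real r ^ k)) \<le> exp (\<alpha> * norm v + \<beta>)" if r: "r \<ge> 0" for y s r
  proof -
    obtain ch where ch: "ch \<ge> 0" "\<And>v. \<bar>perp_form A t h v\<bar> \<le> ch * norm v" by (rule abs_perp_form_le[where A=A and t=t and u=h]) (rule that)
    obtain ce where ce: "ce \<ge> 0" "\<And>v. \<bar>perp_form A t e v\<bar> \<le> ce * norm v" by (rule abs_perp_form_le[where A=A and t=t and u=e]) (rule that)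
    define c where "c = complex_of_real (perp_form A t h e / (4 * pi * y))"
    define q where "q = complex_of_real (perp_form A t h h / (2 * y))"
    define R where "R = norm s * r"
    have R: "R \<ge> 0" using r by (simp add: R_def)
    have "(\<Sum>k<n. norm (H y k v * s ^ k * of_real r ^ k)) \<le>
       exp ((ce + ch * R) * norm v + (norm c * R + norm q * R\<^sup>2 / (4 * pi)))" for v n
    proof -
      let ?b = "complex_of_real (perp_form A t h v)"
      define E where "E = exp (norm ?b * R + norm q * R\<^sup>2 / (4 * pi))"
      have "(\<Sum>k<n. norm (H y k v * s ^ k * of_real r ^ k)) \<le>
         (\<Sum>k<n. \<bar>perp_form A t e v\<bar> * (norm (hermite k ?b q) * R ^ k) + norm c * (norm (hermite_pred k ?b q) * R ^ k))"
      proof (rule sum_mono)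
        fix k
        have "norm (H y k v) \<le> \<bar>perp_form A t e v\<bar> * norm (hermite k ?b q) + norm c * norm (hermite_pred k ?b q)"
          unfolding H c_def[symmetric] q_def[symmetric] by (rule order_trans[OF norm_triangle_ineq4]) (simp add: norm_mult)
        then have "norm (H y k v) * R ^ k \<le> (\<bar>perp_form A t e v\<bar> * norm (hermite k ?b q) + norm c * norm (hermite_pred k ?b q)) * R ^ k"
          using R by (intro mult_right_mono) auto
        then show "norm (H y k v * s ^ k * of_real r ^ k) \<le> \<bar>perp_form A t e v\<bar> * (norm (hermite k ?b q) * R ^ k) + norm c * (norm (hermite_pred k ?b q) * R ^ k)"
          using r by (simp add: norm_mult norm_power R_def power_mult_distrib algebra_simps)
      qed
      also have "\<dots> \<le> \<bar>perp_form A t e v\<bar> * E + norm c * (R * E)"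
        unfolding sum.distrib sum_distrib_left[symmetric] E_def
        using R by (intro add_mono mult_left_mono hermite_partial_sum_le hermite_pred_partial_sum_le) auto
      also have "\<dots> = (\<bar>perp_form A t e v\<bar> + norm c * R) * E" by (simp add: algebra_simps)
      also have "\<dots> \<le> exp (ce * norm v + norm c * R) * exp (ch * norm v * R + norm q * R\<^sup>2 / (4 * pi))"
      proof (intro mult_mono)
        have "\<bar>perp_form A t e v\<bar> + norm c * R \<le> ce * norm v + norm c * R" using ce(2) by simp
        also have "\<dots> \<le> exp (ce * norm v + norm c * R)"
          using exp_ge_add_one_self[of "ce * norm v + norm c * R"] by linarith
        finally show "\<bar>perp_form A t e v\<bar> + norm c * R \<le> exp (ce * norm v + norm c * R)" .
        show "E \<le> exp (ch * norm v * R + norm q * R\<^sup>2 / (4 * pi))"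
          unfolding E_def using R ch(2)[of v] by (simp add: mult_right_mono)
      qed (use R in \<open>auto simp: E_def\<close>)
      finally show ?thesis by (simp add: algebra_simps flip: exp_add)
    qed
    then show ?thesis by blast
  qed
  have "(\<Sum>\<^sub>\<infinity>m\<in>int_lattice. theta_weight A t \<tau>' (a + m) * H (Im \<tau>') d (a + m) * cis (2 * pi * bform A (a + m) b)) =
     (\<Sum>\<^sub>\<infinity>p\<in>dual_lattice A. theta_weight A t \<tau> (b + p) * (H (Im \<tau>) d (b + p) * (\<i> * \<sigma>) ^ d) * (K * cis (- (2 * pi * bform A (b + p) a))))"
  proof (rule coefficient_extraction)
    show "\<exists>M. M summable_on int_lattice \<and> (\<forall>m\<in>int_lattice. \<forall>n. (\<Sum>k<n. norm (theta_weight A t \<tau>' (a + m) * H (Im \<tau>') k (a + m) * cis (2 * pi * bform A (a + m) b)) * r ^ k) \<le> M m)"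
      if "r \<ge> 0" for r
    proof -
      obtain \<alpha> \<beta> where ab: "\<And>v n. (\<Sum>k<n. norm (H (Im \<tau>') k v * 1 ^ k * of_real r ^ k)) \<le> exp (\<alpha> * norm v + \<beta>)"
        using H_le[OF \<open>r \<ge> 0\<close>] by blast
      obtain F where F: "exp_decay F" "\<And>v. F v \<ge> 0"
        "\<And>u v n. norm u \<le> 1 \<Longrightarrow> (\<Sum>k<n. norm (theta_weight A t \<tau>' v * (H (Im \<tau>') k v * 1 ^ k * of_real r ^ k) * u)) \<le> F v"
        by (rule theta_weight_sum_le[OF t \<tau>' ab, where U=1]) (rule that)
      show ?thesis
        using F(3)[of "cis (2 * pi * bform A (a + m) b)" for m] \<open>r \<ge> 0\<close> exp_decay_summable[OF F(1,2), of a]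
        by (intro exI[of _ "\<lambda>m. F (a + m)"]) (simp add: norm_mult norm_power mult_ac)
    qed
    show "\<exists>M. M summable_on dual_lattice A \<and> (\<forall>p\<in>dual_lattice A. \<forall>n. (\<Sum>k<n. norm (theta_weight A t \<tau> (b + p) * (H (Im \<tau>) k (b + p) * (\<i> * \<sigma>) ^ k) * (K * cis (- (2 * pi * bform A (b + p) a)))) * r ^ k) \<le> M p)"
      if "r \<ge> 0" for r
    proof -
      obtain \<alpha> \<beta> where ab: "\<And>v n. (\<Sum>k<n. norm (H (Im \<tau>) k v * (\<i> * \<sigma>) ^ k * of_real r ^ k)) \<le> exp (\<alpha> * norm v + \<beta>)"
        using H_le[OF \<open>r \<ge> 0\<close>] by blast
      obtain F where F: "exp_decay F" "\<And>v. F v \<ge> 0"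
        "\<And>u v n. norm u \<le> norm K \<Longrightarrow> (\<Sum>k<n. norm (theta_weight A t \<tau> v * (H (Im \<tau>) k v * (\<i> * \<sigma>) ^ k * of_real r ^ k) * u)) \<le> F v"
        by (rule theta_weight_sum_le[OF t \<tau> ab, where U="norm K"]) (rule that)
      show ?thesis
        using F(3)[of "K * cis (- (2 * pi * bform A (b + p) a))" for p] \<open>r \<ge> 0\<close> exp_decay_summable_dual[OF F(1,2), of b]
        by (intro exI[of _ "\<lambda>p. F (b + p)"]) (simp add: norm_mult norm_power mult_ac)
    qed
    show "(\<lambda>k. theta_weight A t \<tau>' (a + m) * H (Im \<tau>') k (a + m) * cis (2 * pi * bform A (a + m) b) * X ^ k) sums
        (P \<tau>' X (a + m) * cis (2 * pi * bform A (a + m) b))" for m X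
      using sums_mult2[OF H_sums[OF \<tau>', of "a + m" X], of "cis (2 * pi * bform A (a + m) b)"] by (simp add: mult_ac)
    show "(\<lambda>k. theta_weight A t \<tau> (b + p) * (H (Im \<tau>) k (b + p) * (\<i> * \<sigma>) ^ k) * (K * cis (- (2 * pi * bform A (b + p) a))) * X ^ k) sums
        (K * (P \<tau> (\<i> * \<sigma> * X) (b + p) * cis (- (2 * pi * bform A (b + p) a))))" for p X
      using sums_mult2[OF H_sums[OF \<tau>, of "b + p" "\<i> * \<sigma> * X"], of "K * cis (- (2 * pi * bform A (b + p) a))"]
      by (simp add: power_mult_distrib mult_ac)
    show "(\<Sum>\<^sub>\<infinity>m\<in>int_lattice. P \<tau>' X (a + m) * cis (2 * pi * bform A (a + m) b)) =
       (\<Sum>\<^sub>\<infinity>p\<in>dual_lattice A. K * (P \<tau> (\<i> * \<sigma> * X) (b + p) * cis (- (2 * pi * bform A (b + p) a))))" for X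
      unfolding infsum_cmult_right' K_def P_def \<tau>'_def \<sigma>_def by (rule linear_exponential_inversion[OF t \<tau>])
  qed
  moreover have "theta_weight A t \<tau> (b + p) * (H (Im \<tau>) d (b + p) * (\<i> * \<sigma>) ^ d) * (K * cis (- (2 * pi * bform A (b + p) a))) =
     (K * (\<i> * \<sigma>) ^ d) * (G \<tau> (b + p) * cis (- (2 * pi * bform A (b + p) a)))" for p
    unfolding G_def H_def by (simp only: mult_ac)
  ultimately have "(\<Sum>\<^sub>\<infinity>m\<in>int_lattice. G \<tau>' (a + m) * cis (2 * pi * bform A (a + m) b)) =
     (K * (\<i> * \<sigma>) ^ d) * (\<Sum>\<^sub>\<infinity>p\<in>dual_lattice A. G \<tau> (b + p) * cis (- (2 * pi * bform A (b + p) a)))"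
    by (simp only: infsum_cmult_right' G_def H_def)
  moreover have "K * (\<i> * \<sigma>) ^ d = theta_factor A \<tau> * cis (2 * pi * bform A a b) * (\<i> * \<sigma>) ^ (d + 1)"
    by (simp add: K_def)
  ultimately show ?thesis unfolding \<tau>'_def \<sigma>_def by (simp only:)
qed

end

section \<open>Paths in the cone\<close>

text \<open>The exponential series dominates its term of index \<open>N\<close>. The point is the
  free choice of \<open>\<delta>\<close>: polynomial growth costs an arbitrarily small part of an
  exponential decay.\<close>

lemma power_le_exp:
  fixes x \<delta> :: real
  assumes "x \<ge> 0" "\<delta> > 0"
  shows "(1 + x) ^ N \<le> fact N / \<delta> ^ N * exp \<delta> * exp (\<delta> * x)"
proof -
  have "(\<delta> * (1 + x)) ^ N / fact N \<le> exp (\<delta> * (1 + x))"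
  proof -
    have s: "(\<lambda>i. (\<delta> * (1 + x)) ^ i / fact i) sums exp (\<delta> * (1 + x))"
      using exp_converges[of "\<delta> * (1 + x)"] by (simp add: field_simps)
    have "(\<Sum>i\<in>{N}. (\<delta> * (1 + x)) ^ i / fact i) \<le> (\<Sum>i. (\<delta> * (1 + x)) ^ i / fact i)"
      using s assms by (intro sum_le_suminf) (auto simp: sums_iff)
    then show ?thesis using s by (simp add: sums_iff)
  qed
  then have "\<delta> ^ N * (1 + x) ^ N \<le> fact N * exp (\<delta> * (1 + x))"
    by (simp add: power_mult_distrib divide_le_eq mult.commute)
  then have "(1 + x) ^ N \<le> fact N * exp (\<delta> * (1 + x)) / \<delta> ^ N"
    using assms by (simp add: le_divide_eq mult.commute)
  then show ?thesis by (simp add: distrib_left exp_add mult.assoc)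
qed

section \<open>The error function and its derivatives at infinity\<close>

lemma E_fun_at_top: "(E_fun \<longlongrightarrow> 1) at_top"
proof -
  have "has_bochner_integral lborel (\<lambda>x::real. indicator {0..} x *\<^sub>R exp (- x\<^sup>2)) (sqrt pi / 2)"
    by (rule gaussian_moment_0)
  \<comment> \<open>Scaling the variable by \<open>sqrt pi\<close> turns the half-line integral
    \<open>sqrt pi / 2\<close> into \<open>1 / 2\<close>.\<close>
  then have "has_bochner_integral lborel (\<lambda>x::real. indicator {0..} (0 + sqrt pi * x) *\<^sub>R exp (- (0 + sqrt pi * x)\<^sup>2)) ((sqrt pi / 2) /\<^sub>R \<bar>sqrt pi\<bar>)"
    by (subst (asm) lborel_has_bochner_integral_real_affine_iff[of "sqrt pi" _ _ 0]) auto
  moreover have "indicator {0..} (0 + sqrt pi * x) *\<^sub>R exp (- (0 + sqrt pi * x)\<^sup>2) = indicator {0..} x *\<^sub>R exp (- pi * x\<^sup>2)" for x :: real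
    by (simp add: power_mult_distrib indicator_def zero_le_mult_iff not_le)
  ultimately have "has_bochner_integral lborel (\<lambda>x::real. indicator {0..} x *\<^sub>R exp (- pi * x\<^sup>2)) (1 / 2)"
    by simp
  then have int: "set_integrable lborel {0..} (\<lambda>x::real. exp (- pi * x\<^sup>2))" "(LINT x:{0..}|lborel. exp (- pi * x\<^sup>2)) = 1 / 2"
    by (simp_all add: set_integrable_def set_lebesgue_integral_def has_bochner_integral_iff)
  have "((\<lambda>z. LINT x:{0..z}|lborel. exp (- pi * x\<^sup>2)) \<longlongrightarrow> (LINT x:{0..}|lborel. exp (- pi * x\<^sup>2))) at_top"
    using int(1) by (intro tendsto_set_lebesgue_integral_at_top) auto
  then have "((\<lambda>z. 2 * (LINT x:{0..z}|lborel. exp (- pi * x\<^sup>2))) \<longlongrightarrow> 2 * (1 / 2)) at_top"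
    unfolding int(2) by (intro tendsto_intros)
  moreover have "\<forall>\<^sub>F z in at_top. 2 * (LINT x:{0..z}|lborel. exp (- pi * x\<^sup>2)) = E_fun z"
    using eventually_ge_at_top[of 0]
    by eventually_elim (simp add: E_fun_def interval_integral_Icc zero_ereal_def)
  ultimately show ?thesis using tendsto_cong by fastforce
qed

lemma E_fun_at_bot: "(E_fun \<longlongrightarrow> - 1) at_bot"
proof -
  have "((\<lambda>z. - E_fun (- z)) \<longlongrightarrow> - 1) at_bot"
    by (intro tendsto_minus filterlim_compose[OF E_fun_at_top filterlim_uminus_at_top_at_bot])
  moreover have "- E_fun (- z) = E_fun z" for z using E_fun_deriv_uminus[of 0 z] by simp
  ultimately show ?thesis by simp
qed

text \<open>Towards an isotropic end the powers of \<open>B(t, h)\<close> in \<open>E_kernel\<close>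
  grow at most at the rate of the same powers of \<open>z\<close>; here the Gaussian in the
  derivatives is shown to win.\<close>

lemma E_fun_deriv_power_at_infinity: "((\<lambda>z. (deriv ^^ Suc k) E_fun z * z ^ Suc k) \<longlongrightarrow> 0) at_infinity"
proof -
  define C where "C = 2 * fact k * (real (Suc k) * (1 + 2 * pi) ^ k * (1 + 4 * pi\<^sup>2) ^ k)"
  define N where "N = k + Suc k"
  have bound: "norm ((deriv ^^ Suc k) E_fun z * z ^ Suc k) \<le> C * (fact N * exp 1) * exp (\<bar>z\<bar> - pi * z\<^sup>2)" for z
  proof -
    have "\<bar>hermite k (- 2 * pi * z) (4 * pi\<^sup>2)\<bar> \<le> real (Suc k) * ((1 + 2 * pi * \<bar>z\<bar>) ^ k * (1 + 4 * pi\<^sup>2) ^ k)"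
      using norm_hermite_le_poly[of k "- 2 * pi * z" "4 * pi\<^sup>2"] by (simp add: abs_mult)
    also have "\<dots> \<le> real (Suc k) * (((1 + 2 * pi) * (1 + \<bar>z\<bar>)) ^ k * (1 + 4 * pi\<^sup>2) ^ k)"
      by (intro mult_left_mono mult_right_mono power_mono) (auto simp: algebra_simps intro!: add_nonneg_nonneg)
    finally have h: "\<bar>hermite k (- 2 * pi * z) (4 * pi\<^sup>2)\<bar> \<le> real (Suc k) * (1 + 2 * pi) ^ k * (1 + 4 * pi\<^sup>2) ^ k * (1 + \<bar>z\<bar>) ^ k"
      by (simp add: power_mult_distrib mult_ac)
    have "norm ((deriv ^^ Suc k) E_fun z * z ^ Suc k) = 2 * fact k * exp (- pi * z\<^sup>2) * \<bar>hermite k (- 2 * pi * z) (4 * pi\<^sup>2)\<bar> * \<bar>z\<bar> ^ Suc k"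
      unfolding E_fun_higher_deriv by (simp add: abs_mult power_abs)
    also have "\<dots> \<le> 2 * fact k * exp (- pi * z\<^sup>2) * (real (Suc k) * (1 + 2 * pi) ^ k * (1 + 4 * pi\<^sup>2) ^ k * (1 + \<bar>z\<bar>) ^ k) * (1 + \<bar>z\<bar>) ^ Suc k"
      by (intro mult_mono mult_left_mono h power_mono) auto
    also have "\<dots> = C * exp (- pi * z\<^sup>2) * (1 + \<bar>z\<bar>) ^ N"
      by (simp add: C_def N_def power_add)
    also have "\<dots> \<le> C * exp (- pi * z\<^sup>2) * (fact N / 1 ^ N * exp 1 * exp (1 * \<bar>z\<bar>))"
      by (intro mult_left_mono power_le_exp) (auto simp: C_def)
    also have "\<dots> = C * (fact N * exp 1) * exp (\<bar>z\<bar> - pi * z\<^sup>2)"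
      by (simp add: exp_diff exp_minus field_simps)
    finally show ?thesis .
  qed
  have "((\<lambda>z::real. exp (\<bar>z\<bar> - pi * z\<^sup>2)) \<longlongrightarrow> 0) at_infinity"
  proof (rule tendsto_sandwich[of "\<lambda>_. 0" _ _ "\<lambda>z. exp (1 - \<bar>z\<bar>)"])
    show "\<forall>\<^sub>F z in at_infinity. exp (\<bar>z\<bar> - pi * z\<^sup>2) \<le> exp (1 - \<bar>z\<bar>)" for z :: real
    proof (intro always_eventually allI)
      fix z :: real
      have "2 * \<bar>z\<bar> \<le> 1 + z\<^sup>2" using zero_le_power2[of "\<bar>z\<bar> - 1"] by (simp add: power2_eq_square algebra_simps)
      moreover have "z\<^sup>2 \<le> pi * z\<^sup>2" using pi_gt3 mult_right_mono[of 1 pi "z\<^sup>2"] by simp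
      ultimately show "exp (\<bar>z\<bar> - pi * z\<^sup>2) \<le> exp (1 - \<bar>z\<bar>)" by simp
    qed
    show "((\<lambda>z::real. exp (1 - \<bar>z\<bar>)) \<longlongrightarrow> 0) at_infinity"
    proof -
      have "filterlim (\<lambda>z::real. \<bar>z\<bar>) at_top at_infinity"
        using filterlim_norm_at_top[where 'a=real] unfolding real_norm_def .
      then have "filterlim (\<lambda>z::real. - \<bar>z\<bar>) at_bot at_infinity"
        by (simp add: filterlim_uminus_at_bot)
      from tendsto_mult_right_zero[OF filterlim_compose[OF exp_at_bot this], of "exp 1"] show ?thesis
        by (simp add: exp_diff exp_minus divide_inverse)
    qed
  qed auto
  then have "((\<lambda>z::real. C * (fact N * exp 1) * exp (\<bar>z\<bar> - pi * z\<^sup>2)) \<longlongrightarrow> 0) at_infinity"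
    by (rule tendsto_mult_right_zero)
  then show ?thesis
    by (rule Lim_null_comparison[rotated]) (use bound in \<open>auto intro!: always_eventually\<close>)
qed

text \<open>Differentiating the error function factor raises its order, and differentiating the
  power of \<open>w\<close> lowers the exponent; both resulting sums are convolutions of
  \<open>hermite\<close> values and collapse by \<open>hermite_add\<close>. No error function
  survives: a Gaussian in \<open>B(t, v)\<close> times a polynomial remains.\<close>

lemma E_kernel_has_derivative:
  fixes t :: "real \<Rightarrow> real^'n"
  assumes A: "transpose A = A" and y: "y > 0"
    and t: "\<And>v. ((\<lambda>s. bform A (t s) v) has_real_derivative bform A e v) (at s)"
    and orth: "bform A (t s) e = 0"
  shows "((\<lambda>s. E_kernel A d h y (t s) v) has_real_derivative
    2 * fact d * sqrt y * exp (- pi * y * (bform A (t s) v)\<^sup>2) * hermite_kernel A (t s) d y h e v) (at s)"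
proof -
  define b q where "b = bform A h v" and "q = qform A h / y"
  define w where "w = (\<lambda>s. - bform A (t s) h / (4 * pi * sqrt y))"
  define w' where "w' = - bform A e h / (4 * pi * sqrt y)"
  define Z where "Z = sqrt y * bform A (t s) v"
  define D where "D = (\<lambda>k. (deriv ^^ k) E_fun)"
  define G where "G = 2 * exp (- pi * Z\<^sup>2)"
  have sy: "sqrt y > 0" "sqrt y * sqrt y = y" using y by auto
  have dw: "(w has_real_derivative w') (at s)"
    unfolding w_def w'_def by (intro DERIV_cdivide DERIV_minus t)
  have dD: "((\<lambda>s. D k (sqrt y * bform A (t s) v)) has_real_derivative D (Suc k) Z * (sqrt y * bform A e v)) (at s)" for k
    unfolding D_def Z_def by (rule DERIV_chain2[OF E_fun_deriv_has_derivative]) (intro DERIV_cmult t)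
  have dterm: "((\<lambda>s. D k (sqrt y * bform A (t s) v) * w s ^ k / fact k * hermite (d - k) b q) has_real_derivative
      (D (Suc k) Z * w s ^ k / fact k * (sqrt y * bform A e v) + D k Z * (real k * w s ^ (k - 1) / fact k) * w') * hermite (d - k) b q) (at s)" for k
  proof -
    have "((\<lambda>s. w s ^ k) has_real_derivative real k * w s ^ (k - 1) * w') (at s)"
      using DERIV_power[OF dw, of k] by (simp add: mult_ac)
    from DERIV_mult[OF dD[of k] this]
    have "((\<lambda>s. D k (sqrt y * bform A (t s) v) * w s ^ k / fact k * hermite (d - k) b q) has_real_derivative
      (D (Suc k) Z * (sqrt y * bform A e v) * w s ^ k + real k * w s ^ (k - 1) * w' * D k (sqrt y * bform A (t s) v)) / fact k * hermite (d - k) b q) (at s)"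
      by (intro DERIV_cdivide DERIV_cmult_right)
    then show ?thesis by (simp add: Z_def add_divide_distrib mult_ac)
  qed
  have F1: "((\<lambda>s. E_kernel A d h y (t s) v) has_real_derivative
     fact d * (\<Sum>k\<le>d. (D (Suc k) Z * w s ^ k / fact k * (sqrt y * bform A e v) + D k Z * (real k * w s ^ (k - 1) / fact k) * w') * hermite (d - k) b q)) (at s)"
    unfolding E_kernel_def b_def[symmetric] q_def[symmetric] w_def D_def
    by (intro DERIV_cmult DERIV_sum dterm[unfolded w_def D_def])
  have F2: "(\<Sum>k\<le>d. (D (Suc k) Z * w s ^ k / fact k * (sqrt y * bform A e v) + D k Z * (real k * w s ^ (k - 1) / fact k) * w') * hermite (d - k) b q) =
     sqrt y * bform A e v * (G * hermite d (- 2 * pi * Z * w s + b) (4 * pi\<^sup>2 * (w s)\<^sup>2 + q)) + w' * (G * hermite_pred d (- 2 * pi * Z * w s + b) (4 * pi\<^sup>2 * (w s)\<^sup>2 + q))"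
  proof -
    have sc: "D (Suc k) Z * w s ^ k / fact k = G * hermite k (- 2 * pi * Z * w s) (4 * pi\<^sup>2 * (w s)\<^sup>2)" for k
      unfolding D_def G_def by (rule E_fun_higher_deriv_scaled)
    have "(\<Sum>k\<le>m. D (Suc k) Z * w s ^ k / fact k * hermite (m - k) b q) = G * hermite m (- 2 * pi * Z * w s + b) (4 * pi\<^sup>2 * (w s)\<^sup>2 + q)" for m
      unfolding sc mult.assoc by (simp add: sum_distrib_left[symmetric] hermite_add)
    note S = this
    \<comment> \<open>The term \<open>k = 0\<close> drops out, and shifting the index reduces this
      sum to \<open>S\<close> in degree \<open>d - 1\<close>.\<close>
    have 2: "(\<Sum>k\<le>d. D k Z * (real k * w s ^ (k - 1) / fact k) * hermite (d - k) b q) = G * hermite_pred d (- 2 * pi * Z * w s + b) (4 * pi\<^sup>2 * (w s)\<^sup>2 + q)"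
    proof (cases d)
      case (Suc m)
      have "real (Suc k) * w s ^ k / fact (Suc k) = w s ^ k / fact k" for k
        by (simp del: of_nat_Suc)
      then have "(\<Sum>k\<le>d. D k Z * (real k * w s ^ (k - 1) / fact k) * hermite (d - k) b q) =
          (\<Sum>k\<le>m. D (Suc k) Z * w s ^ k / fact k * hermite (m - k) b q)"
        unfolding Suc sum.atMost_Suc_shift by (simp del: of_nat_Suc fact_Suc)
      then show ?thesis unfolding S by (simp add: Suc hermite_pred_def)
    qed (simp add: hermite_pred_def)
    have "(\<Sum>k\<le>d. (D (Suc k) Z * w s ^ k / fact k * (sqrt y * bform A e v) + D k Z * (real k * w s ^ (k - 1) / fact k) * w') * hermite (d - k) b q) =
       sqrt y * bform A e v * (\<Sum>k\<le>d. D (Suc k) Z * w s ^ k / fact k * hermite (d - k) b q) +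
       w' * (\<Sum>k\<le>d. D k Z * (real k * w s ^ (k - 1) / fact k) * hermite (d - k) b q)"
      unfolding sum_distrib_left sum.distrib[symmetric] by (intro sum.cong refl) (simp add: algebra_simps)
    then show ?thesis unfolding S 2 .
  qed
  \<comment> \<open>The shifts produced by the addition theorem are the projection terms:
    \<open>- 2 * pi * Z * w s\<close> is \<open>B(t, v) * B(t, h) / 2\<close>, and
    \<open>4 * pi ^ 2 * w s ^ 2\<close> is \<open>B(t, h) ^ 2 / (4 * y)\<close>. This is the role of
    the constant \<open>4 * pi\<close> in \<open>E_kernel\<close>.\<close>
  have e1: "- 2 * pi * Z * w s + b = perp_form A (t s) h v"
    using sy(1) by (simp add: Z_def w_def b_def perp_form_def)
  have e2: "4 * pi\<^sup>2 * (w s)\<^sup>2 + q = perp_form A (t s) h h / (2 * y)"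
    using y by (simp add: w_def q_def perp_form_def qform_def power_divide power_mult_distrib field_simps power2_eq_square)
  have e3: "perp_form A (t s) e v = bform A e v" "perp_form A (t s) h e = bform A e h"
    using orth bform_commute[OF A, of e h] by (simp_all add: perp_form_def)
  have e4: "w' = - sqrt y * (bform A e h / (4 * pi * y))"
    using y by (simp add: w'_def field_simps)
  have e5: "G = 2 * exp (- pi * y * (bform A (t s) v)\<^sup>2)"
    using y by (simp add: G_def Z_def power_mult_distrib mult.assoc)
  have "2 * fact d * sqrt y * exp (- pi * y * (bform A (t s) v)\<^sup>2) * hermite_kernel A (t s) d y h e v =
    fact d * (sqrt y * bform A e v * (G * hermite d (- 2 * pi * Z * w s + b) (4 * pi\<^sup>2 * (w s)\<^sup>2 + q)) +
      w' * (G * hermite_pred d (- 2 * pi * Z * w s + b) (4 * pi\<^sup>2 * (w s)\<^sup>2 + q)))"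
    unfolding hermite_kernel_def e1 e2 e3 e4 e5 by (simp add: algebra_simps)
  then show ?thesis using F1[unfolded F2] by (simp only:)
qed

definition null_velocity :: "real^'n \<Rightarrow> real^'n \<Rightarrow> real \<Rightarrow> real^'n" where
  "null_velocity n n' s = (- 1 / (2 * s * sqrt s)) *\<^sub>R n + (1 / (2 * sqrt s)) *\<^sub>R n'"

context lorentzian
begin

lemma null_path_has_derivative:
  assumes "s > 0"
  shows "((\<lambda>s. bform A (null_path n n' s) v) has_real_derivative bform A (null_velocity n n' s) v) (at s)"
proof -
  have "((\<lambda>s. 1 / sqrt s * bform A n v + sqrt s * bform A n' v) has_real_derivative
      - 1 / (2 * s * sqrt s) * bform A n v + 1 / (2 * sqrt s) * bform A n' v) (at s)"
    using assms by (auto intro!: derivative_eq_intros simp: field_simps)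
  then show ?thesis by (simp only: null_path_def null_velocity_def bform_simps)
qed

lemma null_path_velocity_orthogonal:
  assumes "null_pair A n n'" "s > 0"
  shows "bform A (null_path n n' s) (null_velocity n n' s) = 0"
proof -
  have "bform A n n = 0" "bform A n' n' = 0" "bform A n n' = - 1" "bform A n' n = - 1"
    using assms bform_commute[OF A_sym, of n' n] by (auto simp: null_pair_def qform_def)
  then show ?thesis
    using assms(2) by (simp add: null_path_def null_velocity_def bform_simps)
qed

lemma E_kernel_null_path_has_derivative:
  assumes "null_pair A n n'" "s > 0" "y > 0"
  shows "((\<lambda>s. E_kernel A d h y (null_path n n' s) v) has_real_derivative
    2 * fact d * sqrt y * exp (- pi * y * (bform A (null_path n n' s) v)\<^sup>2) *
      hermite_kernel A (null_path n n' s) d y h (null_velocity n n' s) v) (at s)"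
  by (intro E_kernel_has_derivative[OF A_sym] null_path_has_derivative null_path_velocity_orthogonal assms)

text \<open>Only \<open>k = 0\<close> survives, where \<open>E_fun\<close> tends to the sign of
  \<open>B(n, v)\<close>. For \<open>k > 0\<close> the diverging factor
  \<open>- B(t, h) / (4 * pi * sqrt y)\<close> is written as \<open>z * r\<close> with convergent
  \<open>r\<close>, and \<open>z ^ k\<close> times the \<open>k\<close>-th derivative tends to
  \<open>0\<close>. Both arguments rest on \<open>B(n, v)\<close> being nonzero.\<close>

lemma E_kernel_tendsto_sgn_kernel:
  assumes u: "bform A n v \<noteq> 0" and y: "y > 0"
  shows "((\<lambda>s. E_kernel A d h y (null_path n n' s) v) \<longlongrightarrow> sgn_kernel A d h y n v) (at_right 0)"
proof -
  define z where "z = (\<lambda>s. sqrt y * bform A (null_path n n' s) v)"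
  define f where "f = (\<lambda>s. bform A n v + s * bform A n' v)"
  define r where "r = (\<lambda>s. - (bform A n h + s * bform A n' h) / (4 * pi * y * f s))"
  have f: "(f \<longlongrightarrow> bform A n v) (at_right 0)" unfolding f_def by (auto intro!: tendsto_eq_intros)
  have pos: "\<forall>\<^sub>F s in at_right 0. s > (0::real)" by (simp add: eventually_at_right_less)
  have fnz: "\<forall>\<^sub>F s in at_right 0. f s \<noteq> 0" using f u tendsto_imp_eventually_ne by blast
  have zf: "z s = (sqrt y * f s) * (1 / sqrt s)" if "s > 0" for s
    using that by (simp add: z_def f_def null_path_def bform_simps field_simps)
  have inv: "filterlim (\<lambda>s. 1 / sqrt s) at_top (at_right (0::real))"
  proof -
    have "((\<lambda>s. sqrt s) \<longlongrightarrow> 0) (at_right (0::real))" by (auto intro!: tendsto_eq_intros)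
    then have "filterlim sqrt (at_right 0) (at_right (0::real))"
      unfolding filterlim_at using pos by (auto elim: eventually_mono)
    then show ?thesis
      using filterlim_compose[OF filterlim_inverse_at_top_right] by (simp add: inverse_eq_divide)
  qed
  have sf: "((\<lambda>s. sqrt y * f s) \<longlongrightarrow> sqrt y * bform A n v) (at_right 0)" by (intro tendsto_intros f)
  have zlim: "((\<lambda>s. E_fun (z s)) \<longlongrightarrow> sgn (bform A n v)) (at_right 0) \<and> filterlim z at_infinity (at_right 0)"
  proof (cases "bform A n v > 0")
    case True
    have "filterlim (\<lambda>s. (sqrt y * f s) * (1 / sqrt s)) at_top (at_right 0)"
      by (rule filterlim_tendsto_pos_mult_at_top[OF sf _ inv]) (use True y in simp)
    then have "filterlim z at_top (at_right 0)"
      by (rule filterlim_mono_eventually) (use pos zf in \<open>auto elim!: eventually_mono\<close>)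
    then show ?thesis
      using True filterlim_compose[OF E_fun_at_top] filterlim_at_top_imp_at_infinity by auto
  next
    case False
    have "filterlim (\<lambda>s. (sqrt y * f s) * (1 / sqrt s)) at_bot (at_right 0)"
      by (rule filterlim_tendsto_neg_mult_at_bot[OF sf _ inv]) (use False u y in \<open>simp add: mult_less_0_iff\<close>)
    then have "filterlim z at_bot (at_right 0)"
      by (rule filterlim_mono_eventually) (use pos zf in \<open>auto elim!: eventually_mono\<close>)
    then show ?thesis
      using False u filterlim_compose[OF E_fun_at_bot] filterlim_at_bot_imp_at_infinity by auto
  qed
  have rlim: "(r \<longlongrightarrow> - bform A n h / (4 * pi * y * bform A n v)) (at_right 0)"
    unfolding r_def using u y by (auto intro!: tendsto_eq_intros f)
  have term0: "((\<lambda>s. (deriv ^^ k) E_fun (z s) * (- bform A (null_path n n' s) h / (4 * pi * sqrt y)) ^ k / fact k * hermite (d - k) (bform A h v) (qform A h / y))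
       \<longlongrightarrow> (if k = 0 then sgn (bform A n v) * hermite d (bform A h v) (qform A h / y) else 0)) (at_right 0)" for k
  proof (cases k)
    case 0
    have "((\<lambda>s. E_fun (z s) * hermite d (bform A h v) (qform A h / y)) \<longlongrightarrow> sgn (bform A n v) * hermite d (bform A h v) (qform A h / y)) (at_right 0)"
      using zlim by (intro tendsto_mult_right) auto
    then show ?thesis using 0 by simp
  next
    case (Suc j)
    have "((\<lambda>s. ((deriv ^^ Suc j) E_fun (z s) * z s ^ Suc j) * r s ^ Suc j / fact k * hermite (d - k) (bform A h v) (qform A h / y)) \<longlongrightarrow>
       0 * (- bform A n h / (4 * pi * y * bform A n v)) ^ Suc j / fact k * hermite (d - k) (bform A h v) (qform A h / y)) (at_right 0)"
      using zlim by (intro tendsto_intros rlim filterlim_compose[OF E_fun_deriv_power_at_infinity]) auto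
    moreover have "\<forall>\<^sub>F s in at_right 0. ((deriv ^^ Suc j) E_fun (z s) * z s ^ Suc j) * r s ^ Suc j / fact k * hermite (d - k) (bform A h v) (qform A h / y) =
       (deriv ^^ k) E_fun (z s) * (- bform A (null_path n n' s) h / (4 * pi * sqrt y)) ^ k / fact k * hermite (d - k) (bform A h v) (qform A h / y)"
      using pos fnz
    proof eventually_elim
      case (elim s)
      have "z s * r s = - bform A (null_path n n' s) h / (4 * pi * sqrt y)"
      proof -
        define x w where "x = sqrt s" and "w = sqrt y"
        have xw: "x > 0" "w > 0" "s = x * x" "y = w * w" using elim y by (auto simp: x_def w_def)
        show ?thesis
          unfolding zf[OF elim(1)] r_def null_path_def bform_simps x_def[symmetric] w_def[symmetric]
          using elim(2) xw(1,2) unfolding xw(3,4) by (simp add: field_simps)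
      qed
      then show ?case by (simp only: Suc mult.assoc power_mult_distrib[symmetric])
    qed
    ultimately show ?thesis using Suc by (auto intro: Lim_transform_eventually)
  qed
  have "((\<lambda>s. E_kernel A d h y (null_path n n' s) v) \<longlongrightarrow> fact d * (\<Sum>k\<le>d. if k = 0 then sgn (bform A n v) * hermite d (bform A h v) (qform A h / y) else 0)) (at_right 0)"
    unfolding E_kernel_def z_def[symmetric] by (intro tendsto_intros term0[unfolded z_def] ) 
  then show ?thesis by (simp add: sgn_kernel_def sum.delta)
qed

end

section \<open>Uniform bounds along a path\<close>

lemma continuous_on_hermite [continuous_intros]:
  fixes f g :: "'a::topological_space \<Rightarrow> real"
  shows "continuous_on S f \<Longrightarrow> continuous_on S g \<Longrightarrow> continuous_on S (\<lambda>s. hermite d (f s) (g s))"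
  unfolding hermite_def by (intro continuous_intros) auto

lemma continuous_on_hermite_pred [continuous_intros]:
  fixes f g :: "'a::topological_space \<Rightarrow> real"
  shows "continuous_on S f \<Longrightarrow> continuous_on S g \<Longrightarrow> continuous_on S (\<lambda>s. hermite_pred d (f s) (g s))"
  by (cases d) (auto simp: hermite_pred_def intro!: continuous_intros)

lemma abs_bform_le: obtains c where "c \<ge> 0" "\<And>v. \<bar>bform A u v\<bar> \<le> c * norm v"
proof -
  have "linear (\<lambda>v. bform A u v)"
    by (rule linearI) (simp_all add: bform_simps)
  then obtain K where "K > 0" "\<And>v. norm (bform A u v) \<le> K * norm v"
    using linear_bounded_pos by blast
  then show ?thesis using that[of K] by simp
qed

context lorentzian
begin

text \<open>The first bracket is free of \<open>s\<close>; the rest exhibits the degeneration at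
  \<open>s = 0\<close>, where the weight of \<open>B(n', v) ^ 2\<close> tends to
  \<open>0\<close>.\<close>

lemma null_majorant_eq:
  assumes np: "null_pair A n n'" and s: "s > 0"
  shows "qform A v + (bform A (null_path n n' s) v)\<^sup>2 / 2 =
    (qform A v + bform A n v * bform A n' v) + ((bform A n v)\<^sup>2 / s + s * (bform A n' v)\<^sup>2) / 2"
proof -
  define x where "x = sqrt s"
  have x: "x > 0" "s = x * x" using s by (auto simp: x_def)
  show ?thesis
    unfolding null_path_def bform_simps x_def[symmetric] unfolding x(2)
    using x(1) by (simp add: field_simps power2_eq_square)
qed

text \<open>\<open>B(n', v)\<close> enters through its absolute value and not its square, because
  near \<open>s = 0\<close> the majorant yields only a linear bound in it. The starting point is the
  majorant at \<open>s = 1\<close>, where \<open>t = n + n'\<close>.\<close>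

lemma null_majorant_ge:
  assumes np: "null_pair A n n'"
  obtains \<kappa> where "\<kappa> > 0"
    "\<And>v. \<kappa> * norm v \<le> 1 + (qform A v + bform A n v * bform A n' v) + (bform A n v)\<^sup>2 + \<bar>bform A n' v\<bar>"
    "\<And>v. qform A v + bform A n v * bform A n' v \<ge> 0"
proof -
  define t where "t = null_path n n' 1"
  have t: "qform A t = - 1" unfolding t_def by (rule qform_null_path[OF A_sym np]) simp
  have tn: "t = n + n'" by (simp add: t_def null_path_def)
  obtain \<kappa> where \<kappa>: "\<kappa> > 0" "\<And>v. \<kappa> * (norm v)\<^sup>2 \<le> qform A v + (bform A t v)\<^sup>2 / 2"
    by (rule majorant_pos[OF A_sig A_sym t]) (rule that)
  have B: "bform A n n = 0" "bform A n' n' = 0" "bform A n n' = - 1" "bform A n' n = - 1" "qform A n = 0" "qform A n' = 0"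
    using np bform_commute[OF A_sym, of n' n] by (auto simp: null_pair_def qform_def)
  have N: "qform A v + bform A n v * bform A n' v \<ge> 0" for v
  proof -
    \<comment> \<open>The component of \<open>v\<close> orthogonal to the plane of \<open>n\<close>
      and \<open>n'\<close>; the bracket is its value under \<open>Q\<close>.\<close>
    define w where "w = v + (bform A n v *\<^sub>R n' + bform A n' v *\<^sub>R n)"
    have "bform A t w = 0" by (simp add: tn w_def bform_simps B)
    moreover have "0 \<le> \<kappa> * (norm w)\<^sup>2" using \<kappa>(1) by simp
    ultimately have "qform A w \<ge> 0" using \<kappa>(2)[of w] by simp
    moreover have "qform A w = qform A v + bform A n v * bform A n' v"
      using bform_commute[OF A_sym, of v n] bform_commute[OF A_sym, of v n']
      by (simp add: w_def qform_add[OF A_sym] qform_scaleR bform_simps B)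
    ultimately show ?thesis by simp
  qed
  have "sqrt \<kappa> * norm v \<le> 1 + (qform A v + bform A n v * bform A n' v) + (bform A n v)\<^sup>2 + \<bar>bform A n' v\<bar>" for v
  proof (rule power2_le_imp_le)
    define x u u' where "x = qform A v + bform A n v * bform A n' v" and "u = (bform A n v)\<^sup>2" and "u' = \<bar>bform A n' v\<bar>"
    have nn: "x \<ge> 0" "u \<ge> 0" "u' \<ge> 0" using N by (auto simp: x_def u_def u'_def)
    have "\<kappa> * (norm v)\<^sup>2 \<le> x + (u + u'\<^sup>2) / 2"
      using \<kappa>(2)[of v] null_majorant_eq[OF np, of 1 v] by (simp add: t_def x_def u_def u'_def)
    also have "\<dots> \<le> (1 + x + u + u')\<^sup>2"
    proof -
      have "(1 + x + u + u')\<^sup>2 = 1 + 2 * (x + u + u') + (x + u)\<^sup>2 + 2 * (x + u) * u' + u'\<^sup>2"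
        by (simp add: power2_eq_square algebra_simps)
      then show ?thesis using nn by (simp add: mult_nonneg_nonneg add_nonneg_nonneg)
    qed
    finally show "(sqrt \<kappa> * norm v)\<^sup>2 \<le> (1 + (qform A v + bform A n v * bform A n' v) + (bform A n v)\<^sup>2 + \<bar>bform A n' v\<bar>)\<^sup>2"
      using \<kappa>(1) by (simp add: power_mult_distrib x_def u_def u'_def)
    show "0 \<le> 1 + (qform A v + bform A n v * bform A n' v) + (bform A n v)\<^sup>2 + \<bar>bform A n' v\<bar>"
      using nn by (simp add: x_def u_def u'_def)
  qed
  then show ?thesis using that[of "sqrt \<kappa>"] \<kappa>(1) N by simp
qed

text \<open>If \<open>s\<close> stays above a positive \<open>s0\<close>, both squares keep a
  positive weight. Otherwise \<open>u = B(n, v)\<close> is bounded away from \<open>0\<close>: with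
  \<open>u' = B(n', v)\<close>, the sum \<open>u ^ 2 / s + s * u' ^ 2\<close> is at least
  \<open>2 * \<bar>u\<bar> * \<bar>u'\<bar>\<close>, hence linear in \<open>\<bar>u'\<bar>\<close>,
  and \<open>u ^ 2 / s\<close> is at least \<open>\<epsilon> ^ 2 / s\<close>. The gain
  \<open>\<kappa> / s\<close> is what later absorbs powers of \<open>1 / s\<close>.\<close>

lemma null_majorant_bound:
  assumes np: "null_pair A n n'" and s1: "s1 > 0" and s0: "s0 \<ge> 0" and \<epsilon>: "\<epsilon> > 0"
  obtains \<kappa> C where "\<kappa> > 0"
    "\<And>s v. 0 < s \<Longrightarrow> s < s1 \<Longrightarrow> s0 \<le> s \<Longrightarrow> s0 > 0 \<or> \<bar>bform A n v\<bar> \<ge> \<epsilon> \<Longrightarrow>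
      \<kappa> * norm v + \<kappa> / s - C \<le> qform A v + (bform A (null_path n n' s) v)\<^sup>2 / 2"
proof -
  obtain \<kappa>0 where \<kappa>0: "\<kappa>0 > 0"
    "\<And>v. \<kappa>0 * norm v \<le> 1 + (qform A v + bform A n v * bform A n' v) + (bform A n v)\<^sup>2 + \<bar>bform A n' v\<bar>"
    "\<And>v. qform A v + bform A n v * bform A n' v \<ge> 0"
    by (rule null_majorant_ge[OF np]) (rule that)
  note result = that
  \<comment> \<open>Reduces the claim to an inequality between real numbers, with \<open>u\<close>
    and \<open>u'\<close> standing for \<open>B(n, v)\<close> and \<open>B(n', v)\<close>.\<close>
  have main: thesis
    if c: "c > 0" "c \<le> 1" and k: "k > 0" and key: "\<And>s u u'. 0 < s \<Longrightarrow> s < s1 \<Longrightarrow> s0 \<le> s \<Longrightarrow> s0 > 0 \<or> \<bar>u\<bar> \<ge> \<epsilon> \<Longrightarrow>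
      c * (u\<^sup>2 + \<bar>u'\<bar>) + k / s - C \<le> (u\<^sup>2 / s + s * u'\<^sup>2) / 2" for c k C
  proof (rule result[of "min (c * \<kappa>0) k" "C + c"])
    show "min (c * \<kappa>0) k > 0" using c k \<kappa>0(1) by simp
    fix s v assume s: "0 < s" "s < s1" "s0 \<le> s" "s0 > 0 \<or> \<bar>bform A n v\<bar> \<ge> \<epsilon>"
    define x where "x = qform A v + bform A n v * bform A n' v"
    have x: "c * x \<le> x" using c \<kappa>0(3)[of v] mult_right_mono[of c 1 x] by (simp add: x_def)
    have "min (c * \<kappa>0) k * norm v \<le> c * (\<kappa>0 * norm v)"
      by (metis min.cobounded1 mult.assoc mult_right_mono norm_ge_zero)
    also have "\<dots> \<le> c * (1 + x + (bform A n v)\<^sup>2 + \<bar>bform A n' v\<bar>)"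
      using c \<kappa>0(2)[of v] by (intro mult_left_mono) (auto simp: x_def)
    finally have 1: "min (c * \<kappa>0) k * norm v \<le> c + c * x + c * ((bform A n v)\<^sup>2 + \<bar>bform A n' v\<bar>)" by (simp add: algebra_simps)
    have 2: "min (c * \<kappa>0) k / s \<le> k / s" using s by (intro divide_right_mono) auto
    show "min (c * \<kappa>0) k * norm v + min (c * \<kappa>0) k / s - (C + c) \<le> qform A v + (bform A (null_path n n' s) v)\<^sup>2 / 2"
      unfolding null_majorant_eq[OF np s(1)] x_def[symmetric]
      using 1 2 x key[OF s, of "bform A n' v"] by linarith
  qed
  have le_s1: "u\<^sup>2 / s1 \<le> u\<^sup>2 / s" if "0 < s" "s < s1" for u s :: real
    using that by (intro divide_left_mono) auto
  show ?thesis
  proof (cases "s0 > 0")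
    case True
    \<comment> \<open>\<open>s < s1\<close> bounds the weight of \<open>u ^ 2\<close> from below and
      \<open>s0 \<le> s\<close> that of \<open>u' ^ 2\<close>; the summand \<open>1 / s0\<close> of
      the constant pays for the gain \<open>1 / s\<close>.\<close>
    define c where "c = min 1 (min (1 / (2 * s1)) s0)"
    have c: "c > 0" "c \<le> 1" "c \<le> 1 / (2 * s1)" "c \<le> s0" using s1 True by (auto simp: c_def)
    show ?thesis
    proof (rule main[OF c(1,2), of 1 "s0 / 2 + 1 / s0"])
      fix s u u' :: real assume s: "0 < s" "s < s1" "s0 \<le> s"
      have "c * u\<^sup>2 \<le> 1 / (2 * s1) * u\<^sup>2" using c by (intro mult_right_mono) auto
      also have "\<dots> \<le> u\<^sup>2 / s / 2" using le_s1[OF s(1,2), of u] by simp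
      finally have 1: "c * u\<^sup>2 \<le> u\<^sup>2 / s / 2" .
      have "2 * \<bar>u'\<bar> \<le> 1 + u'\<^sup>2" using zero_le_power2[of "\<bar>u'\<bar> - 1"] by (simp add: power2_eq_square algebra_simps)
      then have "s0 * (2 * \<bar>u'\<bar>) \<le> s0 * (1 + u'\<^sup>2)" using True by (intro mult_left_mono) auto
      moreover have "s0 * u'\<^sup>2 \<le> s * u'\<^sup>2" using s by (intro mult_right_mono) auto
      moreover have "c * \<bar>u'\<bar> \<le> s0 * \<bar>u'\<bar>" using c by (intro mult_right_mono) auto
      ultimately have 2: "c * \<bar>u'\<bar> \<le> s0 / 2 + s * u'\<^sup>2 / 2" by (simp add: algebra_simps)
      have "1 / s \<le> 1 / s0" using s True by (intro divide_left_mono) auto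
      with 1 2 show "c * (u\<^sup>2 + \<bar>u'\<bar>) + 1 / s - (s0 / 2 + 1 / s0) \<le> (u\<^sup>2 / s + s * u'\<^sup>2) / 2"
        by (simp add: algebra_simps add_divide_distrib)
    qed simp
  next
    case False
    \<comment> \<open>The available half of \<open>u ^ 2 / s\<close> is spent in three equal parts:
      on \<open>c * u ^ 2\<close>, on \<open>c * \<bar>u'\<bar>\<close> and on the gain
      \<open>\<epsilon> ^ 2 / 6 / s\<close>.\<close>
    define c where "c = min 1 (min (1 / (6 * s1)) (\<epsilon> / 3))"
    have c: "c > 0" "c \<le> 1" "c \<le> 1 / (6 * s1)" "c \<le> \<epsilon> / 3" using s1 \<epsilon> by (auto simp: c_def)
    show ?thesis
    proof (rule main[OF c(1,2), of "\<epsilon>\<^sup>2 / 6" 0])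
      fix s u u' :: real assume s: "0 < s" "s < s1" "s0 \<le> s" "s0 > 0 \<or> \<bar>u\<bar> \<ge> \<epsilon>"
      then have u: "\<bar>u\<bar> \<ge> \<epsilon>" using False by simp
      have "c * u\<^sup>2 \<le> 1 / (6 * s1) * u\<^sup>2" using c by (intro mult_right_mono) auto
      also have "\<dots> \<le> u\<^sup>2 / s / 6" using le_s1[OF s(1,2), of u] by simp
      finally have 1: "c * u\<^sup>2 \<le> u\<^sup>2 / s / 6" .
      have "\<epsilon>\<^sup>2 \<le> u\<^sup>2" using u \<epsilon> by (metis abs_le_square_iff abs_of_pos)
      then have 2: "\<epsilon>\<^sup>2 / s \<le> u\<^sup>2 / s" using s by (intro divide_right_mono) auto
      define x where "x = sqrt s"
      have x: "x > 0" "s = x * x" using s by (auto simp: x_def)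
      have "0 \<le> (\<bar>u\<bar> / x - x * \<bar>u'\<bar>)\<^sup>2" by simp
      also have "\<dots> = u\<^sup>2 / s + s * u'\<^sup>2 - 2 * (\<bar>u\<bar> * \<bar>u'\<bar>)"
        unfolding x(2) using x(1) by (simp add: power2_diff power_divide power_mult_distrib) (simp add: power2_eq_square)
      finally have "2 * (\<bar>u\<bar> * \<bar>u'\<bar>) \<le> u\<^sup>2 / s + s * u'\<^sup>2" by simp
      moreover have "\<epsilon> * \<bar>u'\<bar> \<le> \<bar>u\<bar> * \<bar>u'\<bar>" using u by (intro mult_right_mono) auto
      moreover have "c * \<bar>u'\<bar> \<le> \<epsilon> / 3 * \<bar>u'\<bar>" using c by (intro mult_right_mono) auto
      ultimately have 3: "c * \<bar>u'\<bar> \<le> (u\<^sup>2 / s + s * u'\<^sup>2) / 6" by simp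
      have "s * u'\<^sup>2 \<ge> 0" using s by simp
      with 1 2 3 show "c * (u\<^sup>2 + \<bar>u'\<bar>) + \<epsilon>\<^sup>2 / 6 / s - 0 \<le> (u\<^sup>2 / s + s * u'\<^sup>2) / 2"
        by (simp add: algebra_simps add_divide_distrib)
    qed (use \<epsilon> in simp)
  qed
qed

text \<open>The path grows like \<open>1 / sqrt s\<close> and its velocity like
  \<open>1 / (s * sqrt s)\<close>, so the quantities entering \<open>hermite_kernel\<close> are at
  most a constant times \<open>R = (1 + 1 / s) ^ 2 * (1 + norm v)\<close>. Crude powers of
  \<open>R\<close> are harmless in view of the decay in \<open>1 / s\<close>.\<close>

lemma hermite_kernel_null_path_bound:
  assumes np: "null_pair A n n'" and s1: "s1 > 0" and y: "y > 0"
  obtains C N where "C \<ge> 0"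
    "\<And>s v. 0 < s \<Longrightarrow> s < s1 \<Longrightarrow>
      \<bar>hermite_kernel A (null_path n n' s) d y h (null_velocity n n' s) v\<bar> \<le> C * ((1 + 1 / s)\<^sup>2 * (1 + norm v)) ^ N"
proof -
  obtain c1 where c1: "c1 \<ge> 0" "\<And>v. \<bar>bform A n v\<bar> \<le> c1 * norm v" by (rule abs_bform_le[where A=A and u=n]) (rule that)
  obtain c2 where c2: "c2 \<ge> 0" "\<And>v. \<bar>bform A n' v\<bar> \<le> c2 * norm v" by (rule abs_bform_le[where A=A and u=n']) (rule that)
  obtain ch where ch: "ch \<ge> 0" "\<And>v. \<bar>bform A h v\<bar> \<le> ch * norm v" by (rule abs_bform_le[where A=A and u=h]) (rule that)
  define k where "k = (1 + s1) * (c1 + c2)"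
  have k: "k \<ge> 0" using s1 c1 c2 by (simp add: k_def)
  \<comment> \<open>The sum of the four constants that appear in \<open>b1\<close> to
    \<open>b4\<close>.\<close>
  define a where "a = (c1 + c2) + (c1 + c2) * norm h / (4 * pi * y) + (ch + k * norm h * k) + (ch * norm h + (k * norm h) * (k * norm h)) / (2 * y)"
  have a_nn: "(c1 + c2) \<ge> 0" "(c1 + c2) * norm h / (4 * pi * y) \<ge> 0" "ch + k * norm h * k \<ge> 0" "(ch * norm h + (k * norm h) * (k * norm h)) / (2 * y) \<ge> 0"
    using c1 c2 ch k y by (auto intro!: add_nonneg_nonneg mult_nonneg_nonneg divide_nonneg_pos)
  then have a: "a \<ge> 0" by (simp add: a_def)
  define C where "C = 2 * (a * (real (Suc d) * (1 + a) ^ (2 * d)))"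
  have "\<bar>hermite_kernel A (null_path n n' s) d y h (null_velocity n n' s) v\<bar> \<le> C * ((1 + 1 / s)\<^sup>2 * (1 + norm v)) ^ (2 * d + 1)"
    if s: "0 < s" "s < s1" for s v
  proof -
    define t e where "t = null_path n n' s" and "e = null_velocity n n' s"
    define \<rho> where "\<rho> = 1 + 1 / s"
    define R where "R = \<rho>\<^sup>2 * (1 + norm v)"
    have \<rho>: "\<rho> \<ge> 1" "\<rho> \<le> \<rho>\<^sup>2" "\<rho>\<^sup>2 \<ge> 1" using s by (auto simp: \<rho>_def power2_eq_square field_simps intro: add_pos_pos)
    have R: "\<rho>\<^sup>2 \<le> R" "\<rho>\<^sup>2 * norm v \<le> R" "1 \<le> R" "norm v \<le> R"
    proof -
      show 1: "\<rho>\<^sup>2 \<le> R" "\<rho>\<^sup>2 * norm v \<le> R" by (simp_all add: R_def algebra_simps)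
      show "1 \<le> R" using 1 \<rho> by linarith
      show "norm v \<le> R" using 1 \<rho> mult_right_mono[of 1 "\<rho>\<^sup>2" "norm v"] by simp
    qed
    have rt: "1 / sqrt s \<le> \<rho>" "sqrt s \<le> (1 + s1) * \<rho>" "1 / (2 * s * sqrt s) \<le> \<rho>\<^sup>2" "1 / (2 * sqrt s) \<le> \<rho>\<^sup>2"
    proof -
      define x where "x = sqrt s"
      have x: "x > 0" "s = x * x" using s by (auto simp: x_def)
      have "1 / x \<le> 1 + (1 / x)\<^sup>2"
      proof -
        have "2 * (1 / x) \<le> 1 + (1 / x)\<^sup>2" using zero_le_power2[of "1 / x - 1"] unfolding power2_diff by simp
        moreover have "1 / x \<ge> 0" using x by simp
        ultimately show ?thesis by linarith
      qed
      then show 1: "1 / sqrt s \<le> \<rho>" using x by (simp add: x_def[symmetric] \<rho>_def power_divide power2_eq_square)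
      have "x \<le> 1 + x * x" using zero_le_power2[of "x - 1"] x by (simp add: power2_diff power2_eq_square algebra_simps)
      also have "\<dots> \<le> (1 + s1) * 1" using s x by simp
      also have "\<dots> \<le> (1 + s1) * \<rho>" using \<rho> s1 by (intro mult_left_mono) auto
      finally show "sqrt s \<le> (1 + s1) * \<rho>" by (simp add: x_def)
      have "1 / s \<le> \<rho>" by (simp add: \<rho>_def)
      then have "1 / s * (1 / sqrt s) \<le> \<rho> * \<rho>" using 1 s by (intro mult_mono) (auto intro: order_trans[OF _ \<rho>(1)])
      moreover have "1 / (2 * s * sqrt s) \<le> 1 / s * (1 / sqrt s)" using s by (simp add: field_simps)
      ultimately show "1 / (2 * s * sqrt s) \<le> \<rho>\<^sup>2" by (simp add: power2_eq_square)
      have "1 / (2 * sqrt s) \<le> 1 / sqrt s" using s by (simp add: field_simps)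
      then show "1 / (2 * sqrt s) \<le> \<rho>\<^sup>2" using 1 \<rho> by linarith
    qed
    have t_le: "\<bar>bform A t x\<bar> \<le> k * norm x * \<rho>" for x
    proof -
      have "\<bar>bform A t x\<bar> \<le> 1 / sqrt s * \<bar>bform A n x\<bar> + sqrt s * \<bar>bform A n' x\<bar>"
        unfolding t_def null_path_def bform_simps
        by (rule order_trans[OF abs_triangle_ineq]) (use s in \<open>simp add: abs_mult\<close>)
      also have "\<dots> \<le> \<rho> * (c1 * norm x) + ((1 + s1) * \<rho>) * (c2 * norm x)"
        using rt c1 c2 s s1 \<rho>(1) by (intro add_mono mult_mono mult_nonneg_nonneg) auto
      also have "\<dots> \<le> ((1 + s1) * \<rho>) * (c1 * norm x) + ((1 + s1) * \<rho>) * (c2 * norm x)"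
        using \<rho> s1 c1 c2 by (intro add_mono mult_right_mono) auto
      finally show ?thesis by (simp add: k_def algebra_simps)
    qed
    have e_le: "\<bar>bform A e x\<bar> \<le> (c1 + c2) * norm x * \<rho>\<^sup>2" for x
    proof -
      have "\<bar>bform A e x\<bar> \<le> 1 / (2 * s * sqrt s) * \<bar>bform A n x\<bar> + 1 / (2 * sqrt s) * \<bar>bform A n' x\<bar>"
        unfolding e_def null_velocity_def bform_simps
        by (rule order_trans[OF abs_triangle_ineq]) (use s in \<open>simp add: abs_mult\<close>)
      also have "\<dots> \<le> \<rho>\<^sup>2 * (c1 * norm x) + \<rho>\<^sup>2 * (c2 * norm x)"
        using rt c1 c2 s by (intro add_mono mult_mono) auto
      finally show ?thesis by (simp add: algebra_simps)
    qed
    have perp_e: "perp_form A t e v = bform A e v" "perp_form A t h e = bform A e h"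
      using null_path_velocity_orthogonal[OF np s(1)] bform_commute[OF A_sym, of h e]
      by (simp_all add: perp_form_def t_def e_def)
    have b1: "\<bar>perp_form A t e v\<bar> \<le> a * R"
    proof -
      have "\<bar>perp_form A t e v\<bar> \<le> (c1 + c2) * (\<rho>\<^sup>2 * norm v)" unfolding perp_e using e_le[of v] by (simp add: mult_ac)
      also have "\<dots> \<le> a * R" using R a_nn a by (intro mult_mono) (auto simp: a_def)
      finally show ?thesis .
    qed
    have b2: "\<bar>perp_form A t h e / (4 * pi * y)\<bar> \<le> a * R"
    proof -
      have "\<bar>perp_form A t h e / (4 * pi * y)\<bar> \<le> (c1 + c2) * norm h * \<rho>\<^sup>2 / (4 * pi * y)"
        unfolding perp_e using e_le[of h] y by (simp add: abs_mult divide_right_mono)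
      also have "\<dots> = (c1 + c2) * norm h / (4 * pi * y) * \<rho>\<^sup>2" by simp
      also have "\<dots> \<le> a * R" using R a_nn a by (intro mult_mono) (auto simp: a_def)
      finally show ?thesis .
    qed
    have prod: "\<bar>bform A t u * bform A t x / 2\<bar> \<le> (k * norm u) * (k * norm x) * \<rho>\<^sup>2" for u x
    proof -
      have "\<bar>bform A t u\<bar> * \<bar>bform A t x\<bar> \<le> (k * norm u * \<rho>) * (k * norm x * \<rho>)"
        using k \<rho> by (intro mult_mono t_le) auto
      moreover have "\<bar>bform A t u * bform A t x / 2\<bar> \<le> \<bar>bform A t u\<bar> * \<bar>bform A t x\<bar>" by (simp add: abs_mult)
      ultimately show ?thesis by (simp add: power2_eq_square mult_ac)
    qed
    have b3: "\<bar>perp_form A t h v\<bar> \<le> a * R"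
    proof -
      have "\<bar>perp_form A t h v\<bar> \<le> ch * norm v + (k * norm h) * (k * norm v) * \<rho>\<^sup>2"
        unfolding perp_form_def by (rule order_trans[OF abs_triangle_ineq add_mono[OF ch(2) prod]])
      also have "\<dots> = ch * norm v + (k * norm h * k) * (\<rho>\<^sup>2 * norm v)" by (simp add: mult_ac)
      also have "\<dots> \<le> ch * R + (k * norm h * k) * R" using R ch k by (intro add_mono mult_left_mono) auto
      also have "\<dots> = (ch + k * norm h * k) * R" by (simp add: algebra_simps)
      also have "\<dots> \<le> a * R" using R a_nn by (intro mult_right_mono) (auto simp: a_def)
      finally show ?thesis .
    qed
    have b4: "\<bar>perp_form A t h h / (2 * y)\<bar> \<le> a * R"
    proof -
      have "\<bar>perp_form A t h h\<bar> \<le> ch * norm h + (k * norm h) * (k * norm h) * \<rho>\<^sup>2"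
        unfolding perp_form_def by (rule order_trans[OF abs_triangle_ineq add_mono[OF ch(2) prod]])
      also have "\<dots> \<le> ch * norm h * R + (k * norm h) * (k * norm h) * R"
        using mult_left_mono[of 1 R "ch * norm h"] mult_left_mono[of "\<rho>\<^sup>2" R "(k * norm h) * (k * norm h)"] R ch k by simp
      finally have "\<bar>perp_form A t h h\<bar> / (2 * y) \<le> (ch * norm h * R + (k * norm h) * (k * norm h) * R) / (2 * y)"
        using y by (intro divide_right_mono) auto
      also have "\<dots> = (ch * norm h + (k * norm h) * (k * norm h)) / (2 * y) * R" by (simp add: algebra_simps)
      also have "\<dots> \<le> a * R" using R a_nn by (intro mult_right_mono) (auto simp: a_def)
      finally show ?thesis using y by simp
    qed
    have aR: "1 + a * R \<le> (1 + a) * R" using R by (simp add: algebra_simps)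
    have H: "\<bar>hermite m (perp_form A t h v) (perp_form A t h h / (2 * y))\<bar> \<le> real (Suc d) * ((1 + a) * R) ^ (2 * d)" if "m \<le> d" for m
    proof -
      have "\<bar>hermite m (perp_form A t h v) (perp_form A t h h / (2 * y))\<bar> \<le>
         real (Suc m) * ((1 + \<bar>perp_form A t h v\<bar>) ^ m * (1 + \<bar>perp_form A t h h / (2 * y)\<bar>) ^ m)"
        using norm_hermite_le_poly[of m "perp_form A t h v" "perp_form A t h h / (2 * y)"] by (simp only: real_norm_def)
      also have "\<dots> \<le> real (Suc d) * (((1 + a) * R) ^ m * ((1 + a) * R) ^ m)"
        using b3 b4 aR that R a by (intro mult_mono power_mono) auto
      also have "\<dots> = real (Suc d) * ((1 + a) * R) ^ (2 * m)" by (simp add: power_add[symmetric] mult_2)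
      also have "\<dots> \<le> real (Suc d) * ((1 + a) * R) ^ (2 * d)"
        using that R a mult_mono[of 1 "1 + a" 1 R] by (intro mult_left_mono power_increasing) auto
      finally show ?thesis .
    qed
    have HP: "\<bar>hermite_pred d (perp_form A t h v) (perp_form A t h h / (2 * y))\<bar> \<le> real (Suc d) * ((1 + a) * R) ^ (2 * d)"
      using H[of "d - 1"] R a by (auto simp: hermite_pred_def)
    have "\<bar>hermite_kernel A t d y h e v\<bar> \<le> a * R * (real (Suc d) * ((1 + a) * R) ^ (2 * d)) + a * R * (real (Suc d) * ((1 + a) * R) ^ (2 * d))"
      unfolding hermite_kernel_def
      by (rule order_trans[OF abs_triangle_ineq4])
         (use H[of d] HP b1 b2 R a in \<open>auto simp only: abs_mult intro!: add_mono mult_mono\<close>)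
    also have "\<dots> = C * R ^ (2 * d + 1)" by (simp add: C_def power_mult_distrib)
    finally show ?thesis unfolding t_def e_def R_def \<rho>_def .
  qed
  moreover have "C \<ge> 0" using a by (simp add: C_def)
  ultimately show ?thesis using that by blast
qed

text \<open>The majorant bound gives decay at rate \<open>2 * \<delta>\<close> both in
  \<open>norm v\<close> and in \<open>1 / s\<close>; one \<open>\<delta>\<close> of each absorbs the
  polynomial bound on \<open>hermite_kernel\<close>. The result is uniform in \<open>s\<close>, as
  the exchange of sum and integral demands.\<close>

lemma theta_kernel_bound:
  assumes np: "null_pair A n n'" and s1: "s1 > 0" and s0: "s0 \<ge> 0" and \<epsilon>: "\<epsilon> > 0" and \<tau>: "Im \<tau> > 0"
  obtains C \<delta> where "\<delta> > 0"
    "\<And>s v. 0 < s \<Longrightarrow> s < s1 \<Longrightarrow> s0 \<le> s \<Longrightarrow> s0 > 0 \<or> \<bar>bform A n v\<bar> \<ge> \<epsilon> \<Longrightarrow>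
      norm (theta_weight A (null_path n n' s) \<tau> v * of_real (hermite_kernel A (null_path n n' s) d (Im \<tau>) h (null_velocity n n' s) v))
        \<le> C * exp (- \<delta> * norm v)"
proof -
  obtain C N where C: "C \<ge> 0"
    "\<And>s v. 0 < s \<Longrightarrow> s < s1 \<Longrightarrow>
      \<bar>hermite_kernel A (null_path n n' s) d (Im \<tau>) h (null_velocity n n' s) v\<bar> \<le> C * ((1 + 1 / s)\<^sup>2 * (1 + norm v)) ^ N"
    by (rule hermite_kernel_null_path_bound[OF np s1 \<tau>]) (rule that)
  obtain \<kappa> K where K: "\<kappa> > 0"
    "\<And>s v. 0 < s \<Longrightarrow> s < s1 \<Longrightarrow> s0 \<le> s \<Longrightarrow> s0 > 0 \<or> \<bar>bform A n v\<bar> \<ge> \<epsilon> \<Longrightarrow>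
      \<kappa> * norm v + \<kappa> / s - K \<le> qform A v + (bform A (null_path n n' s) v)\<^sup>2 / 2"
    by (rule null_majorant_bound[OF np s1 s0 \<epsilon>]) (rule that)
  define \<delta> where "\<delta> = pi * Im \<tau> * \<kappa>"
  have \<delta>: "\<delta> > 0" using \<tau> K by (simp add: \<delta>_def)
  define D where "D = (\<lambda>m. fact m / \<delta> ^ m * exp \<delta>)"
  have D: "D m \<ge> 0" for m using \<delta> by (simp add: D_def)
  define E where "E = C * (D (2 * N) * D N) * exp (2 * pi * Im \<tau> * K)"
  have "norm (theta_weight A (null_path n n' s) \<tau> v * of_real (hermite_kernel A (null_path n n' s) d (Im \<tau>) h (null_velocity n n' s) v))
        \<le> E * exp (- \<delta> * norm v)"
    if s: "0 < s" "s < s1" "s0 \<le> s" "s0 > 0 \<or> \<bar>bform A n v\<bar> \<ge> \<epsilon>" for s v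
  proof -
    have "norm (theta_weight A (null_path n n' s) \<tau> v) \<le> exp (2 * pi * Im \<tau> * K - 2 * \<delta> * norm v - 2 * \<delta> * (1 / s))"
    proof -
      have "2 * pi * Im \<tau> * (\<kappa> * norm v + \<kappa> / s - K) \<le> 2 * pi * Im \<tau> * (qform A v + (bform A (null_path n n' s) v)\<^sup>2 / 2)"
        using K(2)[OF s] \<tau> by (intro mult_left_mono) auto
      then show ?thesis unfolding norm_theta_weight by (simp add: \<delta>_def algebra_simps)
    qed
    moreover have "((1 + 1 / s)\<^sup>2 * (1 + norm v)) ^ N \<le> (D (2 * N) * exp (\<delta> * (1 / s))) * (D N * exp (\<delta> * norm v))"
      unfolding power_mult_distrib power_mult[symmetric] D_def
      using \<delta> s D by (intro mult_mono power_le_exp) auto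
    then have "\<bar>hermite_kernel A (null_path n n' s) d (Im \<tau>) h (null_velocity n n' s) v\<bar> \<le> C * ((D (2 * N) * exp (\<delta> * (1 / s))) * (D N * exp (\<delta> * norm v)))"
      using C(2)[OF s(1,2), of v] C(1) mult_left_mono order_trans by blast
    ultimately have "norm (theta_weight A (null_path n n' s) \<tau> v * of_real (hermite_kernel A (null_path n n' s) d (Im \<tau>) h (null_velocity n n' s) v))
       \<le> exp (2 * pi * Im \<tau> * K - 2 * \<delta> * norm v - 2 * \<delta> * (1 / s)) * (C * ((D (2 * N) * exp (\<delta> * (1 / s))) * (D N * exp (\<delta> * norm v))))"
      unfolding norm_mult norm_of_real by (intro mult_mono) auto
    also have "\<dots> = E * exp (- \<delta> * norm v) * exp (- \<delta> * (1 / s))"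
    proof -
      have "exp (2 * pi * Im \<tau> * K - 2 * \<delta> * norm v - 2 * \<delta> * (1 / s)) * (exp (\<delta> * (1 / s)) * exp (\<delta> * norm v)) =
         exp (2 * pi * Im \<tau> * K) * (exp (- \<delta> * norm v) * exp (- \<delta> * (1 / s)))"
        unfolding exp_add[symmetric] by (simp add: algebra_simps)
      moreover have "X * (C * ((d1 * P) * (d2 * Q))) = C * (d1 * d2) * Y * U * V" if "X * (P * Q) = Y * (U * V)" for X P Q Y U V d1 d2 :: real
        using arg_cong[OF that, of "\<lambda>z. C * (d1 * d2) * z"] by (simp only: mult_ac)
      ultimately show ?thesis unfolding E_def by blast
    qed
    also have "\<dots> \<le> E * exp (- \<delta> * norm v) * 1"
      using \<delta> s C D by (intro mult_left_mono) (auto simp: E_def)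
    finally show ?thesis by simp
  qed
  then show ?thesis using that \<delta> by blast
qed

end

section \<open>Integration along a path\<close>

text \<open>The antiderivative is given at the ends by one-sided limits, which covers the isotropic
  end \<open>s = 0\<close>, where \<open>null_path\<close> diverges but the kernel
  converges.\<close>

lemma integral_open_interval_FTC:
  fixes F f :: "real \<Rightarrow> complex"
  assumes s: "s0 < s1"
    and F: "\<And>s. s \<in> {s0<..<s1} \<Longrightarrow> (F has_vector_derivative f s) (at s)"
    and f: "continuous_on {s0<..<s1} f" "integrable (restrict_space lborel {s0<..<s1}) f"
    and A: "(F \<longlongrightarrow> A) (at_right s0)" and B: "(F \<longlongrightarrow> B) (at_left s1)"
  shows "(\<integral>s. f s \<partial>restrict_space lborel {s0<..<s1}) = B - A"
proof -
  have "(LBINT s=ereal s0..ereal s1. f s) = B - A"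
  proof (rule interval_integral_FTC_integrable)
    show "isCont f s" if "ereal s0 < ereal s" "ereal s < ereal s1" for s
      using that f(1) continuous_on_interior[of "{s0<..<s1}" f s] by (simp add: interior_open)
    show "set_integrable lborel (einterval s0 s1) f"
      using f(2) by (simp add: integrable_restrict_space set_integrable_def)
  qed (use s F A B in \<open>auto simp: ereal_tendsto_simps\<close>)
  then show ?thesis
    using s by (simp add: interval_lebesgue_integral_le_eq set_lebesgue_integral_def integral_restrict_space)
qed

definition path_integrand :: "real^'n^'n \<Rightarrow> real^'n \<Rightarrow> real^'n \<Rightarrow> nat \<Rightarrow> real^'n \<Rightarrow> complex \<Rightarrow> real \<Rightarrow> real^'n \<Rightarrow> complex" where
  "path_integrand A n n' d h \<tau> s v = theta_weight A (null_path n n' s) \<tau> v *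
     of_real (hermite_kernel A (null_path n n' s) d (Im \<tau>) h (null_velocity n n' s) v)"

text \<open>The value \<open>s0 = 0\<close> encodes an isotropic start; there the limit
  \<open>sgn_kernel\<close> takes the place of the kernel.\<close>

definition path_start :: "real^'n^'n \<Rightarrow> nat \<Rightarrow> real^'n \<Rightarrow> real \<Rightarrow> real^'n \<Rightarrow> real^'n \<Rightarrow> real \<Rightarrow> real^'n \<Rightarrow> real" where
  "path_start A d h y n n' s0 v =
     (if s0 > 0 then E_kernel A d h y (null_path n n' s0) v else sgn_kernel A d h y n v)"

definition path_term :: "real^'n^'n \<Rightarrow> real^'n \<Rightarrow> real^'n \<Rightarrow> nat \<Rightarrow> real^'n \<Rightarrow> real \<Rightarrow> real \<Rightarrow> complex \<Rightarrow> real^'n \<Rightarrow> complex" where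
  "path_term A n n' d h s0 s1 \<tau> v =
     of_real (E_kernel A d h (Im \<tau>) (null_path n n' s1) v - path_start A d h (Im \<tau>) n n' s0 v) *
     exp (2 * pi * \<i> * \<tau> * qform A v)"

lemma continuous_on_path_integrand: "continuous_on {0<..} (\<lambda>s. path_integrand A n n' d h \<tau> s v)"
proof -
  have t: "continuous_on {0<..} (\<lambda>s. bform A (null_path n n' s) u)"
    and e: "continuous_on {0<..} (\<lambda>s. bform A (null_velocity n n' s) u)"
    and e': "continuous_on {0<..} (\<lambda>s. bform A u (null_velocity n n' s))"
    and te: "continuous_on {0<..} (\<lambda>s. bform A (null_path n n' s) (null_velocity n n' s))" for u
    unfolding null_path_def null_velocity_def bform_simps by (auto intro!: continuous_intros)
  show ?thesis
    unfolding path_integrand_def theta_weight_def hermite_kernel_def perp_form_def divide_inverse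
    by (intro continuous_on_mult continuous_on_add continuous_on_diff continuous_on_exp continuous_on_of_real
        continuous_on_power continuous_on_hermite continuous_on_hermite_pred t e e' te continuous_on_const)
qed

lemma finite_measure_open_interval: "finite_measure (restrict_space lborel {s0<..<s1::real})"
  by (rule finite_measureI)
     (cases "s0 \<le> s1"; simp add: space_restrict_space emeasure_restrict_space)

lemma path_integrand_measurable:
  assumes "s0 \<ge> 0"
  shows "(\<lambda>s. path_integrand A n n' d h \<tau> s v) \<in> borel_measurable (restrict_space lborel {s0<..<s1})"
proof -
  have "(\<lambda>s. path_integrand A n n' d h \<tau> s v) \<in> borel_measurable (restrict_space borel {s0<..<s1})"
    by (intro borel_measurable_continuous_on_restrict continuous_on_subset[OF continuous_on_path_integrand])
       (use assms in auto)
  then show ?thesis by (simp add: measurable_def sets_restrict_space space_restrict_space)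
qed

context lorentzian
begin

lemma path_term_eq_integral:
  assumes np: "null_pair A n n'" and s: "0 \<le> s0" "s0 < s1" and \<tau>: "Im \<tau> > 0"
    and good: "s0 > 0 \<or> bform A n v \<noteq> 0"
  shows "path_term A n n' d h s0 s1 \<tau> v = of_real (2 * fact d * sqrt (Im \<tau>)) *
    (\<integral>s. path_integrand A n n' d h \<tau> s v \<partial>restrict_space lborel {s0<..<s1})"
proof -
  let ?M = "restrict_space lborel {s0<..<s1}"
  interpret finite_measure ?M by (rule finite_measure_open_interval)
  \<comment> \<open>A single \<open>v\<close> is considered, so \<open>\<epsilon>\<close> may depend
    on it; when \<open>B(n, v) = 0\<close> the value \<open>1\<close> is a dummy, since then
    \<open>s0 > 0\<close>.\<close>
  define \<epsilon> where "\<epsilon> = (if bform A n v = 0 then 1 else \<bar>bform A n v\<bar>)"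
  have \<epsilon>: "\<epsilon> > 0" by (simp add: \<epsilon>_def)
  have good': "s0 > 0 \<or> \<bar>bform A n v\<bar> \<ge> \<epsilon>" using good by (auto simp: \<epsilon>_def)
  obtain C \<delta> where C: "\<delta> > 0"
    "\<And>s v. 0 < s \<Longrightarrow> s < s1 \<Longrightarrow> s0 \<le> s \<Longrightarrow> s0 > 0 \<or> \<bar>bform A n v\<bar> \<ge> \<epsilon> \<Longrightarrow>
      norm (theta_weight A (null_path n n' s) \<tau> v * of_real (hermite_kernel A (null_path n n' s) d (Im \<tau>) h (null_velocity n n' s) v))
        \<le> C * exp (- \<delta> * norm v)"
    by (rule theta_kernel_bound[OF np _ s(1) \<epsilon> \<tau>, of s1 d h]) (use s in simp, rule that)
  have int: "integrable ?M (\<lambda>s. path_integrand A n n' d h \<tau> s v)"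
  proof (rule integrable_const_bound[of _ "C * exp (- \<delta> * norm v)"])
    show "AE s in ?M. norm (path_integrand A n n' d h \<tau> s v) \<le> C * exp (- \<delta> * norm v)"
      using C(2) good' s by (intro AE_I2) (simp add: path_integrand_def space_restrict_space)
  qed (rule path_integrand_measurable[OF s(1)])
  define F where "F = (\<lambda>s. exp (2 * pi * \<i> * \<tau> * qform A v) * complex_of_real (E_kernel A d h (Im \<tau>) (null_path n n' s) v))"
  define K where "K = complex_of_real (2 * fact d * sqrt (Im \<tau>))"
  have F: "(F has_vector_derivative K * path_integrand A n n' d h \<tau> s v) (at s)" if "s > 0" for s
  proof -
    have "theta_weight A t \<tau> v = exp (2 * pi * \<i> * \<tau> * qform A v) * complex_of_real (exp (- pi * Im \<tau> * (bform A t v)\<^sup>2))" for t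
      unfolding theta_weight_def exp_of_real[symmetric] exp_add[symmetric] by simp
    then show ?thesis
      unfolding F_def K_def path_integrand_def
      using has_vector_derivative_mult_right[OF has_vector_derivative_of_real[OF
          E_kernel_null_path_has_derivative[OF np that \<tau>, of d h v]], of "exp (2 * pi * \<i> * \<tau> * qform A v)"]
      by (simp add: mult_ac)
  qed
  have cont: "(F \<longlongrightarrow> F s) (at s)" if "s > 0" for s
    using has_vector_derivative_continuous[OF F[OF that]] by (simp add: continuous_at)
  have "(\<integral>s. K * path_integrand A n n' d h \<tau> s v \<partial>?M) =
     F s1 - exp (2 * pi * \<i> * \<tau> * qform A v) * complex_of_real (path_start A d h (Im \<tau>) n n' s0 v)"
  proof (rule integral_open_interval_FTC[OF s(2)])
    show "(F has_vector_derivative K * path_integrand A n n' d h \<tau> s v) (at s)" if "s \<in> {s0<..<s1}" for s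
      using F[of s] that s by simp
    show "continuous_on {s0<..<s1} (\<lambda>s. K * path_integrand A n n' d h \<tau> s v)"
      by (intro continuous_on_mult_left continuous_on_subset[OF continuous_on_path_integrand]) (use s in auto)
    show "(F \<longlongrightarrow> F s1) (at_left s1)"
      by (rule tendsto_within_subset[OF cont]) (use s in auto)
    show "(F \<longlongrightarrow> exp (2 * pi * \<i> * \<tau> * qform A v) * complex_of_real (path_start A d h (Im \<tau>) n n' s0 v)) (at_right s0)"
    proof (cases "s0 > 0")
      case True
      then have "(F \<longlongrightarrow> F s0) (at_right s0)" by (intro tendsto_within_subset[OF cont]) auto
      then show ?thesis using True by (simp add: F_def path_start_def)
    next
      case False
      then show ?thesis
        unfolding F_def path_start_def
        using E_kernel_tendsto_sgn_kernel[of n v "Im \<tau>" d h n'] \<tau> good s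
        by (auto intro!: tendsto_mult tendsto_of_real)
    qed
  qed (use int in auto)
  then show ?thesis
    by (simp add: path_term_def F_def K_def algebra_simps)
qed

text \<open>In contrast to \<open>path_term_eq_integral\<close> the bound \<open>\<epsilon>\<close>
  is uniform over \<open>S\<close>, so the majorant
  \<open>C * exp (- \<delta> * norm (a + m))\<close> is independent of the path parameter.
  \<open>\<omega>\<close> stands for the characters.\<close>

lemma
  fixes S :: "(real^'n) set" and \<omega> :: "real^'n \<Rightarrow> complex"
  assumes np: "null_pair A n n'" and s: "0 \<le> s0" "s0 < s1" and \<tau>: "Im \<tau> > 0" and \<epsilon>: "\<epsilon> > 0"
    and good: "\<And>m. m \<in> S \<Longrightarrow> s0 > 0 \<or> \<bar>bform A n (a + m)\<bar> \<ge> \<epsilon>"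
    and S: "countable S" "\<And>\<delta>. \<delta> > 0 \<Longrightarrow> (\<lambda>m. exp (- \<delta> * norm (a + m))) summable_on S"
    and \<omega>: "\<And>m. norm (\<omega> m) = 1"
  shows path_term_abs_summable: "(\<lambda>m. path_term A n n' d h s0 s1 \<tau> (a + m) * \<omega> m) abs_summable_on S"
    and infsum_path_term: "(\<Sum>\<^sub>\<infinity>m\<in>S. path_term A n n' d h s0 s1 \<tau> (a + m) * \<omega> m) =
      of_real (2 * fact d * sqrt (Im \<tau>)) *
      (\<integral>s. (\<Sum>\<^sub>\<infinity>m\<in>S. path_integrand A n n' d h \<tau> s (a + m) * \<omega> m) \<partial>restrict_space lborel {s0<..<s1})"
proof -
  let ?M = "restrict_space lborel {s0<..<s1}"
  define K where "K = complex_of_real (2 * fact d * sqrt (Im \<tau>))"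
  obtain C \<delta> where C: "\<delta> > 0"
    "\<And>s v. 0 < s \<Longrightarrow> s < s1 \<Longrightarrow> s0 \<le> s \<Longrightarrow> s0 > 0 \<or> \<bar>bform A n v\<bar> \<ge> \<epsilon> \<Longrightarrow>
      norm (theta_weight A (null_path n n' s) \<tau> v * of_real (hermite_kernel A (null_path n n' s) d (Im \<tau>) h (null_velocity n n' s) v))
        \<le> C * exp (- \<delta> * norm v)"
    by (rule theta_kernel_bound[OF np _ s(1) \<epsilon> \<tau>, of s1 d h]) (use s in simp, rule that)
  note prems = S(1) finite_measure_open_interval
  have meas: "(\<lambda>s. path_integrand A n n' d h \<tau> s (a + m) * \<omega> m) \<in> borel_measurable ?M" for m
    by (intro borel_measurable_times path_integrand_measurable s borel_measurable_const)
  have bound: "norm (path_integrand A n n' d h \<tau> s (a + m) * \<omega> m) \<le> C * exp (- \<delta> * norm (a + m))"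
    if "m \<in> S" "s \<in> space ?M" for m s
    using C(2)[of s "a + m"] good[OF that(1)] that(2) s \<omega>[of m]
    by (simp add: path_integrand_def norm_mult space_restrict_space)
  have B: "(\<lambda>m. C * exp (- \<delta> * norm (a + m))) summable_on S"
    by (intro summable_on_cmult_right S(2) C)
  have eq: "path_term A n n' d h s0 s1 \<tau> (a + m) * \<omega> m = K * (\<integral>s. path_integrand A n n' d h \<tau> s (a + m) * \<omega> m \<partial>?M)" if "m \<in> S" for m
  proof -
    have "s0 > 0 \<or> bform A n (a + m) \<noteq> 0" using good[OF that] \<epsilon> by auto
    from path_term_eq_integral[OF np s \<tau> this, of d h] show ?thesis by (simp add: K_def)
  qed
  have "(\<lambda>m. \<integral>s. path_integrand A n n' d h \<tau> s (a + m) * \<omega> m \<partial>?M) abs_summable_on S"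
    by (rule abs_summable_on_integral[OF prems meas bound B])
  then have "(\<lambda>m. K * (\<integral>s. path_integrand A n n' d h \<tau> s (a + m) * \<omega> m \<partial>?M)) abs_summable_on S"
    unfolding norm_mult by (rule summable_on_cmult_right)
  then show "(\<lambda>m. path_term A n n' d h s0 s1 \<tau> (a + m) * \<omega> m) abs_summable_on S"
    by (subst summable_on_cong[OF arg_cong[OF eq, of _ norm]])
  have "(\<Sum>\<^sub>\<infinity>m\<in>S. path_term A n n' d h s0 s1 \<tau> (a + m) * \<omega> m) =
      (\<Sum>\<^sub>\<infinity>m\<in>S. K * (\<integral>s. path_integrand A n n' d h \<tau> s (a + m) * \<omega> m \<partial>?M))"
    using eq by (rule infsum_cong)
  also have "\<dots> = K * (\<integral>s. (\<Sum>\<^sub>\<infinity>m\<in>S. path_integrand A n n' d h \<tau> s (a + m) * \<omega> m) \<partial>?M)"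
    using infsum_integral_swap[OF prems meas bound B] by (simp add: infsum_cmult_right')
  finally show "(\<Sum>\<^sub>\<infinity>m\<in>S. path_term A n n' d h s0 s1 \<tau> (a + m) * \<omega> m) =
      of_real (2 * fact d * sqrt (Im \<tau>)) *
      (\<integral>s. (\<Sum>\<^sub>\<infinity>m\<in>S. path_integrand A n n' d h \<tau> s (a + m) * \<omega> m) \<partial>?M)"
    unfolding K_def .
qed

lemma exp_norm_summable_dual:
  assumes "\<delta> > 0"
  shows "(\<lambda>p. exp (- \<delta> * norm (b + p))) summable_on dual_lattice A"
proof (rule exp_decay_summable_dual)
  show "exp_decay (\<lambda>v::real^'n. exp (- \<delta> * norm v))"
    unfolding exp_decay_def using assms by (intro exI[of _ 1] exI[of _ \<delta>]) auto
qed simp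

text \<open>\<open>hermite_inversion\<close> holds at every point of the path and is integrated. The
  additional \<open>1 / norm \<tau>\<close> stems from the factor \<open>sqrt (Im \<tau>)\<close> in
  the derivative of the kernel, as
  \<open>sqrt (Im (- 1 / \<tau>)) = sqrt (Im \<tau>) / norm \<tau>\<close>.\<close>

lemma path_term_inversion:
  fixes a b :: "real^'n"
  assumes np: "null_pair A n n'" and s: "0 \<le> s0" "s0 < s1" and \<tau>: "Im \<tau> > 0" and \<epsilon>: "\<epsilon> > 0"
    and good_a: "\<And>m. m \<in> int_lattice \<Longrightarrow> s0 > 0 \<or> \<bar>bform A n (a + m)\<bar> \<ge> \<epsilon>"
    and good_b: "\<And>p. p \<in> dual_lattice A \<Longrightarrow> s0 > 0 \<or> \<bar>bform A n (b + p)\<bar> \<ge> \<epsilon>"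
  shows "(\<Sum>\<^sub>\<infinity>m\<in>int_lattice. path_term A n n' d h s0 s1 (- 1 / \<tau>) (a + m) * cis (2 * pi * bform A (a + m) b)) =
    theta_factor A \<tau> * cis (2 * pi * bform A a b) * (\<i> * (- \<i> * \<tau>)) ^ (d + 1) / of_real (norm \<tau>) *
    (\<Sum>\<^sub>\<infinity>p\<in>dual_lattice A. path_term A n n' d h s0 s1 \<tau> (b + p) * cis (- (2 * pi * bform A (b + p) a)))"
proof -
  let ?M = "restrict_space lborel {s0<..<s1}"
  have \<tau>0: "\<tau> \<noteq> 0" using \<tau> by auto
  have \<tau>': "Im (- 1 / \<tau>) > 0" using \<tau> \<tau>0 unfolding Im_inversion by simp
  have sq: "sqrt (Im (- 1 / \<tau>)) = sqrt (Im \<tau>) / norm \<tau>"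
    unfolding Im_inversion by (simp add: real_sqrt_divide)
  define K where "K = theta_factor A \<tau> * cis (2 * pi * bform A a b) * (\<i> * (- \<i> * \<tau>)) ^ (d + 1)"
  have "(\<Sum>\<^sub>\<infinity>m\<in>int_lattice. path_integrand A n n' d h (- 1 / \<tau>) s (a + m) * cis (2 * pi * bform A (a + m) b)) =
     K * (\<Sum>\<^sub>\<infinity>p\<in>dual_lattice A. path_integrand A n n' d h \<tau> s (b + p) * cis (- (2 * pi * bform A (b + p) a)))"
    if "s \<in> space ?M" for s
    unfolding path_integrand_def K_def using that s
    by (intro hermite_inversion[OF qform_null_path[OF A_sym np] \<tau>]) (simp add: space_restrict_space)
  then have eq: "(\<integral>s. (\<Sum>\<^sub>\<infinity>m\<in>int_lattice. path_integrand A n n' d h (- 1 / \<tau>) s (a + m) * cis (2 * pi * bform A (a + m) b)) \<partial>?M) =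
     K * (\<integral>s. (\<Sum>\<^sub>\<infinity>p\<in>dual_lattice A. path_integrand A n n' d h \<tau> s (b + p) * cis (- (2 * pi * bform A (b + p) a))) \<partial>?M)"
    by (subst Bochner_Integration.integral_cong[OF refl]) auto
  have 1: "(\<Sum>\<^sub>\<infinity>m\<in>int_lattice. path_term A n n' d h s0 s1 (- 1 / \<tau>) (a + m) * cis (2 * pi * bform A (a + m) b)) =
      of_real (2 * fact d * sqrt (Im (- 1 / \<tau>))) * (\<integral>s. (\<Sum>\<^sub>\<infinity>m\<in>int_lattice. path_integrand A n n' d h (- 1 / \<tau>) s (a + m) * cis (2 * pi * bform A (a + m) b)) \<partial>?M)"
    by (rule infsum_path_term[OF np s \<tau>' \<epsilon> good_a countable_int_lattice summable_on_exp_norm_lattice norm_cis])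
  have 2: "(\<Sum>\<^sub>\<infinity>p\<in>dual_lattice A. path_term A n n' d h s0 s1 \<tau> (b + p) * cis (- (2 * pi * bform A (b + p) a))) =
      of_real (2 * fact d * sqrt (Im \<tau>)) * (\<integral>s. (\<Sum>\<^sub>\<infinity>p\<in>dual_lattice A. path_integrand A n n' d h \<tau> s (b + p) * cis (- (2 * pi * bform A (b + p) a))) \<partial>?M)"
    by (rule infsum_path_term[OF np s \<tau> \<epsilon> good_b countable_dual_lattice exp_norm_summable_dual norm_cis])
  show ?thesis unfolding 1 2 eq sq K_def by simp
qed

end

section \<open>Transformation laws\<close>

lemma bform_int_lattice_dual:
  assumes "transpose A = A" "invertible A" "m \<in> int_lattice" "p \<in> dual_lattice A"
  shows "bform A m p \<in> \<int>"
proof -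
  obtain k where k: "k \<in> int_lattice" "p = matrix_inv A *v k" using assms(4) by (auto simp: dual_lattice_def)
  have "bform A m p = k \<bullet> m"
    using bform_matrix_inv[OF assms(2,1)] bform_commute[OF assms(1)] k(2) by metis
  then show ?thesis using inner_int_lattice k(1) assms(3) by metis
qed

lemma dual_lattice_diff: "u \<in> dual_lattice A \<Longrightarrow> v \<in> dual_lattice A \<Longrightarrow> u - v \<in> dual_lattice A"
  unfolding dual_lattice_def by (auto simp flip: matrix_vector_mult_diff_distrib intro: int_lattice_diff)

lemma dual_lattice_add: "u \<in> dual_lattice A \<Longrightarrow> v \<in> dual_lattice A \<Longrightarrow> u + v \<in> dual_lattice A"
  unfolding dual_lattice_def by (auto simp flip: matrix_vector_right_distrib intro: int_lattice_add)

lemma Theta_hat_reindex: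
  "Theta_hat A d c1 c2 a b f \<tau> = of_real (Im \<tau> powr (- (real d / 2))) *
     (\<Sum>\<^sub>\<infinity>m\<in>int_lattice. (pfun A d c1 f (sqrt (Im \<tau>) *\<^sub>R (a + m)) - pfun A d c2 f (sqrt (Im \<tau>) *\<^sub>R (a + m)))
        * exp (2 * pi * \<i> * \<tau> * qform A (a + m)) * cis (2 * pi * bform A (a + m) b))"
  unfolding Theta_hat_def
  by (subst infsum_reindex) (auto simp: inj_on_def o_def cis_conv_exp mult_ac)

lemma Theta_hat_translate:
  assumes "l \<in> int_lattice"
  shows "Theta_hat A d c1 c2 (a + l) b f \<tau> = Theta_hat A d c1 c2 a b f \<tau>"
proof -
  have "(\<lambda>m. l + m) ` int_lattice = int_lattice"
    using bij_betw_add_int_lattice[OF assms] by (simp add: bij_betw_def add.commute)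
  then have "(\<lambda>m. (a + l) + m) ` int_lattice = (\<lambda>m. a + m) ` int_lattice"
    by (metis (no_types, lifting) add.assoc image_cong image_image)
  then show ?thesis by (simp add: Theta_hat_def)
qed

lemma Theta_hat_translate_dual:
  assumes A: "transpose A = A" "invertible A" and \<mu>: "\<mu> \<in> dual_lattice A"
  shows "Theta_hat A d c1 c2 a (b + \<mu>) f \<tau> = cis (2 * pi * bform A a \<mu>) * Theta_hat A d c1 c2 a b f \<tau>"
proof -
  have "cis (2 * pi * bform A (a + m) (b + \<mu>)) = cis (2 * pi * bform A a \<mu>) * cis (2 * pi * bform A (a + m) b)"
    if "m \<in> int_lattice" for m
  proof -
    have "cis (2 * pi * bform A (a + m) (b + \<mu>)) =
      cis (2 * pi * bform A a \<mu>) * cis (2 * pi * bform A (a + m) b) * cis (2 * pi * bform A m \<mu>)"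
      by (simp add: cis_mult bform_simps algebra_simps)
    then show ?thesis using cis_multiple_2pi[OF bform_int_lattice_dual[OF A that \<mu>]] by simp
  qed
  then have "Theta_hat A d c1 c2 a (b + \<mu>) f \<tau> = of_real (Im \<tau> powr (- (real d / 2))) *
     (\<Sum>\<^sub>\<infinity>m\<in>int_lattice. cis (2 * pi * bform A a \<mu>) * ((pfun A d c1 f (sqrt (Im \<tau>) *\<^sub>R (a + m)) - pfun A d c2 f (sqrt (Im \<tau>) *\<^sub>R (a + m)))
        * exp (2 * pi * \<i> * \<tau> * qform A (a + m)) * cis (2 * pi * bform A (a + m) b)))"
    unfolding Theta_hat_reindex by (intro arg_cong[where f="\<lambda>S. x * S" for x] infsum_cong) (simp only: mult_ac)
  then show ?thesis unfolding infsum_cmult_right' Theta_hat_reindex[of A d c1 c2 a b] by (simp only: mult_ac)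
qed

text \<open>Any \<open>w\<close> for which \<open>B(m, w) / 2\<close> represents \<open>Q(m)\<close>
  modulo integers will do: \<open>matrix_inv A *v diag_vec A\<close> in general, \<open>0\<close>
  for even \<open>A\<close>. Both forms of the law come from this one computation.\<close>

lemma Theta_hat_add_1:
  assumes A: "transpose A = A" and w: "\<And>m. m \<in> int_lattice \<Longrightarrow> qform A m - bform A m w / 2 \<in> \<int>"
  shows "Theta_hat A d c1 c2 a b f (\<tau> + 1) =
    cis (- (2 * pi * qform A a) - pi * bform A w a) * Theta_hat A d c1 c2 a (a + b + (1 / 2) *\<^sub>R w) f \<tau>"
proof -
  define \<gamma> where "\<gamma> = cis (- (2 * pi * qform A a) - pi * bform A w a)"
  have "exp (2 * pi * \<i> * (\<tau> + 1) * qform A (a + m)) * cis (2 * pi * bform A (a + m) b) =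
     \<gamma> * (exp (2 * pi * \<i> * \<tau> * qform A (a + m)) * cis (2 * pi * bform A (a + m) (a + b + (1 / 2) *\<^sub>R w)))"
    if m: "m \<in> int_lattice" for m
  proof -
    have "exp (2 * pi * \<i> * (\<tau> + 1) * qform A (a + m)) = exp (2 * pi * \<i> * \<tau> * qform A (a + m)) * cis (2 * pi * qform A (a + m))"
      unfolding cis_conv_exp exp_add[symmetric] by (simp add: algebra_simps)
    moreover have "cis (2 * pi * qform A (a + m)) * cis (2 * pi * bform A (a + m) b) =
       \<gamma> * cis (2 * pi * bform A (a + m) (a + b + (1 / 2) *\<^sub>R w)) * cis (2 * pi * (qform A m - bform A m w / 2))"
    proof -
      \<comment> \<open>The phase splits into a constant, a new character and a multiple of
        \<open>2 * pi\<close> supplied by the property of \<open>w\<close>.\<close>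
      have "2 * pi * qform A (a + m) + 2 * pi * bform A (a + m) b =
        (- (2 * pi * qform A a) - pi * bform A w a) + 2 * pi * bform A (a + m) (a + b + (1 / 2) *\<^sub>R w) + 2 * pi * (qform A m - bform A m w / 2)"
        using bform_commute[OF A, of a w] bform_commute[OF A, of a m]
        by (simp add: qform_add[OF A] bform_simps) (simp add: qform_def algebra_simps)
      then show ?thesis unfolding \<gamma>_def cis_mult by simp
    qed
    ultimately show ?thesis using cis_multiple_2pi[OF w[OF m]] by simp
  qed
  then have "Theta_hat A d c1 c2 a b f (\<tau> + 1) = of_real (Im \<tau> powr (- (real d / 2))) *
     (\<Sum>\<^sub>\<infinity>m\<in>int_lattice. \<gamma> * ((pfun A d c1 f (sqrt (Im \<tau>) *\<^sub>R (a + m)) - pfun A d c2 f (sqrt (Im \<tau>) *\<^sub>R (a + m)))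
        * exp (2 * pi * \<i> * \<tau> * qform A (a + m)) * cis (2 * pi * bform A (a + m) (a + b + (1 / 2) *\<^sub>R w))))"
  proof -
    assume *: "\<And>m. m \<in> int_lattice \<Longrightarrow> exp (2 * pi * \<i> * (\<tau> + 1) * qform A (a + m)) * cis (2 * pi * bform A (a + m) b) =
     \<gamma> * (exp (2 * pi * \<i> * \<tau> * qform A (a + m)) * cis (2 * pi * bform A (a + m) (a + b + (1 / 2) *\<^sub>R w)))"
    have "Im (\<tau> + 1) = Im \<tau>" by simp
    have alg: "P * E' * C = g * (P * E * C')" if "E' * C = g * (E * C')" for P E' C g E C' :: complex
      using arg_cong[OF that, of "\<lambda>z. P * z"] by (simp only: mult_ac)
    then show ?thesis
      unfolding Theta_hat_reindex
      unfolding \<open>Im (\<tau> + 1) = Im \<tau>\<close>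
      by (intro arg_cong[where f="\<lambda>S. x * S" for x] infsum_cong) (rule alg[OF *])
  qed
  then show ?thesis unfolding infsum_cmult_right' Theta_hat_reindex[of A d c1 c2 a "a + b + (1 / 2) *\<^sub>R w"] \<gamma>_def by (simp only: mult_ac)
qed

text \<open>By symmetry off-diagonal terms occur twice, and on the diagonal
  \<open>m * (m - 1)\<close> is even.\<close>

lemma even_symmetric_quadratic_sum:
  fixes g :: "'a \<Rightarrow> 'a \<Rightarrow> int" and m :: "'a \<Rightarrow> int"
  assumes "finite F" "\<And>i j. g i j = g j i"
  shows "even ((\<Sum>i\<in>F. \<Sum>j\<in>F. g i j * m i * m j) - (\<Sum>i\<in>F. g i i * m i))"
  using assms(1)
proof (induction F)
  case (insert x F)
  have "(\<Sum>i\<in>insert x F. \<Sum>j\<in>insert x F. g i j * m i * m j) - (\<Sum>i\<in>insert x F. g i i * m i) =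
    ((\<Sum>i\<in>F. \<Sum>j\<in>F. g i j * m i * m j) - (\<Sum>i\<in>F. g i i * m i)) + g x x * (m x * (m x - 1)) + 2 * (\<Sum>j\<in>F. g x j * m x * m j)"
  proof -
    have "(\<Sum>i\<in>F. g i x * m i * m x) = (\<Sum>j\<in>F. g x j * m x * m j)"
    proof (rule sum.cong[OF refl])
      fix i show "g i x * m i * m x = g x i * m x * m i" unfolding assms(2)[of i x] by simp
    qed
    then show ?thesis using insert(1,2) by (simp add: sum.distrib algebra_simps)
  qed
  moreover have "even (m x * (m x - 1))" by simp
  ultimately show ?case using insert.IH by simp
qed simp

lemma qform_int_lattice_parity:
  assumes A: "\<forall>i j. A $ i $ j \<in> \<int>" "transpose A = A" and m: "m \<in> int_lattice"
  shows "qform A m - diag_vec A \<bullet> m / 2 \<in> \<int>"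
proof -
  obtain g where g: "A $ i $ j = of_int (g i j)" for i j using A(1) unfolding Ints_def by (auto simp: image_iff) metis
  obtain k where k: "m $ i = of_int (k i)" for i using m unfolding int_lattice_def Ints_def by (auto simp: image_iff) metis
  have sym: "g i j = g j i" for i j
  proof -
    have "A $ i $ j = A $ j $ i" by (subst A(2)[symmetric]) (simp add: transpose_def)
    then show ?thesis by (simp add: g)
  qed
  have "2 * (qform A m - diag_vec A \<bullet> m / 2) =
     of_int ((\<Sum>i\<in>UNIV. \<Sum>j\<in>UNIV. g i j * k i * k j) - (\<Sum>i\<in>UNIV. g i i * k i))"
  proof -
    have "bform A m m = of_int (\<Sum>i\<in>UNIV. \<Sum>j\<in>UNIV. g i j * k i * k j)"
      by (simp add: bform_def inner_vec_def matrix_vector_mult_def g k sum_distrib_left mult_ac)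
    moreover have "diag_vec A \<bullet> m = of_int (\<Sum>i\<in>UNIV. g i i * k i)"
      by (simp add: inner_vec_def diag_vec_def g k)
    ultimately show ?thesis by (simp add: qform_def)
  qed
  moreover obtain c where "(\<Sum>i\<in>UNIV. \<Sum>j\<in>UNIV. g i j * k i * k j) - (\<Sum>i\<in>UNIV. g i i * k i) = 2 * c"
    by (rule dvdE[OF even_symmetric_quadratic_sum[where F=UNIV and g=g and m=k, OF finite sym]])
  ultimately have "qform A m - diag_vec A \<bullet> m / 2 = of_int c" by simp
  then show ?thesis by simp
qed

lemma pfun_uminus:
  fixes A :: "real^'n^'n"
  assumes A: "invertible A" "transpose A = A" and f: "homogeneous_polynomial d f"
  shows "pfun A d c f (- v) = (- 1) ^ Suc d * pfun A d c f v"
proof -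
  obtain J :: "(('n \<Rightarrow> nat) \<times> ('n \<times> nat) set) set" and r w where J: "finite J" "f = (\<lambda>v. \<Sum>j\<in>J. r j * of_real ((w j \<bullet> v) ^ d))"
    by (rule homogeneous_polynomial_powers[OF f])
  have f': "f = (\<lambda>v. \<Sum>j\<in>J. r j * of_real (bform A (matrix_inv A *v w j) v ^ d))"
    unfolding bform_matrix_inv[OF A] by (rule J(2))
  \<comment> \<open>At \<open>y = 1\<close> the identity for \<open>p_kernel\<close> speaks about
    \<open>pfun\<close> itself, so the parity can be read off term by term.\<close>
  have "pfun A d c f v = (\<Sum>j\<in>J. r j * of_real (p_kernel A d (matrix_inv A *v w j) 1 c v))" for v
    unfolding f' using pfun_power_ridge_sum[OF A, where y=1 and h="\<lambda>j. matrix_inv A *v w j" and J=J and r=r] by simp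
  then show ?thesis by (simp add: p_kernel_uminus sum_distrib_left mult_ac)
qed

lemma Theta_hat_uminus:
  fixes A :: "real^'n^'n"
  assumes A: "invertible A" "transpose A = A" and f: "homogeneous_polynomial d f"
  shows "Theta_hat A d c1 c2 (- a) (- b) f \<tau> = (- 1) ^ (d + 1) * Theta_hat A d c1 c2 a b f \<tau>"
proof -
  have "bij_betw uminus int_lattice (int_lattice :: (real^'n) set)"
    by (rule bij_betw_byWitness[of _ uminus]) (auto intro: int_lattice_uminus)
  then have "Theta_hat A d c1 c2 (- a) (- b) f \<tau> = of_real (Im \<tau> powr (- (real d / 2))) *
     (\<Sum>\<^sub>\<infinity>m\<in>int_lattice. (pfun A d c1 f (sqrt (Im \<tau>) *\<^sub>R (- a + - m)) - pfun A d c2 f (sqrt (Im \<tau>) *\<^sub>R (- a + - m)))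
        * exp (2 * pi * \<i> * \<tau> * qform A (- a + - m)) * cis (2 * pi * bform A (- a + - m) (- b)))"
    unfolding Theta_hat_reindex by (subst infsum_reindex_bij_betw) auto
  also have "\<dots> = of_real (Im \<tau> powr (- (real d / 2))) *
     (\<Sum>\<^sub>\<infinity>m\<in>int_lattice. (- 1) ^ (d + 1) * ((pfun A d c1 f (sqrt (Im \<tau>) *\<^sub>R (a + m)) - pfun A d c2 f (sqrt (Im \<tau>) *\<^sub>R (a + m)))
        * exp (2 * pi * \<i> * \<tau> * qform A (a + m)) * cis (2 * pi * bform A (a + m) b)))"
  proof (rule arg_cong[where f="\<lambda>S. _ * S", OF infsum_cong])
    fix m :: "real^'n"
    have eq: "- a + - m = - (a + m)" by simp
    have Q: "qform A (- v) = qform A v" and B: "bform A (- v) (- u) = bform A v u" for u v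
      by (simp_all add: qform_def bform_simps)
    have alg: "(e * x - e * z) * E * C = e * ((x - z) * E * C)" for e x z E C :: complex by (simp add: algebra_simps)
    show "(pfun A d c1 f (sqrt (Im \<tau>) *\<^sub>R (- a + - m)) - pfun A d c2 f (sqrt (Im \<tau>) *\<^sub>R (- a + - m)))
        * exp (2 * pi * \<i> * \<tau> * qform A (- a + - m)) * cis (2 * pi * bform A (- a + - m) (- b)) =
      (- 1) ^ (d + 1) * ((pfun A d c1 f (sqrt (Im \<tau>) *\<^sub>R (a + m)) - pfun A d c2 f (sqrt (Im \<tau>) *\<^sub>R (a + m)))
        * exp (2 * pi * \<i> * \<tau> * qform A (a + m)) * cis (2 * pi * bform A (a + m) b))"
      unfolding eq scaleR_minus_right pfun_uminus[OF A f] Q B Suc_eq_plus1 alg ..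
  qed
  finally show ?thesis unfolding infsum_cmult_right' Theta_hat_reindex[of A d c1 c2 a b] by (simp only: mult_ac)
qed

text \<open>Integral \<open>g\<close> has to be included: after clearing the denominators of
  \<open>c\<close>, the value \<open>N * B(c, a)\<close> may be an integer although
  \<open>B(c, a)\<close> is not.\<close>

lemma integer_translate_bounded_below:
  fixes g :: real
  obtains \<epsilon> where "\<epsilon> > 0" "\<And>k. k \<in> \<int> \<Longrightarrow> g + k \<noteq> 0 \<Longrightarrow> \<bar>g + k\<bar> \<ge> \<epsilon>"
proof (cases "g \<in> \<int>")
  case True
  have "\<bar>g + k\<bar> \<ge> 1" if "k \<in> \<int>" "g + k \<noteq> 0" for k
    using that True by (intro Ints_nonzero_abs_ge1) auto
  then show ?thesis using that[of 1] by simp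
next
  case False
  have "\<bar>g + k\<bar> \<ge> min (frac g) (1 - frac g)" if "k \<in> \<int>" for k
  proof -
    obtain j where j: "k = of_int j" by (rule Ints_cases[OF \<open>k \<in> \<int>\<close>])
    have "g + k = frac g + of_int (\<lfloor>g\<rfloor> + j)" by (simp add: j frac_def)
    moreover have "0 \<le> frac g" "frac g < 1" by (simp_all add: frac_lt_1)
    moreover have "real_of_int z \<ge> 0 \<or> real_of_int z \<le> - 1" for z by (cases "z \<ge> 0") auto
    ultimately show ?thesis by (smt (verit))
  qed
  moreover have "min (frac g) (1 - frac g) > 0"
    using False by (simp add: frac_lt_1)
  ultimately show ?thesis using that by blast
qed

lemma rat_vector_common_denominator:
  fixes c :: "real^'n"
  assumes "c \<in> rat_vectors"
  obtains N :: nat where "N > 0" "real N *\<^sub>R c \<in> int_lattice"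
proof -
  have "\<exists>N::nat. N > 0 \<and> real N * c $ i \<in> \<int>" for i
  proof -
    have "c $ i \<in> \<rat>" using assms by (simp add: rat_vectors_def)
    then obtain p q where "q > 0" "c $ i = of_int p / of_int q" by (rule Rats_cases')
    then show ?thesis by (intro exI[of _ "nat q"]) simp
  qed
  then obtain N where N: "\<And>i. N i > (0::nat)" "\<And>i. real (N i) * c $ i \<in> \<int>" by metis
  have "real (\<Prod>i\<in>UNIV. N i) * c $ i \<in> \<int>" for i
  proof -
    have "real (\<Prod>i\<in>UNIV. N i) * c $ i = real (\<Prod>i\<in>UNIV - {i}. N i) * (real (N i) * c $ i)"
      by (subst prod.remove[of _ i]) auto
    also have "\<dots> \<in> \<int>" by (intro Ints_mult N Ints_of_nat)
    finally show ?thesis .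
  qed
  then show ?thesis using that[of "\<Prod>i\<in>UNIV. N i"] N by (simp add: int_lattice_def prod_pos)
qed

lemma finite_bounded_int_lattice: "finite {m \<in> int_lattice. norm (m :: real^'n) \<le> r}"
proof -
  have "{m \<in> int_lattice. norm (m :: real^'n) \<le> r} \<subseteq>
     (\<lambda>k. \<chi> i. of_int (k i)) ` {k. \<forall>i. (i \<in> UNIV \<longrightarrow> k i \<in> {- \<lceil>r\<rceil>..\<lceil>r\<rceil>}) \<and> (i \<notin> UNIV \<longrightarrow> k i = 0)}"
  proof
    fix m :: "real^'n" assume m: "m \<in> {m \<in> int_lattice. norm m \<le> r}"
    then obtain k where k: "\<And>i. m $ i = of_int (k i)" unfolding int_lattice_def Ints_def by (auto simp: image_iff) metis
    have "\<bar>m $ i\<bar> \<le> r" for i using m component_le_norm_cart[of m i] by auto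
    then have "k i \<in> {- \<lceil>r\<rceil>..\<lceil>r\<rceil>}" for i unfolding k abs_le_iff atLeastAtMost_iff by (metis ceiling_mono ceiling_of_int minus_le_iff of_int_minus)
    then show "m \<in> (\<lambda>k. \<chi> i. of_int (k i)) ` {k. \<forall>i. (i \<in> UNIV \<longrightarrow> k i \<in> {- \<lceil>r\<rceil>..\<lceil>r\<rceil>}) \<and> (i \<notin> UNIV \<longrightarrow> k i = 0)}"
      using k by (intro image_eqI[of _ _ k]) (auto simp: vec_eq_iff)
  qed
  then show ?thesis by (rule finite_subset) (intro finite_imageI finite_set_of_finite_funs; simp)
qed

section \<open>Principal branches in the right half-plane\<close>

lemma csqrt_cnj_mult:
  assumes "Re \<sigma> > 0"
  shows "csqrt \<sigma> * csqrt (cnj \<sigma>) = of_real (norm \<sigma>)"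
proof -
  have "Re (csqrt \<sigma>) > 0"
    using assms csqrt_principal[of \<sigma>] by (smt (verit) complex_Re_le_cmod real_sqrt_gt_0_iff csqrt.simps(1) half_gt_zero_iff)
  then have "csqrt (cnj \<sigma>) = cnj (csqrt \<sigma>)"
    by (intro csqrt_unique) (simp_all flip: complex_cnj_power)
  then show ?thesis by (simp add: complex_norm_square[symmetric] norm_power[symmetric])
qed

text \<open>With \<open>q = csqrt \<sigma>\<close> the root for the negative direction is
  \<open>norm \<tau> / q\<close>, so \<open>norm \<tau>\<close> cancels and
  \<open>q ^ (n - 1) * \<sigma> / q = q ^ n\<close> remains next to \<open>\<sigma> ^ d\<close>,
  where \<open>n = CARD('n)\<close>.\<close>

lemma theta_factor_powr:
  fixes A :: "real^'n^'n"
  assumes \<tau>: "Im \<tau> > 0"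
  shows "theta_factor A \<tau> * (\<i> * (- \<i> * \<tau>)) ^ (d + 1) / of_real (norm \<tau>) =
    (- \<i> * \<tau>) powr (of_nat CARD('n) / 2 + of_nat d) * (\<i> ^ (d + 1) / of_real (sqrt \<bar>det A\<bar>))"
proof -
  define \<sigma> where "\<sigma> = - \<i> * \<tau>"
  have \<sigma>: "Re \<sigma> > 0" "norm \<sigma> = norm \<tau>" using \<tau> by (simp_all add: \<sigma>_def norm_mult)
  then have \<sigma>0: "\<sigma> \<noteq> 0" by auto
  define q where "q = csqrt \<sigma>"
  have q: "q \<noteq> 0" "\<sigma> = q\<^sup>2" using \<sigma>0 by (simp_all add: q_def)
  have qq: "csqrt (cnj \<sigma>) = of_real (norm \<tau>) / q"
    using csqrt_cnj_mult[OF \<sigma>(1)] q(1) unfolding \<sigma>(2) q_def[symmetric] by (metis nonzero_mult_div_cancel_left)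
  have "\<sigma> powr (of_nat CARD('n) / 2 + of_nat d) = exp (Ln \<sigma> / 2) ^ CARD('n) * \<sigma> ^ d"
  proof -
    have "\<sigma> powr (of_nat CARD('n) / 2) = exp (of_nat CARD('n) * (Ln \<sigma> / 2))"
      using \<sigma>0 by (simp add: powr_def mult.commute)
    then have "\<sigma> powr (of_nat CARD('n) / 2) = exp (Ln \<sigma> / 2) ^ CARD('n)"
      by (simp only: exp_of_nat_mult)
    moreover have "\<sigma> powr of_nat d = \<sigma> ^ d" by (rule powr_nat'[OF disjI1[OF \<sigma>0]])
    ultimately show ?thesis by (simp only: powr_add)
  qed
  also have "exp (Ln \<sigma> / 2) = q" using \<sigma>0 by (simp add: q_def csqrt_exp_Ln)
  finally have pow: "\<sigma> powr (of_nat CARD('n) / 2 + of_nat d) = q ^ CARD('n) * \<sigma> ^ d" .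
  have "q ^ (CARD('n) - 1) * q = q ^ CARD('n)"
    by (metis One_nat_def Suc_pred' power_Suc2 zero_less_card_finite)
  then have "q ^ (CARD('n) - 1) * (\<sigma> / q) = q ^ CARD('n)" using q by (simp add: power2_eq_square)
  moreover have "X * (T / q) / D * (\<i> * \<sigma>) ^ (d + 1) / T = X * (\<sigma> / q) * \<sigma> ^ d * (\<i> ^ (d + 1) / D)"
    if "T \<noteq> 0" for X T D :: complex
    using that by (simp add: power_mult_distrib[of \<i> \<sigma>])
  moreover have "complex_of_real (norm \<tau>) \<noteq> 0" using \<tau> by auto
  ultimately show ?thesis
    unfolding theta_factor_def \<sigma>_def[symmetric] pow qq unfolding q_def[symmetric] by metis
qed

context lorentzian
begin

text \<open>With \<open>N * c\<close> integral, the values \<open>N * B(c, a + p)\<close> lie in one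
  translate of the integers, whose nonzero elements are bounded away from \<open>0\<close>.
  Rationality of isotropic \<open>c\<close> thus makes the estimates uniform over the
  lattice.\<close>

lemma rational_bounded_below:
  assumes c: "c \<in> rat_vectors" and S: "S \<subseteq> dual_lattice A"
    and nz: "\<And>p. p \<in> S \<Longrightarrow> bform A c (a + p) \<noteq> 0"
  obtains \<epsilon> where "\<epsilon> > 0" "\<And>p. p \<in> S \<Longrightarrow> \<bar>bform A c (a + p)\<bar> \<ge> \<epsilon>"
proof -
  obtain N :: nat where N: "N > 0" "real N *\<^sub>R c \<in> int_lattice"
    by (rule rat_vector_common_denominator[OF c]) (rule that)
  obtain \<epsilon> where \<epsilon>: "\<epsilon> > 0" "\<And>k. k \<in> \<int> \<Longrightarrow> real N * bform A c a + k \<noteq> 0 \<Longrightarrow> \<bar>real N * bform A c a + k\<bar> \<ge> \<epsilon>"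
    by (rule integer_translate_bounded_below[of "real N * bform A c a"]) (rule that)
  have "\<bar>bform A c (a + p)\<bar> \<ge> \<epsilon> / real N" if "p \<in> S" for p
  proof -
    have eq: "real N * bform A c a + bform A (real N *\<^sub>R c) p = real N * bform A c (a + p)"
      by (simp add: bform_simps algebra_simps)
    have "bform A (real N *\<^sub>R c) p \<in> \<int>"
      using bform_int_lattice_dual[OF A_sym A_inv N(2)] S that by blast
    from \<epsilon>(2)[OF this] show ?thesis
      unfolding eq using nz[OF that] N(1) by (simp add: abs_mult field_simps)
  qed
  then show ?thesis using that[of "\<epsilon> / real N"] \<epsilon>(1) N(1) by simp
qed

text \<open>Reduced into the unit cube modulo \<open>int_lattice\<close>, distinct representatives
  stay distinct, and \<open>A\<close> maps them to integer vectors of bounded norm. Finiteness gives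
  the sum over \<open>P\<close> its intended meaning.\<close>

lemma finite_dual_representatives:
  assumes "dual_representatives A P"
  shows "finite P"
proof -
  have P: "P \<subseteq> dual_lattice A" and uniq: "\<And>x p p'. x \<in> dual_lattice A \<Longrightarrow> p \<in> P \<Longrightarrow> p' \<in> P \<Longrightarrow>
     x - p \<in> int_lattice \<Longrightarrow> x - p' \<in> int_lattice \<Longrightarrow> p = p'"
    using assms unfolding dual_representatives_def by blast+
  have "\<exists>m. m \<in> int_lattice \<and> p - m \<in> unit_cube" for p :: "real^'n"
    by (rule unit_cube_translates) blast
  then have "\<forall>p. \<exists>m. m \<in> int_lattice \<and> p - m \<in> (unit_cube :: (real^'n) set)" by blast
  from choice[OF this] obtain \<mu> where \<mu>: "\<And>p. \<mu> p \<in> int_lattice" "\<And>p. p - \<mu> p \<in> (unit_cube :: (real^'n) set)" by blast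
  obtain K where K: "\<And>w. norm (A *v w) \<le> K * norm w" "K > 0"
    using linear_bounded_pos[OF matrix_vector_mul_linear[of A]] by metis
  define \<phi> where "\<phi> = (\<lambda>p. A *v (p - \<mu> p))"
  have "inj_on \<phi> P"
  proof (rule inj_onI)
    fix p p' assume p: "p \<in> P" "p' \<in> P" "\<phi> p = \<phi> p'"
    have "p - \<mu> p = p' - \<mu> p'"
      using p(3) A_inv unfolding \<phi>_def by (metis inj_eq inj_matrix_vector_mult)
    then have "p - p' = \<mu> p - \<mu> p'" by (simp add: algebra_simps)
    then show "p = p'" using uniq[of p p p'] p P \<mu>(1) int_lattice_diff int_lattice_0 by (metis diff_self subsetD)
  qed
  moreover have "\<phi> ` P \<subseteq> {m \<in> int_lattice. norm m \<le> K * real CARD('n)}"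
  proof (rule image_subsetI)
    fix p assume "p \<in> P"
    then have "p - \<mu> p \<in> dual_lattice A"
      using P int_lattice_subset_dual[OF A_inv A_int] \<mu>(1)[of p] by (intro dual_lattice_diff) auto
    then have 1: "\<phi> p \<in> int_lattice" unfolding \<phi>_def dual_lattice_def using matrix_inv_mul_vec[OF A_inv] by auto
    have "norm (p - \<mu> p) \<le> (\<Sum>i\<in>UNIV. \<bar>(p - \<mu> p) $ i\<bar>)" by (rule norm_le_l1_cart)
    also have "\<dots> \<le> (\<Sum>i\<in>(UNIV::'n set). 1)" using \<mu>(2)[of p] by (intro sum_mono) (auto simp: unit_cube_def abs_le_iff less_imp_le)
    finally have "norm (\<phi> p) \<le> K * real CARD('n)"
      unfolding \<phi>_def using K(2) by (intro order_trans[OF K(1)] mult_left_mono) auto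
    with 1 show "\<phi> p \<in> {m \<in> int_lattice. norm m \<le> K * real CARD('n)}" by simp
  qed
  ultimately show ?thesis by (rule inj_on_finite) (rule finite_bounded_int_lattice)
qed

end

text \<open>Comparison with the fixed timelike \<open>c0\<close> leaves at most one isotropic end
  per path, also when \<open>c1\<close> and \<open>c2\<close> are both isotropic.\<close>

definition cone_term :: "real^'n^'n \<Rightarrow> real^'n \<Rightarrow> real^'n \<Rightarrow> nat \<Rightarrow> real^'n \<Rightarrow> complex \<Rightarrow> real^'n \<Rightarrow> complex" where
  "cone_term A c0 c d h \<tau> v =
     of_real (p_kernel A d h (Im \<tau>) c0 v - p_kernel A d h (Im \<tau>) c v) * exp (2 * pi * \<i> * \<tau> * qform A v)"

lemma has_sum_linear_combination:
  fixes f g :: "'j \<Rightarrow> 'a \<Rightarrow> complex"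
  assumes "\<And>j. (f j has_sum s j) A" "\<And>j. (g j has_sum t j) A"
  shows "((\<lambda>x. \<Sum>j\<in>J. r j * (f j x - g j x)) has_sum (\<Sum>j\<in>J. r j * (s j - t j))) A"
proof (induction J rule: infinite_finite_induct)
  case (insert j J)
  have "((\<lambda>x. r j * (f j x + - g j x)) has_sum (r j * (s j + - t j))) A"
    by (intro has_sum_cmult_right has_sum_add has_sum_uminusI assms)
  from has_sum_add[OF this insert.IH] show ?case using insert(1,2) by simp
qed simp_all

text \<open>The contributions of \<open>c0\<close> cancel in each term. Since
  \<open>cone_term\<close> is the kernel of \<open>c0\<close> minus that of \<open>c\<close>, the
  cone vectors appear in the order \<open>c2\<close>, \<open>c1\<close>.\<close>

lemma Theta_hat_eq_cone_term:
  assumes A: "invertible A" "transpose A = A" and \<tau>: "Im \<tau> > 0"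
    and f: "f = (\<lambda>v. \<Sum>j\<in>J. r j * of_real (bform A (h j) v ^ d))"
  shows "Theta_hat A d c1 c2 a b f \<tau> = (\<Sum>\<^sub>\<infinity>m\<in>int_lattice.
    (\<Sum>j\<in>J. r j * (cone_term A c0 c2 d (h j) \<tau> (a + m) - cone_term A c0 c1 d (h j) \<tau> (a + m))) * cis (2 * pi * bform A (a + m) b))"
proof -
  define Y where "Y = complex_of_real (Im \<tau> powr (- (real d / 2)))"
  have Y: "Y * pfun A d c f (sqrt (Im \<tau>) *\<^sub>R v) = (\<Sum>j\<in>J. r j * of_real (p_kernel A d (h j) (Im \<tau>) c v))" for c v
    unfolding f Y_def by (rule pfun_power_ridge_sum[OF A \<tau>])
  have "Y * ((pfun A d c1 f (sqrt (Im \<tau>) *\<^sub>R v) - pfun A d c2 f (sqrt (Im \<tau>) *\<^sub>R v)) * exp (2 * pi * \<i> * \<tau> * qform A v) * w) =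
     (\<Sum>j\<in>J. r j * (cone_term A c0 c2 d (h j) \<tau> v - cone_term A c0 c1 d (h j) \<tau> v)) * w" for v w
  proof -
    have "Y * ((pfun A d c1 f (sqrt (Im \<tau>) *\<^sub>R v) - pfun A d c2 f (sqrt (Im \<tau>) *\<^sub>R v)) * exp (2 * pi * \<i> * \<tau> * qform A v) * w) =
      ((\<Sum>j\<in>J. r j * of_real (p_kernel A d (h j) (Im \<tau>) c1 v)) - (\<Sum>j\<in>J. r j * of_real (p_kernel A d (h j) (Im \<tau>) c2 v))) *
        exp (2 * pi * \<i> * \<tau> * qform A v) * w"
      unfolding Y[symmetric] by (simp only: mult.assoc right_diff_distrib left_diff_distrib)
    also have "\<dots> = (\<Sum>j\<in>J. r j * (cone_term A c0 c2 d (h j) \<tau> v - cone_term A c0 c1 d (h j) \<tau> v)) * w"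
      unfolding cone_term_def sum_subtractf[symmetric] sum_distrib_right by (intro sum.cong refl) (simp add: algebra_simps)
    finally show ?thesis .
  qed
  then show ?thesis
    unfolding Theta_hat_reindex Y_def[symmetric] infsum_cmult_right'[symmetric] by (intro infsum_cong)
qed

context lorentzian
begin

text \<open>A timelike \<open>c\<close> sits at \<open>s0 = 1\<close> and an isotropic
  \<open>c\<close> at \<open>s0 = 0\<close>, while \<open>c0\<close> is always the end
  \<open>s1\<close>; proportional timelike vectors have equal kernels.\<close>

lemma cone_term_cases:
  assumes c0: "qform A c0 < 0" and c: "c \<in> C_Q_bar A c0"
  obtains (zero) "\<And>d h \<tau> v. cone_term A c0 c d h \<tau> v = 0"
  | (path) n n' s0 s1 where "null_pair A n n'" "0 \<le> s0" "s0 < s1"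
      "s0 > 0 \<or> n = c \<and> \<not> qform A c < 0 \<and> c \<in> rat_vectors"
      "\<And>d h \<tau> v. cone_term A c0 c d h \<tau> v = path_term A n n' d h s0 s1 \<tau> v"
proof (cases "qform A c < 0")
  case True
  have "bform A c c0 < 0" using c by (auto simp: C_Q_bar_def C_Q_def S_Q_def)
  from A_sig A_sym True c0 this show ?thesis
  proof (cases rule: timelike_null_pair)
    case proportional
    then show ?thesis using True c0 by (intro zero) (simp add: cone_term_def p_kernel_def)
  next
    case (path n n' s1)
    show ?thesis
      by (rule that(2)[of n n' 1 s1]) (use path True c0 in \<open>auto simp: cone_term_def p_kernel_def path_term_def path_start_def\<close>)
  qed
next
  case False
  then have c: "c \<in> rat_vectors" "qform A c = 0" "bform A c c0 < 0"
    using c by (auto simp: C_Q_bar_def C_Q_def S_Q_def)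
  obtain n' s1 where "null_pair A c n'" "s1 > 0" "null_path c n' s1 = c0 /\<^sub>R sqrt (- qform A c0)"
    by (rule isotropic_null_pair[OF A_sym c(2) c0 c(3)])
  then show ?thesis
    by (intro path[of c n' 0 s1]) (use c c0 in \<open>auto simp: cone_term_def p_kernel_def path_term_def path_start_def\<close>)
qed

lemma cone_term_inversion:
  fixes a b :: "real^'n"
  assumes c0: "qform A c0 < 0" and c: "c \<in> C_Q_bar A c0" and \<tau>: "Im \<tau> > 0"
    and a: "\<And>l. l \<in> int_lattice \<Longrightarrow> a + l \<in> R_char A c"
    and b: "\<And>p. p \<in> dual_lattice A \<Longrightarrow> b + p \<in> R_char A c"
  shows "(\<lambda>m. cone_term A c0 c d h (- 1 / \<tau>) (a + m) * cis (2 * pi * bform A (a + m) b)) abs_summable_on int_lattice" (is ?A)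
    and "(\<lambda>p. cone_term A c0 c d h \<tau> (b + p) * cis (- (2 * pi * bform A (b + p) a))) abs_summable_on dual_lattice A" (is ?B)
    and "(\<Sum>\<^sub>\<infinity>m\<in>int_lattice. cone_term A c0 c d h (- 1 / \<tau>) (a + m) * cis (2 * pi * bform A (a + m) b)) =
      theta_factor A \<tau> * cis (2 * pi * bform A a b) * (\<i> * (- \<i> * \<tau>)) ^ (d + 1) / of_real (norm \<tau>) *
      (\<Sum>\<^sub>\<infinity>p\<in>dual_lattice A. cone_term A c0 c d h \<tau> (b + p) * cis (- (2 * pi * bform A (b + p) a)))" (is ?C)
proof -
  have "?A \<and> ?B \<and> ?C"
    using c0 c
  proof (cases rule: cone_term_cases)
    case zero
    then show ?thesis by simp
  next
    case (path n n' s0 s1)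
    \<comment> \<open>For \<open>s0 > 0\<close> any \<open>\<epsilon>\<close> serves. For isotropic
      \<open>c\<close>, admissibility of all translates makes \<open>B(c, x)\<close> nonzero on both
      translated lattices, and rationality improves this to a uniform bound.\<close>
    have "\<exists>\<epsilon>>0. (\<forall>m\<in>int_lattice. s0 > 0 \<or> \<bar>bform A n (a + m)\<bar> \<ge> \<epsilon>) \<and> (\<forall>p\<in>dual_lattice A. s0 > 0 \<or> \<bar>bform A n (b + p)\<bar> \<ge> \<epsilon>)"
    proof (cases "s0 > 0")
      case False
      then have n: "n = c" "\<not> qform A c < 0" "c \<in> rat_vectors" using path(4) by auto
      have nz: "bform A c x \<noteq> 0" if "x \<in> R_char A c" for x
        using that n(2) by (auto simp: R_char_def)
      obtain \<epsilon>1 where 1: "\<epsilon>1 > 0" "\<And>p. p \<in> int_lattice \<Longrightarrow> \<bar>bform A c (a + p)\<bar> \<ge> \<epsilon>1"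
        by (rule rational_bounded_below[OF n(3) int_lattice_subset_dual[OF A_inv A_int], of a]) (use nz a in auto)
      obtain \<epsilon>2 where 2: "\<epsilon>2 > 0" "\<And>p. p \<in> dual_lattice A \<Longrightarrow> \<bar>bform A c (b + p)\<bar> \<ge> \<epsilon>2"
        by (rule rational_bounded_below[OF n(3) order_refl, of b]) (use nz b in auto)
      show ?thesis unfolding n using 1 2 by (intro exI[of _ "min \<epsilon>1 \<epsilon>2"]) (auto intro: min.coboundedI1 min.coboundedI2)
    qed (auto intro: exI[of _ 1])
    then obtain \<epsilon> where \<epsilon>: "\<epsilon> > 0" "\<And>m. m \<in> int_lattice \<Longrightarrow> s0 > 0 \<or> \<bar>bform A n (a + m)\<bar> \<ge> \<epsilon>"
      "\<And>p. p \<in> dual_lattice A \<Longrightarrow> s0 > 0 \<or> \<bar>bform A n (b + p)\<bar> \<ge> \<epsilon>" by blast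
    have \<tau>': "Im (- 1 / \<tau>) > 0" by (rule Im_inversion_pos[OF \<tau>])
    have ?A unfolding path(5)
      by (rule path_term_abs_summable[OF path(1-3) \<tau>' \<epsilon>(1,2) countable_int_lattice summable_on_exp_norm_lattice norm_cis])
    moreover have ?B unfolding path(5)
      by (rule path_term_abs_summable[OF path(1-3) \<tau> \<epsilon>(1,3) countable_dual_lattice exp_norm_summable_dual norm_cis])
    moreover have ?C unfolding path(5)
      by (rule path_term_inversion[OF path(1-3) \<tau> \<epsilon>])
    ultimately show ?thesis by blast
  qed
  then show ?A ?B ?C by blast+
qed

text \<open>Integrality of \<open>A\<close> puts \<open>int_lattice\<close> inside the dual lattice,
  so representatives and integer vectors parametrise it bijectively; summability allows the
  regrouping.\<close>

lemma infsum_dual_lattice: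
  fixes F :: "real^'n \<Rightarrow> complex"
  assumes P: "dual_representatives A P" and F: "F summable_on dual_lattice A"
  shows "infsum F (dual_lattice A) = (\<Sum>p\<in>P. \<Sum>\<^sub>\<infinity>m\<in>int_lattice. F (p + m))"
proof -
  have sub: "int_lattice \<subseteq> dual_lattice A" by (rule int_lattice_subset_dual[OF A_inv A_int])
  have PD: "P \<subseteq> dual_lattice A" and ex: "\<And>x. x \<in> dual_lattice A \<Longrightarrow> \<exists>!p. p \<in> P \<and> x - p \<in> int_lattice"
    using P unfolding dual_representatives_def by blast+
  have bij: "bij_betw (\<lambda>(p, m). p + m) (P \<times> int_lattice) (dual_lattice A)"
    unfolding bij_betw_def
  proof
    show "inj_on (\<lambda>(p, m). p + m) (P \<times> int_lattice)"
    proof (rule inj_onI, clarsimp)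
      fix p m p' m' assume *: "p \<in> P" "m \<in> int_lattice" "p' \<in> P" "m' \<in> int_lattice" "p + m = p' + m'"
      have "p + m \<in> dual_lattice A" using * PD sub by (intro dual_lattice_add) auto
      moreover have "p + m - p \<in> int_lattice" using *(2) by simp
      moreover have "p + m - p' \<in> int_lattice" unfolding *(5) using *(4) by simp
      ultimately have "p = p'" using ex * by blast
      then show "p = p' \<and> m = m'" using * by simp
    qed
    show "(\<lambda>(p, m). p + m) ` (P \<times> int_lattice) = dual_lattice A"
    proof
      show "(\<lambda>(p, m). p + m) ` (P \<times> int_lattice) \<subseteq> dual_lattice A"
        using PD sub by (auto intro: dual_lattice_add)
      show "dual_lattice A \<subseteq> (\<lambda>(p, m). p + m) ` (P \<times> int_lattice)"
      proof
        fix x assume "x \<in> dual_lattice A"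
        then obtain p where "p \<in> P" "x - p \<in> int_lattice" using ex by blast
        then show "x \<in> (\<lambda>(p, m). p + m) ` (P \<times> int_lattice)"
          by (intro image_eqI[of _ _ "(p, x - p)"]) auto
      qed
    qed
  qed
  have "(\<lambda>(p, m). F (p + m)) summable_on P \<times> int_lattice"
    using F summable_on_reindex_bij_betw[OF bij, of F] by (simp add: case_prod_unfold)
  then have "(\<Sum>\<^sub>\<infinity>p\<in>P. \<Sum>\<^sub>\<infinity>m\<in>int_lattice. F (p + m)) = (\<Sum>\<^sub>\<infinity>(p, m)\<in>P \<times> int_lattice. F (p + m))"
    by (rule infsum_Sigma'_banach)
  also have "\<dots> = infsum F (dual_lattice A)"
    using infsum_reindex_bij_betw[OF bij, of F] by (simp add: case_prod_unfold)
  finally show ?thesis unfolding infsum_finite[OF finite_dual_representatives[OF P]] by simp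
qed

text \<open>Absolute convergence is available for each single power and each of \<open>c1\<close>,
  \<open>c2\<close> compared with \<open>c0\<close>; in terms of \<open>has_sum\<close> it passes to
  finite linear combinations and permits the regrouping of the dual lattice into classes.\<close>

theorem Theta_hat_inversion:
  fixes a b :: "real^'n"
  assumes c0: "qform A c0 < 0" and c: "c1 \<in> C_Q_bar A c0" "c2 \<in> C_Q_bar A c0" and \<tau>: "Im \<tau> > 0"
    and a: "\<And>l. l \<in> int_lattice \<Longrightarrow> a + l \<in> R_char A c1 \<inter> R_char A c2"
    and b: "\<And>p. p \<in> dual_lattice A \<Longrightarrow> b + p \<in> R_char A c1 \<inter> R_char A c2"
    and f: "homogeneous_polynomial d f" and P: "dual_representatives A P"
  shows "Theta_hat A d c1 c2 a b f (- 1 / \<tau>) =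
    theta_factor A \<tau> * cis (2 * pi * bform A a b) * (\<i> * (- \<i> * \<tau>)) ^ (d + 1) / of_real (norm \<tau>) *
    (\<Sum>p\<in>P. Theta_hat A d c1 c2 (b + p) (- a) f \<tau>)"
proof -
  obtain J :: "(('n \<Rightarrow> nat) \<times> ('n \<times> nat) set) set" and r w where J: "finite J" "f = (\<lambda>v. \<Sum>j\<in>J. r j * of_real ((w j \<bullet> v) ^ d))"
    by (rule homogeneous_polynomial_powers[OF f])
  define h where "h = (\<lambda>j. matrix_inv A *v w j)"
  have f': "f = (\<lambda>v. \<Sum>j\<in>J. r j * of_real (bform A (h j) v ^ d))"
    unfolding h_def bform_matrix_inv[OF A_inv A_sym] by (rule J(2))
  have \<tau>': "Im (- 1 / \<tau>) > 0" by (rule Im_inversion_pos[OF \<tau>])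
  define K where "K = theta_factor A \<tau> * cis (2 * pi * bform A a b) * (\<i> * (- \<i> * \<tau>)) ^ (d + 1) / of_real (norm \<tau>)"
  define U where "U = (\<lambda>c j m. cone_term A c0 c d (h j) (- 1 / \<tau>) (a + m) * cis (2 * pi * bform A (a + m) b))"
  define V where "V = (\<lambda>c j p. cone_term A c0 c d (h j) \<tau> (b + p) * cis (- (2 * pi * bform A (b + p) a)))"
  define v where "v = (\<lambda>c j. infsum (V c j) (dual_lattice A))"
  have U: "(U c j has_sum K * v c j) int_lattice" and V: "(V c j has_sum v c j) (dual_lattice A)"
    if "c = c1 \<or> c = c2" for c j
  proof -
    have c': "c \<in> C_Q_bar A c0" and a': "\<And>l. l \<in> int_lattice \<Longrightarrow> a + l \<in> R_char A c"
      and b': "\<And>p. p \<in> dual_lattice A \<Longrightarrow> b + p \<in> R_char A c" using that c a b by auto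
    note * = cone_term_inversion[OF c0 c' \<tau> a' b']
    have "infsum (U c j) int_lattice = K * v c j" unfolding U_def v_def V_def K_def by (rule *(3))
    moreover have "U c j summable_on int_lattice" unfolding U_def by (rule abs_summable_summable[OF *(1)])
    ultimately show "(U c j has_sum K * v c j) int_lattice" by (metis has_sum_infsum)
    have "V c j summable_on dual_lattice A" unfolding V_def by (rule abs_summable_summable[OF *(2)])
    then show "(V c j has_sum v c j) (dual_lattice A)" unfolding v_def by (rule has_sum_infsum)
  qed
  define W where "W = (\<lambda>p. \<Sum>j\<in>J. r j * (V c2 j p - V c1 j p))"
  have W: "(W has_sum (\<Sum>j\<in>J. r j * (v c2 j - v c1 j))) (dual_lattice A)"
    unfolding W_def by (intro has_sum_linear_combination V) auto
  have "Theta_hat A d c1 c2 a b f (- 1 / \<tau>) = (\<Sum>\<^sub>\<infinity>m\<in>int_lattice. \<Sum>j\<in>J. r j * (U c2 j m - U c1 j m))"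
    unfolding Theta_hat_eq_cone_term[OF A_inv A_sym \<tau>' f', of c1 c2 a b c0] U_def sum_distrib_right
    by (intro infsum_cong sum.cong refl) (simp add: algebra_simps)
  also have "\<dots> = (\<Sum>j\<in>J. r j * (K * v c2 j - K * v c1 j))"
    by (intro infsumI has_sum_linear_combination U) auto
  also have "\<dots> = K * (\<Sum>j\<in>J. r j * (v c2 j - v c1 j))"
    by (simp add: sum_distrib_left algebra_simps)
  also have "(\<Sum>j\<in>J. r j * (v c2 j - v c1 j)) = infsum W (dual_lattice A)"
    using infsumI[OF W] by simp
  also have "infsum W (dual_lattice A) = (\<Sum>p\<in>P. \<Sum>\<^sub>\<infinity>m\<in>int_lattice. W (p + m))"
    by (rule infsum_dual_lattice[OF P has_sum_imp_summable[OF W]])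
  also have "\<dots> = (\<Sum>p\<in>P. Theta_hat A d c1 c2 (b + p) (- a) f \<tau>)"
    unfolding Theta_hat_eq_cone_term[OF A_inv A_sym \<tau> f', of c1 c2 _ _ c0] W_def V_def sum_distrib_right
    by (intro infsum_cong sum.cong refl) (simp add: algebra_simps bform_simps)
  finally show ?thesis unfolding K_def .
qed

end

theorem theorem2p5:
  fixes A :: "real ^ 'n ^ 'n" and c0 c1 c2 a b :: "real ^ 'n"
    and f :: "real ^ 'n \<Rightarrow> complex" and d :: nat
  assumes A_int: "\<forall>i j. A $ i $ j \<in> \<int>"
    and A_sym: "transpose A = A"
    and A_sig: "has_signature A (CARD('n) - 1) 1"
    and c0: "qform A c0 < 0"
    and c1: "c1 \<in> C_Q_bar A c0"
    and c2: "c2 \<in> C_Q_bar A c0"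
    and a: "a \<in> R_char A c1 \<inter> R_char A c2"
    and f: "homogeneous_polynomial d f"
  shows "\<forall>\<tau>. Im \<tau> > 0 \<longrightarrow>
    (\<forall>l\<in>int_lattice. Theta_hat A d c1 c2 (a + l) b f \<tau> = Theta_hat A d c1 c2 a b f \<tau>)
    \<and> (\<forall>\<mu>\<in>dual_lattice A.
         Theta_hat A d c1 c2 a (b + \<mu>) f \<tau>
           = exp (2 * pi * \<i> * bform A a \<mu>) * Theta_hat A d c1 c2 a b f \<tau>)
    \<and> Theta_hat A d c1 c2 (- a) (- b) f \<tau> = (- 1) ^ (d + 1) * Theta_hat A d c1 c2 a b f \<tau>
    \<and> Theta_hat A d c1 c2 a b f (\<tau> + 1)
         = exp (- 2 * pi * \<i> * qform A a - pi * \<i> * bform A (matrix_inv A *v diag_vec A) a)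
           * Theta_hat A d c1 c2 a (a + b + (1 / 2) *\<^sub>R (matrix_inv A *v diag_vec A)) f \<tau>
    \<and> (even_matrix A \<longrightarrow>
         Theta_hat A d c1 c2 a b f (\<tau> + 1)
           = exp (- 2 * pi * \<i> * qform A a) * Theta_hat A d c1 c2 a (a + b) f \<tau>)
    \<and> (b \<in> R_char A c1 \<inter> R_char A c2
       \<and> (\<forall>l\<in>int_lattice. a + l \<in> R_char A c1 \<inter> R_char A c2)
       \<and> (\<forall>p\<in>dual_lattice A. b + p \<in> R_char A c1 \<inter> R_char A c2)
       \<longrightarrow> (\<forall>P. dual_representatives A P \<longrightarrow>
         Theta_hat A d c1 c2 a b f (- 1 / \<tau>)
           = (- \<i> * \<tau>) powr (of_nat CARD('n) / 2 + of_nat d)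
             * (\<i> ^ (d + 1) / sqrt \<bar>det A\<bar>)
             * exp (2 * pi * \<i> * bform A a b)
             * (\<Sum>p\<in>P. Theta_hat A d c1 c2 (b + p) (- a) f \<tau>)))"
proof (intro allI impI conjI ballI)
  interpret lorentzian A by (rule lorentzian.intro[OF A_int A_sym A_sig])
  have exp_cis: "exp (2 * pi * \<i> * x) = cis (2 * pi * x)" for x :: real
    by (simp add: cis_conv_exp mult_ac)
  \<comment> \<open>\<open>B(m, w)\<close> is the inner product of \<open>m\<close> with the
    diagonal of \<open>A\<close>, which for integral \<open>m\<close> agrees with
    \<open>B(m, m)\<close> modulo \<open>2\<close>.\<close>
  define w where "w = matrix_inv A *v diag_vec A"
  have w: "qform A m - bform A m w / 2 \<in> \<int>" if "m \<in> int_lattice" for m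
    using qform_int_lattice_parity[OF A_int A_sym that] bform_commute[OF A_sym, of m w]
    by (simp add: w_def bform_matrix_inv[OF A_inv A_sym])
  fix \<tau> :: complex assume \<tau>: "Im \<tau> > 0"
  show "Theta_hat A d c1 c2 (a + l) b f \<tau> = Theta_hat A d c1 c2 a b f \<tau>" if "l \<in> int_lattice" for l
    using that by (rule Theta_hat_translate)
  show "Theta_hat A d c1 c2 a (b + \<mu>) f \<tau> = exp (2 * pi * \<i> * bform A a \<mu>) * Theta_hat A d c1 c2 a b f \<tau>"
    if "\<mu> \<in> dual_lattice A" for \<mu>
    unfolding exp_cis by (rule Theta_hat_translate_dual[OF A_sym A_inv that])
  show "Theta_hat A d c1 c2 (- a) (- b) f \<tau> = (- 1) ^ (d + 1) * Theta_hat A d c1 c2 a b f \<tau>"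
    by (rule Theta_hat_uminus[OF A_inv A_sym f])
  show "Theta_hat A d c1 c2 a b f (\<tau> + 1)
         = exp (- 2 * pi * \<i> * qform A a - pi * \<i> * bform A (matrix_inv A *v diag_vec A) a)
           * Theta_hat A d c1 c2 a (a + b + (1 / 2) *\<^sub>R (matrix_inv A *v diag_vec A)) f \<tau>"
    using Theta_hat_add_1[OF A_sym w, of d c1 c2 a b f \<tau>]
    by (simp add: cis_conv_exp w_def algebra_simps)
  show "Theta_hat A d c1 c2 a b f (\<tau> + 1) = exp (- 2 * pi * \<i> * qform A a) * Theta_hat A d c1 c2 a (a + b) f \<tau>"
    if "even_matrix A"
  proof -
    \<comment> \<open>For even \<open>A\<close> the number \<open>diag_vec A \<bullet> m / 2\<close>
      is itself an integer, so \<open>Q\<close> is integral on the lattice and \<open>0\<close> may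
      replace \<open>w\<close>.\<close>
    have "qform A m - bform A m 0 / 2 \<in> \<int>" if m: "m \<in> int_lattice" for m
    proof -
      obtain k where k: "\<And>i. A $ i $ i = 2 * of_int (k i)" using \<open>even_matrix A\<close> unfolding even_matrix_def by metis
      have "diag_vec A \<bullet> m / 2 = (\<Sum>i\<in>UNIV. of_int (k i) * m $ i)"
        by (simp add: inner_vec_def diag_vec_def k sum_divide_distrib)
      also have "\<dots> \<in> \<int>" using m by (intro Ints_sum Ints_mult) (auto simp: int_lattice_def)
      finally have "(qform A m - diag_vec A \<bullet> m / 2) + diag_vec A \<bullet> m / 2 \<in> \<int>"
        by (rule Ints_add[OF qform_int_lattice_parity[OF A_int A_sym m]])
      then show ?thesis by (simp add: bform_def)
    qed
    from Theta_hat_add_1[OF A_sym this, of d c1 c2 a b f \<tau>] show ?thesis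
      by (simp add: cis_conv_exp bform_def algebra_simps)
  qed
  show "Theta_hat A d c1 c2 a b f (- 1 / \<tau>)
           = (- \<i> * \<tau>) powr (of_nat CARD('n) / 2 + of_nat d)
             * (\<i> ^ (d + 1) / sqrt \<bar>det A\<bar>)
             * exp (2 * pi * \<i> * bform A a b)
             * (\<Sum>p\<in>P. Theta_hat A d c1 c2 (b + p) (- a) f \<tau>)"
    if *: "b \<in> R_char A c1 \<inter> R_char A c2
       \<and> (\<forall>l\<in>int_lattice. a + l \<in> R_char A c1 \<inter> R_char A c2)
       \<and> (\<forall>p\<in>dual_lattice A. b + p \<in> R_char A c1 \<inter> R_char A c2)" and P: "dual_representatives A P" for P
  proof -
    have "Theta_hat A d c1 c2 a b f (- 1 / \<tau>) =
      theta_factor A \<tau> * cis (2 * pi * bform A a b) * (\<i> * (- \<i> * \<tau>)) ^ (d + 1) / of_real (norm \<tau>) *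
      (\<Sum>p\<in>P. Theta_hat A d c1 c2 (b + p) (- a) f \<tau>)"
      using * by (intro Theta_hat_inversion[OF c0 c1 c2 \<tau> _ _ f P]) blast+
    also have "theta_factor A \<tau> * cis (2 * pi * bform A a b) * (\<i> * (- \<i> * \<tau>)) ^ (d + 1) / of_real (norm \<tau>) =
      (- \<i> * \<tau>) powr (of_nat CARD('n) / 2 + of_nat d) * (\<i> ^ (d + 1) / of_real (sqrt \<bar>det A\<bar>)) * cis (2 * pi * bform A a b)"
      unfolding theta_factor_powr[OF \<tau>, symmetric] by simp
    finally show ?thesis unfolding exp_cis .
  qed
qed

end
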